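(* Let $\mathcal{C}$ and $\mathcal{X}$ be two $\Lambda$-bounded filtered cospans over a field $\kappa$ that are of finite type. Then $d_B(\mathcal{D}(\mathcal{X}),\mathcal{D}(\mathcal{C}))=d_{\mathrm{int}}(\mathcal{X},\mathcal{C}).$
   Context: Fix a field $\kappa$, $\Lambda>0$, and an increasing homeomorphism $\varphi\colon[-\infty,\infty]\to[-\Lambda,\Lambda]$; for $s\in\mathbb{R}$ let $\rho_s(t)=\varphi(s+\varphi^{-1}(t))$ on $[-\Lambda,\Lambda]$. Filtered cospans and $\mathsf{HCO}$: An ascending chain complex over $\kappa$ is $(C_*,\partial,\ell)$ with $(C_*=\bigoplus_kC_k,\partial)$ a chain complex of $\kappa$-vector spaces and $\ell\colon C_*\to\mathbb{R}\cup\{-\infty\}$ with $\ell(x)=-\infty$ iff $x=0$, $\ell(\sum c_ix_i)\le\max\{\ell(x_i):c_i\ne0\}$ (equality if the $x_i$ lie in distinct degrees), $\ell(\partial x)\le\ell(x)$. A descending complex is $(C_*,\partial,\ell)$ with $\ell\colon C_*\to\mathbb{R}\cup\{+\infty\}$ and $(C_*,\partial,-\ell)$ ascending. A filtered cospan is $\mathcal{C}=((C_{\uparrow*},\partial^C_\uparrow,\ell^C_\uparrow),(C^\downarrow_*,\partial^\downarrow_C,\ell^\downarrow_C),(D_*,\partial_D),\psi_\uparrow,\psi^\downarrow)$ with chain maps $\psi_\uparrow\colon C_{\uparrow*}\to D_*$, $\psi^\downarrow\colon C^\downarrow_*\to D_*$. It is $\Lambda$-bounded if $\ell^C_\uparrow$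 and $\ell^\downarrow_C$ take values in $(-\Lambda,\Lambda)$ on nonzero elements; it is of finite type if it is isomorphic in $\mathsf{HCO}(\kappa)$ to one in which $C_{\uparrow*},C^\downarrow_*,D_*$ are finite-dimensional. For $\mathcal{X}=((X_{\uparrow*},\partial^X_\uparrow,\ell^X_\uparrow),(X^\downarrow_*,\partial^\downarrow_X,\ell^\downarrow_X),(Y_*,\partial_Y),\phi_\uparrow,\phi^\downarrow)$, a degree-$m$ morphism $\mathcal{C}\to\mathcal{X}$ in the dg-category $\mathsf{CO}(\kappa)$ is a quintuple $(\alpha^\downarrow,\alpha_\uparrow,\alpha,K^\downarrow,K_\uparrow)$ of linear maps $\alpha^\downarrow\colon C^\downarrow_*\to X^\downarrow_{*-m}$, $\alpha_\uparrow\colon C_{\uparrow*}\to X_{\uparrow*-m}$, $\alpha\colon D_*\to Y_{*-m}$, $K^\downarrow\colon C^\downarrow_*\to Y_{*-m+1}$, $K_\uparrow\colon C_{\uparrow*}\to Y_{*-m+1}$ with $\ell^X_\uparrow\circ\alpha_\uparrow\le\ell^C_\uparrow$ and $\ell^\downarrow_X\circ\alpha^\downarrow\ge\ell^\downarrow_C$; composition $(\beta^\downarrow,\beta_\uparrow,\beta,L^\downarrow,L_\uparrow)\circ(\alpha^\downarrow,\alpha_\uparrow,\alpha,K^\downarrow,K_\uparrow)=(\beta^\downarrow\alpha^\downarrow,\beta_\uparrow\alpha_\uparrow,\beta\alpha,L^\downarrow\alpha^\downarrow+\beta K^\downarrow,L_\uparrow\alpha_\uparrow+\beta K_\uparrow)$;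 differential $\delta(\alpha^\downarrow,\alpha_\uparrow,\alpha,K^\downarrow,K_\uparrow)=(-\partial^\downarrow_X\alpha^\downarrow+(-1)^m\alpha^\downarrow\partial^\downarrow_C,\ -\partial^X_\uparrow\alpha_\uparrow+(-1)^m\alpha_\uparrow\partial^C_\uparrow,\ \partial_Y\alpha-(-1)^m\alpha\partial_D,\ \phi^\downarrow\alpha^\downarrow-(-1)^m\alpha\psi^\downarrow+\partial_YK^\downarrow+(-1)^mK^\downarrow\partial^\downarrow_C,\ \phi_\uparrow\alpha_\uparrow-(-1)^m\alpha\psi_\uparrow+\partial_YK_\uparrow+(-1)^mK_\uparrow\partial^C_\uparrow)$. $\mathsf{HCO}(\kappa)$ has the same objects and morphisms $H^0(\mathrm{Hom}^*_{\mathsf{CO}(\kappa)}(\mathcal{C},\mathcal{X}),\delta)$. Interleaving distance on cospans: for $\epsilon\ge0$, $\mathcal{T}_\epsilon\mathcal{C}$ is $\mathcal{C}$ with $\ell^C_\uparrow$ replaced by $\rho_{-\epsilon}\circ\ell^C_\uparrow$ and $\ell^\downarrow_C$ by $\rho_\epsilon\circ\ell^\downarrow_C$ (on nonzero elements); $\mathcal{T}_\epsilon$ acts as the identity on morphisms (a morphism $\mathcal{X}\to\mathcal{T}_\epsilon\mathcal{C}$ is then also a morphism $\mathcal{T}_\epsilon\mathcal{X}\to\mathcal{T}_{2\epsilon}\mathcal{C}$). Let $\eta^{2\epsilon}_{\mathcal{C}}\colon\mathcal{C}\to\mathcal{T}_{2\epsilon}\mathcal{C}$ be the class of $(1,1,1,0,0)$.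 An $\epsilon$-interleaving is a pair of morphisms $a\colon\mathcal{C}\to\mathcal{T}_\epsilon\mathcal{X}$, $b\colon\mathcal{X}\to\mathcal{T}_\epsilon\mathcal{C}$ in $\mathsf{HCO}(\kappa)$ with $\mathcal{T}_\epsilon(b)\circ a=\eta^{2\epsilon}_{\mathcal{C}}$ and $\mathcal{T}_\epsilon(a)\circ b=\eta^{2\epsilon}_{\mathcal{X}}$; $d_{\mathrm{int}}(\mathcal{X},\mathcal{C})$ is the infimum of $\epsilon>0$ admitting one ($\infty$ if none). The strip: $\mathbb{M}=\{(x,y):-2\Lambda\le x+y\le2\Lambda\}$, $(x,y)\preceq(x',y')$ iff $x\ge x'$, $y\le y'$, $\partial\mathbb{M}=\{|x+y|=2\Lambda\}$, $T(x,y)=(-2\Lambda-y,2\Lambda-x)$, $S=(-\Lambda,\Lambda]\times[-\Lambda,\Lambda)$, $L=\{x+y\ge-2\Lambda,x\le-\Lambda,y<\Lambda\}$, $A=\{x+y\le2\Lambda,x>-\Lambda,y\ge\Lambda\}$; $\mathbb{M}=\bigsqcup_kT^k(S\sqcup L\sqcup A)$. Flow: $\mathcal{T}^{\mathbb{M}}_\epsilon(T^k(x,y))=T^k(\rho_{-\epsilon}(x),\rho_\epsilon(y))$ for $(x,y)\in S$; $T^k(-2\Lambda-\rho_\epsilon(-2\Lambda-x),\rho_\epsilon(y))$ for $(x,y)\in L$; $T^k(\rho_{-\epsilon}(x),2\Lambda-\rho_{-\epsilon}(2\Lambda-y))$ for $(x,y)\in A$. $d_{\mathbb{M}}(v,w)=\inf\{\epsilon>0:v\preceq\mathcal{T}^{\mathbb{M}}_\epsilon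 w,\ w\preceq\mathcal{T}^{\mathbb{M}}_\epsilon v\}$. For multisets $P,Q$ of points of $\mathbb{M}\setminus\partial\mathbb{M}$, an $\epsilon$-matching relative to $\partial\mathbb{M}$ consists of submultisets $P'\subset P$, $Q'\subset Q$ such that every point of $(P\setminus P')\cup(Q\setminus Q')$ is within $d_{\mathbb{M}}$-distance $\le\epsilon$ of some point of $\partial\mathbb{M}$, and a bijection $f\colon P'\to Q'$ with $d_{\mathbb{M}}(x,f(x))\le\epsilon$; $d_B(P,Q)$ is the infimum of such $\epsilon\ge0$. Persistence diagram: a finite-type $\Lambda$-bounded cospan is isomorphic in $\mathsf{HCO}(\kappa)$ to a direct sum of standard elementary summands, with multiplicities uniquely determined. The standard elementary summands (writing a cospan as [$C^\downarrow$; $D$; $C_\uparrow$], all maps between copies of $\kappa$ the identity, others zero; $\mathcal{E}_k(a,b)_\uparrow$ = $\kappa$ in degrees $k,k+1$ with identity differential and filtration values $a$ (degree $k$), $b$ (degree $k+1$); $\mathcal{E}_k(c,\infty)_\uparrow$ = $\kappa$ in degree $k$ at level $c$; $\mathcal{E}_k(a,b)^\downarrow$ = $\mathcal{E}_k(-a,-b)_\uparrow$ with negated filtration; $\kappa_k$ = $\kappa$ in degree $k$) are: $(\uparrow_a^b)_k=[0;0;\mathcal{E}_k(a,b)_\uparrow]$ ($a<b$), $(\downarrow^a_b)_k=[\mathcal{E}_k(a,b)^\downarrow;0;0]$ ($a>b$), $(\uparrow_a^\infty)_k=[0;0;\mathcal{E}_k(a,\infty)_\uparrow]$, $(\downarrow^a_{-\infty})_k=[\mathcal{E}_k(a,-\infty)^\downarrow;0;0]$,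 $(>_b^a)_k=[\mathcal{E}_k(a,-\infty)^\downarrow;\kappa_k;\mathcal{E}_k(b,\infty)_\uparrow]$, $(\searrow^a)_k=[\mathcal{E}_k(a,-\infty)^\downarrow;\kappa_k;0]$, $(\nearrow_a)_k=[0;\kappa_k;\mathcal{E}_k(a,\infty)_\uparrow]$, $\square_k=[0;\kappa_k;0]$ (parameters in $(-\Lambda,\Lambda)$). To these assign points of $\mathbb{M}\setminus\partial\mathbb{M}$: $(\uparrow_a^b)_k\mapsto T^{-k-1}(-2\Lambda-a,b)$; $(\uparrow_a^\infty)_k\mapsto T^{-k}(\Lambda,a)$; $(\nearrow_a)_k\mapsto T^{-k}(-\Lambda,a)$; $(\downarrow^a_b)_k\mapsto T^{-k-1}(b,2\Lambda-a)$; $(\downarrow^a_{-\infty})_k\mapsto T^{-k}(a,-\Lambda)$; $(\searrow^a)_k\mapsto T^{-k}(a,\Lambda)$; $(>_b^a)_k\mapsto T^{-k}(a,b)$; $\square_k\mapsto T^{-k+1}(\Lambda,-\Lambda)$. The persistence diagram $\mathcal{D}(\mathcal{C})$ is the multiset of the points assigned to the summands in such a decomposition, counted with multiplicity. *)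

theory Defs
  imports "HOL-Analysis.Analysis" "HOL-Library.Function_Algebras" "HOL-Library.Multiset"
begin

section \<open>Flow on filtration values\<close>

text \<open>phi : [-infinity,infinity] -> [-Lambda,Lambda] is an increasing homeomorphism;
  rho_s(t) = phi(s + phi^{-1}(t)).\<close>
definition rho :: "(ereal \<Rightarrow> real) \<Rightarrow> real \<Rightarrow> real \<Rightarrow> real" where
  "rho \<phi> s t = \<phi> (ereal s + inv \<phi> t)"

section \<open>Graded vector spaces inside an ambient vector space\<close>

text \<open>A graded vector space C_* = (+)_k C_k is given by a family of subspaces G k of an
  ambient vector space (scalar multiplication sc) whose sum is direct;
  its carrier is the span of all G k.\<close>
definition gcar :: "('k::field \<Rightarrow> 'v::ab_group_add \<Rightarrow> 'v) \<Rightarrow> (int \<Rightarrow> 'v set) \<Rightarrow> 'v set" where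
  "gcar sc G = module.span sc (\<Union>k. G k)"

definition is_graded :: "('k::field \<Rightarrow> 'v::ab_group_add \<Rightarrow> 'v) \<Rightarrow> (int \<Rightarrow> 'v set) \<Rightarrow> bool" where
  "is_graded sc G \<longleftrightarrow> (\<forall>k. module.subspace sc (G k)) \<and>
     (\<forall>K c. finite K \<longrightarrow> (\<forall>k\<in>K. c k \<in> G k) \<longrightarrow> (\<Sum>k\<in>K. c k) = 0 \<longrightarrow> (\<forall>k\<in>K. c k = 0))"

definition lin_on :: "('k::field \<Rightarrow> 'v::ab_group_add \<Rightarrow> 'v) \<Rightarrow> ('k \<Rightarrow> 'w::ab_group_add \<Rightarrow> 'w)
    \<Rightarrow> 'v set \<Rightarrow> ('v \<Rightarrow> 'w) \<Rightarrow> bool" where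
  "lin_on s1 s2 A f \<longleftrightarrow> (\<forall>x\<in>A. \<forall>y\<in>A. f (x + y) = f x + f y) \<and> (\<forall>c. \<forall>x\<in>A. f (s1 c x) = s2 c (f x))"

text \<open>Linear map C_* -> H_{*-m} (degree m, lowering degrees by m).\<close>
definition gmap :: "('k::field \<Rightarrow> 'v::ab_group_add \<Rightarrow> 'v) \<Rightarrow> ('k \<Rightarrow> 'w::ab_group_add \<Rightarrow> 'w)
    \<Rightarrow> (int \<Rightarrow> 'v set) \<Rightarrow> (int \<Rightarrow> 'w set) \<Rightarrow> int \<Rightarrow> ('v \<Rightarrow> 'w) \<Rightarrow> bool" where
  "gmap s1 s2 G H m f \<longleftrightarrow> lin_on s1 s2 (gcar s1 G) f \<and> (\<forall>k. \<forall>x\<in>G k. f x \<in> H (k - m))"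

definition is_chain :: "('k::field \<Rightarrow> 'v::ab_group_add \<Rightarrow> 'v) \<Rightarrow> (int \<Rightarrow> 'v set) \<Rightarrow> ('v \<Rightarrow> 'v) \<Rightarrow> bool" where
  "is_chain sc G d \<longleftrightarrow> is_graded sc G \<and> gmap sc sc G G 1 d \<and> (\<forall>x\<in>gcar sc G. d (d x) = 0)"

text \<open>Ascending filtration function l : C_* -> R \<union> {-infinity}.\<close>
definition asc_filt :: "('k::field \<Rightarrow> 'v::ab_group_add \<Rightarrow> 'v) \<Rightarrow> (int \<Rightarrow> 'v set) \<Rightarrow> ('v \<Rightarrow> 'v)
    \<Rightarrow> ('v \<Rightarrow> ereal) \<Rightarrow> bool" where
  "asc_filt sc G d l \<longleftrightarrow>
     (\<forall>x\<in>gcar sc G. l x \<noteq> \<infinity>) \<and>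
     (\<forall>x\<in>gcar sc G. l x = -\<infinity> \<longleftrightarrow> x = 0) \<and>
     (\<forall>(I::nat set) x c. finite I \<longrightarrow> (\<forall>i\<in>I. x i \<in> gcar sc G) \<longrightarrow>
        l (\<Sum>i\<in>I. sc (c i) (x i)) \<le> (SUP i\<in>{i\<in>I. c i \<noteq> 0}. l (x i))) \<and>
     (\<forall>(I::nat set) x c (dg::nat \<Rightarrow> int). finite I \<longrightarrow> inj_on dg I \<longrightarrow> (\<forall>i\<in>I. x i \<in> G (dg i)) \<longrightarrow>
        l (\<Sum>i\<in>I. sc (c i) (x i)) = (SUP i\<in>{i\<in>I. c i \<noteq> 0}. l (x i))) \<and>
     (\<forall>x\<in>gcar sc G. l (d x) \<le> l x)"

text \<open>Descending: l : C_* -> R \<union> {+infinity} with -l ascending.\<close>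
definition desc_filt :: "('k::field \<Rightarrow> 'v::ab_group_add \<Rightarrow> 'v) \<Rightarrow> (int \<Rightarrow> 'v set) \<Rightarrow> ('v \<Rightarrow> 'v)
    \<Rightarrow> ('v \<Rightarrow> ereal) \<Rightarrow> bool" where
  "desc_filt sc G d l \<longleftrightarrow> asc_filt sc G d (\<lambda>x. - l x)"

section \<open>Filtered cospans\<close>

text \<open>All three complexes C_up, C^down, D live in one ambient vector space 'v
  (as graded subspaces); this is no loss of generality.\<close>
record 'v cospan =
  upG :: "int \<Rightarrow> 'v set"
  upD :: "'v \<Rightarrow> 'v"
  upL :: "'v \<Rightarrow> ereal"
  dnG :: "int \<Rightarrow> 'v set"
  dnD :: "'v \<Rightarrow> 'v"
  dnL :: "'v \<Rightarrow> ereal"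
  DG :: "int \<Rightarrow> 'v set"
  DD :: "'v \<Rightarrow> 'v"
  psiU :: "'v \<Rightarrow> 'v"
  psiD :: "'v \<Rightarrow> 'v"

definition is_cospan :: "('k::field \<Rightarrow> 'v::ab_group_add \<Rightarrow> 'v) \<Rightarrow> 'v cospan \<Rightarrow> bool" where
  "is_cospan sc C \<longleftrightarrow>
     is_chain sc (upG C) (upD C) \<and> is_chain sc (dnG C) (dnD C) \<and> is_chain sc (DG C) (DD C) \<and>
     asc_filt sc (upG C) (upD C) (upL C) \<and> desc_filt sc (dnG C) (dnD C) (dnL C) \<and>
     gmap sc sc (upG C) (DG C) 0 (psiU C) \<and> gmap sc sc (dnG C) (DG C) 0 (psiD C) \<and>
     (\<forall>x\<in>gcar sc (upG C). psiU C (upD C x) = DD C (psiU C x)) \<and>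
     (\<forall>x\<in>gcar sc (dnG C). psiD C (dnD C x) = DD C (psiD C x))"

definition bounded_cospan :: "('k::field \<Rightarrow> 'v::ab_group_add \<Rightarrow> 'v) \<Rightarrow> real \<Rightarrow> 'v cospan \<Rightarrow> bool" where
  "bounded_cospan sc \<Lambda> C \<longleftrightarrow>
     (\<forall>x\<in>gcar sc (upG C). x \<noteq> 0 \<longrightarrow> ereal (-\<Lambda>) < upL C x \<and> upL C x < ereal \<Lambda>) \<and>
     (\<forall>x\<in>gcar sc (dnG C). x \<noteq> 0 \<longrightarrow> ereal (-\<Lambda>) < dnL C x \<and> dnL C x < ereal \<Lambda>)"

section \<open>The dg-category CO and the homotopy category HCO\<close>

record ('v, 'w) cmor =
  mDn :: "'v \<Rightarrow> 'w"
  mUp :: "'v \<Rightarrow> 'w"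
  mMid :: "'v \<Rightarrow> 'w"
  KDn :: "'v \<Rightarrow> 'w"
  KUp :: "'v \<Rightarrow> 'w"

definition is_mor :: "('k::field \<Rightarrow> 'v::ab_group_add \<Rightarrow> 'v) \<Rightarrow> ('k \<Rightarrow> 'w::ab_group_add \<Rightarrow> 'w)
    \<Rightarrow> int \<Rightarrow> 'v cospan \<Rightarrow> 'w cospan \<Rightarrow> ('v, 'w) cmor \<Rightarrow> bool" where
  "is_mor s1 s2 m C X f \<longleftrightarrow>
     gmap s1 s2 (dnG C) (dnG X) m (mDn f) \<and> gmap s1 s2 (upG C) (upG X) m (mUp f) \<and>
     gmap s1 s2 (DG C) (DG X) m (mMid f) \<and>
     gmap s1 s2 (dnG C) (DG X) (m - 1) (KDn f) \<and> gmap s1 s2 (upG C) (DG X) (m - 1) (KUp f) \<and>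
     (\<forall>x\<in>gcar s1 (upG C). upL X (mUp f x) \<le> upL C x) \<and>
     (\<forall>x\<in>gcar s1 (dnG C). dnL X (mDn f x) \<ge> dnL C x)"

definition sg :: "int \<Rightarrow> 'w::ab_group_add \<Rightarrow> 'w" where
  "sg m v = (if even m then v else - v)"

definition delta :: "int \<Rightarrow> 'v cospan \<Rightarrow> 'w::ab_group_add cospan \<Rightarrow> ('v, 'w) cmor \<Rightarrow> ('v, 'w) cmor" where
  "delta m C X f = \<lparr>
     mDn = (\<lambda>x. - dnD X (mDn f x) + sg m (mDn f (dnD C x))),
     mUp = (\<lambda>x. - upD X (mUp f x) + sg m (mUp f (upD C x))),
     mMid = (\<lambda>x. DD X (mMid f x) - sg m (mMid f (DD C x))),
     KDn = (\<lambda>x. psiD X (mDn f x) - sg m (mMid f (psiD C x)) + DD X (KDn f x) + sg m (KDn f (dnD C x))),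
     KUp = (\<lambda>x. psiU X (mUp f x) - sg m (mMid f (psiU C x)) + DD X (KUp f x) + sg m (KUp f (upD C x))) \<rparr>"

definition mcomp :: "('w, 'u::ab_group_add) cmor \<Rightarrow> ('v, 'w) cmor \<Rightarrow> ('v, 'u) cmor" where
  "mcomp g f = \<lparr> mDn = mDn g \<circ> mDn f, mUp = mUp g \<circ> mUp f, mMid = mMid g \<circ> mMid f,
     KDn = (\<lambda>x. KDn g (mDn f x) + mMid g (KDn f x)),
     KUp = (\<lambda>x. KUp g (mUp f x) + mMid g (KUp f x)) \<rparr>"

definition msub :: "('v, 'w::ab_group_add) cmor \<Rightarrow> ('v, 'w) cmor \<Rightarrow> ('v, 'w) cmor" where
  "msub f g = \<lparr> mDn = (\<lambda>x. mDn f x - mDn g x), mUp = (\<lambda>x. mUp f x - mUp g x),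
     mMid = (\<lambda>x. mMid f x - mMid g x), KDn = (\<lambda>x. KDn f x - KDn g x), KUp = (\<lambda>x. KUp f x - KUp g x) \<rparr>"

definition mzero :: "('v, 'w::ab_group_add) cmor" where
  "mzero = \<lparr> mDn = (\<lambda>_. 0), mUp = (\<lambda>_. 0), mMid = (\<lambda>_. 0), KDn = (\<lambda>_. 0), KUp = (\<lambda>_. 0) \<rparr>"

text \<open>The identity quintuple (1,1,1,0,0).\<close>
definition mid :: "('v::ab_group_add, 'v) cmor" where
  "mid = \<lparr> mDn = id, mUp = id, mMid = id, KDn = (\<lambda>_. 0), KUp = (\<lambda>_. 0) \<rparr>"

text \<open>Equality of morphisms C -> X (maps only matter on the carriers of C).\<close>
definition meq :: "('k::field \<Rightarrow> 'v::ab_group_add \<Rightarrow> 'v) \<Rightarrow> 'v cospan \<Rightarrow> ('v, 'w) cmor \<Rightarrow> ('v, 'w) cmor \<Rightarrow> bool" where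
  "meq sc C f g \<longleftrightarrow>
     (\<forall>x\<in>gcar sc (dnG C). mDn f x = mDn g x \<and> KDn f x = KDn g x) \<and>
     (\<forall>x\<in>gcar sc (upG C). mUp f x = mUp g x \<and> KUp f x = KUp g x) \<and>
     (\<forall>x\<in>gcar sc (DG C). mMid f x = mMid g x)"

text \<open>Degree-0 cycles of Hom^*(C,X): representatives of morphisms in HCO.\<close>
definition hmor :: "('k::field \<Rightarrow> 'v::ab_group_add \<Rightarrow> 'v) \<Rightarrow> ('k \<Rightarrow> 'w::ab_group_add \<Rightarrow> 'w)
    \<Rightarrow> 'v cospan \<Rightarrow> 'w cospan \<Rightarrow> ('v, 'w) cmor \<Rightarrow> bool" where
  "hmor s1 s2 C X f \<longleftrightarrow> is_mor s1 s2 0 C X f \<and> meq s1 C (delta 0 C X f) mzero"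

text \<open>Two degree-0 cycles define the same class in H^0 iff their difference is delta of
  a degree -1 morphism.\<close>
definition homotopic :: "('k::field \<Rightarrow> 'v::ab_group_add \<Rightarrow> 'v) \<Rightarrow> ('k \<Rightarrow> 'w::ab_group_add \<Rightarrow> 'w)
    \<Rightarrow> 'v cospan \<Rightarrow> 'w cospan \<Rightarrow> ('v, 'w) cmor \<Rightarrow> ('v, 'w) cmor \<Rightarrow> bool" where
  "homotopic s1 s2 C X f g \<longleftrightarrow>
     (\<exists>h. is_mor s1 s2 (-1) C X h \<and> meq s1 C (msub f g) (delta (-1) C X h))"

definition hco_iso :: "('k::field \<Rightarrow> 'v::ab_group_add \<Rightarrow> 'v) \<Rightarrow> ('k \<Rightarrow> 'w::ab_group_add \<Rightarrow> 'w)
    \<Rightarrow> 'v cospan \<Rightarrow> 'w cospan \<Rightarrow> bool" where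
  "hco_iso s1 s2 C X \<longleftrightarrow>
     (\<exists>f g. hmor s1 s2 C X f \<and> hmor s2 s1 X C g \<and>
        homotopic s1 s1 C C (mcomp g f) mid \<and> homotopic s2 s2 X X (mcomp f g) mid)"

section \<open>Finite type\<close>

text \<open>Pointwise vector space structure on k-valued functions (used as a universal ambient
  space for finite-dimensional cospans and for sums of elementary summands).\<close>
definition fscale :: "'k::field \<Rightarrow> ('a \<Rightarrow> 'k) \<Rightarrow> ('a \<Rightarrow> 'k)" where
  "fscale c v = (\<lambda>p. c * v p)"

definition fin_dim :: "('k::field \<Rightarrow> 'v::ab_group_add \<Rightarrow> 'v) \<Rightarrow> 'v set \<Rightarrow> bool" where
  "fin_dim sc A \<longleftrightarrow> (\<exists>B. finite B \<and> A \<subseteq> module.span sc B)"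

definition finite_type :: "('k::field \<Rightarrow> 'v::ab_group_add \<Rightarrow> 'v) \<Rightarrow> 'v cospan \<Rightarrow> bool" where
  "finite_type sc C \<longleftrightarrow>
     (\<exists>F :: (nat \<Rightarrow> 'k) cospan. is_cospan fscale F \<and>
        fin_dim fscale (gcar fscale (upG F)) \<and> fin_dim fscale (gcar fscale (dnG F)) \<and>
        fin_dim fscale (gcar fscale (DG F)) \<and> hco_iso sc fscale C F)"

section \<open>Interleaving distance\<close>

definition shiftL :: "(ereal \<Rightarrow> real) \<Rightarrow> real \<Rightarrow> ('v::zero \<Rightarrow> ereal) \<Rightarrow> ('v \<Rightarrow> ereal)" where
  "shiftL \<phi> e l = (\<lambda>x. if x = 0 then l x else ereal (rho \<phi> e (real_of_ereal (l x))))"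

definition Tcos :: "(ereal \<Rightarrow> real) \<Rightarrow> real \<Rightarrow> 'v::zero cospan \<Rightarrow> 'v cospan" where
  "Tcos \<phi> \<epsilon> C = C\<lparr> upL := shiftL \<phi> (-\<epsilon>) (upL C), dnL := shiftL \<phi> \<epsilon> (dnL C) \<rparr>"

definition interleaved :: "(ereal \<Rightarrow> real) \<Rightarrow> ('k::field \<Rightarrow> 'v::ab_group_add \<Rightarrow> 'v)
    \<Rightarrow> ('k \<Rightarrow> 'w::ab_group_add \<Rightarrow> 'w) \<Rightarrow> real \<Rightarrow> 'v cospan \<Rightarrow> 'w cospan \<Rightarrow> bool" where
  "interleaved \<phi> s1 s2 \<epsilon> C X \<longleftrightarrow>
     (\<exists>a b. hmor s1 s2 C (Tcos \<phi> \<epsilon> X) a \<and> hmor s2 s1 X (Tcos \<phi> \<epsilon> C) b \<and>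
        homotopic s1 s1 C (Tcos \<phi> (2 * \<epsilon>) C) (mcomp b a) mid \<and>
        homotopic s2 s2 X (Tcos \<phi> (2 * \<epsilon>) X) (mcomp a b) mid)"

definition d_int :: "(ereal \<Rightarrow> real) \<Rightarrow> ('k::field \<Rightarrow> 'v::ab_group_add \<Rightarrow> 'v)
    \<Rightarrow> ('k \<Rightarrow> 'w::ab_group_add \<Rightarrow> 'w) \<Rightarrow> 'v cospan \<Rightarrow> 'w cospan \<Rightarrow> ereal" where
  "d_int \<phi> s1 s2 C X = Inf (ereal ` {\<epsilon>. \<epsilon> > 0 \<and> interleaved \<phi> s1 s2 \<epsilon> C X})"

section \<open>The strip M and the bottleneck distance\<close>

definition bdM :: "real \<Rightarrow> (real \<times> real) set" where
  "bdM \<Lambda> = {(x, y). \<bar>x + y\<bar> = 2 * \<Lambda>}"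

definition precM :: "real \<times> real \<Rightarrow> real \<times> real \<Rightarrow> bool" where
  "precM v w \<longleftrightarrow> fst v \<ge> fst w \<and> snd v \<le> snd w"

definition TM :: "real \<Rightarrow> real \<times> real \<Rightarrow> real \<times> real" where
  "TM \<Lambda> v = (- 2 * \<Lambda> - snd v, 2 * \<Lambda> - fst v)"

definition TMinv :: "real \<Rightarrow> real \<times> real \<Rightarrow> real \<times> real" where
  "TMinv \<Lambda> v = (2 * \<Lambda> - snd v, - 2 * \<Lambda> - fst v)"

definition Tpow :: "real \<Rightarrow> int \<Rightarrow> real \<times> real \<Rightarrow> real \<times> real" where
  "Tpow \<Lambda> k = (if k \<ge> 0 then TM \<Lambda> ^^ nat k else TMinv \<Lambda> ^^ nat (- k))"

definition SM :: "real \<Rightarrow> (real \<times> real) set" where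
  "SM \<Lambda> = {(x, y). - \<Lambda> < x \<and> x \<le> \<Lambda> \<and> - \<Lambda> \<le> y \<and> y < \<Lambda>}"

definition LM :: "real \<Rightarrow> (real \<times> real) set" where
  "LM \<Lambda> = {(x, y). x + y \<ge> - 2 * \<Lambda> \<and> x \<le> - \<Lambda> \<and> y < \<Lambda>}"

definition AM :: "real \<Rightarrow> (real \<times> real) set" where
  "AM \<Lambda> = {(x, y). x + y \<le> 2 * \<Lambda> \<and> x > - \<Lambda> \<and> y \<ge> \<Lambda>}"

definition flowM :: "real \<Rightarrow> (ereal \<Rightarrow> real) \<Rightarrow> real \<Rightarrow> real \<times> real \<Rightarrow> real \<times> real" where
  "flowM \<Lambda> \<phi> \<epsilon> v = (THE u. \<exists>k x y. v = Tpow \<Lambda> k (x, y) \<and>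
     (((x, y) \<in> SM \<Lambda> \<and> u = Tpow \<Lambda> k (rho \<phi> (-\<epsilon>) x, rho \<phi> \<epsilon> y)) \<or>
      ((x, y) \<in> LM \<Lambda> \<and> u = Tpow \<Lambda> k (- 2 * \<Lambda> - rho \<phi> \<epsilon> (- 2 * \<Lambda> - x), rho \<phi> \<epsilon> y)) \<or>
      ((x, y) \<in> AM \<Lambda> \<and> u = Tpow \<Lambda> k (rho \<phi> (-\<epsilon>) x, 2 * \<Lambda> - rho \<phi> (-\<epsilon>) (2 * \<Lambda> - y)))))"

definition dM :: "real \<Rightarrow> (ereal \<Rightarrow> real) \<Rightarrow> real \<times> real \<Rightarrow> real \<times> real \<Rightarrow> ereal" where
  "dM \<Lambda> \<phi> v w = Inf (ereal ` {\<epsilon>. \<epsilon> > 0 \<and> precM v (flowM \<Lambda> \<phi> \<epsilon> w) \<and> precM w (flowM \<Lambda> \<phi> \<epsilon> v)})"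

definition near_bd :: "real \<Rightarrow> (ereal \<Rightarrow> real) \<Rightarrow> real \<Rightarrow> real \<times> real \<Rightarrow> bool" where
  "near_bd \<Lambda> \<phi> \<epsilon> p \<longleftrightarrow> (\<exists>b\<in>bdM \<Lambda>. dM \<Lambda> \<phi> p b \<le> ereal \<epsilon>)"

text \<open>An epsilon-matching relative to the boundary; the bijection P' -> Q' of multisets is
  encoded as a multiset of pairs R.\<close>
definition matching :: "real \<Rightarrow> (ereal \<Rightarrow> real) \<Rightarrow> real \<Rightarrow> (real \<times> real) multiset
    \<Rightarrow> (real \<times> real) multiset \<Rightarrow> bool" where
  "matching \<Lambda> \<phi> \<epsilon> P Q \<longleftrightarrow>
     (\<exists>P' Q' R. P' \<subseteq># P \<and> Q' \<subseteq># Q \<and>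
        (\<forall>p\<in>#P - P'. near_bd \<Lambda> \<phi> \<epsilon> p) \<and> (\<forall>q\<in>#Q - Q'. near_bd \<Lambda> \<phi> \<epsilon> q) \<and>
        image_mset fst R = P' \<and> image_mset snd R = Q' \<and>
        (\<forall>pq\<in>#R. dM \<Lambda> \<phi> (fst pq) (snd pq) \<le> ereal \<epsilon>))"

definition dB :: "real \<Rightarrow> (ereal \<Rightarrow> real) \<Rightarrow> (real \<times> real) multiset \<Rightarrow> (real \<times> real) multiset \<Rightarrow> ereal" where
  "dB \<Lambda> \<phi> P Q = Inf (ereal ` {\<epsilon>. \<epsilon> \<ge> 0 \<and> matching \<Lambda> \<phi> \<epsilon> P Q})"

section \<open>Standard elementary summands and the persistence diagram\<close>

text \<open>Up a b k = (up_a^b)_k; UpInf a k = (up_a^infinity)_k; Dn a b k = (down^a_b)_k;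
  DnInf a k = (down^a_{-infinity})_k; Gt a b k = (>_b^a)_k; SE a k = (searrow^a)_k;
  NE a k = (nearrow_a)_k; Sq k = square_k.\<close>
datatype summand =
    Up real real int | UpInf real int | Dn real real int | DnInf real int
  | Gt real real int | SE real int | NE real int | Sq int

fun valid_summand :: "real \<Rightarrow> summand \<Rightarrow> bool" where
  "valid_summand \<Lambda> (Up a b k) \<longleftrightarrow> - \<Lambda> < a \<and> a < b \<and> b < \<Lambda>"
| "valid_summand \<Lambda> (UpInf a k) \<longleftrightarrow> - \<Lambda> < a \<and> a < \<Lambda>"
| "valid_summand \<Lambda> (Dn a b k) \<longleftrightarrow> - \<Lambda> < b \<and> b < a \<and> a < \<Lambda>"
| "valid_summand \<Lambda> (DnInf a k) \<longleftrightarrow> - \<Lambda> < a \<and> a < \<Lambda>"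
| "valid_summand \<Lambda> (Gt a b k) \<longleftrightarrow> - \<Lambda> < a \<and> a < \<Lambda> \<and> - \<Lambda> < b \<and> b < \<Lambda>"
| "valid_summand \<Lambda> (SE a k) \<longleftrightarrow> - \<Lambda> < a \<and> a < \<Lambda>"
| "valid_summand \<Lambda> (NE a k) \<longleftrightarrow> - \<Lambda> < a \<and> a < \<Lambda>"
| "valid_summand \<Lambda> (Sq k) \<longleftrightarrow> True"

fun summand_pt :: "real \<Rightarrow> summand \<Rightarrow> real \<times> real" where
  "summand_pt \<Lambda> (Up a b k) = Tpow \<Lambda> (- k - 1) (- 2 * \<Lambda> - a, b)"
| "summand_pt \<Lambda> (UpInf a k) = Tpow \<Lambda> (- k) (\<Lambda>, a)"
| "summand_pt \<Lambda> (NE a k) = Tpow \<Lambda> (- k) (- \<Lambda>, a)"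
| "summand_pt \<Lambda> (Dn a b k) = Tpow \<Lambda> (- k - 1) (b, 2 * \<Lambda> - a)"
| "summand_pt \<Lambda> (DnInf a k) = Tpow \<Lambda> (- k) (a, - \<Lambda>)"
| "summand_pt \<Lambda> (SE a k) = Tpow \<Lambda> (- k) (a, \<Lambda>)"
| "summand_pt \<Lambda> (Gt a b k) = Tpow \<Lambda> (- k) (a, b)"
| "summand_pt \<Lambda> (Sq k) = Tpow \<Lambda> (- k + 1) (\<Lambda>, - \<Lambda>)"

text \<open>Basis elements of a summand: slot j (0,1 for C_up; 2,3 for C^down; 4 for D),
  degree, filtration level.\<close>
fun up_basis :: "summand \<Rightarrow> (nat \<times> int \<times> real) list" where
  "up_basis (Up a b k) = [(0, k, a), (1, k + 1, b)]"
| "up_basis (UpInf a k) = [(0, k, a)]"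
| "up_basis (Gt a b k) = [(0, k, b)]"
| "up_basis (NE a k) = [(0, k, a)]"
| "up_basis _ = []"

fun dn_basis :: "summand \<Rightarrow> (nat \<times> int \<times> real) list" where
  "dn_basis (Dn a b k) = [(2, k, a), (3, k + 1, b)]"
| "dn_basis (DnInf a k) = [(2, k, a)]"
| "dn_basis (Gt a b k) = [(2, k, a)]"
| "dn_basis (SE a k) = [(2, k, a)]"
| "dn_basis _ = []"

fun mid_basis :: "summand \<Rightarrow> (nat \<times> int) list" where
  "mid_basis (Gt a b k) = [(4, k)]"
| "mid_basis (SE a k) = [(4, k)]"
| "mid_basis (NE a k) = [(4, k)]"
| "mid_basis (Sq k) = [(4, k)]"
| "mid_basis _ = []"

fun is_up2 :: "summand \<Rightarrow> bool" where "is_up2 (Up a b k) = True" | "is_up2 _ = False"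
fun is_dn2 :: "summand \<Rightarrow> bool" where "is_dn2 (Dn a b k) = True" | "is_dn2 _ = False"
fun has_psiU :: "summand \<Rightarrow> bool" where
  "has_psiU (Gt a b k) = True" | "has_psiU (NE a k) = True" | "has_psiU _ = False"
fun has_psiD :: "summand \<Rightarrow> bool" where
  "has_psiD (Gt a b k) = True" | "has_psiD (SE a k) = True" | "has_psiD _ = False"

text \<open>The direct sum of the summands in the list L, realised in the space of functions
  nat \<times> nat -> k with basis vectors indexed by (summand index i, slot j).
  Filtrations of the direct sum: max (resp. min) over the support.\<close>
definition model :: "summand list \<Rightarrow> (nat \<times> nat \<Rightarrow> 'k::field) cospan" where
  "model L = \<lparr>
     upG = (\<lambda>k. {v. \<forall>i j. v (i, j) \<noteq> 0 \<longrightarrow> i < length L \<and> (\<exists>a. (j, k, a) \<in> set (up_basis (L ! i)))}),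
     upD = (\<lambda>v (i, j). if j = 0 \<and> i < length L \<and> is_up2 (L ! i) then v (i, 1) else 0),
     upL = (\<lambda>v. Sup {ereal a | i j k a. i < length L \<and> (j, k, a) \<in> set (up_basis (L ! i)) \<and> v (i, j) \<noteq> 0}),
     dnG = (\<lambda>k. {v. \<forall>i j. v (i, j) \<noteq> 0 \<longrightarrow> i < length L \<and> (\<exists>a. (j, k, a) \<in> set (dn_basis (L ! i)))}),
     dnD = (\<lambda>v (i, j). if j = 2 \<and> i < length L \<and> is_dn2 (L ! i) then v (i, 3) else 0),
     dnL = (\<lambda>v. Inf {ereal a | i j k a. i < length L \<and> (j, k, a) \<in> set (dn_basis (L ! i)) \<and> v (i, j) \<noteq> 0}),
     DG = (\<lambda>k. {v. \<forall>i j. v (i, j) \<noteq> 0 \<longrightarrow> i < length L \<and> (j, k) \<in> set (mid_basis (L ! i))}),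
     DD = (\<lambda>v. 0),
     psiU = (\<lambda>v (i, j). if j = 4 \<and> i < length L \<and> has_psiU (L ! i) then v (i, 0) else 0),
     psiD = (\<lambda>v (i, j). if j = 4 \<and> i < length L \<and> has_psiD (L ! i) then v (i, 2) else 0) \<rparr>"

definition is_diagram :: "real \<Rightarrow> ('k::field \<Rightarrow> 'v::ab_group_add \<Rightarrow> 'v) \<Rightarrow> 'v cospan
    \<Rightarrow> (real \<times> real) multiset \<Rightarrow> bool" where
  "is_diagram \<Lambda> sc C M \<longleftrightarrow>
     (\<exists>L. list_all (valid_summand \<Lambda>) L \<and> M = mset (map (summand_pt \<Lambda>) L) \<and>
        hco_iso sc fscale C (model L :: (nat \<times> nat \<Rightarrow> 'k) cospan))"

definition diagram :: "real \<Rightarrow> ('k::field \<Rightarrow> 'v::ab_group_add \<Rightarrow> 'v) \<Rightarrow> 'v cospan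
    \<Rightarrow> (real \<times> real) multiset" where
  "diagram \<Lambda> sc C = (THE M. is_diagram \<Lambda> sc C M)"

end

theory Submission
  imports Defs
begin

text \<open>
  Transporting levels along the inverse of \<open>\<phi>\<close> turns the flow into translation of the real line, so
  an \<open>\<epsilon>\<close>-interleaving is a pair of degree-0 cycles that may move levels by \<open>\<epsilon>\<close> and are mutually inverse up
  to homotopies that may move levels by \<open>2\<epsilon>\<close>.

  Every finite-dimensional cospan is equivalent to a direct sum of elementary summands: choosing an element of
  extremal level and a dual functional splits off one summand at a time. For sums of elementary
  summands, the diagonal blocks of the two interleaving maps give matrices \<open>F\<close> and \<open>G\<close> indexed by summands whose
  product, ordered by the sum of the coordinates of the summands, is unitriangular on those summands that are
  not close to zero, while nonzero entries only occur between summands whose coordinates increase by at most \<open>\<epsilon>\<close>.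
  A rank count then verifies Hall's condition for the relation of being \<open>\<epsilon>\<close>-close; this gives an injection in each
  direction, and a Schroeder-Bernstein argument merges the two into one matching. Conversely a matching is
  itself an interleaving. For \<open>\<epsilon> = 0\<close> the same argument shows that the diagram is unique.

  The flow on the strip is the product of a flow on the line and its inverse. The line flow fixes the odd
  multiples of \<open>\<Lambda>\<close> and is equivariant under reflection in them, so closeness in the strip can be
  tested after applying a power of \<open>T\<close>, where it is closeness of the coordinates of the summands.
\<close>

section \<open>Graded linear maps\<close>

text \<open>Why the blocks between equal types suffice: a map of models sends the cycle of a finite
  bar only to finite bars, that of an infinite bar to finite or infinite ones, and a generator of
  the middle only to generators with at least the same arms attached. A composite of two maps
  between summands of equal type therefore never passes through another type. Why the sum of the
  coordinates is the right order: if p -> q -> p' carries nonzero entries and the sum at p is at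
  most that at p', then q is e-close to p or to p', so the neighbours of a set of summands carry the
  whole known half of the product. The homotopy term joins p to p' only if the end of p' lies at
  most 2e above the start of p, and this contradicts the order once neither bar is small. Down types
  become up types by negating levels and exchanging the arms. Two slacks shape the statements:
  distance in the strip is an infimum, so a matching at e gives interleavings only at larger values;
  and finite type controls dimensions but not levels, so the bounds on the summands must be
  recovered from the cospan itself.\<close>

lemma gcar_closed:
  assumes "vector_space s"
  shows "0 \<in> gcar s G" "x \<in> gcar s G \<Longrightarrow> y \<in> gcar s G \<Longrightarrow> x + y \<in> gcar s G"
    "x \<in> gcar s G \<Longrightarrow> y \<in> gcar s G \<Longrightarrow> x - y \<in> gcar s G"
    "x \<in> gcar s G \<Longrightarrow> - x \<in> gcar s G" "x \<in> gcar s G \<Longrightarrow> s c x \<in> gcar s G" "x \<in> G k \<Longrightarrow> x \<in> gcar s G"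
proof -
  interpret vector_space s by fact
  show "0 \<in> gcar s G" "x \<in> gcar s G \<Longrightarrow> y \<in> gcar s G \<Longrightarrow> x + y \<in> gcar s G"
    "x \<in> gcar s G \<Longrightarrow> y \<in> gcar s G \<Longrightarrow> x - y \<in> gcar s G"
    "x \<in> gcar s G \<Longrightarrow> - x \<in> gcar s G" "x \<in> gcar s G \<Longrightarrow> s c x \<in> gcar s G"
    by (auto simp: gcar_def span_zero span_add span_diff span_neg span_scale)
  show "x \<in> G k \<Longrightarrow> x \<in> gcar s G" by (auto simp: gcar_def intro: span_base)
qed

text \<open>Induction over the carrier: a property that defines a subspace only has to be checked on
  homogeneous elements.\<close>

lemma gcar_subset:
  assumes "vector_space s" "\<And>k. G k \<subseteq> U" "module.subspace s U"
  shows "gcar s G \<subseteq> U"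
proof -
  interpret vector_space s by fact
  show ?thesis unfolding gcar_def using assms(2,3) by (intro span_minimal) auto
qed

lemma lin_on_basic:
  assumes "vector_space s1" "vector_space s2" "lin_on s1 s2 (gcar s1 G) f"
  shows "f 0 = 0" "x \<in> gcar s1 G \<Longrightarrow> f (- x) = - f x"
    "x \<in> gcar s1 G \<Longrightarrow> y \<in> gcar s1 G \<Longrightarrow> f (x - y) = f x - f y"
proof -
  interpret v1: vector_space s1 by fact
  interpret v2: vector_space s2 by fact
  note c = gcar_closed[OF assms(1)]
  have l: "\<And>x y. x \<in> gcar s1 G \<Longrightarrow> y \<in> gcar s1 G \<Longrightarrow> f (x + y) = f x + f y"
    "\<And>c x. x \<in> gcar s1 G \<Longrightarrow> f (s1 c x) = s2 c (f x)"
    using assms(3) by (auto simp: lin_on_def)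
  show "f 0 = 0" using l(1)[of 0 0] c(1) by simp
  have m: "f (- x) = - f x" if "x \<in> gcar s1 G" for x
    using l(2)[of x "-1"] that by simp
  then show "x \<in> gcar s1 G \<Longrightarrow> f (- x) = - f x" .
  show "x \<in> gcar s1 G \<Longrightarrow> y \<in> gcar s1 G \<Longrightarrow> f (x - y) = f x - f y"
    using l(1)[of x "- y"] m c by simp
qed

lemma gmap_mem:
  assumes "vector_space s1" "vector_space s2" "gmap s1 s2 G H m f" "x \<in> gcar s1 G"
  shows "f x \<in> gcar s2 H"
proof -
  interpret v1: vector_space s1 by fact
  interpret v2: vector_space s2 by fact
  note c1 = gcar_closed[OF assms(1)] and c2 = gcar_closed[OF assms(2)]
  have l: "lin_on s1 s2 (gcar s1 G) f" using assms(3) by (auto simp: gmap_def)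
  have "gcar s1 G \<subseteq> {x \<in> gcar s1 G. f x \<in> gcar s2 H}"
  proof (rule gcar_subset[OF assms(1)])
    show "G k \<subseteq> {x \<in> gcar s1 G. f x \<in> gcar s2 H}" for k
      using assms(3) c1(6) c2(6) by (fastforce simp: gmap_def)
    show "v1.subspace {x \<in> gcar s1 G. f x \<in> gcar s2 H}"
      using l c1 c2 lin_on_basic(1)[OF assms(1,2) l]
      by (auto simp: v1.subspace_def lin_on_def)
  qed
  then show ?thesis using assms(4) by auto
qed

lemma gmap_lin:
  assumes "vector_space s1" "vector_space s2" "gmap s1 s2 G H m f"
  shows "(\<forall>x\<in>gcar s1 G. f x \<in> gcar s2 H) \<and>
    (\<forall>x\<in>gcar s1 G. \<forall>y\<in>gcar s1 G. f (x + y) = f x + f y) \<and>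
    (\<forall>x\<in>gcar s1 G. \<forall>y\<in>gcar s1 G. f (x - y) = f x - f y) \<and>
    (\<forall>x\<in>gcar s1 G. f (- x) = - f x) \<and> (\<forall>x\<in>gcar s1 G. \<forall>c. f (s1 c x) = s2 c (f x)) \<and> f 0 = 0"
proof -
  have l: "lin_on s1 s2 (gcar s1 G) f" using assms(3) by (auto simp: gmap_def)
  then show ?thesis using gmap_mem[OF assms] lin_on_basic[OF assms(1,2) l]
    by (auto simp: lin_on_def)
qed

lemma gmapD: "gmap s1 s2 G H m f \<Longrightarrow> x \<in> G k \<Longrightarrow> f x \<in> H (k - m)"
  by (auto simp: gmap_def)

lemma gmap_comp:
  assumes "vector_space s1" "vector_space s2" "vector_space s3"
    "gmap s1 s2 G H m f" "gmap s2 s3 H J n g" "p = m + n"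
  shows "gmap s1 s3 G J p (\<lambda>x. g (f x))"
  unfolding gmap_def lin_on_def assms(6) diff_diff_eq[symmetric]
  using gmap_lin[OF assms(1,2,4)] gmap_lin[OF assms(2,3,5)] gmapD[OF assms(4)] gmapD[OF assms(5)]
  by simp

lemma gmap_add:
  assumes "vector_space s1" "vector_space s2" "gmap s1 s2 G H m f" "gmap s1 s2 G H m g"
    "\<And>k. module.subspace s2 (H k)"
  shows "gmap s1 s2 G H m (\<lambda>x. f x + g x)"
proof -
  interpret v2: vector_space s2 by fact
  show ?thesis
    unfolding gmap_def lin_on_def
    using gmap_lin[OF assms(1-3)] gmap_lin[OF assms(1,2,4)] gmapD[OF assms(3)] gmapD[OF assms(4)] assms(5)
    by (simp add: v2.scale_right_distrib algebra_simps v2.subspace_add)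
qed

lemma gmap_minus:
  assumes "vector_space s1" "vector_space s2" "gmap s1 s2 G H m f"
    "\<And>k. module.subspace s2 (H k)"
  shows "gmap s1 s2 G H m (\<lambda>x. - f x)"
proof -
  interpret v2: vector_space s2 by fact
  show ?thesis
    unfolding gmap_def lin_on_def
    using gmap_lin[OF assms(1-3)] gmapD[OF assms(3)] assms(4)
    by (simp add: v2.subspace_neg)
qed

lemma gmap_zero:
  assumes "vector_space s2" "\<And>k. module.subspace s2 (H k)"
  shows "gmap s1 s2 G H m (\<lambda>x. 0)"
proof -
  interpret v2: vector_space s2 by fact
  show ?thesis unfolding gmap_def lin_on_def using assms(2) by (simp add: v2.subspace_0)
qed

lemma gmap_id: "gmap s s G G 0 id"
  by (auto simp: gmap_def lin_on_def)

section \<open>Shifted morphisms\<close>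

text \<open>The data of a cospan that matter for composing morphisms up to homotopy; the filtration axioms
  and \<^term>\<open>d (d x) = 0\<close> play no role there.\<close>
definition wcos :: "('k::field \<Rightarrow> 'v::ab_group_add \<Rightarrow> 'v) \<Rightarrow> 'v cospan \<Rightarrow> bool" where
  "wcos s C \<longleftrightarrow> vector_space s \<and>
     gmap s s (upG C) (upG C) 1 (upD C) \<and> gmap s s (dnG C) (dnG C) 1 (dnD C) \<and>
     gmap s s (DG C) (DG C) 1 (DD C) \<and> gmap s s (upG C) (DG C) 0 (psiU C) \<and>
     gmap s s (dnG C) (DG C) 0 (psiD C) \<and>
     (\<forall>k. module.subspace s (upG C k)) \<and> (\<forall>k. module.subspace s (dnG C k)) \<and> (\<forall>k. module.subspace s (DG C k))"

lemma is_cospan_wcos: "vector_space s \<Longrightarrow> is_cospan s C \<Longrightarrow> wcos s C"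
  by (auto simp: is_cospan_def wcos_def is_chain_def is_graded_def)

text \<open>Here \<open>A\<close> turns filtration values into real numbers on which the flow acts by translation.
  With \<open>A = real_of_ereal\<close> and \<open>e = 0\<close> one recovers \<^const>\<open>is_mor\<close>, with \<open>A\<close> derived
  from the inverse of \<open>\<phi>\<close> one gets morphisms into \<^term>\<open>Tcos \<phi> e X\<close>.\<close>
definition emor :: "(ereal \<Rightarrow> real) \<Rightarrow> ('k::field \<Rightarrow> 'v::ab_group_add \<Rightarrow> 'v) \<Rightarrow> ('k \<Rightarrow> 'w::ab_group_add \<Rightarrow> 'w)
    \<Rightarrow> real \<Rightarrow> int \<Rightarrow> 'v cospan \<Rightarrow> 'w cospan \<Rightarrow> ('v, 'w) cmor \<Rightarrow> bool" where
  "emor A s1 s2 e m C X f \<longleftrightarrow>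
     gmap s1 s2 (dnG C) (dnG X) m (mDn f) \<and> gmap s1 s2 (upG C) (upG X) m (mUp f) \<and>
     gmap s1 s2 (DG C) (DG X) m (mMid f) \<and>
     gmap s1 s2 (dnG C) (DG X) (m - 1) (KDn f) \<and> gmap s1 s2 (upG C) (DG X) (m - 1) (KUp f) \<and>
     (\<forall>x\<in>gcar s1 (upG C). mUp f x \<noteq> 0 \<longrightarrow> A (upL X (mUp f x)) \<le> A (upL C x) + e) \<and>
     (\<forall>x\<in>gcar s1 (dnG C). mDn f x \<noteq> 0 \<longrightarrow> A (dnL X (mDn f x)) \<ge> A (dnL C x) - e)"

lemma emorD:
  assumes "emor A s1 s2 e m C X f"
  shows "gmap s1 s2 (dnG C) (dnG X) m (mDn f)" "gmap s1 s2 (upG C) (upG X) m (mUp f)"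
     "gmap s1 s2 (DG C) (DG X) m (mMid f)"
     "gmap s1 s2 (dnG C) (DG X) (m - 1) (KDn f)" "gmap s1 s2 (upG C) (DG X) (m - 1) (KUp f)"
  using assms by (auto simp: emor_def)

lemma emorL:
  assumes "emor A s1 s2 e m C X f"
  shows "x\<in>gcar s1 (upG C) \<Longrightarrow> mUp f x \<noteq> 0 \<Longrightarrow> A (upL X (mUp f x)) \<le> A (upL C x) + e"
    "x\<in>gcar s1 (dnG C) \<Longrightarrow> mDn f x \<noteq> 0 \<Longrightarrow> A (dnL X (mDn f x)) \<ge> A (dnL C x) - e"
  using assms by (auto simp: emor_def)

lemma wcosD:
  assumes "wcos s C"
  shows "gmap s s (upG C) (upG C) 1 (upD C)" "gmap s s (dnG C) (dnG C) 1 (dnD C)"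
     "gmap s s (DG C) (DG C) 1 (DD C)" "gmap s s (upG C) (DG C) 0 (psiU C)"
     "gmap s s (dnG C) (DG C) 0 (psiD C)"
  using assms by (auto simp: wcos_def)

lemma wcos_vs: "wcos s C \<Longrightarrow> vector_space s"
  by (simp add: wcos_def)

lemma wcos_sub:
  assumes "wcos s C"
  shows "module.subspace s (upG C k)" "module.subspace s (dnG C k)" "module.subspace s (DG C k)"
  using assms by (auto simp: wcos_def)

lemma emor_comp:
  assumes w: "wcos s1 C" "wcos s2 X" "wcos s3 Y"
    and f: "emor A s1 s2 e m C X f" and g: "emor A s2 s3 e' n X Y g"
    and "e'' = e + e'" "p = m + n"
  shows "emor A s1 s3 e'' p C Y (mcomp g f)"
proof -
  note v = w[THEN wcos_vs]
  note fl = emorD[OF f] and gl = emorD[OF g]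
  note ll = fl[THEN gmap_lin[OF v(1,2)]] gl[THEN gmap_lin[OF v(2,3)]]
  have u: "A (upL Y (mUp g (mUp f x))) \<le> A (upL C x) + e''"
    if "x\<in>gcar s1 (upG C)" "mUp g (mUp f x) \<noteq> 0" for x
  proof -
    have "mUp f x \<noteq> 0" using that ll by metis
    then show ?thesis using emorL(1)[OF f that(1)] emorL(1)[OF g _ that(2)] that(1) ll assms(6) by fastforce
  qed
  have d: "A (dnL Y (mDn g (mDn f x))) \<ge> A (dnL C x) - e''"
    if "x\<in>gcar s1 (dnG C)" "mDn g (mDn f x) \<noteq> 0" for x
  proof -
    have "mDn f x \<noteq> 0" using that ll by metis
    then show ?thesis using emorL(2)[OF f that(1)] emorL(2)[OF g _ that(2)] that(1) ll assms(6) by fastforce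
  qed
  show ?thesis unfolding emor_def assms(7)
    using gmap_comp[OF v fl(1) gl(1) refl] gmap_comp[OF v fl(2) gl(2) refl] gmap_comp[OF v fl(3) gl(3) refl]
      gmap_add[OF v(1,3) gmap_comp[OF v fl(1) gl(4)] gmap_comp[OF v fl(4) gl(3)] wcos_sub(3)[OF w(3)]]
      gmap_add[OF v(1,3) gmap_comp[OF v fl(2) gl(5)] gmap_comp[OF v fl(5) gl(3)] wcos_sub(3)[OF w(3)]]
      u d add_diff_eq[of n m 1]
    by (simp add: mcomp_def comp_def algebra_simps)
qed

text \<open>The vanishing of \<open>delta 0 C X f\<close> on the carriers, solved for the values of
  \<open>f\<close> on boundaries so that it can serve as a set of rewrite rules.\<close>

definition mcyc :: "('k::field \<Rightarrow> 'v::ab_group_add \<Rightarrow> 'v) \<Rightarrow> 'v cospan \<Rightarrow> 'w::ab_group_add cospan \<Rightarrow> ('v, 'w) cmor \<Rightarrow> bool" where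
  "mcyc s C X f \<longleftrightarrow>
    (\<forall>x\<in>gcar s (dnG C). dnD X (mDn f x) = mDn f (dnD C x) \<and>
        KDn f (dnD C x) = mMid f (psiD C x) - psiD X (mDn f x) - DD X (KDn f x)) \<and>
    (\<forall>x\<in>gcar s (upG C). upD X (mUp f x) = mUp f (upD C x) \<and>
        KUp f (upD C x) = mMid f (psiU C x) - psiU X (mUp f x) - DD X (KUp f x)) \<and>
    (\<forall>x\<in>gcar s (DG C). DD X (mMid f x) = mMid f (DD C x))"

lemma mcyc_iff: "meq s C (delta 0 C X f) mzero \<longleftrightarrow> mcyc s C X f"
  by (auto simp: mcyc_def meq_def delta_def mzero_def sg_def algebra_simps add_eq_0_iff eq_neg_iff_add_eq_0)


lemma mcycD:
  assumes "mcyc s C X f"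
  shows "x\<in>gcar s (dnG C) \<Longrightarrow> mDn f (dnD C x) = dnD X (mDn f x)"
    "x\<in>gcar s (dnG C) \<Longrightarrow> KDn f (dnD C x) = mMid f (psiD C x) - psiD X (mDn f x) - DD X (KDn f x)"
    "x\<in>gcar s (upG C) \<Longrightarrow> mUp f (upD C x) = upD X (mUp f x)"
    "x\<in>gcar s (upG C) \<Longrightarrow> KUp f (upD C x) = mMid f (psiU C x) - psiU X (mUp f x) - DD X (KUp f x)"
    "x\<in>gcar s (DG C) \<Longrightarrow> mMid f (DD C x) = DD X (mMid f x)"
  using assms by (auto simp: mcyc_def)

lemma mcyc_comp:
  assumes w: "wcos s1 C" "wcos s2 X" "wcos s3 Y"
    and f: "emor A s1 s2 e 0 C X f" "mcyc s1 C X f"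
    and g: "emor A s2 s3 e' 0 X Y g" "mcyc s2 X Y g"
  shows "mcyc s1 C Y (mcomp g f)"
proof -
  note v = w[THEN wcos_vs]
  note cl = v[THEN gcar_closed(2)] v[THEN gcar_closed(3)] v[THEN gcar_closed(4)]
  note fl = emorD[OF f(1)] and gl = emorD[OF g(1)]
  note ll = fl[THEN gmap_lin[OF v(1,2)]] gl[THEN gmap_lin[OF v(2,3)]]
    wcosD[OF w(1), THEN gmap_lin[OF v(1,1)]] wcosD[OF w(2), THEN gmap_lin[OF v(2,2)]]
    wcosD[OF w(3), THEN gmap_lin[OF v(3,3)]]
  show ?thesis unfolding mcyc_def mcomp_def
    by (simp add: ll cl mcycD[OF f(2)] mcycD[OF g(2)])
qed

section \<open>Homotopy classes of shifted morphisms\<close>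

definition ehm where
  "ehm A s1 s2 e C X f \<longleftrightarrow> emor A s1 s2 e 0 C X f \<and> mcyc s1 C X f"

text \<open>This is \<open>f = g + delta (-1) h\<close> with the signs of degree -1 resolved: minus
  on the two arms, plus on the middle complex, because \<open>delta\<close> follows opposite
  conventions there.\<close>

definition ehtp :: "('k::field \<Rightarrow> 'v::ab_group_add \<Rightarrow> 'v) \<Rightarrow> 'v cospan \<Rightarrow> 'w::ab_group_add cospan
    \<Rightarrow> ('v, 'w) cmor \<Rightarrow> ('v, 'w) cmor \<Rightarrow> ('v, 'w) cmor \<Rightarrow> bool" where
  "ehtp s C X f g h \<longleftrightarrow>
    (\<forall>x\<in>gcar s (dnG C). mDn f x = mDn g x - dnD X (mDn h x) - mDn h (dnD C x) \<and>
       KDn f x = KDn g x + psiD X (mDn h x) + mMid h (psiD C x) + DD X (KDn h x) - KDn h (dnD C x)) \<and>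
    (\<forall>x\<in>gcar s (upG C). mUp f x = mUp g x - upD X (mUp h x) - mUp h (upD C x) \<and>
       KUp f x = KUp g x + psiU X (mUp h x) + mMid h (psiU C x) + DD X (KUp h x) - KUp h (upD C x)) \<and>
    (\<forall>x\<in>gcar s (DG C). mMid f x = mMid g x + DD X (mMid h x) + mMid h (DD C x))"

lemma ehtp_iff: "meq s C (msub f g) (delta (-1) C X h) \<longleftrightarrow> ehtp s C X f g h"
  by (auto simp: ehtp_def meq_def delta_def msub_def sg_def algebra_simps)

lemma ehtpD:
  assumes "ehtp s C X f g h"
  shows "x\<in>gcar s (dnG C) \<Longrightarrow> mDn f x = mDn g x - dnD X (mDn h x) - mDn h (dnD C x)"
    "x\<in>gcar s (dnG C) \<Longrightarrow> KDn f x = KDn g x + psiD X (mDn h x) + mMid h (psiD C x) + DD X (KDn h x) - KDn h (dnD C x)"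
    "x\<in>gcar s (upG C) \<Longrightarrow> mUp f x = mUp g x - upD X (mUp h x) - mUp h (upD C x)"
    "x\<in>gcar s (upG C) \<Longrightarrow> KUp f x = KUp g x + psiU X (mUp h x) + mMid h (psiU C x) + DD X (KUp h x) - KUp h (upD C x)"
    "x\<in>gcar s (DG C) \<Longrightarrow> mMid f x = mMid g x + DD X (mMid h x) + mMid h (DD C x)"
  using assms by (auto simp: ehtp_def)

definition eho where
  "eho A s1 s2 e C X f g \<longleftrightarrow> (\<exists>h. emor A s1 s2 e (-1) C X h \<and> ehtp s1 C X f g h)"

lemma ehm_comp:
  assumes "wcos s1 C" "wcos s2 X" "wcos s3 Y" "ehm A s1 s2 e C X f" "ehm A s2 s3 e' X Y g" "e'' = e + e'"
  shows "ehm A s1 s3 e'' C Y (mcomp g f)"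
  using assms emor_comp[OF assms(1-3), of A e 0 f e' 0 g e'' 0] mcyc_comp[OF assms(1-3)]
  by (auto simp: ehm_def)

lemma ehm_id: "wcos s C \<Longrightarrow> 0 \<le> e \<Longrightarrow> ehm A s s e C C mid"
  by (simp add: ehm_def emor_def mcyc_def mid_def gmap_id gmap_zero wcos_vs wcos_sub
      gmap_lin[OF wcos_vs wcos_vs wcosD(3)])

lemma eho_meq:
  assumes w: "wcos s1 C" "wcos s2 X" and "meq s1 C f g"
  shows "eho A s1 s2 e C X f g"
  unfolding eho_def
  using assms(3)
  by (intro exI[of _ mzero])
    (simp add: emor_def ehtp_def mzero_def meq_def gmap_zero[OF wcos_vs[OF w(2)] wcos_sub(1)[OF w(2)]]
      gmap_zero[OF wcos_vs[OF w(2)] wcos_sub(2)[OF w(2)]] gmap_zero[OF wcos_vs[OF w(2)] wcos_sub(3)[OF w(2)]]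
      gmap_lin[OF wcos_vs[OF w(2)] wcos_vs[OF w(2)] wcosD(1)[OF w(2)]]
      gmap_lin[OF wcos_vs[OF w(2)] wcos_vs[OF w(2)] wcosD(2)[OF w(2)]]
      gmap_lin[OF wcos_vs[OF w(2)] wcos_vs[OF w(2)] wcosD(3)[OF w(2)]]
      gmap_lin[OF wcos_vs[OF w(2)] wcos_vs[OF w(2)] wcosD(4)[OF w(2)]]
      gmap_lin[OF wcos_vs[OF w(2)] wcos_vs[OF w(2)] wcosD(5)[OF w(2)]])

definition madd :: "('v, 'w::ab_group_add) cmor \<Rightarrow> ('v, 'w) cmor \<Rightarrow> ('v, 'w) cmor" where
  "madd f g = \<lparr> mDn = (\<lambda>x. mDn f x + mDn g x), mUp = (\<lambda>x. mUp f x + mUp g x),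
     mMid = (\<lambda>x. mMid f x + mMid g x), KDn = (\<lambda>x. KDn f x + KDn g x), KUp = (\<lambda>x. KUp f x + KUp g x) \<rparr>"

text \<open>\<open>A\<close> has no meaningful value at the infinite level of \<open>0\<close>, hence the case distinctions.\<close>
definition ultra :: "(ereal \<Rightarrow> real) \<Rightarrow> ('k::field \<Rightarrow> 'v::ab_group_add \<Rightarrow> 'v) \<Rightarrow> 'v cospan \<Rightarrow> bool" where
  "ultra A s C \<longleftrightarrow>
    (\<forall>x\<in>gcar s (upG C). \<forall>y\<in>gcar s (upG C). \<forall>r. x + y \<noteq> 0 \<longrightarrow> (x \<noteq> 0 \<longrightarrow> A (upL C x) \<le> r) \<longrightarrow>
       (y \<noteq> 0 \<longrightarrow> A (upL C y) \<le> r) \<longrightarrow> A (upL C (x + y)) \<le> r) \<and>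
    (\<forall>x\<in>gcar s (dnG C). \<forall>y\<in>gcar s (dnG C). \<forall>r. x + y \<noteq> 0 \<longrightarrow> (x \<noteq> 0 \<longrightarrow> A (dnL C x) \<ge> r) \<longrightarrow>
       (y \<noteq> 0 \<longrightarrow> A (dnL C y) \<ge> r) \<longrightarrow> A (dnL C (x + y)) \<ge> r) \<and>
    (\<forall>x\<in>gcar s (upG C). upL C (- x) = upL C x) \<and> (\<forall>x\<in>gcar s (dnG C). dnL C (- x) = dnL C x)"

lemma ultraD:
  assumes "ultra A s C"
  shows "x\<in>gcar s (upG C) \<Longrightarrow> y\<in>gcar s (upG C) \<Longrightarrow> x + y \<noteq> 0 \<Longrightarrow> (x \<noteq> 0 \<Longrightarrow> A (upL C x) \<le> r) \<Longrightarrow>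
       (y \<noteq> 0 \<Longrightarrow> A (upL C y) \<le> r) \<Longrightarrow> A (upL C (x + y)) \<le> r"
    "x\<in>gcar s (dnG C) \<Longrightarrow> y\<in>gcar s (dnG C) \<Longrightarrow> x + y \<noteq> 0 \<Longrightarrow> (x \<noteq> 0 \<Longrightarrow> A (dnL C x) \<ge> r) \<Longrightarrow>
       (y \<noteq> 0 \<Longrightarrow> A (dnL C y) \<ge> r) \<Longrightarrow> A (dnL C (x + y)) \<ge> r"
  using assms unfolding ultra_def by blast+

text \<open>A sum of two maps keeps their common shift by the strong triangle inequality of the
  target. This is why transitivity of \<open>eho\<close>, which adds homotopies, asks for
  \<open>ultra\<close>.\<close>

lemma emor_add:
  assumes w: "wcos s1 C" "wcos s2 X" and u: "ultra A s2 X"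
    and f: "emor A s1 s2 e m C X f" and g: "emor A s1 s2 e m C X g"
  shows "emor A s1 s2 e m C X (madd f g)"
proof -
  note v = w[THEN wcos_vs]
  note fl = emorD[OF f] and gl = emorD[OF g]
  note ll = fl[THEN gmap_lin[OF v(1,2)]] gl[THEN gmap_lin[OF v(1,2)]]
  have "A (upL X (mUp f x + mUp g x)) \<le> A (upL C x) + e" if "x\<in>gcar s1 (upG C)" "mUp f x + mUp g x \<noteq> 0" for x
    by (rule ultraD(1)[OF u]) (use that emorL(1)[OF f that(1)] emorL(1)[OF g that(1)] in \<open>simp_all add: ll\<close>)
  moreover have "A (dnL X (mDn f x + mDn g x)) \<ge> A (dnL C x) - e" if "x\<in>gcar s1 (dnG C)" "mDn f x + mDn g x \<noteq> 0" for x
    by (rule ultraD(2)[OF u]) (use that emorL(2)[OF f that(1)] emorL(2)[OF g that(1)] in \<open>simp_all add: ll\<close>)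
  ultimately show ?thesis unfolding emor_def madd_def
    using gmap_add[OF v fl(1) gl(1) wcos_sub(2)[OF w(2)]] gmap_add[OF v fl(2) gl(2) wcos_sub(1)[OF w(2)]]
      gmap_add[OF v fl(3) gl(3) wcos_sub(3)[OF w(2)]] gmap_add[OF v fl(4) gl(4) wcos_sub(3)[OF w(2)]]
      gmap_add[OF v fl(5) gl(5) wcos_sub(3)[OF w(2)]]
    by simp
qed

lemma eho_add:
  assumes w: "wcos s1 C" "wcos s2 X" and u: "ultra A s2 X"
    and "eho A s1 s2 e C X f f'" "eho A s1 s2 e C X g g'"
  shows "eho A s1 s2 e C X (madd f g) (madd f' g')"
proof -
  note v = w[THEN wcos_vs]
  obtain h k where h: "emor A s1 s2 e (-1) C X h" "ehtp s1 C X f f' h"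
    and k: "emor A s1 s2 e (-1) C X k" "ehtp s1 C X g g' k"
    using assms(4,5) by (auto simp: eho_def)
  note ll = emorD[OF h(1), THEN gmap_lin[OF v(1,2)]] emorD[OF k(1), THEN gmap_lin[OF v(1,2)]]
    wcosD[OF w(2), THEN gmap_lin[OF v(2,2)]]
  have "ehtp s1 C X (madd f g) (madd f' g') (madd h k)"
    unfolding ehtp_def madd_def by (simp add: ll ehtpD[OF h(2)] ehtpD[OF k(2)])
  then show ?thesis using emor_add[OF w u h(1) k(1)] by (auto simp: eho_def)
qed

lemma eho_trans:
  assumes w: "wcos s1 C" "wcos s2 X" and u: "ultra A s2 X"
    and "eho A s1 s2 e C X f g" "eho A s1 s2 e C X g g'"
  shows "eho A s1 s2 e C X f g'"
proof -
  note v = w[THEN wcos_vs]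
  obtain h k where h: "emor A s1 s2 e (-1) C X h" "ehtp s1 C X f g h"
    and k: "emor A s1 s2 e (-1) C X k" "ehtp s1 C X g g' k"
    using assms(4,5) by (auto simp: eho_def)
  note ll = emorD[OF h(1), THEN gmap_lin[OF v(1,2)]] emorD[OF k(1), THEN gmap_lin[OF v(1,2)]]
    wcosD[OF w(2), THEN gmap_lin[OF v(2,2)]]
  have "ehtp s1 C X f g' (madd h k)"
    unfolding ehtp_def madd_def by (simp add: ll ehtpD[OF h(2)] ehtpD[OF k(2)])
  then show ?thesis using emor_add[OF w u h(1) k(1)] by (auto simp: eho_def)
qed

text \<open>The homotopy is \<open>mcomp g h\<close>, so its shift is that of \<open>h\<close> plus
  that of \<open>g\<close>, whatever the shifts \<open>d\<close> and \<open>d'\<close> of the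
  homotopic maps are.\<close>

lemma eho_comp_left:
  assumes w: "wcos s1 C" "wcos s2 X" "wcos s3 Y"
    and f: "emor A s1 s2 d 0 C X f" "emor A s1 s2 d' 0 C X f'"
    and "eho A s1 s2 e C X f f'" and g: "ehm A s2 s3 e' X Y g" and "e'' = e + e'"
  shows "eho A s1 s3 e'' C Y (mcomp g f) (mcomp g f')"
proof -
  note v = w[THEN wcos_vs]
  note cl = v[THEN gcar_closed(2)] v[THEN gcar_closed(3)] v[THEN gcar_closed(4)]
  obtain h where h: "emor A s1 s2 e (-1) C X h" "ehtp s1 C X f f' h"
    using assms(6) by (auto simp: eho_def)
  have g: "emor A s2 s3 e' 0 X Y g" "mcyc s2 X Y g" using g by (auto simp: ehm_def)
  note ll = emorD[OF h(1), THEN gmap_lin[OF v(1,2)]] emorD[OF g(1), THEN gmap_lin[OF v(2,3)]]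
    emorD[OF f(1), THEN gmap_lin[OF v(1,2)]] emorD[OF f(2), THEN gmap_lin[OF v(1,2)]]
    wcosD[OF w(1), THEN gmap_lin[OF v(1,1)]] wcosD[OF w(2), THEN gmap_lin[OF v(2,2)]]
    wcosD[OF w(3), THEN gmap_lin[OF v(3,3)]]
  have "ehtp s1 C Y (mcomp g f) (mcomp g f') (mcomp g h)"
    unfolding ehtp_def mcomp_def by (simp add: ll cl ehtpD[OF h(2)] mcycD[OF g(2)])
  moreover have "emor A s1 s3 e'' (-1) C Y (mcomp g h)"
    by (rule emor_comp[OF w h(1) g(1) assms(8)]) simp
  ultimately show ?thesis by (auto simp: eho_def)
qed

lemma eho_comp_right:
  assumes w: "wcos s1 C" "wcos s2 X" "wcos s3 Y"
    and g: "emor A s2 s3 d 0 X Y g" "emor A s2 s3 d' 0 X Y g'"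
    and "eho A s2 s3 e X Y g g'" and f: "ehm A s1 s2 e' C X f" and "e'' = e' + e"
  shows "eho A s1 s3 e'' C Y (mcomp g f) (mcomp g' f)"
proof -
  note v = w[THEN wcos_vs]
  note cl = v[THEN gcar_closed(2)] v[THEN gcar_closed(3)] v[THEN gcar_closed(4)]
  obtain h where h: "emor A s2 s3 e (-1) X Y h" "ehtp s2 X Y g g' h"
    using assms(6) by (auto simp: eho_def)
  have f: "emor A s1 s2 e' 0 C X f" "mcyc s1 C X f" using f by (auto simp: ehm_def)
  note ll = emorD[OF h(1), THEN gmap_lin[OF v(2,3)]] emorD[OF f(1), THEN gmap_lin[OF v(1,2)]]
    emorD[OF g(1), THEN gmap_lin[OF v(2,3)]] emorD[OF g(2), THEN gmap_lin[OF v(2,3)]]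
    wcosD[OF w(1), THEN gmap_lin[OF v(1,1)]] wcosD[OF w(2), THEN gmap_lin[OF v(2,2)]]
    wcosD[OF w(3), THEN gmap_lin[OF v(3,3)]]
  have "ehtp s1 C Y (mcomp g f) (mcomp g' f) (mcomp h f)"
    unfolding ehtp_def mcomp_def by (simp add: ll cl ehtpD[OF h(2)] mcycD[OF f(2)])
  moreover have "emor A s1 s3 e'' (-1) C Y (mcomp h f)"
    by (rule emor_comp[OF w f(1) h(1) assms(8)]) simp
  ultimately show ?thesis by (auto simp: eho_def)
qed

section \<open>Equivalences and interleavings up to homotopy\<close>

definition good where "good A s C \<longleftrightarrow> wcos s C \<and> ultra A s C"

definition eiso where
  "eiso A s1 s2 C X \<longleftrightarrow> (\<exists>f g. ehm A s1 s2 0 C X f \<and> ehm A s2 s1 0 X C g \<and>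
     eho A s1 s1 0 C C (mcomp g f) mid \<and> eho A s2 s2 0 X X (mcomp f g) mid)"

definition eint where
  "eint A s1 s2 e C X \<longleftrightarrow> (\<exists>f g. ehm A s1 s2 e C X f \<and> ehm A s2 s1 e X C g \<and>
     eho A s1 s1 (2 * e) C C (mcomp g f) mid \<and> eho A s2 s2 (2 * e) X X (mcomp f g) mid)"

lemma eiso_eint0: "eiso A s1 s2 C X \<longleftrightarrow> eint A s1 s2 0 C X"
  by (simp add: eiso_def eint_def)

lemma ehm_emor: "ehm A s1 s2 e C X f \<Longrightarrow> emor A s1 s2 e 0 C X f"
  by (simp add: ehm_def)

lemma mcomp_mid: "mcomp mid f = f" 
  by (simp add: mcomp_def mid_def)

lemma eho_mono:
  assumes "eho A s1 s2 e C X f g" "e \<le> e'"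
  shows "eho A s1 s2 e' C X f g"
proof -
  obtain h where h: "emor A s1 s2 e (-1) C X h" "ehtp s1 C X f g h" using assms(1) by (auto simp: eho_def)
  have "emor A s1 s2 e' (-1) C X h"
    using emorD[OF h(1)] emorL[OF h(1)] assms(2) by (fastforce simp: emor_def)
  with h(2) show ?thesis by (auto simp: eho_def)
qed

lemma goodD: "good A s C \<Longrightarrow> wcos s C" "good A s C \<Longrightarrow> ultra A s C"
  by (auto simp: good_def)

text \<open>The homotopy from \<open>mcomp g f\<close> to the identity is composed with
  \<open>a\<close> on one side and \<open>b\<close> on the other, and the three shifts add up. The
  bracketing is the one in which long composites are contracted from the inside; associativity holds
  only up to \<open>meq\<close>.\<close>

lemma eho_insert:
  assumes w: "good A s1 C" "good A s2 X" "good A s3 Y" "good A s4 Z"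
    and f: "ehm A s2 s3 d X Y f" and g: "ehm A s3 s2 d' Y X g" and gf: "eho A s2 s2 d'' X X (mcomp g f) mid"
    and a: "ehm A s1 s2 e C X a" and b: "ehm A s2 s4 e' X Z b" and "d'' = d + d'"
  shows "eho A s1 s4 (e + d'' + e') C Z (mcomp (mcomp b g) (mcomp f a)) (mcomp b a)"
proof -
  have w': "wcos s1 C" "wcos s2 X" "wcos s3 Y" "wcos s4 Z" and u: "ultra A s4 Z" "ultra A s2 X"
    using w by (auto simp: good_def)
  note gfc = ehm_comp[OF w'(2,3,2) f g assms(10)]
  have i: "emor A s2 s2 0 0 X X mid" using ehm_id[OF w'(2), of 0] by (simp add: ehm_def)
  have "eho A s1 s2 (e + d'') C X (mcomp (mcomp g f) a) (mcomp mid a)"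
    by (rule eho_comp_right[OF w'(1,2,2) ehm_emor[OF gfc] i gf a]) simp
  then have 1: "eho A s1 s4 (e + d'' + e') C Z (mcomp b (mcomp (mcomp g f) a)) (mcomp b a)"
    using eho_comp_left[OF w'(1,2,4) ehm_emor[OF ehm_comp[OF w'(1,2,2) a gfc refl]] ehm_emor[OF a] _ b refl]
    by (simp add: mcomp_mid)
  note v = w'[THEN wcos_vs]
  note cl = v[THEN gcar_closed(2)]
  note ll = emorD[OF ehm_emor[OF a], THEN gmap_lin[OF v(1,2)]] emorD[OF ehm_emor[OF b], THEN gmap_lin[OF v(2,4)]]
    emorD[OF ehm_emor[OF f], THEN gmap_lin[OF v(2,3)]] emorD[OF ehm_emor[OF g], THEN gmap_lin[OF v(3,2)]]
  have "meq s1 C (mcomp (mcomp b g) (mcomp f a)) (mcomp b (mcomp (mcomp g f) a))"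
    unfolding meq_def mcomp_def by (simp add: ll cl add.assoc)
  from eho_trans[OF w'(1,4) u(1) eho_meq[OF w'(1,4) this] 1] show ?thesis .
qed

text \<open>The given maps are conjugated by the equivalences. In the composite, the innermost pair
  cancels at shift 0, the next one at shift \<open>2 * e\<close>, and the outer one at shift 0, so
  the total stays at \<open>2 * e\<close>.\<close>

lemma eint_transfer:
  assumes w: "good A s1 C" "good A s2 X" "good A t1 C'" "good A t2 X'"
    and "eint A s1 s2 e C X" and "eiso A s1 t1 C C'" and "eiso A s2 t2 X X'" and e: "0 \<le> e"
  shows "eint A t1 t2 e C' X'"
proof -
  note w' = w[THEN goodD(1)] and u = w[THEN goodD(2)]
  obtain a b where a: "ehm A s1 s2 e C X a" and b: "ehm A s2 s1 e X C b"
    and ba: "eho A s1 s1 (2 * e) C C (mcomp b a) mid" and ab: "eho A s2 s2 (2 * e) X X (mcomp a b) mid"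
    using assms(5) by (auto simp: eint_def)
  obtain f g where f: "ehm A s1 t1 0 C C' f" and g: "ehm A t1 s1 0 C' C g"
    and gf: "eho A s1 s1 0 C C (mcomp g f) mid" and fg: "eho A t1 t1 0 C' C' (mcomp f g) mid"
    using assms(6) by (auto simp: eiso_def)
  obtain p q where p: "ehm A s2 t2 0 X X' p" and q: "ehm A t2 s2 0 X' X q"
    and qp: "eho A s2 s2 0 X X (mcomp q p) mid" and pq: "eho A t2 t2 0 X' X' (mcomp p q) mid"
    using assms(7) by (auto simp: eiso_def)
  have ag: "ehm A t1 s2 e C' X (mcomp a g)" by (rule ehm_comp[OF w'(3,1,2) g a]) simp
  have fb: "ehm A s2 t1 e X C' (mcomp f b)" by (rule ehm_comp[OF w'(2,1,3) b f]) simp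
  have bq: "ehm A t2 s1 e X' C (mcomp b q)" by (rule ehm_comp[OF w'(4,2,1) q b]) simp
  have pa: "ehm A s1 t2 e C X' (mcomp p a)" by (rule ehm_comp[OF w'(1,2,4) a p]) simp
  have a': "ehm A t1 t2 e C' X' (mcomp p (mcomp a g))" by (rule ehm_comp[OF w'(3,2,4) ag p]) simp
  have b': "ehm A t2 t1 e X' C' (mcomp (mcomp f b) q)" by (rule ehm_comp[OF w'(4,2,3) q fb]) simp
  note v = w'[THEN wcos_vs]
  note cl = v[THEN gcar_closed(2)]
  note ll = emorD[OF ehm_emor[OF a], THEN gmap_lin[OF v(1,2)]] emorD[OF ehm_emor[OF b], THEN gmap_lin[OF v(2,1)]]
    emorD[OF ehm_emor[OF f], THEN gmap_lin[OF v(1,3)]] emorD[OF ehm_emor[OF g], THEN gmap_lin[OF v(3,1)]]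
    emorD[OF ehm_emor[OF p], THEN gmap_lin[OF v(2,4)]] emorD[OF ehm_emor[OF q], THEN gmap_lin[OF v(4,2)]]
  have "eho A t1 t1 (e + 0 + e) C' C' (mcomp (mcomp (mcomp f b) q) (mcomp p (mcomp a g))) (mcomp (mcomp f b) (mcomp a g))"
    by (rule eho_insert[OF w(3,2,4,3) p q qp ag fb]) simp
  moreover have "eho A t1 t1 (0 + 2 * e + 0) C' C' (mcomp (mcomp f b) (mcomp a g)) (mcomp f g)"
    by (rule eho_insert[OF w(3,1,2,3) a b ba g f]) simp
  moreover have "eho A t1 t1 (2 * e) C' C' (mcomp f g) mid"
    using fg e by (rule_tac eho_mono[of A t1 t1 0]) auto
  ultimately have 1: "eho A t1 t1 (2 * e) C' C' (mcomp (mcomp (mcomp f b) q) (mcomp p (mcomp a g))) mid"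
    using eho_trans[OF w'(3,3) u(3)] by (metis add_0 add.right_neutral mult_2)
  \<comment> \<open>The two new maps are bracketed differently, as suits the first composite; the
    second one has to be rebracketed before \<open>eho_insert\<close> can find its inner
    pair.\<close>
  have "meq t2 X' (mcomp (mcomp p (mcomp a g)) (mcomp (mcomp f b) q)) (mcomp (mcomp (mcomp p a) g) (mcomp f (mcomp b q)))"
    unfolding meq_def mcomp_def by (simp add: ll cl add.assoc)
  from eho_meq[OF w'(4,4) this]
  have "eho A t2 t2 (2 * e) X' X' (mcomp (mcomp p (mcomp a g)) (mcomp (mcomp f b) q)) (mcomp (mcomp (mcomp p a) g) (mcomp f (mcomp b q)))" .
  moreover have "eho A t2 t2 (e + 0 + e) X' X' (mcomp (mcomp (mcomp p a) g) (mcomp f (mcomp b q))) (mcomp (mcomp p a) (mcomp b q))"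
    by (rule eho_insert[OF w(4,1,3,4) f g gf bq pa]) simp
  moreover have "eho A t2 t2 (0 + 2 * e + 0) X' X' (mcomp (mcomp p a) (mcomp b q)) (mcomp p q)"
    by (rule eho_insert[OF w(4,2,1,4) b a ab q p]) simp
  moreover have "eho A t2 t2 (2 * e) X' X' (mcomp p q) mid"
    using pq e by (rule_tac eho_mono[of A t2 t2 0]) auto
  ultimately have "eho A t2 t2 (2 * e) X' X' (mcomp (mcomp p (mcomp a g)) (mcomp (mcomp f b) q)) mid"
    using eho_trans[OF w'(4,4) u(4)] by (metis add_0 add.right_neutral mult_2)
  with 1 a' b' show ?thesis by (auto simp: eint_def)
qed

lemma eiso_refl: "wcos s C \<Longrightarrow> eiso A s s C C"
  unfolding eiso_def by (intro exI[of _ mid]) (simp add: ehm_id mcomp_mid eho_meq meq_def)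

lemma eiso_sym: "eiso A s1 s2 C X \<Longrightarrow> eiso A s2 s1 X C"
  by (auto simp: eiso_def)

lemma eint_sym: "eint A s1 s2 e C X \<Longrightarrow> eint A s2 s1 e X C"
  by (auto simp: eint_def)

text \<open>An equivalence is a 0-interleaving, so transitivity is the transport of
  \<open>X \<simeq> Y\<close> along \<open>X \<simeq> C\<close>.\<close>

lemma eiso_trans:
  assumes "good A s1 C" "good A s2 X" "good A s3 Y" "eiso A s1 s2 C X" "eiso A s2 s3 X Y"
  shows "eiso A s1 s3 C Y"
  using eint_transfer[OF assms(2,3,1,3) _ eiso_sym[OF assms(4)] eiso_refl, of 0] assms(5) goodD(1)[OF assms(3)]
  by (simp add: eiso_eint0)

text \<open>A strict direct sum decomposition \<open>C = F \<oplus> S\<close> (up to the \<open>K\<close>-components) and a second one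
  \<open>Q = P \<oplus> S\<close> with \<open>F \<simeq> P\<close>.\<close>
lemma eiso_direct_sum:
  assumes w: "good A s C" "good A s F" "good A t P" "good A t Q" "good A t S"
    and FP: "eiso A s t F P"
    and p: "ehm A s s 0 C F p" and i: "ehm A s s 0 F C i"
    and ps: "ehm A s t 0 C S ps" and si: "ehm A t s 0 S C si"
    and j1: "ehm A t t 0 P Q j1" and q1: "ehm A t t 0 Q P q1"
    and j2: "ehm A t t 0 S Q j2" and q2: "ehm A t t 0 Q S q2"
    and z: "KDn j1 = (\<lambda>_. 0)" "KUp j1 = (\<lambda>_. 0)" "KDn j2 = (\<lambda>_. 0)" "KUp j2 = (\<lambda>_. 0)"
      "KDn q1 = (\<lambda>_. 0)" "KUp q1 = (\<lambda>_. 0)" "KDn q2 = (\<lambda>_. 0)" "KUp q2 = (\<lambda>_. 0)"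
    and m: "meq s F (mcomp p i) mid" "meq t S (mcomp ps si) mid" "meq t S (mcomp p si) mzero" "meq s F (mcomp ps i) mzero"
      "meq s C (madd (mcomp i p) (mcomp si ps)) mid"
    and n: "meq t P (mcomp q1 j1) mid" "meq t S (mcomp q2 j2) mid" "meq t S (mcomp q1 j2) mzero" "meq t P (mcomp q2 j1) mzero"
      "meq t Q (madd (mcomp j1 q1) (mcomp j2 q2)) mid"
  shows "eiso A s t C Q"
proof -
  note w' = w[THEN goodD(1)] and u = w[THEN goodD(2)]
  obtain f g where f: "ehm A s t 0 F P f" and g: "ehm A t s 0 P F g"
    and gf: "eho A s s 0 F F (mcomp g f) mid" and fg: "eho A t t 0 P P (mcomp f g) mid"
    using FP by (auto simp: eiso_def)
  \<comment> \<open>On the first summand the given equivalence \<open>F \<simeq> P\<close> is used,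
    on the second the identity of \<open>S\<close>.\<close>
  let ?a1 = "mcomp j1 (mcomp f p)" and ?b1 = "mcomp (mcomp i g) q1"
  let ?a = "madd ?a1 (mcomp j2 ps)" and ?b = "madd ?b1 (mcomp si q2)"
  have fp: "ehm A s t 0 C P (mcomp f p)" by (rule ehm_comp[OF w'(1,2,3) p f]) simp
  have ig: "ehm A t s 0 P C (mcomp i g)" by (rule ehm_comp[OF w'(3,2,1) g i]) simp
  have a1: "ehm A s t 0 C Q ?a1" by (rule ehm_comp[OF w'(1,3,4) fp j1]) simp
  have a2: "ehm A s t 0 C Q (mcomp j2 ps)" by (rule ehm_comp[OF w'(1,5,4) ps j2]) simp
  have b1: "ehm A t s 0 Q C ?b1" by (rule ehm_comp[OF w'(4,3,1) q1 ig]) simp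
  have b2: "ehm A t s 0 Q C (mcomp si q2)" by (rule ehm_comp[OF w'(4,5,1) q2 si]) simp
  note v = w'[THEN wcos_vs]
  note cl = v[THEN gcar_closed(2)] v[THEN gcar_closed(3)] v[THEN gcar_closed(4)]
  have add: "ehm A s1 s2 0 D E (madd h k)" if "ehm A s1 s2 0 D E h" "ehm A s1 s2 0 D E k" "good A s1 D" "good A s2 E"
    for s1 :: "'a \<Rightarrow> 'x::ab_group_add \<Rightarrow> 'x" and s2 :: "'a \<Rightarrow> 'y::ab_group_add \<Rightarrow> 'y" and D E h k
  proof -
    note W = goodD(1)[OF that(3)] goodD(1)[OF that(4)]
    note l = wcosD[OF W(2), THEN gmap_lin[OF W(2)[THEN wcos_vs] W(2)[THEN wcos_vs]]]
      emorD[OF ehm_emor[OF that(1)], THEN gmap_lin[OF W[THEN wcos_vs]]]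
      emorD[OF ehm_emor[OF that(2)], THEN gmap_lin[OF W[THEN wcos_vs]]]
    have "mcyc s1 D E h" "mcyc s1 D E k" using that by (auto simp: ehm_def)
    then have "mcyc s1 D E (madd h k)" unfolding mcyc_def madd_def by (simp add: l)
    then show ?thesis using emor_add[OF W goodD(2)[OF that(4)] ehm_emor[OF that(1)] ehm_emor[OF that(2)]]
      by (simp add: ehm_def)
  qed
  have a: "ehm A s t 0 C Q ?a" by (rule add[OF a1 a2 w(1,4)])
  have b: "ehm A t s 0 Q C ?b" by (rule add[OF b1 b2 w(4,1)])
  note ll = emorD[OF ehm_emor[OF p], THEN gmap_lin[OF v(1,2)]] emorD[OF ehm_emor[OF i], THEN gmap_lin[OF v(2,1)]]
    emorD[OF ehm_emor[OF f], THEN gmap_lin[OF v(2,3)]] emorD[OF ehm_emor[OF g], THEN gmap_lin[OF v(3,2)]]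
    emorD[OF ehm_emor[OF ps], THEN gmap_lin[OF v(1,5)]] emorD[OF ehm_emor[OF si], THEN gmap_lin[OF v(5,1)]]
    emorD[OF ehm_emor[OF j1], THEN gmap_lin[OF v(3,4)]] emorD[OF ehm_emor[OF q1], THEN gmap_lin[OF v(4,3)]]
    emorD[OF ehm_emor[OF j2], THEN gmap_lin[OF v(5,4)]] emorD[OF ehm_emor[OF q2], THEN gmap_lin[OF v(4,5)]]
  \<comment> \<open>The \<open>K\<close>-components of the four mixed composites vanish by
    assumption although those of the single maps need not; solved for one of the two terms, this
    lets the \<open>K\<close>-terms of the large composite cancel.\<close>
  have kk: "x \<in> gcar s (dnG F) \<Longrightarrow> KDn p (mDn i x) = - mMid p (KDn i x)"
    "x \<in> gcar s (upG F) \<Longrightarrow> KUp p (mUp i x) = - mMid p (KUp i x)"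
    "y \<in> gcar t (dnG S) \<Longrightarrow> KDn ps (mDn si y) = - mMid ps (KDn si y)"
    "y \<in> gcar t (upG S) \<Longrightarrow> KUp ps (mUp si y) = - mMid ps (KUp si y)"
    "y \<in> gcar t (dnG S) \<Longrightarrow> KDn p (mDn si y) = - mMid p (KDn si y)"
    "y \<in> gcar t (upG S) \<Longrightarrow> KUp p (mUp si y) = - mMid p (KUp si y)"
    "x \<in> gcar s (dnG F) \<Longrightarrow> KDn ps (mDn i x) = - mMid ps (KDn i x)"
    "x \<in> gcar s (upG F) \<Longrightarrow> KUp ps (mUp i x) = - mMid ps (KUp i x)" for x y
    using m(1-4) unfolding meq_def mcomp_def mid_def mzero_def by (auto simp: eq_neg_iff_add_eq_0)
  note mm = m(1-4)[unfolded meq_def mcomp_def mid_def mzero_def, simplified]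
    n(1-4)[unfolded meq_def mcomp_def mid_def mzero_def, simplified]
  have ba: "meq s C (mcomp ?b ?a) (madd (mcomp (mcomp i g) (mcomp f p)) (mcomp si ps))"
    unfolding meq_def mcomp_def madd_def by (simp add: ll cl mm z)
  have ab: "meq t Q (mcomp ?a ?b) (madd (mcomp j1 (mcomp (mcomp f g) q1)) (mcomp j2 q2))"
    unfolding meq_def mcomp_def madd_def by (simp add: ll cl z mm kk)
  have "eho A s s (0+0+0) C C (mcomp (mcomp i g) (mcomp f p)) (mcomp i p)"
    by (rule eho_insert[OF w(1,2,3,1) f g gf p i]) simp
  then have "eho A s s 0 C C (madd (mcomp (mcomp i g) (mcomp f p)) (mcomp si ps)) (madd (mcomp i p) (mcomp si ps))"
    using eho_add[OF w'(1,1) u(1)] eho_meq[OF w'(1,1), of "mcomp si ps" "mcomp si ps"] by (simp add: meq_def)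
  then have 1: "eho A s s 0 C C (mcomp ?b ?a) mid"
    using eho_trans[OF w'(1,1) u(1)] eho_meq[OF w'(1,1) ba] eho_meq[OF w'(1,1) m(5)] by blast
  have fgq: "eho A t t 0 Q P (mcomp (mcomp f g) q1) (mcomp mid q1)"
    by (rule eho_comp_right[OF w'(4,3,3) ehm_emor[OF ehm_comp[OF w'(3,2,3) g f refl]] ehm_emor[OF ehm_id[OF w'(3)]] fg q1, of 0]) simp_all
  have fgq': "ehm A t t 0 Q P (mcomp (mcomp f g) q1)"
    by (rule ehm_comp[OF w'(4,3,3) q1 ehm_comp[OF w'(3,2,3) g f refl]]) simp
  have "eho A t t 0 Q Q (mcomp j1 (mcomp (mcomp f g) q1)) (mcomp j1 q1)"
    using eho_comp_left[OF w'(4,3,4) ehm_emor[OF fgq'] _ fgq j1, of 0 0] ehm_emor[OF q1] by (simp add: mcomp_mid)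
  then have "eho A t t 0 Q Q (madd (mcomp j1 (mcomp (mcomp f g) q1)) (mcomp j2 q2)) (madd (mcomp j1 q1) (mcomp j2 q2))"
    using eho_add[OF w'(4,4) u(4)] eho_meq[OF w'(4,4), of "mcomp j2 q2" "mcomp j2 q2"] by (simp add: meq_def)
  then have 2: "eho A t t 0 Q Q (mcomp ?a ?b) mid"
    using eho_trans[OF w'(4,4) u(4)] eho_meq[OF w'(4,4) ab] eho_meq[OF w'(4,4) n(5)] by blast
  from 1 2 a b show ?thesis by (auto simp: eiso_def)
qed

lemma eiso_retract:
  assumes w: "good A s C" "good A t F"
    and "ehm A s t 0 C F p" "ehm A t s 0 F C i"
    and "meq t F (mcomp p i) mid" "eho A s s 0 C C (mcomp i p) mid"
  shows "eiso A s t C F"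
  using assms eho_meq[OF goodD(1)[OF w(2)] goodD(1)[OF w(2)] assms(5)] by (auto simp: eiso_def)

section \<open>Exchanging the two arms\<close>

definition sw :: "'v cospan \<Rightarrow> 'v cospan" where
  "sw C = \<lparr> upG = dnG C, upD = dnD C, upL = (\<lambda>x. - dnL C x), dnG = upG C, dnD = upD C, dnL = (\<lambda>x. - upL C x),
     DG = DG C, DD = DD C, psiU = psiD C, psiD = psiU C \<rparr>"

definition swm :: "('v, 'w) cmor \<Rightarrow> ('v, 'w) cmor" where
  "swm f = \<lparr> mDn = mUp f, mUp = mDn f, mMid = mMid f, KDn = KUp f, KUp = KDn f \<rparr>"

text \<open>Exchanging the arms negates levels; the outer sign makes \<open>swA A\<close> increasing
  again whenever \<open>A\<close> is, and turns shifts by \<open>e\<close> into shifts by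
  \<open>e\<close>.\<close>

definition swA :: "(ereal \<Rightarrow> real) \<Rightarrow> ereal \<Rightarrow> real" where "swA A x = - A (- x)"

lemma sw_sw: "sw (sw C) = C" by (simp add: sw_def)
lemma swA_real: "swA real_of_ereal = real_of_ereal" by (simp add: swA_def fun_eq_iff)

lemma emor_sw: "emor A s1 s2 e m C X f \<Longrightarrow> emor (swA A) s1 s2 e m (sw C) (sw X) (swm f)"
  by (auto simp: emor_def sw_def swm_def swA_def)

lemma ehm_sw: "ehm A s1 s2 e C X f \<Longrightarrow> ehm (swA A) s1 s2 e (sw C) (sw X) (swm f)"
  using emor_sw[of A s1 s2 e 0 C X f] by (auto simp: ehm_def mcyc_def sw_def swm_def)

lemma eho_sw: "eho A s1 s2 e C X f g \<Longrightarrow> eho (swA A) s1 s2 e (sw C) (sw X) (swm f) (swm g)"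
proof -
  assume "eho A s1 s2 e C X f g"
  then obtain h where h: "emor A s1 s2 e (-1) C X h" "ehtp s1 C X f g h" by (auto simp: eho_def)
  from h(2) have "ehtp s1 (sw C) (sw X) (swm f) (swm g) (swm h)" by (simp add: ehtp_def sw_def swm_def)
  with emor_sw[OF h(1)] show ?thesis by (auto simp: eho_def)
qed

lemma swm_comp: "swm (mcomp g f) = mcomp (swm g) (swm f)" "swm mid = mid"
  by (auto simp: swm_def mcomp_def mid_def)

lemma eint_sw: "eint A s1 s2 e C X \<Longrightarrow> eint (swA A) s1 s2 e (sw C) (sw X)"
proof -
  assume "eint A s1 s2 e C X"
  then obtain f g where f: "ehm A s1 s2 e C X f" and g: "ehm A s2 s1 e X C g"
    and h: "eho A s1 s1 (2 * e) C C (mcomp g f) mid" "eho A s2 s2 (2 * e) X X (mcomp f g) mid"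
    by (auto simp: eint_def)
  show ?thesis unfolding eint_def
    using ehm_sw[OF f] ehm_sw[OF g] h[THEN eho_sw] unfolding swm_comp by blast
qed

lemma eiso_sw: "eiso A s1 s2 C X \<Longrightarrow> eiso (swA A) s1 s2 (sw C) (sw X)"
  by (simp add: eiso_eint0 eint_sw)

lemma good_sw:
  assumes "good A s C" shows "good (swA A) s (sw C)"
proof -
  have "ultra (swA A) s (sw C)"
    unfolding ultra_def
  proof (intro conjI ballI allI impI)
    fix x y r
    assume "x \<in> gcar s (upG (sw C))" "y \<in> gcar s (upG (sw C))" "x + y \<noteq> 0"
      "x \<noteq> 0 \<longrightarrow> swA A (upL (sw C) x) \<le> r" "y \<noteq> 0 \<longrightarrow> swA A (upL (sw C) y) \<le> r"
    then show "swA A (upL (sw C) (x + y)) \<le> r"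
      using ultraD(2)[OF goodD(2)[OF assms], of x y "-r"] by (auto simp: sw_def swA_def)
  next
    fix x y r
    assume "x \<in> gcar s (dnG (sw C))" "y \<in> gcar s (dnG (sw C))" "x + y \<noteq> 0"
      "x \<noteq> 0 \<longrightarrow> swA A (dnL (sw C) x) \<ge> r" "y \<noteq> 0 \<longrightarrow> swA A (dnL (sw C) y) \<ge> r"
    then show "swA A (dnL (sw C) (x + y)) \<ge> r"
      using ultraD(1)[OF goodD(2)[OF assms], of x y "-r"] by (auto simp: sw_def swA_def)
  qed (use goodD(2)[OF assms] in \<open>auto simp: ultra_def sw_def\<close>)
  then show ?thesis using goodD(1)[OF assms] by (auto simp: good_def wcos_def sw_def)
qed

lemma is_cospan_sw: "is_cospan s C \<Longrightarrow> is_cospan s (sw C)"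
  by (auto simp: is_cospan_def sw_def desc_filt_def)

section \<open>Translation to the flow\<close>

text \<open>\<open>B\<close> is the range of levels on which \<open>A\<close> is order preserving:
  all reals for \<open>real_of_ereal\<close>, the open interval for the flow. The levels of 0 are
  recorded because the shift leaves them alone.\<close>

definition levok :: "real set \<Rightarrow> ('k::field \<Rightarrow> 'v::ab_group_add \<Rightarrow> 'v) \<Rightarrow> 'v cospan \<Rightarrow> bool" where
  "levok B s C \<longleftrightarrow> (\<forall>x\<in>gcar s (upG C). x \<noteq> 0 \<longrightarrow> upL C x \<in> ereal ` B) \<and> (\<forall>x\<in>gcar s (dnG C). x \<noteq> 0 \<longrightarrow> dnL C x \<in> ereal ` B)
     \<and> upL C 0 = -\<infinity> \<and> dnL C 0 = \<infinity>"

lemma levok_sw: "levok B s C \<Longrightarrow> uminus ` B \<subseteq> B' \<Longrightarrow> levok B' s (sw C)"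
  by (fastforce simp: levok_def sw_def)

lemma asc_comb:
  assumes "vector_space s" "asc_filt s G d l" "x \<in> gcar s G" "y \<in> gcar s G"
  shows "l (s a x + s b y) \<le> max (l x) (l y)"
proof -
  let ?X = "\<lambda>i::nat. if i = 0 then x else y" and ?c = "\<lambda>i::nat. if i = 0 then a else b"
  have "l (\<Sum>i\<in>{0,1}. s (?c i) (?X i)) \<le> (SUP i\<in>{i\<in>{0,1}. ?c i \<noteq> 0}. l (?X i))"
    using assms(2,3,4) unfolding asc_filt_def by (elim conjE allE[of _ "{0,1::nat}"] allE[of _ ?X] allE[of _ ?c]) simp
  also have "\<dots> \<le> max (l x) (l y)" by (rule SUP_least) auto
  finally show ?thesis by simp
qed

lemma asc_add:
  assumes "vector_space s" "asc_filt s G d l" "x \<in> gcar s G" "y \<in> gcar s G"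
  shows "l (x + y) \<le> max (l x) (l y)" "l (x - y) \<le> max (l x) (l y)" "l (- x) = l x" "l (s a x) \<le> l x"
proof -
  interpret vector_space s by fact
  show "l (x + y) \<le> max (l x) (l y)" "l (x - y) \<le> max (l x) (l y)"
    using asc_comb[OF assms, of 1 1] asc_comb[OF assms, of 1 "-1"] by auto
  have sc: "l (s a x) \<le> l x" if "x \<in> gcar s G" for a x
    using asc_comb[OF assms(1,2) that that, of a 0] by auto
  then show "l (s a x) \<le> l x" using assms(3) .
  show "l (- x) = l x" using sc[of x "-1"] sc[of "- x" "-1"] assms(3) gcar_closed(4)[OF assms(1) assms(3)] by auto
qed

lemma ultraI:
  assumes w: "wcos s C" and l: "levok B s C" and A: "mono_on (ereal ` B) A"
    and u: "\<And>x y. x \<in> gcar s (upG C) \<Longrightarrow> y \<in> gcar s (upG C) \<Longrightarrow> upL C (x + y) \<le> max (upL C x) (upL C y)"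
      "\<And>x. x \<in> gcar s (upG C) \<Longrightarrow> upL C (- x) = upL C x"
    and d: "\<And>x y. x \<in> gcar s (dnG C) \<Longrightarrow> y \<in> gcar s (dnG C) \<Longrightarrow> dnL C (x + y) \<ge> min (dnL C x) (dnL C y)"
      "\<And>x. x \<in> gcar s (dnG C) \<Longrightarrow> dnL C (- x) = dnL C x"
  shows "ultra A s C"
proof -
  note cl = wcos_vs[OF w, THEN gcar_closed(2)]
  have 1: "A (upL C (x + y)) \<le> r" if x: "x \<in> gcar s (upG C)" and y: "y \<in> gcar s (upG C)" and n: "x + y \<noteq> 0"
    and r: "x \<noteq> 0 \<longrightarrow> A (upL C x) \<le> r" "y \<noteq> 0 \<longrightarrow> A (upL C y) \<le> r" for x y r
  proof (cases "x = 0 \<or> y = 0")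
    case False
    with l x y have "upL C x \<in> ereal ` B" "upL C y \<in> ereal ` B" by (auto simp: levok_def)
    moreover have "upL C (x + y) \<in> ereal ` B" using l n x y cl by (auto simp: levok_def)
    ultimately have "A (upL C (x + y)) \<le> max (A (upL C x)) (A (upL C y))"
      using u(1)[OF x y] mono_onD[OF A] unfolding le_max_iff_disj by auto
    then show ?thesis using r False by auto
  qed (use r n in auto)
  have 2: "r \<le> A (dnL C (x + y))" if x: "x \<in> gcar s (dnG C)" and y: "y \<in> gcar s (dnG C)" and n: "x + y \<noteq> 0"
    and r: "x \<noteq> 0 \<longrightarrow> A (dnL C x) \<ge> r" "y \<noteq> 0 \<longrightarrow> A (dnL C y) \<ge> r" for x y r
  proof (cases "x = 0 \<or> y = 0")
    case False
    with l x y have "dnL C x \<in> ereal ` B" "dnL C y \<in> ereal ` B" by (auto simp: levok_def)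
    moreover have "dnL C (x + y) \<in> ereal ` B" using l n x y cl by (auto simp: levok_def)
    ultimately have "A (dnL C (x + y)) \<ge> min (A (dnL C x)) (A (dnL C y))"
      using d(1)[OF x y] mono_onD[OF A] unfolding min_le_iff_disj by auto
    then show ?thesis using r False by auto
  qed (use r n in auto)
  show ?thesis using 1 2 u(2) d(2) by (auto simp: ultra_def)
qed

lemma good_cospan:
  assumes "vector_space s" "is_cospan s C" "levok B s C" "mono_on (ereal ` B) A"
  shows "good A s C"
proof -
  have a: "asc_filt s (upG C) (upD C) (upL C)" "asc_filt s (dnG C) (dnD C) (\<lambda>x. - dnL C x)"
    using assms(2) by (auto simp: is_cospan_def desc_filt_def)
  have "ultra A s C"
  proof (rule ultraI[OF is_cospan_wcos[OF assms(1,2)] assms(3,4)])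
    show "min (dnL C x) (dnL C y) \<le> dnL C (x + y)" if "x \<in> gcar s (dnG C)" "y \<in> gcar s (dnG C)" for x y
      using asc_add(1)[OF assms(1) a(2) that] by (auto simp: max_def min_def split: if_splits)
    show "dnL C (- x) = dnL C x" if "x \<in> gcar s (dnG C)" for x
      using asc_add(3)[OF assms(1) a(2) that that] by simp
  qed (use asc_add[OF assms(1) a(1)] in auto)
  then show ?thesis using is_cospan_wcos[OF assms(1,2)] by (simp add: good_def)
qed

lemma levok_UNIV:
  assumes "vector_space s" "is_cospan s C"
  shows "levok UNIV s C"
proof -
  have "l x \<in> range ereal" if "asc_filt s G d l" "x \<in> gcar s G" "x \<noteq> 0" for G d l x
    using that unfolding asc_filt_def by (cases "l x") auto
  moreover have "l 0 = -\<infinity>" if "asc_filt s G d l" for G d l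
    using that gcar_closed(1)[OF assms(1)] by (auto simp: asc_filt_def)
  ultimately show ?thesis using assms(2)
    unfolding is_cospan_def levok_def desc_filt_def
    by (metis (no_types, lifting) ereal_uminus_uminus rangeE rangeI uminus_ereal.simps(1,3))
qed

lemma levok_bounded:
  assumes "vector_space s" "is_cospan s C" "bounded_cospan s \<Lambda> C"
  shows "levok {-\<Lambda><..<\<Lambda>} s C"
  using levok_UNIV[OF assms(1,2)] assms(3) unfolding levok_def bounded_cospan_def
  by (fastforce simp: image_iff)

text \<open>\<open>X'\<close> is \<open>X\<close> with its levels relabelled by \<open>f\<close> and
  \<open>g\<close>, and the two equivalences on \<open>B\<close> say that, seen through
  \<open>A\<close>, relabelling is translation by \<open>e\<close>. With the identity this covers
  plain morphisms, with \<open>rho\<close> those into \<open>Tcos \<phi> e X\<close>. At elements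
  sent to 0 the original condition holds trivially, since the target level is infinite.\<close>

lemma is_mor_emor:
  assumes w: "wcos s1 C" "wcos s2 X" and l: "levok B s1 C" "levok B s2 X"
    and TU: "\<And>x. x \<in> gcar s2 (upG X) \<Longrightarrow> upL X' x = (if x = 0 then upL X x else ereal (f (real_of_ereal (upL X x))))"
    and TD: "\<And>x. x \<in> gcar s2 (dnG X) \<Longrightarrow> dnL X' x = (if x = 0 then dnL X x else ereal (g (real_of_ereal (dnL X x))))"
    and X': "upG X' = upG X" "dnG X' = dnG X" "DG X' = DG X"
    and A: "\<And>a b. a \<in> B \<Longrightarrow> b \<in> B \<Longrightarrow> f a \<le> b \<longleftrightarrow> A (ereal a) \<le> A (ereal b) + e"
      "\<And>a b. a \<in> B \<Longrightarrow> b \<in> B \<Longrightarrow> g a \<ge> b \<longleftrightarrow> A (ereal a) \<ge> A (ereal b) - e"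
  shows "is_mor s1 s2 m C X' h \<longleftrightarrow> emor A s1 s2 e m C X h"
proof -
  note v = w[THEN wcos_vs]
  have U: "upL X' (mUp h x) \<le> upL C x \<longleftrightarrow> (mUp h x \<noteq> 0 \<longrightarrow> A (upL X (mUp h x)) \<le> A (upL C x) + e)"
    if p: "gmap s1 s2 (upG C) (upG X) m (mUp h)" and that: "x \<in> gcar s1 (upG C)" for x
  proof (cases "mUp h x = 0")
    case True
    then show ?thesis using l(2) gcar_closed(1)[OF v(2)] by (simp add: TU levok_def)
  next
    case False
    have "x \<noteq> 0" using False gmap_lin[OF v p] by metis
    have hx: "mUp h x \<in> gcar s2 (upG X)" using gmap_mem[OF v p that] .
    from hx \<open>x \<noteq> 0\<close> have "upL C x \<in> ereal ` B" "upL X (mUp h x) \<in> ereal ` B"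
      using l that False unfolding levok_def by blast+
    then obtain a b where "upL C x = ereal b" "upL X (mUp h x) = ereal a" "a \<in> B" "b \<in> B"
      by blast
    then show ?thesis using False A(1)[of a b] by (simp add: TU[OF hx])
  qed
  have D: "dnL X' (mDn h x) \<ge> dnL C x \<longleftrightarrow> (mDn h x \<noteq> 0 \<longrightarrow> A (dnL X (mDn h x)) \<ge> A (dnL C x) - e)"
    if p: "gmap s1 s2 (dnG C) (dnG X) m (mDn h)" and that: "x \<in> gcar s1 (dnG C)" for x
  proof (cases "mDn h x = 0")
    case True
    then show ?thesis using l(2) gcar_closed(1)[OF v(2)] by (simp add: TD levok_def)
  next
    case False
    have "x \<noteq> 0" using False gmap_lin[OF v p] by metis
    have hx: "mDn h x \<in> gcar s2 (dnG X)" using gmap_mem[OF v p that] .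
    from hx \<open>x \<noteq> 0\<close> have "dnL C x \<in> ereal ` B" "dnL X (mDn h x) \<in> ereal ` B"
      using l that False unfolding levok_def by blast+
    then obtain a b where "dnL C x = ereal b" "dnL X (mDn h x) = ereal a" "a \<in> B" "b \<in> B"
      by blast
    then show ?thesis using False A(2)[of a b] by (simp add: TD[OF hx])
  qed
  have "(\<forall>x\<in>gcar s1 (upG C). upL X' (mUp h x) \<le> upL C x) \<longleftrightarrow> (\<forall>x\<in>gcar s1 (upG C). mUp h x \<noteq> 0 \<longrightarrow> A (upL X (mUp h x)) \<le> A (upL C x) + e)"
    if "gmap s1 s2 (upG C) (upG X) m (mUp h)" by (rule ball_cong[OF refl U[OF that]])
  moreover have "(\<forall>x\<in>gcar s1 (dnG C). dnL X' (mDn h x) \<ge> dnL C x) \<longleftrightarrow> (\<forall>x\<in>gcar s1 (dnG C). mDn h x \<noteq> 0 \<longrightarrow> A (dnL X (mDn h x)) \<ge> A (dnL C x) - e)"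
    if "gmap s1 s2 (dnG C) (dnG X) m (mDn h)" by (rule ball_cong[OF refl D[OF that]])
  ultimately show ?thesis unfolding is_mor_def emor_def X' by blast
qed

lemma delta_Tcos: "delta m C (Tcos \<phi> e X) f = delta m C X f"
  by (simp add: delta_def Tcos_def)

lemma is_mor_emor0:
  assumes w: "wcos s1 C" "wcos s2 X" and l: "levok B s1 C" "levok B s2 X"
    and A: "\<And>a b. a \<in> B \<Longrightarrow> b \<in> B \<Longrightarrow> a \<le> b \<longleftrightarrow> A (ereal a) \<le> A (ereal b)"
  shows "is_mor s1 s2 m C X h \<longleftrightarrow> emor A s1 s2 0 m C X h"
proof -
  have 1: "upL X x = (if x = 0 then upL X x else ereal (real_of_ereal (upL X x)))" if "x \<in> gcar s2 (upG X)" for x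
    using l(2) that by (force simp: levok_def)
  have 2: "dnL X x = (if x = 0 then dnL X x else ereal (real_of_ereal (dnL X x)))" if "x \<in> gcar s2 (dnG X)" for x
    using l(2) that by (force simp: levok_def)
  show ?thesis
    by (rule is_mor_emor[where f = "\<lambda>x. x" and g = "\<lambda>x. x" and B = B, OF w l]) (use 1 2 A in auto)
qed

lemma hmor_ehm:
  assumes "wcos s1 C" "wcos s2 X" "levok B s1 C" "levok B s2 X"
    and A: "\<And>a b. a \<in> B \<Longrightarrow> b \<in> B \<Longrightarrow> a \<le> b \<longleftrightarrow> A (ereal a) \<le> A (ereal b)"
  shows "hmor s1 s2 C X f \<longleftrightarrow> ehm A s1 s2 0 C X f" "homotopic s1 s2 C X f g \<longleftrightarrow> eho A s1 s2 0 C X f g"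
  using is_mor_emor0[OF assms] by (simp_all add: hmor_def ehm_def mcyc_iff homotopic_def eho_def ehtp_iff)

text \<open>At shift 0 only the order of levels matters, so every \<open>A\<close> that embeds the
  order of \<open>B\<close> gives the same equivalences. This permits changing from real levels to
  flow parameters later.\<close>

lemma hco_iso_eiso:
  assumes w: "wcos s1 C" "wcos s2 X" and l: "levok B s1 C" "levok B s2 X"
    and A: "\<And>a b. a \<in> B \<Longrightarrow> b \<in> B \<Longrightarrow> a \<le> b \<longleftrightarrow> A (ereal a) \<le> A (ereal b)"
  shows "hco_iso s1 s2 C X \<longleftrightarrow> eiso A s1 s2 C X"
  using hmor_ehm[OF w l A] hmor_ehm[OF w(2,1) l(2,1) A] hmor_ehm[OF w(1,1) l(1,1) A] hmor_ehm[OF w(2,2) l(2,2) A]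
  by (simp add: hco_iso_def eiso_def)

lemma hmor_Tcos_ehm:
  assumes w: "wcos s1 C" "wcos s2 X" and l: "levok B s1 C" "levok B s2 X"
    and A: "\<And>e a b. a \<in> B \<Longrightarrow> b \<in> B \<Longrightarrow> rho \<phi> (- e) a \<le> b \<longleftrightarrow> A (ereal a) \<le> A (ereal b) + e"
      "\<And>e a b. a \<in> B \<Longrightarrow> b \<in> B \<Longrightarrow> rho \<phi> e a \<ge> b \<longleftrightarrow> A (ereal a) \<ge> A (ereal b) - e"
  shows "hmor s1 s2 C (Tcos \<phi> e X) f \<longleftrightarrow> ehm A s1 s2 e C X f"
    "homotopic s1 s2 C (Tcos \<phi> e X) f g \<longleftrightarrow> eho A s1 s2 e C X f g"
proof -
  have *: "is_mor s1 s2 m C (Tcos \<phi> e X) f \<longleftrightarrow> emor A s1 s2 e m C X f" for m f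
    by (rule is_mor_emor[OF w l, where f = "rho \<phi> (- e)" and g = "rho \<phi> e"]) (auto simp: Tcos_def shiftL_def A)
  show "hmor s1 s2 C (Tcos \<phi> e X) f \<longleftrightarrow> ehm A s1 s2 e C X f"
    "homotopic s1 s2 C (Tcos \<phi> e X) f g \<longleftrightarrow> eho A s1 s2 e C X f g"
    using * by (simp_all add: hmor_def ehm_def mcyc_iff delta_Tcos homotopic_def eho_def ehtp_iff)
qed

lemma interleaved_eint:
  assumes w: "wcos s1 C" "wcos s2 X" and l: "levok B s1 C" "levok B s2 X"
    and A: "\<And>e a b. a \<in> B \<Longrightarrow> b \<in> B \<Longrightarrow> rho \<phi> (- e) a \<le> b \<longleftrightarrow> A (ereal a) \<le> A (ereal b) + e"
      "\<And>e a b. a \<in> B \<Longrightarrow> b \<in> B \<Longrightarrow> rho \<phi> e a \<ge> b \<longleftrightarrow> A (ereal a) \<ge> A (ereal b) - e"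
  shows "interleaved \<phi> s1 s2 e C X \<longleftrightarrow> eint A s1 s2 e C X"
proof -
  note h = hmor_Tcos_ehm[where B = B and A = A and \<phi> = \<phi>]
  have 1: "hmor s1 s2 C (Tcos \<phi> e X) f \<longleftrightarrow> ehm A s1 s2 e C X f" for f by (rule h(1)) (use w l A in auto)
  have 2: "hmor s2 s1 X (Tcos \<phi> e C) f \<longleftrightarrow> ehm A s2 s1 e X C f" for f by (rule h(1)) (use w l A in auto)
  have 3: "homotopic s1 s1 C (Tcos \<phi> (2 * e) C) f g \<longleftrightarrow> eho A s1 s1 (2 * e) C C f g" for f g by (rule h(2)) (use w l A in auto)
  have 4: "homotopic s2 s2 X (Tcos \<phi> (2 * e) X) f g \<longleftrightarrow> eho A s2 s2 (2 * e) X X f g" for f g by (rule h(2)) (use w l A in auto)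
  show ?thesis unfolding interleaved_def eint_def 1 2 3 4 ..
qed

section \<open>Models\<close>

lemma vs_fscale: "vector_space (fscale :: 'k::field \<Rightarrow> ('a \<Rightarrow> 'k) \<Rightarrow> _)"
  by unfold_locales (auto simp: fscale_def fun_eq_iff algebra_simps)

section \<open>Supports, carriers and levels in models\<close>

definition unit :: "'a \<Rightarrow> 'a \<Rightarrow> 'k::field" where "unit p = (\<lambda>q. if q = p then 1 else 0)"

lemma fun_sum_apply: "(\<Sum>i\<in>I. f i) x = (\<Sum>i\<in>I. f i x)"
  by (induction I rule: infinite_finite_induct) auto

lemma unit_expand:
  fixes v :: "'a \<Rightarrow> 'k::field"
  assumes "finite T" "\<And>p. v p \<noteq> 0 \<Longrightarrow> p \<in> T"
  shows "v = (\<Sum>p\<in>T. fscale (v p) (unit p))"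
proof
  fix q show "v q = (\<Sum>p\<in>T. fscale (v p) (unit p)) q"
    using assms by (auto simp: fun_sum_apply fscale_def unit_def if_distrib cong: if_cong)
qed

lemma subspace_supp: "module.subspace (fscale :: 'k::field \<Rightarrow> ('a \<Rightarrow> 'k) \<Rightarrow> _) {v. \<forall>p. v p \<noteq> 0 \<longrightarrow> p \<in> T}"
proof -
  interpret vector_space "fscale :: 'k \<Rightarrow> ('a \<Rightarrow> 'k) \<Rightarrow> _" by (rule vs_fscale)
  show ?thesis unfolding subspace_def by (auto simp: fscale_def) (metis add_0)
qed

lemma gcar_supp:
  fixes G :: "int \<Rightarrow> ('a \<Rightarrow> 'k::field) set"
  assumes "finite (\<Union>k. S k)" "\<And>k. G k = {v. \<forall>p. v p \<noteq> 0 \<longrightarrow> p \<in> S k}"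
  shows "gcar fscale G = {v. \<forall>p. v p \<noteq> 0 \<longrightarrow> p \<in> (\<Union>k. S k)}"
proof
  interpret vector_space "fscale :: 'k \<Rightarrow> ('a \<Rightarrow> 'k) \<Rightarrow> _" by (rule vs_fscale)
  show "gcar fscale G \<subseteq> {v. \<forall>p. v p \<noteq> 0 \<longrightarrow> p \<in> (\<Union>k. S k)}"
    by (rule gcar_subset[OF vs_fscale _ subspace_supp]) (auto simp: assms(2))
  show "{v. \<forall>p. v p \<noteq> 0 \<longrightarrow> p \<in> (\<Union>k. S k)} \<subseteq> gcar fscale G"
  proof
    fix v :: "'a \<Rightarrow> 'k" assume "v \<in> {v. \<forall>p. v p \<noteq> 0 \<longrightarrow> p \<in> (\<Union>k. S k)}"
    then have "v = (\<Sum>p\<in>(\<Union>k. S k). fscale (v p) (unit p))" by (intro unit_expand assms(1)) auto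
    also have "\<dots> \<in> gcar fscale G" unfolding gcar_def
      by (intro span_sum span_scale span_base) (auto simp: assms(2) unit_def split: if_splits)
    finally show "v \<in> gcar fscale G" .
  qed
qed

definition upS where "upS L k = {(i, j). i < length L \<and> (\<exists>a. (j, k, a) \<in> set (up_basis (L ! i)))}"
definition dnS where "dnS L k = {(i, j). i < length L \<and> (\<exists>a. (j, k, a) \<in> set (dn_basis (L ! i)))}"
definition midS where "midS L k = {(i, j). i < length L \<and> (j, k) \<in> set (mid_basis (L ! i))}"

lemma up_slot: "(j, k, a) \<in> set (up_basis s) \<Longrightarrow> j < 5" by (cases s) auto
lemma dn_slot: "(j, k, a) \<in> set (dn_basis s) \<Longrightarrow> j < 5" by (cases s) auto
lemma mid_slot: "(j, k) \<in> set (mid_basis s) \<Longrightarrow> j < 5" by (cases s) auto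

lemma finite_slots: "finite (\<Union>k. upS L k)" "finite (\<Union>k. dnS L k)" "finite (\<Union>k. midS L k)"
proof -
  have "(\<Union>k. upS L k) \<subseteq> {..<length L} \<times> {..<5}" "(\<Union>k. dnS L k) \<subseteq> {..<length L} \<times> {..<5}"
    "(\<Union>k. midS L k) \<subseteq> {..<length L} \<times> {..<5}"
    by (auto simp: upS_def dnS_def midS_def dest: up_slot dn_slot mid_slot)
  then show "finite (\<Union>k. upS L k)" "finite (\<Union>k. dnS L k)" "finite (\<Union>k. midS L k)"
    by (simp_all add: finite_subset[of _ "{..<length L} \<times> {..<5}"])
qed

lemma model_G:
  "upG (model L) k = {v. \<forall>p. v p \<noteq> 0 \<longrightarrow> p \<in> upS L k}"
  "dnG (model L) k = {v. \<forall>p. v p \<noteq> 0 \<longrightarrow> p \<in> dnS L k}"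
  "DG (model L) k = {v. \<forall>p. v p \<noteq> 0 \<longrightarrow> p \<in> midS L k}"
  by (auto simp: model_def upS_def dnS_def midS_def)

lemma model_car:
  "gcar fscale (upG (model L :: (nat \<times> nat \<Rightarrow> 'k::field) cospan)) = {v. \<forall>p. v p \<noteq> 0 \<longrightarrow> p \<in> (\<Union>k. upS L k)}"
  "gcar fscale (dnG (model L :: (nat \<times> nat \<Rightarrow> 'k::field) cospan)) = {v. \<forall>p. v p \<noteq> 0 \<longrightarrow> p \<in> (\<Union>k. dnS L k)}"
  "gcar fscale (DG (model L :: (nat \<times> nat \<Rightarrow> 'k::field) cospan)) = {v. \<forall>p. v p \<noteq> 0 \<longrightarrow> p \<in> (\<Union>k. midS L k)}"
  by (rule gcar_supp; simp add: finite_slots model_G)+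

lemma model_maps:
  "upD (model L) v (i, j) = (if j = 0 \<and> i < length L \<and> is_up2 (L ! i) then v (i, 1) else 0)"
  "dnD (model L) v (i, j) = (if j = 2 \<and> i < length L \<and> is_dn2 (L ! i) then v (i, 3) else 0)"
  "DD (model L) v = 0"
  "psiU (model L) v (i, j) = (if j = 4 \<and> i < length L \<and> has_psiU (L ! i) then v (i, 0) else 0)"
  "psiD (model L) v (i, j) = (if j = 4 \<and> i < length L \<and> has_psiD (L ! i) then v (i, 2) else 0)"
  by (auto simp: model_def)

lemma is_up2_E: "is_up2 s \<Longrightarrow> (\<And>a b k. s = Up a b k \<Longrightarrow> P) \<Longrightarrow> P" by (cases s) auto
lemma is_dn2_E: "is_dn2 s \<Longrightarrow> (\<And>a b k. s = Dn a b k \<Longrightarrow> P) \<Longrightarrow> P" by (cases s) auto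

lemma basis_psi:
  "has_psiU s \<Longrightarrow> (0, k, a) \<in> set (up_basis s) \<Longrightarrow> (4, k) \<in> set (mid_basis s)"
  "has_psiD s \<Longrightarrow> (2, k, a) \<in> set (dn_basis s) \<Longrightarrow> (4, k) \<in> set (mid_basis s)"
  by (cases s; auto)+

lemma wcos_model: "wcos fscale (model L :: (nat \<times> nat \<Rightarrow> 'k::field) cospan)"
proof -
  let ?M = "model L :: (nat \<times> nat \<Rightarrow> 'k) cospan"
  note sub = subspace_supp[where 'k = 'k and 'a = "nat \<times> nat"]
  have lin: "lin_on fscale fscale X (upD ?M)" "lin_on fscale fscale X (dnD ?M)" "lin_on fscale fscale X (DD ?M)"
    "lin_on fscale fscale X (psiU ?M)" "lin_on fscale fscale X (psiD ?M)" for X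
    by (auto simp: lin_on_def fun_eq_iff model_maps fscale_def)
  have deg: "v \<in> upG ?M k \<Longrightarrow> upD ?M v \<in> upG ?M (k - 1)" "v \<in> dnG ?M k \<Longrightarrow> dnD ?M v \<in> dnG ?M (k - 1)"
    "v \<in> DG ?M k \<Longrightarrow> DD ?M v \<in> DG ?M (k - 1)" 
    "v \<in> upG ?M k \<Longrightarrow> psiU ?M v \<in> DG ?M (k - 0)" "v \<in> dnG ?M k \<Longrightarrow> psiD ?M v \<in> DG ?M (k - 0)" for v k
        apply (auto simp: model_G model_maps upS_def dnS_def midS_def split: if_splits elim!: is_up2_E is_dn2_E)
        apply fastforce+
     apply (metis basis_psi(1))
    apply (metis basis_psi(2))
    done
  show ?thesis
    unfolding wcos_def gmap_def using deg lin sub by (simp add: vs_fscale model_G)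
qed

lemma gen_image: "{ereal a | i j k a. P i j k a} = (\<lambda>(i, j, k, a). ereal a) ` {(i, j, k, a). P i j k a}"
proof (intro set_eqI iffI)
  fix x assume "x \<in> {ereal a | i j k a. P i j k a}"
  then obtain i j k a where "x = ereal a" "P i j k a" by blast
  then show "x \<in> (\<lambda>(i, j, k, a). ereal a) ` {(i, j, k, a). P i j k a}"
    by (intro image_eqI[of _ _ "(i, j, k, a)"]) auto
qed auto

lemma upL_model: "upL (model L) v = Sup {ereal a | i j k a. i < length L \<and> (j, k, a) \<in> set (up_basis (L ! i)) \<and> v (i, j) \<noteq> 0}"
  by (simp add: model_def)
lemma dnL_model: "dnL (model L) v = Inf {ereal a | i j k a. i < length L \<and> (j, k, a) \<in> set (dn_basis (L ! i)) \<and> v (i, j) \<noteq> 0}"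
  by (simp add: model_def)

lemma finite_gen: "finite {ereal a | i j k a. i < length L \<and> (j, k, a) \<in> set (f (L ! i)) \<and> P i j}"
proof -
  have "{(i, j, k, a). i < length L \<and> (j, k, a) \<in> set (f (L ! i)) \<and> P i j} \<subseteq> (SIGMA i:{..<length L}. set (f (L ! i)))" by auto
  then have "finite {(i, j, k, a). i < length L \<and> (j, k, a) \<in> set (f (L ! i)) \<and> P i j}" by (rule finite_subset) auto
  then show ?thesis by (subst gen_image) (rule finite_imageI)
qed

lemma upL_ge: "i < length L \<Longrightarrow> (j, k, a) \<in> set (up_basis (L ! i)) \<Longrightarrow> v (i, j) \<noteq> 0 \<Longrightarrow> ereal a \<le> upL (model L) v"
  unfolding upL_model by (rule Sup_upper) blast
lemma dnL_le: "i < length L \<Longrightarrow> (j, k, a) \<in> set (dn_basis (L ! i)) \<Longrightarrow> v (i, j) \<noteq> 0 \<Longrightarrow> dnL (model L) v \<le> ereal a"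
  unfolding dnL_model by (rule Inf_lower) blast

text \<open>\<open>A\<close> is controlled only at levels in \<open>B\<close>, so a bound on
  \<open>A (upL (model L) v)\<close> needs the supremum as the level of an actual basis vector in
  the support of \<open>v\<close>; the support meets finitely many levels.\<close>

lemma upL_attained:
  assumes "v \<in> gcar fscale (upG (model L))" "v \<noteq> 0"
  obtains i j k a where "i < length L" "(j, k, a) \<in> set (up_basis (L ! i))" "v (i, j) \<noteq> 0" "upL (model L) v = ereal a"
proof -
  let ?S = "{ereal a | i j k a. i < length L \<and> (j, k, a) \<in> set (up_basis (L ! i)) \<and> v (i, j) \<noteq> 0}"
  obtain i j where "v (i, j) \<noteq> 0" using assms(2) by (auto simp: fun_eq_iff)
  moreover then obtain k a where "i < length L" "(j, k, a) \<in> set (up_basis (L ! i))"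
    using assms(1) unfolding model_car upS_def by blast
  ultimately have ne: "?S \<noteq> {}" by blast
  have fin: "finite ?S" by (rule finite_gen)
  have "upL (model L) v = Max ?S" unfolding upL_model by (rule Max_Sup[OF fin ne, symmetric])
  with Max_in[OF fin ne] have "upL (model L) v \<in> ?S" by metis
  then show thesis using that by auto
qed

lemma dnL_attained:
  assumes "v \<in> gcar fscale (dnG (model L))" "v \<noteq> 0"
  obtains i j k a where "i < length L" "(j, k, a) \<in> set (dn_basis (L ! i))" "v (i, j) \<noteq> 0" "dnL (model L) v = ereal a"
proof -
  let ?S = "{ereal a | i j k a. i < length L \<and> (j, k, a) \<in> set (dn_basis (L ! i)) \<and> v (i, j) \<noteq> 0}"
  obtain i j where "v (i, j) \<noteq> 0" using assms(2) by (auto simp: fun_eq_iff)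
  moreover then obtain k a where "i < length L" "(j, k, a) \<in> set (dn_basis (L ! i))"
    using assms(1) unfolding model_car dnS_def by blast
  ultimately have ne: "?S \<noteq> {}" by blast
  have fin: "finite ?S" by (rule finite_gen)
  have "dnL (model L) v = Min ?S" unfolding dnL_model by (rule Min_Inf[OF fin ne, symmetric])
  with Min_in[OF fin ne] have "dnL (model L) v \<in> ?S" by metis
  then show thesis using that by auto
qed

definition levin where "levin B s \<longleftrightarrow> (\<forall>(j, k, a) \<in> set (up_basis s) \<union> set (dn_basis s). a \<in> B)"

lemma levinD: "levin B s \<Longrightarrow> (j, k, a) \<in> set (up_basis s) \<Longrightarrow> a \<in> B" "levin B s \<Longrightarrow> (j, k, a) \<in> set (dn_basis s) \<Longrightarrow> a \<in> B"
  by (fastforce simp: levin_def)+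

lemma levin_UNIV: "levin UNIV s" by (auto simp: levin_def)

lemma levok_model:
  assumes "\<And>i. i < length L \<Longrightarrow> levin B (L ! i)"
  shows "levok B fscale (model L :: (nat \<times> nat \<Rightarrow> 'k::field) cospan)"
proof -
  let ?M = "model L :: (nat \<times> nat \<Rightarrow> 'k) cospan"
  have "upL ?M x \<in> ereal ` B" if x: "x \<in> gcar fscale (upG ?M)" "x \<noteq> 0" for x
    by (rule upL_attained[OF x]) (simp add: levinD(1)[OF assms])
  moreover have "dnL ?M x \<in> ereal ` B" if x: "x \<in> gcar fscale (dnG ?M)" "x \<noteq> 0" for x
    by (rule dnL_attained[OF x]) (simp add: levinD(2)[OF assms])
  moreover have "upL ?M 0 = -\<infinity>" "dnL ?M 0 = \<infinity>" by (simp_all add: upL_model dnL_model bot_ereal_def top_ereal_def)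
  ultimately show ?thesis by (auto simp: levok_def)
qed

lemma good_model:
  assumes "\<And>i. i < length L \<Longrightarrow> levin B (L ! i)" "mono_on (ereal ` B) A"
  shows "good A fscale (model L :: (nat \<times> nat \<Rightarrow> 'k::field) cospan)"
proof -
  let ?M = "model L :: (nat \<times> nat \<Rightarrow> 'k) cospan"
  have "ultra A fscale ?M"
  proof (rule ultraI[OF wcos_model levok_model[OF assms(1)] assms(2)])
    show "upL ?M (x + y) \<le> max (upL ?M x) (upL ?M y)" for x y
      unfolding upL_model[of L "x + y"]
    proof (rule Sup_least, clarsimp)
      fix i j k a assume "i < length L" "(j, k, a) \<in> set (up_basis (L ! i))" "x (i, j) + y (i, j) \<noteq> 0"
      then have "ereal a \<le> upL ?M x \<or> ereal a \<le> upL ?M y" using upL_ge by (metis add_0)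
      then show "ereal a \<le> max (upL ?M x) (upL ?M y)" by (auto simp: le_max_iff_disj)
    qed
    show "dnL ?M (x + y) \<ge> min (dnL ?M x) (dnL ?M y)" for x y
      unfolding dnL_model[of L "x + y"]
    proof (rule Inf_greatest, clarsimp)
      fix i j k a assume "i < length L" "(j, k, a) \<in> set (dn_basis (L ! i))" "x (i, j) + y (i, j) \<noteq> 0"
      then have "ereal a \<ge> dnL ?M x \<or> ereal a \<ge> dnL ?M y" using dnL_le by (metis add_0)
      then show "ereal a \<ge> min (dnL ?M x) (dnL ?M y)" by (auto simp: min_le_iff_disj)
    qed
  qed (auto simp: upL_model dnL_model)
  then show ?thesis by (simp add: good_def wcos_model)
qed

section \<open>Coordinates of summands and maps that permute summands\<close>

fun ty :: "summand \<Rightarrow> nat" where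
  "ty (Up a b k) = 0" | "ty (UpInf a k) = 1" | "ty (Dn a b k) = 2" | "ty (DnInf a k) = 3"
| "ty (Gt a b k) = 4" | "ty (SE a k) = 5" | "ty (NE a k) = 6" | "ty (Sq k) = 7"

fun dg :: "summand \<Rightarrow> int" where
  "dg (Up a b k) = k" | "dg (UpInf a k) = k" | "dg (Dn a b k) = k" | "dg (DnInf a k) = k"
| "dg (Gt a b k) = k" | "dg (SE a k) = k" | "dg (NE a k) = k" | "dg (Sq k) = k"

text \<open>Coordinates in which an \<open>e\<close>-morphism between summands of equal type and degree exists
  iff both coordinates increase by at most \<open>e\<close>.\<close>
fun c1 :: "(ereal \<Rightarrow> real) \<Rightarrow> summand \<Rightarrow> real" where
  "c1 A (Up a b k) = A a" | "c1 A (UpInf a k) = A a" | "c1 A (Dn a b k) = - A a" | "c1 A (DnInf a k) = - A a"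
| "c1 A (Gt a b k) = - A a" | "c1 A (SE a k) = - A a" | "c1 A (NE a k) = A a" | "c1 A (Sq k) = 0"

fun c2 :: "(ereal \<Rightarrow> real) \<Rightarrow> summand \<Rightarrow> real" where
  "c2 A (Up a b k) = A b" | "c2 A (Dn a b k) = - A b" | "c2 A (Gt a b k) = A b" | "c2 A _ = 0"

definition sle where
  "sle A e s s' \<longleftrightarrow> ty s = ty s' \<and> dg s = dg s' \<and> c1 A s' \<le> c1 A s + e \<and> c2 A s' \<le> c2 A s + e"

lemma sle_up:
  assumes "sle A e s s'"
  shows "(j, k, a') \<in> set (up_basis s') \<Longrightarrow> \<exists>a. (j, k, a) \<in> set (up_basis s) \<and> A (ereal a') \<le> A (ereal a) + e"
    "(j, k, a) \<in> set (up_basis s) \<Longrightarrow> \<exists>a'. (j, k, a') \<in> set (up_basis s')"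
    "(j, k, a') \<in> set (dn_basis s') \<Longrightarrow> \<exists>a. (j, k, a) \<in> set (dn_basis s) \<and> A (ereal a') \<ge> A (ereal a) - e"
    "(j, k, a) \<in> set (dn_basis s) \<Longrightarrow> \<exists>a'. (j, k, a') \<in> set (dn_basis s')"
    "is_up2 s' = is_up2 s" "is_dn2 s' = is_dn2 s" "has_psiU s' = has_psiU s" "has_psiD s' = has_psiD s"
    "mid_basis s' = mid_basis s"
  using assms by (cases s; cases s'; auto simp: sle_def)+

text \<open>\<open>r\<close> goes backwards, from indices of the target to indices of the source:
  summand \<open>i\<close> is copied to every \<open>i'\<close> with \<open>r i' = Some i\<close>,
  and target summands without a source receive 0.\<close>

definition rel :: "(nat \<Rightarrow> nat option) \<Rightarrow> (nat \<times> nat \<Rightarrow> 'k::zero) \<Rightarrow> nat \<times> nat \<Rightarrow> 'k" where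
  "rel r v = (\<lambda>(i, j). case r i of None \<Rightarrow> 0 | Some i' \<Rightarrow> v (i', j))"

text \<open>One function serves all three complexes because the slots keep them apart; the maps
  commute strictly with the structure, hence the zero \<open>K\<close>-components.\<close>

definition strm :: "('v \<Rightarrow> 'w::zero) \<Rightarrow> ('v, 'w) cmor" where
  "strm f = \<lparr>mDn = f, mUp = f, mMid = f, KDn = (\<lambda>_. 0), KUp = (\<lambda>_. 0)\<rparr>"

lemma rel_apply: "rel r v (i, j) = (case r i of None \<Rightarrow> 0 | Some i' \<Rightarrow> v (i', j))"
  by (simp add: rel_def)

lemma strm_ehm:
  fixes \<phi> :: "(nat \<times> nat \<Rightarrow> 'k::field) \<Rightarrow> (nat \<times> nat \<Rightarrow> 'k)"
  assumes "\<And>x y. \<phi> (x + y) = \<phi> x + \<phi> y" "\<And>c x. \<phi> (fscale c x) = fscale c (\<phi> x)"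
    and w: "wcos fscale C" "wcos fscale X"
    and "\<And>v k. v \<in> upG C k \<Longrightarrow> \<phi> v \<in> upG X k" "\<And>v k. v \<in> dnG C k \<Longrightarrow> \<phi> v \<in> dnG X k" "\<And>v k. v \<in> DG C k \<Longrightarrow> \<phi> v \<in> DG X k"
    and "\<And>v. v \<in> gcar fscale (upG C) \<Longrightarrow> \<phi> v \<noteq> 0 \<Longrightarrow> A (upL X (\<phi> v)) \<le> A (upL C v) + e"
    and "\<And>v. v \<in> gcar fscale (dnG C) \<Longrightarrow> \<phi> v \<noteq> 0 \<Longrightarrow> A (dnL X (\<phi> v)) \<ge> A (dnL C v) - e"
    and "\<And>v. v \<in> gcar fscale (upG C) \<Longrightarrow> upD X (\<phi> v) = \<phi> (upD C v)" "\<And>v. v \<in> gcar fscale (dnG C) \<Longrightarrow> dnD X (\<phi> v) = \<phi> (dnD C v)"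
      "\<And>v. DD X (\<phi> v) = \<phi> (DD C v)" "\<And>v. psiU X (\<phi> v) = \<phi> (psiU C v)" "\<And>v. psiD X (\<phi> v) = \<phi> (psiD C v)"
  shows "ehm A fscale fscale e C X (strm \<phi>)"
proof -
  have "gmap fscale fscale G H 0 \<phi>" if "\<And>v k. v \<in> G k \<Longrightarrow> \<phi> v \<in> H k" for G H
    using assms(1,2) that by (auto simp: gmap_def lin_on_def)
  moreover have "gmap fscale fscale G (DG X) (-1) (\<lambda>_. 0)" for G :: "int \<Rightarrow> (nat \<times> nat \<Rightarrow> 'k) set"
    by (rule gmap_zero[OF vs_fscale wcos_sub(3)[OF w(2)]])
  moreover have "DD X 0 = 0" using wcosD(3)[OF w(2), THEN gmap_lin[OF vs_fscale vs_fscale]] by blast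
  ultimately show ?thesis using assms
    by (simp add: ehm_def emor_def mcyc_def strm_def)
qed

lemma rel_ehm:
  assumes r: "\<And>i i'. r i' = Some i \<Longrightarrow> i < length L \<and> i' < length L' \<and> sle A e (L ! i) (L' ! i')"
    and B: "\<And>i. i < length L \<Longrightarrow> levin B (L ! i)" "\<And>i. i < length L' \<Longrightarrow> levin B (L' ! i)" "mono_on (ereal ` B) A"
  shows "ehm A fscale fscale e (model L) (model L' :: (nat \<times> nat \<Rightarrow> 'k::field) cospan) (strm (rel r))"
proof (rule strm_ehm[OF _ _ wcos_model wcos_model])
  let ?M = "model L :: (nat \<times> nat \<Rightarrow> 'k) cospan" and ?N = "model L' :: (nat \<times> nat \<Rightarrow> 'k) cospan"
  show "rel r (x + y) = rel r x + rel r y" "rel r (fscale c x) = fscale c (rel r x)" for x y :: "nat \<times> nat \<Rightarrow> 'k" and c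
    by (auto simp: fun_eq_iff rel_apply fscale_def split: option.splits)
  show U: "rel r v \<in> upG ?N k" if "v \<in> upG ?M k" for v k
    using that r sle_up(2) by (fastforce simp: model_G upS_def rel_apply split: option.splits)
  show D: "rel r v \<in> dnG ?N k" if "v \<in> dnG ?M k" for v k
    using that r sle_up(4) by (fastforce simp: model_G dnS_def rel_apply split: option.splits)
  show "rel r v \<in> DG ?N k" if "v \<in> DG ?M k" for v k
    using that r sle_up(9) by (fastforce simp: model_G midS_def rel_apply split: option.splits)
  show "upD ?N (rel r v) = rel r (upD ?M v)" "dnD ?N (rel r v) = rel r (dnD ?M v)" "DD ?N (rel r v) = rel r (DD ?M v)"
    "psiU ?N (rel r v) = rel r (psiU ?M v)" "psiD ?N (rel r v) = rel r (psiD ?M v)" for v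
    using r sle_up(5-8) by (auto simp: fun_eq_iff rel_apply model_maps split: option.splits) blast+
  show "A (upL ?N (rel r v)) \<le> A (upL ?M v) + e" if v: "v \<in> gcar fscale (upG ?M)" "rel r v \<noteq> 0" for v
  proof -
    have "rel r v \<in> gcar fscale (upG ?N)"
      using v(1) r sle_up(2) by (fastforce simp: model_car upS_def rel_apply split: option.splits)
    then obtain i j k a where a: "i < length L'" "(j, k, a) \<in> set (up_basis (L' ! i))" "rel r v (i, j) \<noteq> 0" "upL ?N (rel r v) = ereal a"
      using upL_attained v(2) by metis
    then obtain i' where i': "r i = Some i'" "v (i', j) \<noteq> 0" by (auto simp: rel_apply split: option.splits)
    then obtain a' where a': "(j, k, a') \<in> set (up_basis (L ! i'))" "A (ereal a) \<le> A (ereal a') + e"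
      using sle_up(1) r a(2) by blast
    have "upL ?M v \<in> ereal ` B" using levok_model[OF B(1)] v(1) i'(2) by (auto simp: levok_def)
    then have "A (ereal a') \<le> A (upL ?M v)"
      using upL_ge[of i' L j k a' v] i' a' r[OF i'(1)] levinD(1)[OF B(1)] by (intro mono_onD[OF B(3)]) auto
    then show ?thesis using a' a by simp
  qed
  show "A (dnL ?N (rel r v)) \<ge> A (dnL ?M v) - e" if v: "v \<in> gcar fscale (dnG ?M)" "rel r v \<noteq> 0" for v
  proof -
    have "rel r v \<in> gcar fscale (dnG ?N)"
      using v(1) r sle_up(4) by (fastforce simp: model_car dnS_def rel_apply split: option.splits)
    then obtain i j k a where a: "i < length L'" "(j, k, a) \<in> set (dn_basis (L' ! i))" "rel r v (i, j) \<noteq> 0" "dnL ?N (rel r v) = ereal a"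
      using dnL_attained v(2) by metis
    then obtain i' where i': "r i = Some i'" "v (i', j) \<noteq> 0" by (auto simp: rel_apply split: option.splits)
    then obtain a' where a': "(j, k, a') \<in> set (dn_basis (L ! i'))" "A (ereal a) \<ge> A (ereal a') - e"
      using sle_up(3) r a(2) by blast
    have "dnL ?M v \<in> ereal ` B" using levok_model[OF B(1)] v(1) i'(2) by (auto simp: levok_def)
    then have "A (ereal a') \<ge> A (dnL ?M v)"
      using dnL_le[of i' L j k a' v] i' a' r[OF i'(1)] levinD(2)[OF B(1)] by (intro mono_onD[OF B(3)]) auto
    then show ?thesis using a' a by simp
  qed
qed

lemma rel_linear:
  fixes x y :: "nat \<times> nat \<Rightarrow> 'k::field"
  shows "rel r (x + y) = rel r x + rel r y" "rel r (fscale c x) = fscale c (rel r x)" "rel r (0 :: nat \<times> nat \<Rightarrow> 'k) = 0"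
  by (auto simp: fun_eq_iff rel_apply fscale_def split: option.splits)

lemma mcomp_strm: "f 0 = 0 \<Longrightarrow> mcomp (strm f) (strm g) = strm (\<lambda>x. f (g x) :: 'v::ab_group_add)"
  by (simp add: mcomp_def strm_def comp_def)

text \<open>These are the summands that are \<open>d/2\<close>-interleaved with the zero cospan.\<close>
definition small where "small A d s \<longleftrightarrow> ty s \<in> {0, 2} \<and> c2 A s \<le> c1 A s + d"

lemma small_up:
  assumes "small A d s" "(j, k, a) \<in> set (up_basis s)" "j \<noteq> 1"
  shows "j = 0" "\<exists>b. (1, k + 1, b) \<in> set (up_basis s) \<and> A (ereal b) \<le> A (ereal a) + d"
  using assms by (cases s; auto simp: small_def)+

lemma small_dn:
  assumes "small A d s" "(j, k, a) \<in> set (dn_basis s)" "j \<noteq> 3"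
  shows "j = 2" "\<exists>b. (3, k + 1, b) \<in> set (dn_basis s) \<and> A (ereal b) \<ge> A (ereal a) - d"
  using assms by (cases s; auto simp: small_def)+

lemma small_up2:
  assumes "small A d s"
  shows "(0, k, a) \<in> set (up_basis s) \<Longrightarrow> is_up2 s" "(1, k, a) \<in> set (up_basis s) \<Longrightarrow> is_up2 s"
    "(2, k, a) \<in> set (dn_basis s) \<Longrightarrow> is_dn2 s" "(3, k, a) \<in> set (dn_basis s) \<Longrightarrow> is_dn2 s" "mid_basis s = []"
  using assms by (cases s; auto simp: small_def)+

lemma basis_slots:
  "(j, k, a) \<in> set (up_basis s) \<Longrightarrow> j = 0 \<or> j = 1" "(j, k, a) \<in> set (dn_basis s) \<Longrightarrow> j = 2 \<or> j = 3"
  "(j, k) \<in> set (mid_basis s) \<Longrightarrow> j = 4"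
  by (cases s; auto)+

lemma up_basis_unique: "(j, k, a) \<in> set (up_basis s) \<Longrightarrow> (j, k', a') \<in> set (up_basis s) \<Longrightarrow> k' = k \<and> a' = a"
  by (cases s) auto
lemma dn_basis_unique: "(j, k, a) \<in> set (dn_basis s) \<Longrightarrow> (j, k', a') \<in> set (dn_basis s) \<Longrightarrow> k' = k \<and> a' = a"
  by (cases s) auto

text \<open>The composite is the projection to the matched summands. Every unmatched summand is a
  two-term complex with identity differential, and the inverse of that differential is a contracting
  homotopy, whose shift is at most \<open>d\<close> precisely because the summand is small.\<close>

lemma model_contract:
  fixes L :: "summand list"
  assumes r: "\<And>i i'. r i' = Some i \<longleftrightarrow> r' i = Some i'"
    and small: "\<And>i. i < length L \<Longrightarrow> r' i = None \<Longrightarrow> small A d (L ! i)"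
    and B: "\<And>i. i < length L \<Longrightarrow> levin B (L ! i)" "mono_on (ereal ` B) A"
  shows "eho A fscale fscale d (model L) (model L :: (nat \<times> nat \<Rightarrow> 'k::field) cospan) (mcomp (strm (rel r')) (strm (rel r))) mid"
proof -
  let ?M = "model L :: (nat \<times> nat \<Rightarrow> 'k) cospan"
  \<comment> \<open>Slot 1 receives slot 0 and slot 3 receives slot 2: the generator of degree k
    goes to the one of degree k + 1, in either arm.\<close>
  define h :: "(nat \<times> nat \<Rightarrow> 'k) \<Rightarrow> nat \<times> nat \<Rightarrow> 'k"
    where "h v = (\<lambda>(i, j). if r' i = None \<and> (j = 1 \<or> j = 3) then v (i, j - 1) else 0)" for v
  have ha: "h v (i, j) = (if r' i = None \<and> (j = 1 \<or> j = 3) then v (i, j - 1) else 0)" for v i j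
    by (simp add: h_def)
  let ?h = "\<lparr>mDn = h, mUp = h, mMid = (\<lambda>_. 0), KDn = (\<lambda>_. 0), KUp = (\<lambda>_. 0)\<rparr>"
  have rr: "mcomp (strm (rel r')) (strm (rel r)) = (strm (\<lambda>v (i, j). if r' i = None then 0 else v (i, j)) :: (nat \<times> nat \<Rightarrow> 'k, nat \<times> nat \<Rightarrow> 'k) cmor)"
    by (subst mcomp_strm[where f = "rel r'"], rule rel_linear(3), rule arg_cong[where f = strm]) (auto simp: fun_eq_iff rel_apply split: option.splits, (metis r option.distinct(1) option.inject)+)
  have U: "\<exists>k a b. j = 1 \<and> i < length L \<and> v (i, 0) \<noteq> 0 \<and> (0, k, a) \<in> set (up_basis (L ! i)) \<and>
       (1, k + 1, b) \<in> set (up_basis (L ! i)) \<and> A (ereal b) \<le> A (upL ?M v) + d"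
    if v: "v \<in> gcar fscale (upG ?M)" and "h v (i, j) \<noteq> 0" for v i j
  proof -
    have *: "r' i = None" "v (i, j - 1) \<noteq> 0" "j = 1 \<or> j = 3" using that(2) by (auto simp: ha split: if_splits)
    then obtain k a where a: "i < length L" "(j - 1, k, a) \<in> set (up_basis (L ! i))"
      using v unfolding model_car upS_def by blast
    with *(3) basis_slots(1)[OF a(2)] have j: "j = 1" by auto
    obtain b where b: "(1, k + 1, b) \<in> set (up_basis (L ! i))" "A (ereal b) \<le> A (ereal a) + d"
      using small_up(2)[OF small[OF a(1) *(1)] a(2)] j by auto
    have "upL ?M v \<in> ereal ` B" using levok_model[of L B] B(1) *(2) v by (auto simp: levok_def)
    then have "A (ereal a) \<le> A (upL ?M v)"
      using upL_ge[OF a(1), of "j - 1" k a v] *(2) a levinD(1)[OF B(1)] by (intro mono_onD[OF B(2)]) auto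
    then show ?thesis using b j * a by (intro exI[of _ k] exI[of _ a] exI[of _ b]) simp
  qed
  have D: "\<exists>k a b. j = 3 \<and> i < length L \<and> v (i, 2) \<noteq> 0 \<and> (2, k, a) \<in> set (dn_basis (L ! i)) \<and>
       (3, k + 1, b) \<in> set (dn_basis (L ! i)) \<and> A (ereal b) \<ge> A (dnL ?M v) - d"
    if v: "v \<in> gcar fscale (dnG ?M)" and "h v (i, j) \<noteq> 0" for v i j
  proof -
    have *: "r' i = None" "v (i, j - 1) \<noteq> 0" "j = 1 \<or> j = 3" using that(2) by (auto simp: ha split: if_splits)
    then obtain k a where a: "i < length L" "(j - 1, k, a) \<in> set (dn_basis (L ! i))"
      using v unfolding model_car dnS_def by blast
    with *(3) basis_slots(2)[OF a(2)] have j: "j = 3" by auto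
    obtain b where b: "(3, k + 1, b) \<in> set (dn_basis (L ! i))" "A (ereal b) \<ge> A (ereal a) - d"
      using small_dn(2)[OF small[OF a(1) *(1)] a(2)] j by auto
    have "dnL ?M v \<in> ereal ` B" using levok_model[of L B] B(1) *(2) v by (auto simp: levok_def)
    then have "A (ereal a) \<ge> A (dnL ?M v)"
      using dnL_le[OF a(1), of "j - 1" k a v] *(2) a levinD(2)[OF B(1)] by (intro mono_onD[OF B(2)]) auto
    then show ?thesis using b j * a by (intro exI[of _ k] exI[of _ a] exI[of _ b]) simp
  qed
  note bu = up_basis_unique dn_basis_unique
  have degU: "h v \<in> upG ?M (k + 1)" if w: "v \<in> upG ?M k" for v k
    unfolding model_G upS_def
  proof (clarsimp)
    fix i j assume "h v (i, j) \<noteq> 0"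
    from U[OF gcar_closed(6)[OF vs_fscale, where G = "upG ?M", OF w] this] obtain l a b where
      *: "j = 1" "i < length L" "v (i, 0) \<noteq> 0" "(0, l, a) \<in> set (up_basis (L ! i))" "(1, l + 1, b) \<in> set (up_basis (L ! i))"
      by blast
    moreover obtain a' where "(0, k, a') \<in> set (up_basis (L ! i))" using w *(3) unfolding model_G upS_def by blast
    ultimately have "l = k" using bu by blast
    with * show "i < length L \<and> (\<exists>a. (j, k + 1, a) \<in> set (up_basis (L ! i)))" by auto
  qed
  have degD: "h v \<in> dnG ?M (k + 1)" if w: "v \<in> dnG ?M k" for v k
    unfolding model_G dnS_def
  proof (clarsimp)
    fix i j assume "h v (i, j) \<noteq> 0"
    from D[OF gcar_closed(6)[OF vs_fscale, where G = "dnG ?M", OF w] this] obtain l a b where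
      *: "j = 3" "i < length L" "v (i, 2) \<noteq> 0" "(2, l, a) \<in> set (dn_basis (L ! i))" "(3, l + 1, b) \<in> set (dn_basis (L ! i))"
      by blast
    moreover obtain a' where "(2, k, a') \<in> set (dn_basis (L ! i))" using w *(3) unfolding model_G dnS_def by blast
    ultimately have "l = k" using bu by blast
    with * show "i < length L \<and> (\<exists>a. (j, k + 1, a) \<in> set (dn_basis (L ! i)))" by auto
  qed
  have hl: "h (x + y) = h x + h y" "h (fscale c x) = fscale c (h x)" for x y c
    by (auto simp: h_def fun_eq_iff fscale_def)
  have lin: "gmap fscale fscale G H (-1) h" if "\<And>v k. v \<in> G k \<Longrightarrow> h v \<in> H (k + 1)" for G H
    using that hl by (auto simp: gmap_def lin_on_def)
  have linU: "gmap fscale fscale (upG ?M) (upG ?M) (-1) h" by (rule lin) (rule degU)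
  have linD: "gmap fscale fscale (dnG ?M) (dnG ?M) (-1) h" by (rule lin) (rule degD)
  have zero: "gmap fscale fscale G (DG ?M) m (\<lambda>_. 0)" for G m
    by (rule gmap_zero[OF vs_fscale wcos_sub(3)[OF wcos_model]])
  have e: "emor A fscale fscale d (-1) ?M ?M ?h"
  proof -
    have "A (upL ?M (h v)) \<le> A (upL ?M v) + d" if v: "v \<in> gcar fscale (upG ?M)" "h v \<noteq> 0" for v
    proof -
      have "h v \<in> gcar fscale (upG ?M)" using gmap_mem[OF vs_fscale vs_fscale linU v(1)] .
      then obtain i j k a where a: "i < length L" "(j, k, a) \<in> set (up_basis (L ! i))" "h v (i, j) \<noteq> 0" "upL ?M (h v) = ereal a"
        using upL_attained v(2) by metis
      with U[OF v(1) a(3)] bu show ?thesis by metis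
    qed
    moreover have "A (dnL ?M (h v)) \<ge> A (dnL ?M v) - d" if v: "v \<in> gcar fscale (dnG ?M)" "h v \<noteq> 0" for v
    proof -
      have "h v \<in> gcar fscale (dnG ?M)" using gmap_mem[OF vs_fscale vs_fscale linD v(1)] .
      then obtain i j k a where a: "i < length L" "(j, k, a) \<in> set (dn_basis (L ! i))" "h v (i, j) \<noteq> 0" "dnL ?M (h v) = ereal a"
        using dnL_attained v(2) by metis
      with D[OF v(1) a(3)] bu show ?thesis by metis
    qed
    ultimately show ?thesis unfolding emor_def by (simp add: linU linD zero)
  qed
  have sU: "is_up2 (L ! i)" "i < length L" "j = 0 \<or> j = 1" if w: "v \<in> gcar fscale (upG ?M)" "v (i, j) \<noteq> 0" "r' i = None" for v i j
  proof -
    obtain k a where a: "i < length L" "(j, k, a) \<in> set (up_basis (L ! i))" using w(1,2) unfolding model_car upS_def by blast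
    then show "is_up2 (L ! i)" "i < length L" "j = 0 \<or> j = 1" 
      using basis_slots(1)[OF a(2)] small_up2(1,2)[OF small[OF a(1) w(3)]] by auto
  qed
  have sD: "is_dn2 (L ! i)" "i < length L" "j = 2 \<or> j = 3" if w: "v \<in> gcar fscale (dnG ?M)" "v (i, j) \<noteq> 0" "r' i = None" for v i j
  proof -
    obtain k a where a: "i < length L" "(j, k, a) \<in> set (dn_basis (L ! i))" using w(1,2) unfolding model_car dnS_def by blast
    then show "is_dn2 (L ! i)" "i < length L" "j = 2 \<or> j = 3" 
      using basis_slots(2)[OF a(2)] small_up2(3,4)[OF small[OF a(1) w(3)]] by auto
  qed
  have d: "(\<lambda>(i, j). if r' i = None then 0 else v (i, j)) = v - dnD ?M (h v) - h (dnD ?M v)"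
    if v: "v \<in> gcar fscale (dnG ?M)" for v
  proof -
    have z: "r' i = None \<Longrightarrow> j \<noteq> 2 \<Longrightarrow> j \<noteq> 3 \<Longrightarrow> v (i, j) = 0"
      "r' i = None \<Longrightarrow> \<not> (i < length L \<and> is_dn2 (L ! i)) \<Longrightarrow> v (i, j) = 0" for i j
      using sD[OF v, of i j] by blast+
    show ?thesis by (auto simp: fun_eq_iff model_maps ha z)
  qed
  have u: "(\<lambda>(i, j). if r' i = None then 0 else v (i, j)) = v - upD ?M (h v) - h (upD ?M v)"
    if v: "v \<in> gcar fscale (upG ?M)" for v
  proof -
    have z: "r' i = None \<Longrightarrow> j \<noteq> 0 \<Longrightarrow> j \<noteq> 1 \<Longrightarrow> v (i, j) = 0"
      "r' i = None \<Longrightarrow> \<not> (i < length L \<and> is_up2 (L ! i)) \<Longrightarrow> v (i, j) = 0" for i j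
      using sU[OF v, of i j] by blast+
    show ?thesis by (auto simp: fun_eq_iff model_maps ha z)
  qed
  have psi: "psiD ?M (h v) = 0" "psiU ?M (h v) = 0" for v by (auto simp: fun_eq_iff model_maps ha)
  have m: "(\<lambda>(i, j). if r' i = None then 0 else v (i, j)) = v" if v: "v \<in> gcar fscale (DG ?M)" for v
  proof -
    have "r' i \<noteq> None" if w: "v (i, j) \<noteq> 0" for i j
    proof
      assume n: "r' i = None"
      obtain k where "i < length L" "(j, k) \<in> set (mid_basis (L ! i))" using v w unfolding model_car midS_def by blast
      with small_up2(5)[OF small[OF _ n]] show False by auto
    qed
    then have z: "r' i = None \<Longrightarrow> v (i, j) = 0" for i j by metis
    show ?thesis by (auto simp: fun_eq_iff z)
  qed
  have "ehtp fscale ?M ?M (mcomp (strm (rel r')) (strm (rel r))) mid ?h"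
    unfolding rr unfolding ehtp_def strm_def mid_def cmor.simps using d u m psi by (simp add: model_maps(3))
  with e show ?thesis unfolding eho_def by blast
qed

lemma model_eint:
  assumes r: "\<And>i i'. r i' = Some i \<longleftrightarrow> r' i = Some i'"
    and m: "\<And>i i'. r i' = Some i \<Longrightarrow> i < length L \<and> i' < length L' \<and> sle A e (L ! i) (L' ! i') \<and> sle A e (L' ! i') (L ! i)"
    and s: "\<And>i. i < length L \<Longrightarrow> r' i = None \<Longrightarrow> small A (2 * e) (L ! i)"
      "\<And>i. i < length L' \<Longrightarrow> r i = None \<Longrightarrow> small A (2 * e) (L' ! i)"
    and B: "\<And>i. i < length L \<Longrightarrow> levin B (L ! i)" "\<And>i. i < length L' \<Longrightarrow> levin B (L' ! i)" "mono_on (ereal ` B) A"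
  shows "eint A fscale fscale e (model L) (model L' :: (nat \<times> nat \<Rightarrow> 'k::field) cospan)"
  unfolding eint_def
proof (intro exI conjI)
  show "ehm A fscale fscale e (model L) (model L' :: (nat \<times> nat \<Rightarrow> 'k) cospan) (strm (rel r))"
    by (rule rel_ehm[OF _ B]) (use m in auto)
  show "ehm A fscale fscale e (model L') (model L :: (nat \<times> nat \<Rightarrow> 'k) cospan) (strm (rel r'))"
    by (rule rel_ehm[OF _ B(2,1,3)]) (use m r in blast)
  show "eho A fscale fscale (2 * e) (model L) (model L :: (nat \<times> nat \<Rightarrow> 'k) cospan) (mcomp (strm (rel r')) (strm (rel r))) mid"
    by (rule model_contract[OF r s(1) B(1,3)])
  show "eho A fscale fscale (2 * e) (model L') (model L' :: (nat \<times> nat \<Rightarrow> 'k) cospan) (mcomp (strm (rel r)) (strm (rel r'))) mid"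
    by (rule model_contract[OF r[symmetric] s(2) B(2,3)])
qed

section \<open>Models and the exchange of arms\<close>

fun sws :: "summand \<Rightarrow> summand" where
  "sws (Up a b k) = Dn (- a) (- b) k" | "sws (UpInf a k) = DnInf (- a) k" | "sws (Dn a b k) = Up (- a) (- b) k"
| "sws (DnInf a k) = UpInf (- a) k" | "sws (Gt a b k) = Gt (- b) (- a) k" | "sws (SE a k) = NE (- a) k"
| "sws (NE a k) = SE (- a) k" | "sws (Sq k) = Sq k"

definition swj :: "nat \<Rightarrow> nat" where
  "swj j = (if j = 0 then 2 else if j = 2 then 0 else if j = 1 then 3 else if j = 3 then 1 else j)"

lemma sws_basis:
  "(j, k, a) \<in> set (up_basis (sws s)) \<longleftrightarrow> (swj j, k, - a) \<in> set (dn_basis s)"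
  "(j, k, a) \<in> set (dn_basis (sws s)) \<longleftrightarrow> (swj j, k, - a) \<in> set (up_basis s)"
  "mid_basis (sws s) = mid_basis s" "is_up2 (sws s) = is_dn2 s" "is_dn2 (sws s) = is_up2 s"
  "has_psiU (sws s) = has_psiD s" "has_psiD (sws s) = has_psiU s"
  by (cases s; auto simp: swj_def split: if_splits)+

lemma swj_simps: "swj 0 = 2" "swj 1 = 3" "swj (Suc 0) = 3" "swj 2 = 0" "swj 3 = 1" "swj 4 = 4" "swj (swj j) = j"
  by (auto simp: swj_def)

lemma wcos_sw: "wcos s C \<Longrightarrow> wcos s (sw C)"
  by (simp add: wcos_def sw_def)

definition swv :: "(nat \<times> nat \<Rightarrow> 'k) \<Rightarrow> nat \<times> nat \<Rightarrow> 'k" where "swv v = (\<lambda>(i, j). v (i, swj j))"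

lemma swv_apply: "swv v (i, j) = v (i, swj j)" by (simp add: swv_def)

lemma levin_sws: "levin B s \<Longrightarrow> uminus ` B \<subseteq> B \<Longrightarrow> levin B (sws s)"
  unfolding levin_def by (force simp: sws_basis)

text \<open>Both cospans live in the same function space and differ only in the naming of slots,
  with levels negated. The renaming \<open>swv\<close> is an involution, so it serves as its own
  inverse.\<close>

lemma model_sw:
  fixes L :: "summand list"
  assumes B: "\<And>i. i < length L \<Longrightarrow> levin B (L ! i)" "mono_on (ereal ` B) A" "uminus ` B \<subseteq> B"
  shows "eiso A fscale fscale (sw (model L)) (model (map sws L) :: (nat \<times> nat \<Rightarrow> 'k::field) cospan)"
proof -
  let ?M = "sw (model L) :: (nat \<times> nat \<Rightarrow> 'k) cospan" and ?N = "model (map sws L) :: (nat \<times> nat \<Rightarrow> 'k) cospan"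
  let ?K = "model L :: (nat \<times> nat \<Rightarrow> 'k) cospan"
  have wM: "wcos fscale ?M" by (rule wcos_sw[OF wcos_model])
  have B': "\<And>i. i < length (map sws L) \<Longrightarrow> levin B (map sws L ! i)" using B(1,3) levin_sws by auto
  have lM: "levok B fscale ?M" by (rule levok_sw[OF levok_model[OF B(1)] B(3)])
  have lN: "levok B fscale ?N" by (rule levok_model[OF B'])
  have swG: "upG ?M = dnG ?K" "dnG ?M = upG ?K" "DG ?M = DG ?K" "upL ?M = (\<lambda>x. - dnL ?K x)" "dnL ?M = (\<lambda>x. - upL ?K x)"
    "upD ?M = dnD ?K" "dnD ?M = upD ?K" "DD ?M = DD ?K" "psiU ?M = psiD ?K" "psiD ?M = psiU ?K"
    by (auto simp: sw_def)
  have s2: "swv (swv v) = v" for v :: "nat \<times> nat \<Rightarrow> 'k" by (auto simp: fun_eq_iff swv_apply swj_simps)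
  have lin: "swv (x + y) = swv x + swv y" "swv (fscale c x) = fscale c (swv x)" "swv 0 = 0" for x y :: "nat \<times> nat \<Rightarrow> 'k" and c
    by (auto simp: fun_eq_iff swv_apply fscale_def)
  have nz: "swv v \<noteq> 0 \<Longrightarrow> v \<noteq> 0" for v :: "nat \<times> nat \<Rightarrow> 'k" using lin(3) by auto
  have Gs: "swv v p \<noteq> 0 \<Longrightarrow> p \<in> upS (map sws L) k" if "\<forall>p. v p \<noteq> 0 \<longrightarrow> p \<in> dnS L k" for v :: "nat \<times> nat \<Rightarrow> 'k" and p k
    using that unfolding upS_def dnS_def by (cases p) (fastforce simp: swv_apply sws_basis intro: exI[of _ "- _"])
  have Gs': "swv v p \<noteq> 0 \<Longrightarrow> p \<in> dnS L k" if "\<forall>p. v p \<noteq> 0 \<longrightarrow> p \<in> upS (map sws L) k" for v :: "nat \<times> nat \<Rightarrow> 'k" and p k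
    using that unfolding upS_def dnS_def by (cases p) (fastforce simp: swv_apply sws_basis swj_simps)
  have Hs: "swv v p \<noteq> 0 \<Longrightarrow> p \<in> dnS (map sws L) k" if "\<forall>p. v p \<noteq> 0 \<longrightarrow> p \<in> upS L k" for v :: "nat \<times> nat \<Rightarrow> 'k" and p k
    using that unfolding upS_def dnS_def by (cases p) (fastforce simp: swv_apply sws_basis intro: exI[of _ "- _"])
  have Hs': "swv v p \<noteq> 0 \<Longrightarrow> p \<in> upS L k" if "\<forall>p. v p \<noteq> 0 \<longrightarrow> p \<in> dnS (map sws L) k" for v :: "nat \<times> nat \<Rightarrow> 'k" and p k
    using that unfolding upS_def dnS_def by (cases p) (fastforce simp: swv_apply sws_basis swj_simps)
  let ?f = "strm swv :: (nat \<times> nat \<Rightarrow> 'k, nat \<times> nat \<Rightarrow> 'k) cmor"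
  have gm: "gmap fscale fscale G H 0 swv" if "\<And>v k. v \<in> G k \<Longrightarrow> swv v \<in> H k" for G H :: "int \<Rightarrow> (nat \<times> nat \<Rightarrow> 'k) set"
    using lin that by (auto simp: gmap_def lin_on_def)
  have du: "swv v \<in> upG ?N k" if "v \<in> dnG ?K k" for v k using that Gs by (simp add: model_G)
  have ud: "swv v \<in> dnG ?N k" if "v \<in> upG ?K k" for v k using that Hs by (simp add: model_G)
  have ud': "swv v \<in> dnG ?K k" if "v \<in> upG ?N k" for v k using that Gs' by (simp add: model_G)
  have du': "swv v \<in> upG ?K k" if "v \<in> dnG ?N k" for v k using that Hs' by (simp add: model_G)
  have "midS (map sws L) k = midS L k" for k by (auto simp: midS_def sws_basis)
  then have KN: "DG ?N = DG ?K" by (simp add: fun_eq_iff model_G)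
  \<comment> \<open>The middle complex is concentrated in slot 4, which the renaming fixes.\<close>
  have mm: "swv v = v" if v: "v \<in> DG ?K k" for v k
  proof -
    have *: "j = 4" if "v (i, j) \<noteq> 0" for i j
      using that v basis_slots(3) unfolding model_G midS_def by blast
    have "v (i, swj j) = v (i, j)" for i j
    proof (cases "j = 4")
      case False
      then have "swj j \<noteq> 4" by (metis swj_simps(6,7))
      with * False have "v (i, swj j) = 0" "v (i, j) = 0" by blast+
      then show ?thesis by simp
    qed (simp add: swj_simps)
    then show ?thesis by (auto simp: fun_eq_iff swv_apply)
  qed
  have ga: "swv v \<in> gcar fscale (upG ?N)" if "v \<in> gcar fscale (dnG ?K)" for v
    by (rule gmap_mem[OF vs_fscale vs_fscale _ that]) (rule gm, rule du)
  have gb: "swv v \<in> gcar fscale (dnG ?N)" if "v \<in> gcar fscale (upG ?K)" for v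
    by (rule gmap_mem[OF vs_fscale vs_fscale _ that]) (rule gm, rule ud)
  have gc: "swv v \<in> gcar fscale (dnG ?K)" if "v \<in> gcar fscale (upG ?N)" for v
    by (rule gmap_mem[OF vs_fscale vs_fscale _ that]) (rule gm, rule ud')
  have gd: "swv v \<in> gcar fscale (upG ?K)" if "v \<in> gcar fscale (dnG ?N)" for v
    by (rule gmap_mem[OF vs_fscale vs_fscale _ that]) (rule gm, rule du')
  have la: "upL ?N (swv v) \<le> - dnL ?K v" if v: "v \<in> gcar fscale (dnG ?K)" "swv v \<noteq> 0" for v
  proof -
    obtain i j k a where a: "i < length (map sws L)" "(j, k, a) \<in> set (up_basis (map sws L ! i))" "swv v (i, j) \<noteq> 0" "upL ?N (swv v) = ereal a"
      using upL_attained[OF ga[OF v(1)] v(2)] by metis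
    then have "dnL ?K v \<le> ereal (- a)" by (intro dnL_le[of i L "swj j" k]) (auto simp: sws_basis swv_apply)
    then show ?thesis unfolding a(4) by (metis ereal_minus_le_minus ereal_uminus_uminus uminus_ereal.simps(1))
  qed
  have lb: "upL ?K v \<ge> - dnL ?N (swv v)" if v: "v \<in> gcar fscale (upG ?K)" "swv v \<noteq> 0" for v
  proof -
    obtain i j k a where a: "i < length (map sws L)" "(j, k, a) \<in> set (dn_basis (map sws L ! i))" "swv v (i, j) \<noteq> 0" "dnL ?N (swv v) = ereal a"
      using dnL_attained[OF gb[OF v(1)] v(2)] by metis
    then have "upL ?K v \<ge> ereal (- a)" by (intro upL_ge[of i L "swj j" k]) (auto simp: sws_basis swv_apply)
    then show ?thesis unfolding a(4) by simp
  qed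
  have lc: "- dnL ?K (swv v) \<le> upL ?N v" if v: "v \<in> gcar fscale (upG ?N)" "swv v \<noteq> 0" for v
  proof -
    obtain i j k a where a: "i < length L" "(j, k, a) \<in> set (dn_basis (L ! i))" "swv v (i, j) \<noteq> 0" "dnL ?K (swv v) = ereal a"
      using dnL_attained[OF gc[OF v(1)] v(2)] by metis
    then have "ereal (- a) \<le> upL ?N v" by (intro upL_ge[of i _ "swj j" k]) (auto simp: sws_basis swv_apply swj_simps)
    then show ?thesis unfolding a(4) by simp
  qed
  have ld: "upL ?K (swv v) \<le> - dnL ?N v" if v: "v \<in> gcar fscale (dnG ?N)" "swv v \<noteq> 0" for v
  proof -
    obtain i j k a where a: "i < length L" "(j, k, a) \<in> set (up_basis (L ! i))" "swv v (i, j) \<noteq> 0" "upL ?K (swv v) = ereal a"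
      using upL_attained[OF gd[OF v(1)] v(2)] by metis
    then have "dnL ?N v \<le> ereal (- a)" by (intro dnL_le[of i _ "swj j" k]) (auto simp: sws_basis swv_apply swj_simps)
    then show ?thesis unfolding a(4) by (metis ereal_minus_le_minus ereal_uminus_uminus uminus_ereal.simps(1))
  qed
  have AB: "A x \<le> A y" if "x \<le> y" "x \<in> ereal ` B" "y \<in> ereal ` B" for x y
    using mono_onD[OF B(2)] that by blast
  note lM' = lM[unfolded levok_def swG] and lN' = lN[unfolded levok_def]
  have lM2: "dnL ?M v \<in> ereal ` B" if "v \<in> gcar fscale (upG ?K)" "v \<noteq> 0" for v
    using lM that by (auto simp: levok_def swG)
  have lM1: "upL ?M v \<in> ereal ` B" if "v \<in> gcar fscale (dnG ?K)" "v \<noteq> 0" for v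
    using lM that by (auto simp: levok_def swG)
  have lN2: "dnL ?N v \<in> ereal ` B" if "v \<in> gcar fscale (dnG ?N)" "v \<noteq> 0" for v
    using lN that by (auto simp: levok_def)
  have lN1: "upL ?N v \<in> ereal ` B" if "v \<in> gcar fscale (upG ?N)" "v \<noteq> 0" for v
    using lN that by (auto simp: levok_def)
  note lMM = lM1[unfolded swG] lM2[unfolded swG]
  have neg: "- x \<le> y" if "- y \<le> x" for x y :: ereal using that by (metis ereal_minus_le_minus ereal_uminus_uminus)
  have f: "ehm A fscale fscale 0 ?M ?N ?f"
  proof (rule strm_ehm[OF lin(1,2) wM wcos_model], unfold swG)
    fix v
    show "v \<in> dnG ?K k \<Longrightarrow> swv v \<in> upG ?N k" "v \<in> upG ?K k \<Longrightarrow> swv v \<in> dnG ?N k" "v \<in> DG ?K k \<Longrightarrow> swv v \<in> DG ?N k" for k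
      using du ud mm KN by simp_all
    show "A (upL ?N (swv v)) \<le> A (- dnL ?K v) + 0" if "v \<in> gcar fscale (dnG ?K)" "swv v \<noteq> 0"
      using AB[OF la[OF that] lN1[OF ga[OF that(1)] that(2)] lMM(1)[OF that(1) nz[OF that(2)]]] by simp
    show "A (- upL ?K v) - 0 \<le> A (dnL ?N (swv v))" if "v \<in> gcar fscale (upG ?K)" "swv v \<noteq> 0"
      using AB[OF neg[OF lb[OF that]] lMM(2)[OF that(1) nz[OF that(2)]] lN2[OF gb[OF that(1)] that(2)]] by simp
  qed (auto simp: fun_eq_iff swv_apply model_maps sws_basis swj_simps swj_def)
  have g: "ehm A fscale fscale 0 ?N ?M ?f"
  proof (rule strm_ehm[OF lin(1,2) wcos_model wM], unfold swG)
    fix v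
    show "v \<in> upG ?N k \<Longrightarrow> swv v \<in> dnG ?K k" "v \<in> dnG ?N k \<Longrightarrow> swv v \<in> upG ?K k" "v \<in> DG ?N k \<Longrightarrow> swv v \<in> DG ?K k" for k
      using du' ud' mm KN by simp_all
    show "A (- dnL ?K (swv v)) \<le> A (upL ?N v) + 0" if "v \<in> gcar fscale (upG ?N)" "swv v \<noteq> 0"
      using AB[OF lc[OF that] lMM(1)[OF gc[OF that(1)] that(2)] lN1[OF that(1) nz[OF that(2)]]] by simp
    show "A (dnL ?N v) - 0 \<le> A (- upL ?K (swv v))" if "v \<in> gcar fscale (dnG ?N)" "swv v \<noteq> 0"
    proof -
      have "dnL ?N v \<le> - upL ?K (swv v)" using ld[OF that] by (metis ereal_minus_le_minus ereal_uminus_uminus)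
      then show ?thesis using AB lN2[OF that(1) nz[OF that(2)]] lMM(2)[OF gd[OF that(1)] that(2)] by simp
    qed
  qed (auto simp: fun_eq_iff swv_apply model_maps sws_basis swj_simps swj_def)
  have "mcomp ?f ?f = mid"
    by (subst mcomp_strm[where f = swv], rule lin(3)) (simp add: s2 strm_def mid_def fun_eq_iff)
  then show ?thesis unfolding eiso_def using f g
    by (intro exI[of _ ?f]) (simp add: eho_meq[OF wM wM] eho_meq[OF wcos_model wcos_model] meq_def)
qed

lemma mono_on_real: "mono_on (ereal ` B) real_of_ereal"
  by (rule mono_onI) (metis imageE ereal_less_eq(3) real_of_ereal.simps(1))

text \<open>The instance of \<open>eiso_direct_sum\<close> in which the second decomposition is the
  evident one of \<open>L @ [e]\<close>: its inclusions and projections are reindexings.\<close>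

lemma model_sum_split:
  fixes C F :: "'v::ab_group_add cospan" and s :: "'k::field \<Rightarrow> 'v \<Rightarrow> 'v"
  assumes w: "good real_of_ereal s C" "good real_of_ereal s F" and FP: "eiso real_of_ereal s fscale F (model L :: (nat \<times> nat \<Rightarrow> 'k) cospan)"
    and p: "ehm real_of_ereal s s 0 C F p" and i: "ehm real_of_ereal s s 0 F C i"
    and ps: "ehm real_of_ereal s fscale 0 C (model [e] :: (nat \<times> nat \<Rightarrow> 'k) cospan) ps"
    and si: "ehm real_of_ereal fscale s 0 (model [e] :: (nat \<times> nat \<Rightarrow> 'k) cospan) C si"
    and m: "meq s F (mcomp p i) mid" "meq fscale (model [e] :: (nat \<times> nat \<Rightarrow> 'k) cospan) (mcomp ps si) mid"
      "meq fscale (model [e] :: (nat \<times> nat \<Rightarrow> 'k) cospan) (mcomp p si) mzero" "meq s F (mcomp ps i) mzero"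
      "meq s C (madd (mcomp i p) (mcomp si ps)) mid"
  shows "eiso real_of_ereal s fscale C (model (L @ [e]) :: (nat \<times> nat \<Rightarrow> 'k) cospan)"
proof -
  let ?n = "length L"
  \<comment> \<open>Appending leaves the old indices unchanged, so \<open>?r1\<close> describes both
    the inclusion and the projection of the first block; the new summand moves between index 0 and
    index \<open>?n\<close>.\<close>
  let ?r1 = "\<lambda>i. if i < ?n then Some i else None" and ?j2 = "\<lambda>i. if i = ?n then Some 0 else None"
    and ?q2 = "\<lambda>i::nat. if i = 0 then Some ?n else None"
  note mo = mono_on_real[of UNIV]
  have g: "good real_of_ereal fscale (model L' :: (nat \<times> nat \<Rightarrow> 'k) cospan)" for L'
    by (rule good_model[where B = UNIV, OF levin_UNIV mo])
  have e: "ehm real_of_ereal fscale fscale 0 (model L') (model L'' :: (nat \<times> nat \<Rightarrow> 'k) cospan) (strm (rel r))"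
    if "\<And>i i'. r i' = Some i \<Longrightarrow> i < length L' \<and> i' < length L'' \<and> L' ! i = L'' ! i'" for L' L'' r
    by (rule rel_ehm[where B = UNIV, OF _ levin_UNIV levin_UNIV mo]) (use that in \<open>auto simp: sle_def\<close>)
  have c: "v (i, j) = 0" if "v \<in> gcar fscale (upG (model L')) \<or> v \<in> gcar fscale (dnG (model L')) \<or> v \<in> gcar fscale (DG (model L'))"
    "\<not> i < length L'" for v :: "nat \<times> nat \<Rightarrow> 'k" and L' i j
  proof (rule ccontr)
    assume "v (i, j) \<noteq> 0"
    then have "(i, j) \<in> (\<Union>k. upS L' k) \<or> (i, j) \<in> (\<Union>k. dnS L' k) \<or> (i, j) \<in> (\<Union>k. midS L' k)"
      using that(1) unfolding model_car by blast
    then show False using that(2) by (auto simp: upS_def dnS_def midS_def)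
  qed
  show ?thesis
  proof (rule eiso_direct_sum[OF w g g g FP p i ps si _ _ _ _ _ _ _ _ _ _ _ _ m])
    show "ehm real_of_ereal fscale fscale 0 (model L) (model (L @ [e]) :: (nat \<times> nat \<Rightarrow> 'k) cospan) (strm (rel ?r1))"
      by (rule e) (auto simp: nth_append split: if_splits)
    show "ehm real_of_ereal fscale fscale 0 (model (L @ [e])) (model L :: (nat \<times> nat \<Rightarrow> 'k) cospan) (strm (rel ?r1))"
      by (rule e) (auto simp: nth_append split: if_splits)
    show "ehm real_of_ereal fscale fscale 0 (model [e]) (model (L @ [e]) :: (nat \<times> nat \<Rightarrow> 'k) cospan) (strm (rel ?j2))"
      by (rule e) (auto simp: nth_append split: if_splits)
    show "ehm real_of_ereal fscale fscale 0 (model (L @ [e])) (model [e] :: (nat \<times> nat \<Rightarrow> 'k) cospan) (strm (rel ?q2))"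
      by (rule e) (auto simp: nth_append split: if_splits)
    have k1: "rel ?r1 (rel ?r1 v) = v" if "\<And>i j. \<not> i < length L \<Longrightarrow> v (i, j) = 0" for v :: "nat \<times> nat \<Rightarrow> 'k"
      using that by (auto simp: fun_eq_iff rel_apply)
    have k1': "rel ?r1 (rel ?r1 v) = v" if "v \<in> gcar fscale (upG (model L)) \<or> v \<in> gcar fscale (dnG (model L)) \<or> v \<in> gcar fscale (DG (model L))" for v :: "nat \<times> nat \<Rightarrow> 'k"
      by (rule k1, rule c[OF that])
    have k2: "rel ?q2 (rel ?j2 v) = v" if "\<And>i j. \<not> i < length [e] \<Longrightarrow> v (i, j) = 0" for v :: "nat \<times> nat \<Rightarrow> 'k"
      using that by (auto simp: fun_eq_iff rel_apply)
    have k2': "rel ?q2 (rel ?j2 v) = v" if "v \<in> gcar fscale (upG (model [e])) \<or> v \<in> gcar fscale (dnG (model [e])) \<or> v \<in> gcar fscale (DG (model [e]))" for v :: "nat \<times> nat \<Rightarrow> 'k"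
      by (rule k2, rule c[OF that])
    have k3: "rel ?r1 (rel ?r1 v) + rel ?j2 (rel ?q2 v) = v" if "\<And>i j. \<not> i < length (L @ [e]) \<Longrightarrow> v (i, j) = 0" for v :: "nat \<times> nat \<Rightarrow> 'k"
      using that by (auto simp: fun_eq_iff rel_apply)
    have k3': "rel ?r1 (rel ?r1 v) + rel ?j2 (rel ?q2 v) = v" if "v \<in> gcar fscale (upG (model (L @ [e]))) \<or> v \<in> gcar fscale (dnG (model (L @ [e]))) \<or> v \<in> gcar fscale (DG (model (L @ [e])))" for v :: "nat \<times> nat \<Rightarrow> 'k"
      by (rule k3, rule c[OF that])
    have k4: "rel ?r1 (rel ?j2 v) = 0" "rel ?q2 (rel ?r1 v) = 0" for v :: "nat \<times> nat \<Rightarrow> 'k"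
      by (auto simp: fun_eq_iff rel_apply)
    note k = meq_def mcomp_def strm_def mid_def mzero_def madd_def rel_linear(3)
    show "meq fscale (model L :: (nat \<times> nat \<Rightarrow> 'k) cospan) (mcomp (strm (rel ?r1)) (strm (rel ?r1))) mid"
      unfolding k by (simp add: k1' rel_linear(3))
    show "meq fscale (model [e] :: (nat \<times> nat \<Rightarrow> 'k) cospan) (mcomp (strm (rel ?q2)) (strm (rel ?j2))) mid"
      unfolding k by (simp add: k2' rel_linear(3))
    show "meq fscale (model [e] :: (nat \<times> nat \<Rightarrow> 'k) cospan) (mcomp (strm (rel ?r1)) (strm (rel ?j2))) mzero"
      unfolding k by (simp add: k4 rel_linear(3))
    show "meq fscale (model L :: (nat \<times> nat \<Rightarrow> 'k) cospan) (mcomp (strm (rel ?q2)) (strm (rel ?r1))) mzero"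
      unfolding k by (simp add: k4 rel_linear(3))
    show "meq fscale (model (L @ [e]) :: (nat \<times> nat \<Rightarrow> 'k) cospan) (madd (mcomp (strm (rel ?r1)) (strm (rel ?r1))) (mcomp (strm (rel ?j2)) (strm (rel ?q2)))) mid"
      unfolding k by (simp add: k3' rel_linear(3))
  qed (simp_all add: strm_def)
qed

section \<open>Linear functionals on graded spaces\<close>

definition linf :: "('k::field \<Rightarrow> 'v::ab_group_add \<Rightarrow> 'v) \<Rightarrow> 'v set \<Rightarrow> ('v \<Rightarrow> 'k) \<Rightarrow> bool" where
  "linf s X l \<longleftrightarrow> (\<forall>x\<in>X. \<forall>y\<in>X. l (x + y) = l x + l y) \<and> (\<forall>c. \<forall>x\<in>X. l (s c x) = c * l x)"

lemma linfD:
  assumes "linf s (gcar s G) l" "vector_space s"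
  shows "x \<in> gcar s G \<Longrightarrow> y \<in> gcar s G \<Longrightarrow> l (x + y) = l x + l y" "x \<in> gcar s G \<Longrightarrow> l (s c x) = c * l x" "l 0 = 0"
    "x \<in> gcar s G \<Longrightarrow> l (- x) = - l x" "x \<in> gcar s G \<Longrightarrow> y \<in> gcar s G \<Longrightarrow> l (x - y) = l x - l y"
proof -
  note gc = gcar_closed[OF assms(2)]
  show 1: "x \<in> gcar s G \<Longrightarrow> y \<in> gcar s G \<Longrightarrow> l (x + y) = l x + l y" "x \<in> gcar s G \<Longrightarrow> l (s c x) = c * l x" for x y
    using assms by (auto simp: linf_def)
  have "l 0 = l 0 + l 0" using 1(1)[of 0 0] gc(1) by (simp only: add_0)
  then show 2: "l 0 = 0" by (simp only: add_cancel_right_right)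
  show 3: "x \<in> gcar s G \<Longrightarrow> l (- x) = - l x" for x using 1(1)[of x "- x"] 2 gc(4) by (simp add: eq_neg_iff_add_eq_0 add.commute)
  show "x \<in> gcar s G \<Longrightarrow> y \<in> gcar s G \<Longrightarrow> l (x - y) = l x - l y" using 1(1)[of x "- y"] 3 gc(4) by simp
qed

lemma linf_mono: "linf s X l \<Longrightarrow> Y \<subseteq> X \<Longrightarrow> linf s Y l" unfolding linf_def by blast

lemma linf_zero: "linf s X (\<lambda>_. 0)" by (simp add: linf_def)

text \<open>A basis of \<open>U\<close> together with \<open>u\<close> is independent, so the values
  0 and 1 may be prescribed on it. Dimensions need not be finite.\<close>

lemma exists_functional:
  fixes s :: "'k::field \<Rightarrow> 'v::ab_group_add \<Rightarrow> 'v"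
  assumes "vector_space s" "module.subspace s U" "u \<notin> U"
  shows "\<exists>l. linf s UNIV l \<and> l u = 1 \<and> (\<forall>x\<in>U. l x = 0)"
proof -
  interpret vector_space s by fact
  have K: "vector_space ((*) :: 'k \<Rightarrow> 'k \<Rightarrow> 'k)"
    by unfold_locales (simp_all add: distrib_left distrib_right mult.assoc)
  note P = vector_space_pair.intro[OF assms(1) K]
  obtain B where B: "B \<subseteq> U" "independent B" "U \<subseteq> span B" by (rule basis_exists)
  have "span B \<subseteq> U" using B(1) assms(2) by (rule span_minimal)
  then have "u \<notin> span B" using assms(3) by auto
  then have "independent (insert u B)" using B(2) by (rule independent_insertI)
  then obtain g where g: "Vector_Spaces.linear s (*) g" "\<forall>x\<in>insert u B. g x = (if x = u then 1 else 0)"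
    using vector_space_pair.linear_independent_extend[OF P, of "insert u B" "\<lambda>x. if x = u then 1 else 0"] by auto
  then have ga: "g (x + y) = g x + g y" "g (s c x) = c * g x" for x y c
    by (simp_all add: Vector_Spaces.linear_iff)
  then have lg: "linf s UNIV g" by (simp add: linf_def)
  have g0: "g 0 = 0" using ga(2)[of 0 0] by simp
  have "subspace {x. g x = 0}" by (simp add: subspace_def ga g0)
  moreover have "B \<subseteq> {x. g x = 0}" using g(2) B(1) assms(3) by auto
  ultimately have "span B \<subseteq> {x. g x = 0}" by (simp add: span_minimal)
  then show ?thesis using lg g(2) B(3) by auto
qed

lemma gcar_decomp:
  assumes "vector_space s" "\<And>k. module.subspace s (G k)" "x \<in> gcar s G"
  shows "\<exists>K c. finite K \<and> (\<forall>k. c k \<in> G k) \<and> x = (\<Sum>k\<in>K. c k)"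
proof -
  interpret vector_space s by fact
  note sub = subspace_0[OF assms(2)] subspace_add[OF assms(2)] subspace_scale[OF assms(2)]
  let ?U = "{x. \<exists>K c. finite K \<and> (\<forall>k. c k \<in> G k) \<and> x = (\<Sum>k\<in>K. c k)}"
  have "gcar s G \<subseteq> ?U"
  proof (rule gcar_subset[OF assms(1)])
    show "G k \<subseteq> ?U" for k
    proof
      fix x assume "x \<in> G k"
      then show "x \<in> ?U" using sub by (auto intro!: exI[of _ "{k}"] exI[of _ "\<lambda>l. if l = k then x else 0"])
    qed
    show "subspace ?U"
    proof (rule subspaceI)
      show "0 \<in> ?U" using sub by (auto intro!: exI[of _ "{}"] exI[of _ "\<lambda>_. 0"])
      fix x assume "x \<in> ?U"
      then obtain K c where x: "finite K" "\<forall>k. c k \<in> G k" "x = (\<Sum>k\<in>K. c k)" by auto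
      then show "s r x \<in> ?U" for r using sub by (auto intro!: exI[of _ K] exI[of _ "\<lambda>k. s r (c k)"] simp: scale_sum_right)
      fix y assume "y \<in> ?U"
      then obtain K' c' where y: "finite K'" "\<forall>k. c' k \<in> G k" "y = (\<Sum>k\<in>K'. c' k)" by auto
      have "x + y = (\<Sum>k\<in>K \<union> K'. (if k \<in> K then c k else 0) + (if k \<in> K' then c' k else 0))"
        unfolding sum.distrib using x(1) y(1)
        by (simp add: sum.If_cases Int_absorb1 Int_absorb2 x(3) y(3) Un_Int_distrib2)
      then show "x + y \<in> ?U" using x y sub
        by (intro CollectI exI[of _ "K \<union> K'"] exI[of _ "\<lambda>k. (if k \<in> K then c k else 0) + (if k \<in> K' then c' k else 0)"]) auto
    qed
  qed
  then show ?thesis using assms(3) by auto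
qed

text \<open>Killing \<open>W\<close> and all other degrees means killing the carrier of the family
  in which \<open>G k\<close> is replaced by \<open>W\<close>; directness of the grading keeps
  \<open>u\<close> outside of it.\<close>

lemma graded_functional:
  fixes s :: "'k::field \<Rightarrow> 'v::ab_group_add \<Rightarrow> 'v"
  assumes "vector_space s" "is_graded s G" "u \<in> G k" "module.subspace s W" "W \<subseteq> G k" "u \<notin> W"
  shows "\<exists>l. linf s UNIV l \<and> l u = 1 \<and> (\<forall>x\<in>W. l x = 0) \<and> (\<forall>j x. j \<noteq> k \<longrightarrow> x \<in> G j \<longrightarrow> l x = 0)"
proof -
  interpret vector_space s by fact
  let ?G = "\<lambda>j. if j = k then W else G j"
  have sub: "subspace (?G j)" "subspace (G j)" for j using assms(2,4) by (auto simp: is_graded_def)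
  have "u \<notin> gcar s ?G"
  proof
    assume "u \<in> gcar s ?G"
    then obtain K c where c: "finite K" "\<forall>j. c j \<in> ?G j" "u = (\<Sum>j\<in>K. c j)"
      using gcar_decomp[where G = ?G and x = u, OF assms(1) sub(1)] by auto
    \<comment> \<open>Subtracting \<open>u\<close> in degree \<open>k\<close> turns its membership
      in the span into a vanishing sum of homogeneous components, so each of them is 0 and
      \<open>u\<close> would lie in \<open>W\<close>.\<close>
    let ?c = "\<lambda>j. (if j \<in> K then c j else 0) - (if j = k then u else 0)"
    have "(\<Sum>j\<in>insert k K. ?c j) = 0"
      unfolding sum_subtractf using c(1,3) by (simp add: sum.If_cases Int_absorb1 subset_insertI)
    moreover have "?c j \<in> G j" for j
      using c(2)[rule_format, of j] assms(3,5) subspace_0[OF sub(2)] subspace_diff[OF sub(2)]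
        subspace_neg[OF sub(2)] by (auto split: if_splits)
    ultimately have "\<forall>j\<in>insert k K. ?c j = 0"
      using assms(2) c(1) unfolding is_graded_def
      by (elim conjE allE[of _ "insert k K"] allE[of _ ?c]) simp
    then have "?c k = 0" by blast
    then have "u = (if k \<in> K then c k else 0)" by simp
    moreover have "(if k \<in> K then c k else 0) \<in> W" using c(2)[rule_format, of k] subspace_0[OF assms(4)] by simp
    ultimately show False using assms(6) by simp
  qed
  moreover have "subspace (gcar s ?G)" by (simp add: gcar_def)
  ultimately obtain l where l: "linf s UNIV l" "l u = 1" "\<forall>x\<in>gcar s ?G. l x = 0"
    using exists_functional[OF assms(1)] by blast
  have "l x = 0" if "x \<in> W" for x
    using l(3) gcar_closed(6)[OF assms(1), of x ?G k] that by simp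
  moreover have "l x = 0" if "j \<noteq> k" "x \<in> G j" for j x
    using l(3) gcar_closed(6)[OF assms(1), of x ?G j] that by simp
  ultimately show ?thesis using l by blast
qed

text \<open>The equality axiom for distinct degrees, with all coefficients 1, makes the level of a
  sum the maximum of those of its components.\<close>

lemma asc_component:
  assumes "vector_space s" "asc_filt s G d l" "finite K" "\<forall>k. c k \<in> G k" "j \<in> K"
  shows "l (c j) \<le> l (\<Sum>k\<in>K. c k)"
proof -
  interpret vector_space s by fact
  \<comment> \<open>The axiom speaks of families indexed by naturals, so the degrees are enumerated
    first.\<close>
  obtain e where e: "bij_betw e {..<card K} K"
    using ex_bij_betw_nat_finite[OF assms(3)] by (auto simp: atLeast0LessThan)
  have eq: "l (\<Sum>i\<in>{..<card K}. s 1 (c (e i))) = (SUP i\<in>{i\<in>{..<card K}. (1::'a) \<noteq> 0}. l (c (e i)))"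
    using assms(2,4) e unfolding asc_filt_def bij_betw_def
    by (elim conjE allE[of _ "{..<card K}"] allE[of _ "\<lambda>i. c (e i)"] allE[of _ "\<lambda>_. 1"] allE[of _ e]) simp
  have "(\<Sum>i\<in>{..<card K}. s 1 (c (e i))) = (\<Sum>k\<in>K. c k)"
    using sum.reindex_bij_betw[OF e, of c] by simp
  moreover have "j \<in> e ` {..<card K}" using e assms(5) by (simp add: bij_betw_def)
  then obtain i where i: "j = e i" "i \<in> {..<card K}" by (rule imageE)
  have "l (c (e i)) \<le> (SUP i\<in>{i\<in>{..<card K}. (1::'a) \<noteq> 0}. l (c (e i)))" by (rule SUP_upper) (use i in simp)
  ultimately show ?thesis using eq i(1) by simp
qed

text \<open>Only the component of degree \<open>k\<close> contributes to \<open>f x\<close>, its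
  level is at most that of \<open>x\<close>, and if it lay below \<open>l u\<close> then
  \<open>f\<close> would vanish on it.\<close>

lemma functional_level:
  fixes s :: "'k::field \<Rightarrow> 'v::ab_group_add \<Rightarrow> 'v"
  assumes v: "vector_space s" and g: "is_graded s G" and a: "asc_filt s G d l" and f: "linf s (gcar s G) f"
    and k: "\<And>j x. x \<in> G j \<Longrightarrow> j \<noteq> k \<Longrightarrow> f x = 0" and low: "\<And>x. x \<in> G k \<Longrightarrow> l x < l u \<Longrightarrow> f x = 0"
    and x: "x \<in> gcar s G" "f x \<noteq> 0"
  shows "l u \<le> l x"
proof -
  interpret vector_space s by fact
  have sub: "subspace (G j)" for j using g by (auto simp: is_graded_def)
  obtain K c where c: "finite K" "\<forall>j. c j \<in> G j" "x = (\<Sum>j\<in>K. c j)" using gcar_decomp[where G = G, OF v sub x(1)] by auto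
  have gc: "c j \<in> gcar s G" for j using c(2) gcar_closed(6)[OF v, of _ G j] by blast
  have "(\<Sum>j\<in>K'. c j) \<in> gcar s G" for K' unfolding gcar_def by (rule span_sum) (use gc in \<open>simp add: gcar_def\<close>)
  then have "f (\<Sum>j\<in>K'. c j) = (\<Sum>j\<in>K'. f (c j))" for K'
    by (induction K' rule: infinite_finite_induct) (simp_all add: linfD[OF f v] gc)
  then have "\<exists>j\<in>K. f (c j) \<noteq> 0" using x(2) c(3) by (metis (no_types, lifting) sum.neutral)
  then obtain j where j: "j \<in> K" "f (c j) \<noteq> 0" by blast
  then have "j = k" using k c(2) by blast
  then have "\<not> l (c j) < l u" using low[of "c j"] c(2) j(2) by auto
  then show ?thesis using asc_component[OF v a c(1,2) j(1)] c(3) by auto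
qed

text \<open>By the strong triangle inequality open balls around 0 are subspaces.\<close>

lemma low_subspace:
  fixes s :: "'k::field \<Rightarrow> 'v::ab_group_add \<Rightarrow> 'v"
  assumes v: "vector_space s" and g: "is_graded s G" and a: "asc_filt s G d l" and u: "u \<in> G k" "u \<noteq> 0"
  shows "module.subspace s {y \<in> G k. l y < l u}"
proof -
  interpret vector_space s by fact
  note ga = asc_add[OF v a]
  have sub: "subspace (G j)" for j using g by (auto simp: is_graded_def)
  note gc = gcar_closed(6)[OF v, of _ G k]
  have l0: "l 0 = -\<infinity>" using a gcar_closed(1)[OF v] by (auto simp: asc_filt_def)
  have lu: "-\<infinity> < l u" using a gc[OF u(1)] u(2) unfolding asc_filt_def by auto
  let ?V = "{y \<in> G k. l y < l u}"
  show "subspace ?V"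
  proof (rule subspaceI)
    show "0 \<in> ?V" using l0 lu subspace_0[OF sub] by simp
    fix x assume x: "x \<in> ?V"
    then show "s r x \<in> ?V" for r
      using ga(4)[of x x r] gc subspace_scale[OF sub] by (auto intro: le_less_trans)
    fix y assume y: "y \<in> ?V"
    then show "x + y \<in> ?V"
      using ga(1)[of x y] gc subspace_add[OF sub] x by (auto intro!: le_less_trans[OF ga(1)[of x y]])
  qed
qed

text \<open>The level bound says that \<open>s (f x) u\<close> is never higher than
  \<open>x\<close>. This makes the splitting of \<open>u\<close> and the kernel of \<open>f\<close>
  compatible with the filtration.\<close>

lemma level_functional:
  fixes s :: "'k::field \<Rightarrow> 'v::ab_group_add \<Rightarrow> 'v"
  assumes v: "vector_space s" and g: "is_graded s G" and a: "asc_filt s G d l" and u: "u \<in> G k" "u \<noteq> 0"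
  shows "\<exists>f. linf s UNIV f \<and> f u = 1 \<and> (\<forall>j x. j \<noteq> k \<longrightarrow> x \<in> G j \<longrightarrow> f x = 0) \<and>
    (\<forall>x\<in>gcar s G. f x \<noteq> 0 \<longrightarrow> l u \<le> l x)"
proof -
  obtain f where f: "linf s UNIV f" "f u = 1" "\<forall>x\<in>{y \<in> G k. l y < l u}. f x = 0" "\<forall>j x. j \<noteq> k \<longrightarrow> x \<in> G j \<longrightarrow> f x = 0"
    using graded_functional[OF v g u(1) low_subspace[OF v g a u]] by force
  have "l u \<le> l x" if "x \<in> gcar s G" "f x \<noteq> 0" for x
    by (rule functional_level[where f = f and k = k and u = u, OF v g a]) (use f that linf_mono[OF f(1) subset_UNIV] in auto)
  then show ?thesis using f by blast
qed

lemma dim_strict: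
  fixes s :: "'k::field \<Rightarrow> 'v::ab_group_add \<Rightarrow> 'v"
  assumes "vector_space s" "module.subspace s U" "U \<subseteq> V" "x \<in> V" "x \<notin> U" "fin_dim s V"
  shows "vector_space.dim s U < vector_space.dim s V"
proof -
  interpret vector_space s by fact
  obtain T where T: "finite T" "V \<subseteq> span T" using assms(6) by (auto simp: fin_dim_def)
  obtain B where B: "B \<subseteq> U" "independent B" "U \<subseteq> span B" "card B = dim U" by (rule basis_exists)
  obtain C where C: "C \<subseteq> V" "independent C" "V \<subseteq> span C" "card C = dim V" by (rule basis_exists)
  have fC: "finite C" using independent_span_bound[OF T(1) C(2)] C(1) T(2) by auto
  have "span B \<subseteq> U" using B(1) assms(2) by (rule span_minimal)
  then have xB: "x \<notin> span B" using assms(5) by auto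
  then have "independent (insert x B)" using B(2) by (rule independent_insertI)
  moreover have "insert x B \<subseteq> span C" using B(1) C(3) assms(3,4) by auto
  ultimately have "finite (insert x B) \<and> card (insert x B) \<le> card C"
    by (rule independent_span_bound[OF fC])
  moreover have "x \<notin> B" using xB span_base by blast
  ultimately show ?thesis using B(4) C(4) by auto
qed

text \<open>Levels are real, so well-foundedness has to come from elsewhere: the ball of all
  elements at most as high as \<open>x\<close> is a subspace, its dimension is a natural number, and
  it drops strictly when the level drops.\<close>

lemma exists_min_level:
  fixes s :: "'k::field \<Rightarrow> 'v::ab_group_add \<Rightarrow> 'v"
  assumes v: "vector_space s" and a: "asc_filt s G d l" and fd: "fin_dim s (gcar s G)"
    and ex: "x0 \<in> gcar s G" "P x0"
  shows "\<exists>x\<in>gcar s G. P x \<and> (\<forall>y\<in>gcar s G. P y \<longrightarrow> l x \<le> l y)"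
proof -
  interpret vector_space s by fact
  note ga = asc_add[OF v a] and gc = gcar_closed[OF v]
  let ?V = "\<lambda>x. {y \<in> gcar s G. l y \<le> l x}"
  have l0: "l 0 = -\<infinity>" using a gcar_closed(1)[OF v] by (auto simp: asc_filt_def)
  have V: "subspace (?V x)" for x
  proof (rule subspaceI)
    show "0 \<in> ?V x" using l0 gc by simp
    fix y assume y: "y \<in> ?V x"
    then show "s r y \<in> ?V x" for r using ga(4)[of y y r] gc by (auto intro: order_trans)
    fix z assume "z \<in> ?V x"
    then show "y + z \<in> ?V x" using ga(1)[of y z] gc y by (auto intro!: order_trans[OF ga(1)[of y z]])
  qed
  obtain x where x: "x \<in> gcar s G \<and> P x" "\<forall>y. y \<in> gcar s G \<and> P y \<longrightarrow> dim (?V x) \<le> dim (?V y)"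
    using ex_has_least_nat[of "\<lambda>x. x \<in> gcar s G \<and> P x" x0 "\<lambda>x. dim (?V x)"] ex by blast
  have "l x \<le> l y" if "y \<in> gcar s G" "P y" for y
  proof (rule ccontr)
    assume n: "\<not> l x \<le> l y"
    have "fin_dim s (?V x)" using fd unfolding fin_dim_def by blast
    then have "dim (?V y) < dim (?V x)"
      using x(1) n by (intro dim_strict[OF v V, of _ _ x]) auto
    then show False using x(2) that by force
  qed
  then show ?thesis using x(1) by blast
qed

section \<open>Subcospans\<close>

definition subc :: "'v cospan \<Rightarrow> 'v set \<Rightarrow> 'v set \<Rightarrow> 'v set \<Rightarrow> 'v cospan" where
  "subc F U D M = F\<lparr>upG := \<lambda>k. upG F k \<inter> U, dnG := \<lambda>k. dnG F k \<inter> D, DG := \<lambda>k. DG F k \<inter> M\<rparr>"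

lemma gcar_sub:
  assumes "vector_space s" "module.subspace s U"
  shows "gcar s (\<lambda>k. G k \<inter> U) \<subseteq> gcar s G \<inter> U"
proof -
  interpret vector_space s by fact
  have "subspace (gcar s G \<inter> U)" using assms(2) by (simp add: gcar_def subspace_inter)
  then show ?thesis using gcar_closed(6)[OF assms(1), of _ G] by (intro gcar_subset[OF assms(1)]) auto
qed

lemma gmap_sub:
  assumes "vector_space s" "module.subspace s U" "gmap s t G H m f"
    "\<And>k x. x \<in> G k \<Longrightarrow> x \<in> U \<Longrightarrow> f x \<in> U'"
  shows "gmap s t (\<lambda>k. G k \<inter> U) (\<lambda>k. H k \<inter> U') m f"
proof -
  have "\<And>x. x \<in> gcar s (\<lambda>k. G k \<inter> U) \<Longrightarrow> x \<in> gcar s G" using gcar_sub[OF assms(1,2), of G] by blast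
  then show ?thesis using assms(3) unfolding gmap_def lin_on_def by (auto simp: assms(4))
qed

lemma chain_sub:
  assumes "vector_space s" "module.subspace s U" "is_chain s G d" "\<And>k x. x \<in> G k \<Longrightarrow> x \<in> U \<Longrightarrow> d x \<in> U"
  shows "is_chain s (\<lambda>k. G k \<inter> U) d"
proof -
  interpret vector_space s by fact
  have "gmap s s (\<lambda>k. G k \<inter> U) (\<lambda>k. G k \<inter> U) 1 d"
    by (rule gmap_sub[OF assms(1,2)]) (use assms(3,4) in \<open>auto simp: is_chain_def\<close>)
  moreover have "is_graded s (\<lambda>k. G k \<inter> U)"
    using assms(2,3) unfolding is_chain_def is_graded_def by (auto simp: subspace_inter)
  ultimately show ?thesis using assms(3) gcar_sub[OF assms(1,2), of G] unfolding is_chain_def by blast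
qed

lemma asc_sub:
  assumes "vector_space s" "module.subspace s U" "asc_filt s G d l"
  shows "asc_filt s (\<lambda>k. G k \<inter> U) d l"
proof -
  have sub: "\<And>x. x \<in> gcar s (\<lambda>k. G k \<inter> U) \<Longrightarrow> x \<in> gcar s G" using gcar_sub[OF assms(1,2), of G] by blast
  have 3: "l (\<Sum>i\<in>I. s (c i) (x i)) \<le> (SUP i\<in>{i\<in>I. c i \<noteq> 0}. l (x i))"
    if "finite I" "\<forall>i\<in>I. x i \<in> gcar s G" for I :: "nat set" and x c
    using assms(3) that unfolding asc_filt_def by simp
  have 4: "l (\<Sum>i\<in>I. s (c i) (x i)) = (SUP i\<in>{i\<in>I. c i \<noteq> 0}. l (x i))"
    if "finite I" "inj_on dg I" "\<forall>i\<in>I. x i \<in> G (dg i)" for I :: "nat set" and x c dg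
    using assms(3) that unfolding asc_filt_def by simp
  show ?thesis unfolding asc_filt_def
  proof (intro conjI allI impI)
    show "l (\<Sum>i\<in>I. s (c i) (x i)) \<le> (SUP i\<in>{i\<in>I. c i \<noteq> 0}. l (x i))"
      if "finite I" "\<forall>i\<in>I. x i \<in> gcar s (\<lambda>k. G k \<inter> U)" for I :: "nat set" and x c
      by (rule 3) (use that sub in auto)
    show "l (\<Sum>i\<in>I. s (c i) (x i)) = (SUP i\<in>{i\<in>I. c i \<noteq> 0}. l (x i))"
      if "finite I" "inj_on dg I" "\<forall>i\<in>I. x i \<in> G (dg i) \<inter> U" for I :: "nat set" and x c dg
      by (rule 4) (use that in auto)
  qed (use assms(3) sub in \<open>simp_all add: asc_filt_def\<close>)
qed

lemma is_cospan_subc: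
  assumes v: "vector_space s" and F: "is_cospan s F"
    and U: "module.subspace s U" "module.subspace s D" "module.subspace s M"
    and m: "\<And>k x. x \<in> upG F k \<Longrightarrow> x \<in> U \<Longrightarrow> upD F x \<in> U" "\<And>k x. x \<in> dnG F k \<Longrightarrow> x \<in> D \<Longrightarrow> dnD F x \<in> D"
      "\<And>k x. x \<in> DG F k \<Longrightarrow> x \<in> M \<Longrightarrow> DD F x \<in> M"
      "\<And>k x. x \<in> upG F k \<Longrightarrow> x \<in> U \<Longrightarrow> psiU F x \<in> M" "\<And>k x. x \<in> dnG F k \<Longrightarrow> x \<in> D \<Longrightarrow> psiD F x \<in> M"
  shows "is_cospan s (subc F U D M)"
proof -
  note F' = F[unfolded is_cospan_def desc_filt_def]
  have 1: "is_chain s (\<lambda>k. upG F k \<inter> U) (upD F)" by (rule chain_sub[OF v U(1)]) (use F' m in auto)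
  have 2: "is_chain s (\<lambda>k. dnG F k \<inter> D) (dnD F)" by (rule chain_sub[OF v U(2)]) (use F' m in auto)
  have 3: "is_chain s (\<lambda>k. DG F k \<inter> M) (DD F)" by (rule chain_sub[OF v U(3)]) (use F' m in auto)
  have 4: "asc_filt s (\<lambda>k. upG F k \<inter> U) (upD F) (upL F)" by (rule asc_sub[OF v U(1)]) (use F' in auto)
  have 5: "asc_filt s (\<lambda>k. dnG F k \<inter> D) (dnD F) (\<lambda>x. - dnL F x)" by (rule asc_sub[OF v U(2)]) (use F' in auto)
  have 6: "gmap s s (\<lambda>k. upG F k \<inter> U) (\<lambda>k. DG F k \<inter> M) 0 (psiU F)" by (rule gmap_sub[OF v U(1)]) (use F' m in auto)
  have 7: "gmap s s (\<lambda>k. dnG F k \<inter> D) (\<lambda>k. DG F k \<inter> M) 0 (psiD F)" by (rule gmap_sub[OF v U(2)]) (use F' m in auto)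
  have 8: "\<forall>x\<in>gcar s (\<lambda>k. upG F k \<inter> U). psiU F (upD F x) = DD F (psiU F x)"
    using F' gcar_sub[OF v U(1), of "upG F"] by blast
  have 9: "\<forall>x\<in>gcar s (\<lambda>k. dnG F k \<inter> D). psiD F (dnD F x) = DD F (psiD F x)"
    using F' gcar_sub[OF v U(2), of "dnG F"] by blast
  show ?thesis unfolding is_cospan_def desc_filt_def subc_def using 1 2 3 4 5 6 7 8 9 by simp
qed

lemma gmap_rank1:
  assumes v: "vector_space s" "vector_space t" and l: "linf s (gcar s G) l"
    and k: "\<And>j x. x \<in> G j \<Longrightarrow> j \<noteq> k \<Longrightarrow> l x = 0" and u: "u \<in> H (k - m)" and H: "\<And>j. module.subspace t (H j)"
  shows "gmap s t G H m (\<lambda>x. t (l x) u)"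
proof -
  interpret t: vector_space t by fact
  have "t (l x) u \<in> H (j - m)" if "x \<in> G j" for x j
    using k[OF that] u t.subspace_0[OF H] t.subspace_scale[OF H u] by (cases "j = k") auto
  then show ?thesis using linfD[OF l v(1)]
    by (simp add: gmap_def lin_on_def t.scale_left_distrib)
qed

lemma gmap_into:
  assumes "vector_space s" "gmap s t G H m f" "\<And>x. x \<in> gcar s G \<Longrightarrow> f x \<in> V"
  shows "gmap s t G (\<lambda>k. H k \<inter> V) m f"
  using assms(2,3) gcar_closed(6)[OF assms(1), of _ G] unfolding gmap_def by blast

lemma gmap_diff:
  assumes "vector_space s1" "vector_space s2" "gmap s1 s2 G H m f" "gmap s1 s2 G H m g"
    "\<And>k. module.subspace s2 (H k)"
  shows "gmap s1 s2 G H m (\<lambda>x. f x - g x)"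
  using gmap_add[OF assms(1-3) gmap_minus[OF assms(1,2,4,5)] assms(5)] by simp

lemma ehm_real:
  assumes "wcos s1 C" "wcos s2 X" "levok UNIV s1 C" "levok UNIV s2 X" "is_mor s1 s2 0 C X h" "mcyc s1 C X h"
  shows "ehm real_of_ereal s1 s2 0 C X h"
  using is_mor_emor0[OF assms(1-4), of real_of_ereal 0 h] assms(5,6) by (simp add: ehm_def)

lemma linf_coord: "linf fscale X (\<lambda>v. v p)" by (simp add: linf_def fscale_def)

lemma upL_leI:
  assumes "\<And>i j k a. i < length L \<Longrightarrow> (j, k, a) \<in> set (up_basis (L ! i)) \<Longrightarrow> v (i, j) \<noteq> 0 \<Longrightarrow> ereal a \<le> r"
  shows "upL (model L) v \<le> r"
  unfolding upL_model using assms by (auto intro!: Sup_least)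

lemma dnL_geI:
  assumes "\<And>i j k a. i < length L \<Longrightarrow> (j, k, a) \<in> set (dn_basis (L ! i)) \<Longrightarrow> v (i, j) \<noteq> 0 \<Longrightarrow> ereal a \<ge> r"
  shows "dnL (model L) v \<ge> r"
  unfolding dnL_model using assms by (auto intro!: Inf_greatest)

text \<open>The basis vector at \<open>p\<close> if the flag says that the summand has it, and 0
  otherwise; one set of formulas then covers all shapes of summands.\<close>

definition qq :: "bool \<Rightarrow> 'a \<Rightarrow> 'a \<Rightarrow> 'k::field" where "qq b p = (\<lambda>r. if b \<and> r = p then 1 else 0)"

lemma qv: "qq b p r = (if b \<and> r = p then 1 else 0)" by (simp add: qq_def)

lemma unit_apply: "unit p q = (if q = p then 1 else 0)" by (simp add: unit_def)

text \<open>A copy of the summand \<open>e\<close> inside \<open>F\<close>: it is spanned by \<open>u0, u1, w, z\<close>, with dual functionals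
  \<open>l0, l1, lw, lm\<close> whose common kernel is the complement. The flags \<open>b0, b1, bw, bm\<close> tell which of the four
  vectors \<open>e\<close> has; the others are \<open>0\<close>. The image \<open>y1\<close> of \<open>u1\<close> need not vanish; the \<open>K\<close>-component
  absorbs it because \<open>u0\<close> is the boundary of \<open>u1\<close>.\<close>
locale splitting =
  fixes s :: "'k::field \<Rightarrow> 'v::ab_group_add \<Rightarrow> 'v" and F :: "'v cospan" and e :: summand and k :: int
    and l0 l1 lw lm :: "'v \<Rightarrow> 'k" and u0 u1 w z y1 :: 'v and b0 b1 bw bm :: bool
  assumes v: "vector_space s" and F: "is_cospan s F"
    and lin: "linf s (gcar s (upG F)) l0" "linf s (gcar s (upG F)) l1" "linf s (gcar s (dnG F)) lw" "linf s (gcar s (DG F)) lm"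
    and deg: "\<And>j x. x \<in> upG F j \<Longrightarrow> j \<noteq> k \<Longrightarrow> l0 x = 0" "\<And>j x. x \<in> upG F j \<Longrightarrow> j \<noteq> k + 1 \<Longrightarrow> l1 x = 0"
      "\<And>j x. x \<in> dnG F j \<Longrightarrow> j \<noteq> k \<Longrightarrow> lw x = 0" "\<And>j x. x \<in> DG F j \<Longrightarrow> j \<noteq> k \<Longrightarrow> lm x = 0"
    and mem: "u0 \<in> upG F k" "u1 \<in> upG F (k + 1)" "w \<in> dnG F k" "z \<in> DG F k" "y1 \<in> DG F (k + 1)"
    and lev: "\<And>x. x \<in> gcar s (upG F) \<Longrightarrow> l0 x \<noteq> 0 \<Longrightarrow> upL F u0 \<le> upL F x" "\<And>x. x \<in> gcar s (upG F) \<Longrightarrow> l1 x \<noteq> 0 \<Longrightarrow> upL F u1 \<le> upL F x"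
      "\<And>x. x \<in> gcar s (dnG F) \<Longrightarrow> lw x \<noteq> 0 \<Longrightarrow> dnL F x \<le> dnL F w"
    and bas: "\<And>j l a. (j, l, a) \<in> set (up_basis e) \<longleftrightarrow> j = 0 \<and> l = k \<and> b0 \<and> ereal a = upL F u0 \<or> j = 1 \<and> l = k + 1 \<and> b1 \<and> ereal a = upL F u1"
      "\<And>j l a. (j, l, a) \<in> set (dn_basis e) \<longleftrightarrow> j = 2 \<and> l = k \<and> bw \<and> ereal a = dnL F w"
      "\<And>j l. (j, l) \<in> set (mid_basis e) \<longleftrightarrow> j = 4 \<and> l = k \<and> bm" "is_up2 e = b1" "\<not> is_dn2 e" "b1 \<longrightarrow> b0"
      "has_psiU e \<longrightarrow> b0 \<and> bm" "has_psiD e \<longrightarrow> bw \<and> bm"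
    and dual: "l0 u0 = (if b0 then 1 else 0)" "l0 u1 = 0" "l1 u0 = 0" "l1 u1 = (if b1 then 1 else 0)"
      "lw w = (if bw then 1 else 0)" "lm z = (if bm then 1 else 0)"
    and triv: "\<And>x. \<not> b0 \<Longrightarrow> l0 x = 0" "\<not> b0 \<Longrightarrow> u0 = 0" "\<And>x. \<not> b1 \<Longrightarrow> l1 x = 0" "\<not> b1 \<Longrightarrow> u1 = 0" "\<not> b1 \<Longrightarrow> y1 = 0"
      "\<And>x. \<not> bw \<Longrightarrow> lw x = 0" "\<not> bw \<Longrightarrow> w = 0" "\<And>x. \<not> bm \<Longrightarrow> lm x = 0" "\<not> bm \<Longrightarrow> z = 0"
    and dif: "upD F u1 = u0 \<or> \<not> b1" "upD F u0 = 0" "\<And>x. x \<in> gcar s (upG F) \<Longrightarrow> l0 (upD F x) = l1 x" "\<And>x. x \<in> gcar s (upG F) \<Longrightarrow> l1 (upD F x) = 0"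
      "dnD F w = 0" "\<And>x. x \<in> gcar s (dnG F) \<Longrightarrow> lw (dnD F x) = 0" "DD F z = 0" "DD F y1 = 0" "\<And>x. x \<in> gcar s (DG F) \<Longrightarrow> lm (DD F x) = 0"
    and psi: "psiU F u0 = (if has_psiU e then z else 0)" "psiU F u1 = y1" "psiD F w = (if has_psiD e then z else 0)"
      "\<And>x. x \<in> gcar s (upG F) \<Longrightarrow> lm (psiU F x) = (if has_psiU e then l0 x else 0)"
      "\<And>x. x \<in> gcar s (dnG F) \<Longrightarrow> lm (psiD F x) = (if has_psiD e then lw x else 0)"
begin

interpretation vector_space s by (rule v)

abbreviation E :: "(nat \<times> nat \<Rightarrow> 'k) cospan" where "E \<equiv> model [e]"

definition "F' = subc F {x \<in> gcar s (upG F). l0 x = 0 \<and> l1 x = 0} {x \<in> gcar s (dnG F). lw x = 0} {x \<in> gcar s (DG F). lm x = 0}"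

lemmas wF = is_cospan_wcos[OF v F]
lemmas gc = gcar_closed[OF v]
lemmas wg = wcosD[OF wF, THEN gmap_lin[OF v v]]
lemmas lf = linfD[OF lin(1) v] linfD[OF lin(2) v] linfD[OF lin(3) v] linfD[OF lin(4) v]
lemmas memg = gc(6)[of u0 "upG F", OF mem(1)] gc(6)[of u1 "upG F", OF mem(2)] gc(6)[of w "dnG F", OF mem(3)]
  gc(6)[of z "DG F", OF mem(4)] gc(6)[of y1 "DG F", OF mem(5)]

lemma lm_y1: "lm y1 = 0"
  using psi(4)[OF memg(2)] dual(2) by (simp add: psi(2))

lemma sub: "subspace {x \<in> gcar s (upG F). l0 x = 0 \<and> l1 x = 0}" "subspace {x \<in> gcar s (dnG F). lw x = 0}"
    "subspace {x \<in> gcar s (DG F). lm x = 0}"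
  unfolding subspace_def by (simp_all add: gc lf)

lemma F'_sel: "upG F' = (\<lambda>k. upG F k \<inter> {x \<in> gcar s (upG F). l0 x = 0 \<and> l1 x = 0})"
    "dnG F' = (\<lambda>k. dnG F k \<inter> {x \<in> gcar s (dnG F). lw x = 0})" "DG F' = (\<lambda>k. DG F k \<inter> {x \<in> gcar s (DG F). lm x = 0})"
    "upD F' = upD F" "dnD F' = dnD F" "DD F' = DD F" "psiU F' = psiU F" "psiD F' = psiD F" "upL F' = upL F" "dnL F' = dnL F"
  by (simp_all add: F'_def subc_def)

lemma cosF': "is_cospan s F'"
  unfolding F'_def
proof (rule is_cospan_subc[OF v F sub])
  show "upD F x \<in> {x \<in> gcar s (upG F). l0 x = 0 \<and> l1 x = 0}" if "x \<in> {x \<in> gcar s (upG F). l0 x = 0 \<and> l1 x = 0}" for x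
    using that wg by (simp add: dif)
  show "dnD F x \<in> {x \<in> gcar s (dnG F). lw x = 0}" if "x \<in> {x \<in> gcar s (dnG F). lw x = 0}" for x
    using that wg by (simp add: dif)
  show "DD F x \<in> {x \<in> gcar s (DG F). lm x = 0}" if "x \<in> {x \<in> gcar s (DG F). lm x = 0}" for x
    using that wg by (simp add: dif)
  show "psiU F x \<in> {x \<in> gcar s (DG F). lm x = 0}" if "x \<in> {x \<in> gcar s (upG F). l0 x = 0 \<and> l1 x = 0}" for x
    using that wg by (simp add: psi)
  show "psiD F x \<in> {x \<in> gcar s (DG F). lm x = 0}" if "x \<in> {x \<in> gcar s (dnG F). lw x = 0}" for x
    using that wg by (simp add: psi)
qed

lemma carF': "x \<in> gcar s (upG F') \<Longrightarrow> x \<in> gcar s (upG F) \<and> l0 x = 0 \<and> l1 x = 0"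
  "x \<in> gcar s (dnG F') \<Longrightarrow> x \<in> gcar s (dnG F) \<and> lw x = 0" "x \<in> gcar s (DG F') \<Longrightarrow> x \<in> gcar s (DG F) \<and> lm x = 0"
  using gcar_sub[OF v sub(1), of "upG F"] gcar_sub[OF v sub(2), of "dnG F"] gcar_sub[OF v sub(3), of "DG F"]
  unfolding F'_sel by blast+

lemmas wF' = is_cospan_wcos[OF v cosF']
lemmas lF = levok_UNIV[OF v F] and lF' = levok_UNIV[OF v cosF']
lemma lE: "levok UNIV fscale E" by (rule levok_model) (rule levin_UNIV)
lemmas subF = wcos_sub[OF wF]
lemmas ascU = F[unfolded is_cospan_def, THEN conjunct2, THEN conjunct2, THEN conjunct2, THEN conjunct1]
lemmas ascD = F[unfolded is_cospan_def desc_filt_def, THEN conjunct2, THEN conjunct2, THEN conjunct2, THEN conjunct2, THEN conjunct1]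

abbreviation "q0 \<equiv> qq b0 (0, 0) :: nat \<times> nat \<Rightarrow> 'k"
abbreviation "q1 \<equiv> qq b1 (0, 1) :: nat \<times> nat \<Rightarrow> 'k"
abbreviation "q2 \<equiv> qq bw (0, 2) :: nat \<times> nat \<Rightarrow> 'k"
abbreviation "q4 \<equiv> qq bm (0, 4) :: nat \<times> nat \<Rightarrow> 'k"

text \<open>\<open>p\<close> projects to the complement, \<open>ps\<close> to the summand, and
  \<open>si\<close> includes the summand; the complement is included by \<open>mid\<close>. Since
  \<open>l0 (upD F x) = l1 x\<close>, the \<open>K\<close>-component \<open>s (l0 x) y1\<close> of
  \<open>p\<close> takes the value \<open>s (l1 x) y1\<close> on boundaries, which is the defect
  caused by \<open>y1\<close>. The one of \<open>si\<close> is opposite, so that the two cancel in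
  the sum of the idempotents.\<close>

definition "p = \<lparr>mDn = \<lambda>x. x - s (lw x) w, mUp = \<lambda>x. x - (s (l0 x) u0 + s (l1 x) u1), mMid = \<lambda>x. x - s (lm x) z,
  KDn = \<lambda>x. 0, KUp = \<lambda>x. s (l0 x) y1\<rparr>"
definition "ps = \<lparr>mDn = \<lambda>x. fscale (lw x) q2, mUp = \<lambda>x. fscale (l0 x) q0 + fscale (l1 x) q1, mMid = \<lambda>x. fscale (lm x) q4,
  KDn = \<lambda>x. 0, KUp = \<lambda>x. 0\<rparr>"
definition "si = \<lparr>mDn = \<lambda>x. s (x (0, 2)) w, mUp = \<lambda>x. s (x (0, 0)) u0 + s (x (0, 1)) u1, mMid = \<lambda>x. s (x (0, 4)) z,
  KDn = \<lambda>x. 0, KUp = \<lambda>x. - s (x (0, 0)) y1\<rparr>"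

lemma up_sum_le:
  assumes "x \<in> gcar s (upG F)" "y \<in> gcar s (upG F)" "upL F x \<le> r" "upL F y \<le> r"
  shows "upL F (x + y) \<le> r" "upL F (x - y) \<le> r"
  using asc_add(1,2)[OF v ascU assms(1,2)] assms(3,4) by (auto intro: order_trans)

lemma dn_diff_ge:
  assumes "x \<in> gcar s (dnG F)" "y \<in> gcar s (dnG F)" "dnL F x \<ge> r" "dnL F y \<ge> r"
  shows "dnL F (x - y) \<ge> r"
proof -
  have "- dnL F (x - y) \<le> max (- dnL F x) (- dnL F y)" by (rule asc_add(2)[OF v ascD assms(1,2)])
  also have "\<dots> \<le> - r" using assms(3,4) by simp
  finally show ?thesis by simp
qed

lemma up_scale_le: "upL F (s c u) \<le> r" if "u \<in> gcar s (upG F)" "c \<noteq> 0 \<Longrightarrow> upL F u \<le> r" for u c r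
proof (cases "c = 0")
  case True then show ?thesis using lF by (simp add: levok_def)
next
  case False then show ?thesis using asc_add(4)[OF v ascU that(1) that(1), of c] that(2) by (auto intro: order_trans)
qed

lemma dn_scale_ge: "dnL F (s c u) \<ge> r" if "u \<in> gcar s (dnG F)" "c \<noteq> 0 \<Longrightarrow> dnL F u \<ge> r" for u c r
proof (cases "c = 0")
  case True then show ?thesis using lF by (simp add: levok_def)
next
  case False then show ?thesis using asc_add(4)[OF v ascD that(1) that(1), of c] that(2) by (auto intro: order_trans)
qed

lemma du1: "upD F u1 \<noteq> u0 \<Longrightarrow> l1 x = 0" using dif(1) triv(3) by blast

lemma p_hm: "ehm real_of_ereal s s 0 F F' p"
proof (rule ehm_real[OF wF wF' lF lF'])
  have dn: "gmap s s (dnG F) (dnG F') 0 (\<lambda>x. x - s (lw x) w)"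
    unfolding F'_sel
    by (rule gmap_into[OF v gmap_diff[OF v v gmap_id[unfolded id_def] gmap_rank1[OF v v lin(3) deg(3)] subF(2)]])
      (use mem(3) in \<open>auto simp: subF gc memg lf dual triv\<close>)
  have up: "gmap s s (upG F) (upG F') 0 (\<lambda>x. x - (s (l0 x) u0 + s (l1 x) u1))"
    unfolding F'_sel
    by (rule gmap_into[OF v gmap_diff[OF v v gmap_id[unfolded id_def] gmap_add[OF v v gmap_rank1[OF v v lin(1) deg(1)] gmap_rank1[OF v v lin(2) deg(2)] subF(1)] subF(1)]])
      (use mem(1,2) in \<open>auto simp: subF gc memg lf dual triv\<close>)
  have md: "gmap s s (DG F) (DG F') 0 (\<lambda>x. x - s (lm x) z)"
    unfolding F'_sel
    by (rule gmap_into[OF v gmap_diff[OF v v gmap_id[unfolded id_def] gmap_rank1[OF v v lin(4) deg(4)] subF(3)]])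
      (use mem(4) in \<open>auto simp: subF gc memg lf dual triv\<close>)
  have ku: "gmap s s (upG F) (DG F') (-1) (\<lambda>x. s (l0 x) y1)"
    unfolding F'_sel
    by (rule gmap_into[OF v gmap_rank1[OF v v lin(1) deg(1)]])
      (use mem(5) in \<open>auto simp: subF gc memg lf dual triv lm_y1\<close>)
  have z: "gmap s s (dnG F) (DG F') (-1) (\<lambda>x. 0)" by (rule gmap_zero[OF v wcos_sub(3)[OF wF']])
  have "upL F (x - (s (l0 x) u0 + s (l1 x) u1)) \<le> upL F x" if "x \<in> gcar s (upG F)" for x
    by (intro up_sum_le up_scale_le) (use that lev in \<open>auto simp: gc memg\<close>)
  moreover have "dnL F (x - s (lw x) w) \<ge> dnL F x" if "x \<in> gcar s (dnG F)" for x
    by (intro dn_diff_ge dn_scale_ge) (use that lev in \<open>auto simp: gc memg\<close>)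
  ultimately show "is_mor s s 0 F F' p" unfolding is_mor_def p_def by (simp add: dn up md ku z F'_sel(9,10))
  show "mcyc s F F' p" unfolding mcyc_def p_def
    using du1 by (auto simp: F'_sel(4-8) gc memg wg dif psi triv)
qed

lemma i_hm: "ehm real_of_ereal s s 0 F' F mid"
proof (rule ehm_real[OF wF' wF lF' lF])
  have z: "gmap s s G (DG F) m (\<lambda>x. 0)" for G m by (rule gmap_zero[OF v subF(3)])
  have id: "gmap s s (\<lambda>k. G k \<inter> V) G 0 id" if "module.subspace s V" for G V
    using gcar_sub[OF v that, of G] by (auto simp: gmap_def lin_on_def)
  show "is_mor s s 0 F' F mid"
    unfolding is_mor_def mid_def by (simp add: z F'_sel(9,10)) (simp add: F'_sel(1-3) id sub)
  show "mcyc s F' F mid" unfolding mcyc_def mid_def by (simp add: F'_sel(4-8) wg)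
qed

lemma lvl: "b0 \<Longrightarrow> \<exists>a. ereal a = upL F u0" "b1 \<Longrightarrow> \<exists>a. ereal a = upL F u1" "bw \<Longrightarrow> \<exists>a. ereal a = dnL F w"
proof -
  have r: "x \<in> range ereal \<Longrightarrow> \<exists>a. ereal a = x" for x by (metis rangeE)
  have 1: "upL F x \<in> range ereal" if "x \<in> gcar s (upG F)" "x \<noteq> 0" for x using lF that unfolding levok_def by blast
  have 2: "dnL F x \<in> range ereal" if "x \<in> gcar s (dnG F)" "x \<noteq> 0" for x using lF that unfolding levok_def by blast
  show "b0 \<Longrightarrow> \<exists>a. ereal a = upL F u0" using dual(1) lf(3) by (intro r 1 memg) auto
  show "b1 \<Longrightarrow> \<exists>a. ereal a = upL F u1" using dual(4) lf(8) by (intro r 1 memg) auto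
  show "bw \<Longrightarrow> \<exists>a. ereal a = dnL F w" using dual(5) lf(13) by (intro r 2 memg) auto
qed

lemma ES: "upS [e] j = (if b0 \<and> j = k then {(0, 0)} else {}) \<union> (if b1 \<and> j = k + 1 then {(0, 1)} else {})"
  "dnS [e] j = (if bw \<and> j = k then {(0, 2)} else {})" "midS [e] j = (if bm \<and> j = k then {(0, 4)} else {})"
proof -
  show "upS [e] j = (if b0 \<and> j = k then {(0, 0)} else {}) \<union> (if b1 \<and> j = k + 1 then {(0, 1)} else {})"
    unfolding upS_def using lvl(1,2) by (auto simp: less_Suc_eq bas)
  show "dnS [e] j = (if bw \<and> j = k then {(0, 2)} else {})"
    unfolding dnS_def using lvl(3) by (auto simp: less_Suc_eq bas)
  show "midS [e] j = (if bm \<and> j = k then {(0, 4)} else {})"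
    unfolding midS_def by (auto simp: less_Suc_eq bas)
qed

lemma q_mem: "q0 \<in> upG E k" "q1 \<in> upG E (k + 1)" "q2 \<in> dnG E k" "q4 \<in> DG E k"
  by (auto simp: qv model_G ES)

lemma E_slots:
  "x \<in> upG E j \<Longrightarrow> j \<noteq> k \<Longrightarrow> x (0, 0) = 0" "x \<in> upG E j \<Longrightarrow> j \<noteq> k + 1 \<Longrightarrow> x (0, 1) = 0"
  "x \<in> dnG E j \<Longrightarrow> j \<noteq> k \<Longrightarrow> x (0, 2) = 0" "x \<in> DG E j \<Longrightarrow> j \<noteq> k \<Longrightarrow> x (0, 4) = 0"
  by (auto simp: model_G ES split: if_splits)

lemma E_supp:
  "x \<in> gcar fscale (upG E) \<Longrightarrow> x r \<noteq> 0 \<Longrightarrow> b0 \<and> r = (0, 0) \<or> b1 \<and> r = (0, 1)"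
  "x \<in> gcar fscale (dnG E) \<Longrightarrow> x r \<noteq> 0 \<Longrightarrow> bw \<and> r = (0, 2)"
  "x \<in> gcar fscale (DG E) \<Longrightarrow> x r \<noteq> 0 \<Longrightarrow> bm \<and> r = (0, 4)"
proof -
  assume "x \<in> gcar fscale (upG E)" "x r \<noteq> 0"
  then have "r \<in> (\<Union>k. upS [e] k)" unfolding model_car by blast
  then show "b0 \<and> r = (0, 0) \<or> b1 \<and> r = (0, 1)" by (auto simp: ES split: if_splits)
next
  assume "x \<in> gcar fscale (dnG E)" "x r \<noteq> 0"
  then have "r \<in> (\<Union>k. dnS [e] k)" unfolding model_car by blast
  then show "bw \<and> r = (0, 2)" by (auto simp: ES split: if_splits)
next
  assume "x \<in> gcar fscale (DG E)" "x r \<noteq> 0"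
  then have "r \<in> (\<Union>k. midS [e] k)" unfolding model_car by blast
  then show "bm \<and> r = (0, 4)" by (auto simp: ES split: if_splits)
qed

lemma E_car:
  "x \<in> gcar fscale (upG E) \<Longrightarrow> x (0, 0) \<noteq> 0 \<Longrightarrow> b0" "x \<in> gcar fscale (upG E) \<Longrightarrow> x (0, 1) \<noteq> 0 \<Longrightarrow> b1"
  "x \<in> gcar fscale (dnG E) \<Longrightarrow> x (0, 2) \<noteq> 0 \<Longrightarrow> bw" "x \<in> gcar fscale (DG E) \<Longrightarrow> x (0, 4) \<noteq> 0 \<Longrightarrow> bm"
  by (drule (1) E_supp, simp)+

lemmas subE = wcos_sub[OF wcos_model[of "[e]"]]

lemma ps_hm: "ehm real_of_ereal s fscale 0 F E ps"
proof (rule ehm_real[OF wF wcos_model lF lE])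
  have up: "gmap s fscale (upG F) (upG E) 0 (\<lambda>x. fscale (l0 x) q0 + fscale (l1 x) q1)"
    by (rule gmap_add[OF v vs_fscale gmap_rank1[OF v vs_fscale lin(1) deg(1)] gmap_rank1[OF v vs_fscale lin(2) deg(2)] subE(1)])
      (use q_mem in \<open>auto simp: subE\<close>)
  have dn: "gmap s fscale (dnG F) (dnG E) 0 (\<lambda>x. fscale (lw x) q2)"
    by (rule gmap_rank1[OF v vs_fscale lin(3) deg(3)]) (use q_mem in \<open>auto simp: subE\<close>)
  have md: "gmap s fscale (DG F) (DG E) 0 (\<lambda>x. fscale (lm x) q4)"
    by (rule gmap_rank1[OF v vs_fscale lin(4) deg(4)]) (use q_mem in \<open>auto simp: subE\<close>)
  have z: "gmap s fscale G (DG E) m (\<lambda>x. 0)" for G m by (rule gmap_zero[OF vs_fscale subE(3)])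
  have "upL E (fscale (l0 x) q0 + fscale (l1 x) q1) \<le> upL F x" if "x \<in> gcar s (upG F)" for x
  proof (rule upL_leI)
    fix i j l a assume "i < length [e]" "(j, l, a) \<in> set (up_basis ([e] ! i))" "(fscale (l0 x) q0 + fscale (l1 x) q1) (i, j) \<noteq> 0"
    then show "ereal a \<le> upL F x" using lev(1,2)[OF that] by (auto simp: bas fscale_def qv split: if_splits)
  qed
  moreover have "dnL E (fscale (lw x) q2) \<ge> dnL F x" if "x \<in> gcar s (dnG F)" for x
  proof (rule dnL_geI)
    fix i j l a assume "i < length [e]" "(j, l, a) \<in> set (dn_basis ([e] ! i))" "fscale (lw x) q2 (i, j) \<noteq> 0"
    then show "ereal a \<ge> dnL F x" using lev(3)[OF that] by (auto simp: bas fscale_def qv split: if_splits)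
  qed
  ultimately show "is_mor s fscale 0 F E ps" unfolding is_mor_def ps_def using dn up md z by simp
  have "upD E (fscale (l0 x) q0 + fscale (l1 x) q1) = fscale (l0 (upD F x)) q0 + fscale (l1 (upD F x)) q1" if "x \<in> gcar s (upG F)" for x
    using bas(4,6) triv(3)[of x] that by (auto simp: fun_eq_iff model_maps fscale_def qv dif)
  moreover have "dnD E (fscale (lw x) q2) = fscale (lw (dnD F x)) q2" if "x \<in> gcar s (dnG F)" for x
    using bas(5) that by (auto simp: fun_eq_iff model_maps fscale_def qv dif)
  moreover have "fscale (lm (psiU F x)) q4 = psiU E (fscale (l0 x) q0 + fscale (l1 x) q1)" if "x \<in> gcar s (upG F)" for x
    using bas(7) that by (auto simp: fun_eq_iff model_maps fscale_def qv psi)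
  moreover have "fscale (lm (psiD F x)) q4 = psiD E (fscale (lw x) q2)" if "x \<in> gcar s (dnG F)" for x
    using bas(8) that by (auto simp: fun_eq_iff model_maps fscale_def qv psi)
  moreover have "fscale (lm (DD F x)) q4 = 0" if "x \<in> gcar s (DG F)" for x
    using that by (auto simp: fun_eq_iff fscale_def dif)
  ultimately show "mcyc s F E ps" unfolding mcyc_def ps_def by (simp add: model_maps(3))
qed

lemma si_hm: "ehm real_of_ereal fscale s 0 E F si"
proof (rule ehm_real[OF wcos_model wF lE lF])
  have up: "gmap fscale s (upG E) (upG F) 0 (\<lambda>x. s (x (0, 0)) u0 + s (x (0, 1)) u1)"
    by (rule gmap_add[OF vs_fscale v gmap_rank1[OF vs_fscale v linf_coord E_slots(1)] gmap_rank1[OF vs_fscale v linf_coord E_slots(2)] subF(1)])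
      (use mem in \<open>auto simp: subF\<close>)
  have dn: "gmap fscale s (dnG E) (dnG F) 0 (\<lambda>x. s (x (0, 2)) w)"
    by (rule gmap_rank1[OF vs_fscale v linf_coord E_slots(3)]) (use mem in \<open>auto simp: subF\<close>)
  have md: "gmap fscale s (DG E) (DG F) 0 (\<lambda>x. s (x (0, 4)) z)"
    by (rule gmap_rank1[OF vs_fscale v linf_coord E_slots(4)]) (use mem in \<open>auto simp: subF\<close>)
  have ku: "gmap fscale s (upG E) (DG F) (-1) (\<lambda>x. - s (x (0, 0)) y1)"
    by (rule gmap_minus[OF vs_fscale v gmap_rank1[OF vs_fscale v linf_coord E_slots(1)] subF(3)]) (use mem in \<open>auto simp: subF\<close>)
  have z: "gmap fscale s G (DG F) m (\<lambda>x. 0)" for G m by (rule gmap_zero[OF v subF(3)])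
  have 0: "upL F u0 \<le> upL E x" if x: "x \<in> gcar fscale (upG E)" "x (0, 0) \<noteq> 0" for x
  proof -
    obtain a where "ereal a = upL F u0" using lvl(1) E_car(1)[OF x] by blast
    then show ?thesis using upL_ge[of 0 "[e]" 0 k a x] x(2) E_car(1)[OF x] by (simp add: bas)
  qed
  have 1: "upL F u1 \<le> upL E x" if x: "x \<in> gcar fscale (upG E)" "x (0, 1) \<noteq> 0" for x
  proof -
    obtain a where "ereal a = upL F u1" using lvl(2) E_car(2)[OF x] by blast
    then show ?thesis using upL_ge[of 0 "[e]" 1 "k + 1" a x] x(2) E_car(2)[OF x] by (simp add: bas)
  qed
  have 2: "dnL F w \<ge> dnL E x" if x: "x \<in> gcar fscale (dnG E)" "x (0, 2) \<noteq> 0" for x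
  proof -
    obtain a where "ereal a = dnL F w" using lvl(3) E_car(3)[OF x] by blast
    then show ?thesis using dnL_le[of 0 "[e]" 2 k a x] x(2) E_car(3)[OF x] by (simp add: bas)
  qed
  have "upL F (s (x (0, 0)) u0 + s (x (0, 1)) u1) \<le> upL E x" if "x \<in> gcar fscale (upG E)" for x
    by (intro up_sum_le up_scale_le gc memg 0 1 that)
  moreover have "dnL F (s (x (0, 2)) w) \<ge> dnL E x" if "x \<in> gcar fscale (dnG E)" for x
    by (intro dn_scale_ge memg 2 that)
  ultimately show "is_mor fscale s 0 E F si" unfolding is_mor_def si_def using dn up md ku z by simp
  have d1: "s (x (0, 1)) (upD F u1) = s (x (0, 1)) u0" if "x \<in> gcar fscale (upG E)" for x
    using dif(1) E_car(2)[OF that] by (cases "x (0, 1) = 0") auto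
  have d2: "upD E x (0, 0) = x (0, 1)" "upD E x (0, 1) = 0" if "x \<in> gcar fscale (upG E)" for x
    using E_car(2)[OF that] bas(4) by (auto simp: model_maps)
  have d3: "dnD E x (0, 2) = 0" for x using bas(5) by (simp add: model_maps)
  have d4: "s (psiU E x (0, 4)) z = (if has_psiU e then s (x (0, 0)) z else 0)" "s (psiD E x (0, 4)) z = (if has_psiD e then s (x (0, 2)) z else 0)" for x
    by (simp_all add: model_maps)
  show "mcyc fscale E F si" unfolding mcyc_def si_def
    by (simp add: d1[simplified] d2[simplified] d3 d4 model_maps(3) gc memg wg dif psi)
qed

lemma hom_eqs:
  "meq s F' (mcomp p mid) mid" "meq fscale E (mcomp ps si) mid" "meq fscale E (mcomp p si) mzero"
  "meq s F' (mcomp ps mid) mzero" "meq s F (madd (mcomp mid p) (mcomp si ps)) mid"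
proof -
  note m = meq_def mcomp_def mid_def mzero_def madd_def
  show "meq s F' (mcomp p mid) mid"
    unfolding m by (auto simp: p_def lf dest!: carF')
  show "meq s F' (mcomp ps mid) mzero"
    unfolding m by (auto simp: ps_def lf fscale_def fun_eq_iff dest!: carF')
  have 1: "fscale (lw (s (x (0, 2)) w)) q2 = x" if x: "x \<in> gcar fscale (dnG E)" for x
  proof
    fix r :: "nat \<times> nat"
    show "fscale (lw (s (x (0, 2)) w)) q2 r = x r"
      using E_supp(2)[OF x, of r] E_car(3)[OF x] by (cases "x r = 0") (auto simp: lf memg gc dual fscale_def qv)
  qed
  have 2: "fscale (l0 (s (x (0, 0)) u0 + s (x (0, 1)) u1)) q0 + fscale (l1 (s (x (0, 0)) u0 + s (x (0, 1)) u1)) q1 = x"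
    if x: "x \<in> gcar fscale (upG E)" for x
  proof
    fix r :: "nat \<times> nat"
    have "r = (0, 0) \<or> r = (0, 1) \<or> x r = 0" using E_supp(1)[OF x, of r] by auto
    then show "(fscale (l0 (s (x (0, 0)) u0 + s (x (0, 1)) u1)) q0 + fscale (l1 (s (x (0, 0)) u0 + s (x (0, 1)) u1)) q1) r = x r"
      using E_car(1,2)[OF x] by (auto simp: lf memg gc dual fscale_def qv)
  qed
  have 3: "fscale (lm (s (x (0, 4)) z)) q4 = x" if x: "x \<in> gcar fscale (DG E)" for x
  proof
    fix r :: "nat \<times> nat"
    show "fscale (lm (s (x (0, 4)) z)) q4 r = x r"
      using E_supp(3)[OF x, of r] E_car(4)[OF x] by (cases "x r = 0") (auto simp: lf memg gc dual fscale_def qv)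
  qed
  have 4: "fscale (lm (- s (x (0, 0)) y1)) q4 = 0" for x :: "nat \<times> nat \<Rightarrow> 'k"
    by (simp add: lf memg gc lm_y1 fscale_def fun_eq_iff)
  have 5: "fscale (lm 0) q4 = 0" by (simp add: lf fscale_def fun_eq_iff)
  show "meq fscale E (mcomp ps si) mid"
    unfolding m using 1 2 3 4 5 by (simp add: ps_def si_def)
  show "meq fscale E (mcomp p si) mzero"
    unfolding m using triv bas(6)
    by (auto simp: p_def si_def lf gc memg dual lm_y1)
  show "meq s F (madd (mcomp mid p) (mcomp si ps)) mid"
    unfolding m using triv bas(6)
    by (auto simp: p_def ps_def si_def lf fscale_def qv)
qed

theorem split:
  assumes "eiso real_of_ereal s fscale F' (model L :: (nat \<times> nat \<Rightarrow> 'k) cospan)"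
  shows "eiso real_of_ereal s fscale F (model (L @ [e]) :: (nat \<times> nat \<Rightarrow> 'k) cospan)"
  by (rule model_sum_split[OF good_cospan[OF v F lF mono_on_real] good_cospan[OF v cosF' lF' mono_on_real] assms p_hm i_hm ps_hm si_hm hom_eqs])

end

section \<open>Existence of the decomposition\<close>

definition fdc where
  "fdc s F \<longleftrightarrow> fin_dim s (gcar s (upG F)) \<and> fin_dim s (gcar s (dnG F)) \<and> fin_dim s (gcar s (DG F))"

definition dimc where
  "dimc s F = vector_space.dim s (gcar s (upG F)) + vector_space.dim s (gcar s (dnG F)) + vector_space.dim s (gcar s (DG F))"

text \<open>Finite bars may still have length zero at this stage: the levels of an element and of
  its boundary can agree.\<close>

definition okl :: "(ereal \<Rightarrow> real) \<Rightarrow> summand list \<Rightarrow> bool" where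
  "okl A L \<longleftrightarrow> (\<forall>x\<in>set L. ty x \<in> {0, 2} \<longrightarrow> c1 A x \<le> c2 A x)"

definition hasnf :: "('k::field \<Rightarrow> 'v::ab_group_add \<Rightarrow> 'v) \<Rightarrow> 'v cospan \<Rightarrow> bool" where
  "hasnf s F \<longleftrightarrow> (\<exists>L. okl real_of_ereal L \<and> eiso real_of_ereal s fscale F (model L :: (nat \<times> nat \<Rightarrow> 'k) cospan))"

lemma dim_le:
  assumes "vector_space s" "module.subspace s U" "U \<subseteq> V" "fin_dim s V"
  shows "vector_space.dim s U \<le> vector_space.dim s V"
  using dim_strict[OF assms(1-3) _ _ assms(4)] assms(3) by (metis less_imp_le_nat order_refl subset_antisym subsetI)

lemma subspace_gcar: "vector_space s \<Longrightarrow> module.subspace s (gcar s G)"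
proof -
  assume "vector_space s"
  then interpret vector_space s .
  show ?thesis by (simp add: gcar_def)
qed

lemma dimc_less:
  assumes v: "vector_space s" and fd: "fdc s F"
    and "gcar s (upG F') \<subseteq> gcar s (upG F)" "gcar s (dnG F') \<subseteq> gcar s (dnG F)" "gcar s (DG F') \<subseteq> gcar s (DG F)"
    and "gcar s (upG F') \<noteq> gcar s (upG F) \<or> gcar s (dnG F') \<noteq> gcar s (dnG F) \<or> gcar s (DG F') \<noteq> gcar s (DG F)"
  shows "dimc s F' < dimc s F \<and> fdc s F'"
proof -
  have le: "vector_space.dim s (gcar s G) \<le> vector_space.dim s (gcar s H)" if "gcar s G \<subseteq> gcar s H" "fin_dim s (gcar s H)" for G H
    by (rule dim_le[OF v subspace_gcar[OF v] that])
  have lt: "vector_space.dim s (gcar s G) < vector_space.dim s (gcar s H)" if "gcar s G \<subseteq> gcar s H" "gcar s G \<noteq> gcar s H" "fin_dim s (gcar s H)" for G H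
    using dim_strict[OF v subspace_gcar[OF v] that(1) _ _ that(3)] that(1,2) by blast
  have fd': "fin_dim s (gcar s (upG F))" "fin_dim s (gcar s (dnG F))" "fin_dim s (gcar s (DG F))" using fd by (auto simp: fdc_def)
  have "fdc s F'" using fd' assms(3-5) unfolding fdc_def fin_dim_def by (meson order_trans)
  moreover have "dimc s F' < dimc s F"
    using le[OF assms(3) fd'(1)] le[OF assms(4) fd'(2)] le[OF assms(5) fd'(3)] lt[OF assms(3) _ fd'(1)] lt[OF assms(4) _ fd'(2)] lt[OF assms(5) _ fd'(3)] assms(6)
    unfolding dimc_def by linarith
  ultimately show ?thesis by simp
qed

text \<open>A generator belonging to a true flag is not in the complement, since its dual functional
  takes the value 1 there; so the total dimension drops and the induction hypothesis applies to
  \<open>F'\<close>.\<close>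

lemma (in splitting) reduce:
  assumes "fdc s F" "b0 \<or> bw \<or> bm" "\<And>F''. is_cospan s F'' \<Longrightarrow> fdc s F'' \<Longrightarrow> dimc s F'' < dimc s F \<Longrightarrow> hasnf s F''"
    "ty e \<in> {0, 2} \<longrightarrow> c1 real_of_ereal e \<le> c2 real_of_ereal e"
  shows "hasnf s F"
proof -
  have "u0 \<notin> gcar s (upG F')" if b0 using carF'(1)[of u0] that dual(1) by auto
  moreover have "w \<notin> gcar s (dnG F')" if bw using carF'(2)[of w] that dual(5) by auto
  moreover have "z \<notin> gcar s (DG F')" if bm using carF'(3)[of z] that dual(6) by auto
  ultimately have "dimc s F' < dimc s F \<and> fdc s F'"
    using memg assms(2) carF' by (intro dimc_less[OF v assms(1)]) blast+
  then obtain L where L: "okl real_of_ereal L" "eiso real_of_ereal s fscale F' (model L :: (nat \<times> nat \<Rightarrow> 'k) cospan)"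
    using assms(3)[OF cosF'] by (auto simp: hasnf_def)
  have "okl real_of_ereal (L @ [e])" using L(1) assms(4) by (auto simp: okl_def)
  with split[OF L(2)] show ?thesis unfolding hasnf_def by blast
qed

lemma okl_sws: "okl real_of_ereal L \<Longrightarrow> okl real_of_ereal (map sws L)"
proof -
  have "(ty (sws e) \<in> {0, 2} \<longrightarrow> c1 real_of_ereal (sws e) \<le> c2 real_of_ereal (sws e))"
    if "ty e \<in> {0, 2} \<longrightarrow> c1 real_of_ereal e \<le> c2 real_of_ereal e" for e
    using that by (cases e) auto
  then show "okl real_of_ereal L \<Longrightarrow> okl real_of_ereal (map sws L)" unfolding okl_def by simp
qed

lemma good_real_model: "good real_of_ereal fscale (model L :: (nat \<times> nat \<Rightarrow> 'k::field) cospan)"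
  by (rule good_model[where B = UNIV, OF levin_UNIV mono_on_real])

lemma good_real: "vector_space s \<Longrightarrow> is_cospan s F \<Longrightarrow> good real_of_ereal s F"
  by (rule good_cospan[OF _ _ levok_UNIV mono_on_real])

lemma eiso_model_sw:
  fixes s :: "'k::field \<Rightarrow> 'v::ab_group_add \<Rightarrow> 'v"
  assumes "vector_space s" "good A s F" "good (swA A) s (sw F)" 
    and L: "\<And>i. i < length L \<Longrightarrow> levin B (L ! i)" "mono_on (ereal ` B) A" "mono_on (ereal ` B) (swA A)" "uminus ` B \<subseteq> B"
    and e: "eiso A s fscale F (model L :: (nat \<times> nat \<Rightarrow> 'k) cospan)"
  shows "eiso (swA A) s fscale (sw F) (model (map sws L) :: (nat \<times> nat \<Rightarrow> 'k) cospan)"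
proof -
  have lv: "\<And>i. i < length (map sws L) \<Longrightarrow> levin B (map sws L ! i)" using L(1,4) levin_sws by auto
  have g: "good (swA A) fscale (sw (model L :: (nat \<times> nat \<Rightarrow> 'k) cospan))"
    by (rule good_sw[OF good_model[OF L(1,2)]])
  have g': "good (swA A) fscale (model (map sws L) :: (nat \<times> nat \<Rightarrow> 'k) cospan)"
    by (rule good_model[OF lv L(3)])
  have "eiso (swA A) s fscale (sw F) (sw (model L :: (nat \<times> nat \<Rightarrow> 'k) cospan))" by (rule eiso_sw[OF e])
  then show ?thesis using model_sw[OF L(1,3,4)] eiso_trans[OF assms(3) g g'] by blast
qed

text \<open>Halves the case distinction: what is shown for the ascending arm holds for the
  descending one.\<close>

lemma hasnf_sw:
  assumes "vector_space s" "is_cospan s F" "hasnf s (sw F)"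
  shows "hasnf s F"
proof -
  obtain L where L: "okl real_of_ereal L" "eiso real_of_ereal s fscale (sw F) (model L :: (nat \<times> nat \<Rightarrow> 'a) cospan)"
    using assms(3) by (auto simp: hasnf_def)
  have g: "good real_of_ereal s F" "good real_of_ereal s (sw F)"
    using good_real[OF assms(1)] assms(2) is_cospan_sw by blast+
  have "eiso (swA real_of_ereal) s fscale (sw (sw F)) (model (map sws L) :: (nat \<times> nat \<Rightarrow> 'a) cospan)"
    by (rule eiso_model_sw[where B = UNIV, OF assms(1) g(2) _ levin_UNIV mono_on_real _ _ L(2)])
      (simp_all only: swA_real sw_sw g(1) mono_on_real subset_UNIV)
  moreover have "okl real_of_ereal (map sws L)" by (rule okl_sws[OF L(1)])
  ultimately show ?thesis unfolding hasnf_def sw_sw swA_real by blast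
qed

section \<open>Splitting off single summands\<close>

lemma homogeneous_nonzero:
  assumes v: "vector_space s" and t: "vector_space t" and l: "lin_on s t (gcar s G) f" and x: "x \<in> gcar s G" "f x \<noteq> 0"
  shows "\<exists>k. \<exists>y\<in>G k. f y \<noteq> 0"
proof (rule ccontr)
  assume "\<not> ?thesis"
  then have n: "f y = 0" if "y \<in> G k" for y k using that by blast
  interpret vector_space s by fact
  interpret t: vector_space t by fact
  note gc = gcar_closed[OF v]
  have "subspace {x \<in> gcar s G. f x = 0}"
    using l lin_on_basic(1)[OF v t l] by (auto simp: subspace_def lin_on_def gc)
  then have "gcar s G \<subseteq> {x \<in> gcar s G. f x = 0}" by (intro gcar_subset[OF v]) (use n gc(6)[of _ G] in auto)
  then show False using x by blast
qed

lemma homogeneous_zero: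
  assumes v: "vector_space s" and g: "linf s (gcar s G) f" and "\<And>k x. x \<in> G k \<Longrightarrow> f x = 0" and "x \<in> gcar s G"
  shows "f x = 0"
proof -
  interpret vector_space s by fact
  note gc = gcar_closed[OF v]
  have "subspace {x \<in> gcar s G. f x = 0}" unfolding subspace_def by (simp add: gc linfD[OF g v])
  then have "gcar s G \<subseteq> {x \<in> gcar s G. f x = 0}" by (intro gcar_subset[OF v]) (use assms(3) gc(6)[of _ G] in auto)
  then show ?thesis using assms(4) by blast
qed

lemma linf_comp:
  assumes "vector_space s" "vector_space t" "gmap s t G H m f" "linf t (gcar t H) l"
  shows "linf s (gcar s G) (\<lambda>x. l (f x))"
  using gmap_lin[OF assms(1-3)] assms(4) by (simp add: linf_def)

lemma nonzero_levels:
  assumes "vector_space s" "is_cospan s F"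
  shows "x \<in> gcar s (upG F) \<Longrightarrow> x \<noteq> 0 \<Longrightarrow> \<exists>a. upL F x = ereal a"
    "x \<in> gcar s (dnG F) \<Longrightarrow> x \<noteq> 0 \<Longrightarrow> \<exists>a. dnL F x = ereal a"
proof -
  have 1: "y \<in> range ereal \<Longrightarrow> \<exists>a. y = ereal a" for y by blast
  show "x \<in> gcar s (upG F) \<Longrightarrow> x \<noteq> 0 \<Longrightarrow> \<exists>a. upL F x = ereal a"
    "x \<in> gcar s (dnG F) \<Longrightarrow> x \<noteq> 0 \<Longrightarrow> \<exists>a. dnL F x = ereal a"
    using levok_UNIV[OF assms] 1 unfolding levok_def by blast+
qed

lemma wcos_zero:
  assumes "wcos s F"
  shows "upD F 0 = 0" "dnD F 0 = 0" "DD F 0 = 0" "psiU F 0 = 0" "psiD F 0 = 0"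
  using wcosD[OF assms, THEN gmap_lin[OF wcos_vs[OF assms] wcos_vs[OF assms]]] by blast+

lemma maps_zero:
  assumes "vector_space s" "is_cospan s F"
  shows "upD F 0 = 0" "dnD F 0 = 0" "DD F 0 = 0" "psiU F 0 = 0" "psiD F 0 = 0"
  by (rule wcos_zero[OF is_cospan_wcos[OF assms]])+

text \<open>Once the differentials and \<open>psiU\<close> vanish, nothing ties the vectors of the
  ascending arm to each other or to the middle. Any nonzero homogeneous one splits off, with the
  functional of \<open>level_functional\<close> as its dual.\<close>

lemma case_UpInf:
  fixes s :: "'k::field \<Rightarrow> 'v::ab_group_add \<Rightarrow> 'v"
  assumes v: "vector_space s" and F: "is_cospan s F" and fd: "fdc s F"
    and z: "\<And>x. x \<in> gcar s (upG F) \<Longrightarrow> upD F x = 0" "\<And>x. x \<in> gcar s (dnG F) \<Longrightarrow> dnD F x = 0" "\<And>x. x \<in> gcar s (DG F) \<Longrightarrow> DD F x = 0"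
      "\<And>x. x \<in> gcar s (upG F) \<Longrightarrow> psiU F x = 0"
    and x: "x \<in> gcar s (upG F)" "x \<noteq> 0"
    and IH: "\<And>F''. is_cospan s F'' \<Longrightarrow> fdc s F'' \<Longrightarrow> dimc s F'' < dimc s F \<Longrightarrow> hasnf s F''"
  shows "hasnf s F"
proof -
  note F' = F[unfolded is_cospan_def]
  interpret vector_space s by fact
  have gr: "is_graded s (upG F)" "is_graded s (dnG F)" "is_graded s (DG F)" using F' by (auto simp: is_chain_def)
  have sub: "subspace (upG F k)" "subspace (dnG F k)" "subspace (DG F k)" for k using gr by (auto simp: is_graded_def)
  obtain k u where u: "u \<in> upG F k" "u \<noteq> 0"
    using homogeneous_nonzero[OF v v _ x(1), where f = "\<lambda>x. x"] x(2) by (auto simp: lin_on_def)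
  have asc: "asc_filt s (upG F) (upD F) (upL F)" using F' by blast
  obtain l where l: "linf s UNIV l" "l u = 1" "\<forall>j x. j \<noteq> k \<longrightarrow> x \<in> upG F j \<longrightarrow> l x = 0"
    "\<forall>x\<in>gcar s (upG F). l x \<noteq> 0 \<longrightarrow> upL F u \<le> upL F x"
    using level_functional[OF v gr(1) asc u] by blast
  have lg: "linf s (gcar s (upG F)) l" by (rule linf_mono[OF l(1)]) simp
  have ug: "u \<in> gcar s (upG F)" using gcar_closed(6)[OF v, of u "upG F" k] u by blast
  obtain a where a: "upL F u = ereal a" using nonzero_levels(1)[OF v F ug u(2)] by blast
  let ?e = "UpInf a k"
  interpret splitting s F ?e k l "\<lambda>_. 0" "\<lambda>_. 0" "\<lambda>_. 0" u 0 0 0 0 True False False False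
    by unfold_locales
      (use v F lg l u sub z ug a maps_zero[OF v F] in \<open>auto simp: linf_zero subspace_0 levok_def linfD[OF lg v] gcar_closed(1)[OF v]\<close>)
  show ?thesis by (rule reduce[OF fd _ IH]) auto
qed


lemma case_Sq:
  fixes s :: "'k::field \<Rightarrow> 'v::ab_group_add \<Rightarrow> 'v"
  assumes v: "vector_space s" and F: "is_cospan s F" and fd: "fdc s F"
    and z: "\<And>x. x \<in> gcar s (upG F) \<Longrightarrow> x = 0" "\<And>x. x \<in> gcar s (dnG F) \<Longrightarrow> x = 0" "\<And>x. x \<in> gcar s (DG F) \<Longrightarrow> DD F x = 0"
    and x: "x \<in> gcar s (DG F)" "x \<noteq> 0"
    and IH: "\<And>F''. is_cospan s F'' \<Longrightarrow> fdc s F'' \<Longrightarrow> dimc s F'' < dimc s F \<Longrightarrow> hasnf s F''"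
  shows "hasnf s F"
proof -
  note F' = F[unfolded is_cospan_def]
  interpret vector_space s by fact
  have gr: "is_graded s (upG F)" "is_graded s (dnG F)" "is_graded s (DG F)" using F' by (auto simp: is_chain_def)
  have sub: "subspace (upG F k)" "subspace (dnG F k)" "subspace (DG F k)" for k using gr by (auto simp: is_graded_def)
  obtain k u where u: "u \<in> DG F k" "u \<noteq> 0"
    using homogeneous_nonzero[OF v v _ x(1), where f = "\<lambda>x. x"] x(2) by (auto simp: lin_on_def)
  obtain l where l: "linf s UNIV l" "l u = 1" "\<forall>j x. j \<noteq> k \<longrightarrow> x \<in> DG F j \<longrightarrow> l x = 0"
    using graded_functional[OF v gr(3) u(1), of "{0}"] u(2) subspace_0[OF sub(3)] by (auto simp: subspace_single_0)
  have lg: "linf s (gcar s (DG F)) l" by (rule linf_mono[OF l(1)]) simp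
  have l0: "l 0 = 0" by (rule linfD(3)[OF lg v])
  have h: "x \<in> upG F j \<Longrightarrow> x = 0" "x \<in> dnG F j \<Longrightarrow> x = 0" for x j
    using z(1,2) gcar_closed(6)[OF v, of x "upG F" j] gcar_closed(6)[OF v, of x "dnG F" j] by blast+
  have p: "psiU F x = 0" if "x \<in> gcar s (upG F)" for x using z(1)[OF that] maps_zero[OF v F] by simp
  have q: "psiD F x = 0" if "x \<in> gcar s (dnG F)" for x using z(2)[OF that] maps_zero[OF v F] by simp
  interpret splitting s F "Sq k" k "\<lambda>_. 0" "\<lambda>_. 0" "\<lambda>_. 0" l 0 0 0 u 0 False False False True
    by unfold_locales
      (use v F lg l u sub z gcar_closed(6)[OF v, of u "DG F" k] maps_zero[OF v F] l0 p q in \<open>auto simp: linf_zero subspace_0 gcar_closed(1)[OF v]\<close>)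
  show ?thesis by (rule reduce[OF fd _ IH]) auto
qed

lemma case_empty:
  fixes s :: "'k::field \<Rightarrow> 'v::ab_group_add \<Rightarrow> 'v"
  assumes v: "vector_space s" and F: "is_cospan s F"
    and z: "\<And>x. x \<in> gcar s (upG F) \<Longrightarrow> x = 0" "\<And>x. x \<in> gcar s (dnG F) \<Longrightarrow> x = 0" "\<And>x. x \<in> gcar s (DG F) \<Longrightarrow> x = 0"
  shows "hasnf s F"
proof -
  let ?E = "model [] :: (nat \<times> nat \<Rightarrow> 'k) cospan"
  note wF = is_cospan_wcos[OF v F]
  have E: "x = 0" if "x \<in> gcar fscale (upG ?E) \<or> x \<in> gcar fscale (dnG ?E) \<or> x \<in> gcar fscale (DG ?E)" for x
    using that by (auto simp: model_car upS_def dnS_def midS_def fun_eq_iff)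
  have zr: "ehm real_of_ereal s1 s2 0 C X mzero" if "wcos s1 C" "wcos s2 X" for s1 :: "'k \<Rightarrow> 'x::ab_group_add \<Rightarrow> 'x" and s2 :: "'k \<Rightarrow> 'y::ab_group_add \<Rightarrow> 'y" and C X
    by (simp add: ehm_def emor_def mcyc_def mzero_def wcos_zero[OF that(2)] gmap_zero[OF wcos_vs[OF that(2)] wcos_sub(1)[OF that(2)]]
      gmap_zero[OF wcos_vs[OF that(2)] wcos_sub(2)[OF that(2)]] gmap_zero[OF wcos_vs[OF that(2)] wcos_sub(3)[OF that(2)]])
  have "eiso real_of_ereal s fscale F ?E"
    unfolding eiso_def
  proof (intro exI conjI)
    show "eho real_of_ereal s s 0 F F (mcomp mzero mzero) mid"
      by (rule eho_meq[OF wF wF]) (use z in \<open>auto simp: meq_def mcomp_def mzero_def mid_def\<close>)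
    show "eho real_of_ereal fscale fscale 0 ?E ?E (mcomp mzero mzero) mid"
      by (rule eho_meq[OF wcos_model wcos_model]) (use E in \<open>auto simp: meq_def mcomp_def mzero_def mid_def\<close>)
  qed (use zr wF wcos_model in blast)+
  then show ?thesis unfolding hasnf_def by (intro exI[of _ "[]"]) (simp add: okl_def)
qed

text \<open>\<open>u1\<close> has least level among the homogeneous elements with nonzero boundary,
  so everything lower in its degree is a cycle. Hence the composite \<open>?l1\<close> of the
  differential and the functional of \<open>u0\<close> respects the level of \<open>u1\<close>, and
  using this composite as the dual of \<open>u1\<close> makes the complement a subcomplex. The image
  of \<open>u1\<close> in the middle is not normalised but handed on as \<open>y1\<close>.\<close>

lemma case_Up:
  fixes s :: "'k::field \<Rightarrow> 'v::ab_group_add \<Rightarrow> 'v"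
  assumes v: "vector_space s" and F: "is_cospan s F" and fd: "fdc s F"
    and z: "\<And>x. x \<in> gcar s (DG F) \<Longrightarrow> DD F x = 0"
    and x: "x \<in> gcar s (upG F)" "upD F x \<noteq> 0"
    and IH: "\<And>F''. is_cospan s F'' \<Longrightarrow> fdc s F'' \<Longrightarrow> dimc s F'' < dimc s F \<Longrightarrow> hasnf s F''"
  shows "hasnf s F"
proof -
  note F' = F[unfolded is_cospan_def]
  interpret vector_space s by fact
  note wg = wcosD[OF is_cospan_wcos[OF v F]]
  note wl = wg[THEN gmap_lin[OF v v]]
  have gr: "is_graded s (upG F)" "is_graded s (dnG F)" "is_graded s (DG F)" using F' by (auto simp: is_chain_def)
  have sub: "subspace (upG F k)" "subspace (dnG F k)" "subspace (DG F k)" for k using gr by (auto simp: is_graded_def)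
  have asc: "asc_filt s (upG F) (upD F) (upL F)" using F' by blast
  have dd: "upD F (upD F x) = 0" if "x \<in> gcar s (upG F)" for x using F' that by (auto simp: is_chain_def)
  have "lin_on s s (gcar s (upG F)) (upD F)" using wg(1) by (simp add: gmap_def)
  then obtain k' x' where x': "x' \<in> upG F k'" "upD F x' \<noteq> 0" using homogeneous_nonzero[OF v v _ x(1)] x(2) by blast
  note gcU = gcar_closed(6)[OF v, of _ "upG F"]
  obtain u1 where "u1 \<in> gcar s (upG F)" and u1': "\<exists>k. u1 \<in> upG F k \<and> upD F u1 \<noteq> 0"
    "\<forall>y\<in>gcar s (upG F). (\<exists>k. y \<in> upG F k \<and> upD F y \<noteq> 0) \<longrightarrow> upL F u1 \<le> upL F y"
    using exists_min_level[OF v asc _ gcU[OF x'(1)], of "\<lambda>y. \<exists>k. y \<in> upG F k \<and> upD F y \<noteq> 0"] fd x' by (auto simp: fdc_def)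
  then obtain K where K: "u1 \<in> upG F K" "upD F u1 \<noteq> 0" by blast
  define k where "k = K - 1"
  have u1: "u1 \<in> upG F (k + 1)" "upD F u1 \<noteq> 0" "u1 \<noteq> 0" using K maps_zero(1)[OF v F] by (auto simp: k_def)
  define u0 where "u0 = upD F u1"
  have u0: "u0 \<in> upG F k" "u0 \<noteq> 0" using gmapD[OF wg(1) u1(1)] u1(2) by (simp_all add: u0_def)
  note ug = gcU[OF u0(1)] gcU[OF u1(1)]
  obtain l where l: "linf s UNIV l" "l u0 = 1" "\<forall>j x. j \<noteq> k \<longrightarrow> x \<in> upG F j \<longrightarrow> l x = 0"
    "\<forall>x\<in>gcar s (upG F). l x \<noteq> 0 \<longrightarrow> upL F u0 \<le> upL F x"
    using level_functional[OF v gr(1) asc u0] by blast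
  have lg: "linf s (gcar s (upG F)) l" by (rule linf_mono[OF l(1)]) simp
  have l0: "l 0 = 0" by (rule linfD(3)[OF lg v])
  let ?l1 = "\<lambda>x. l (upD F x)"
  have lg1: "linf s (gcar s (upG F)) ?l1" by (rule linf_comp[OF v v wg(1) lg])
  have deg1: "?l1 x = 0" if "x \<in> upG F j" "j \<noteq> k + 1" for j x
  proof -
    have "j - 1 \<noteq> k" using that(2) by simp
    then show ?thesis using gmapD[OF wg(1) that(1)] l(3) by blast
  qed
  have lev1: "upL F u1 \<le> upL F x" if "x \<in> gcar s (upG F)" "?l1 x \<noteq> 0" for x
  proof (rule functional_level[where f = ?l1 and k = "k + 1" and u = u1, OF v gr(1) asc lg1 deg1 _ that])
    fix y assume y: "y \<in> upG F (k + 1)" "upL F y < upL F u1"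
    then have "upD F y = 0" using u1'(2) gcU[OF y(1)] by force
    then show "?l1 y = 0" using l0 by simp
  qed
  obtain a b where ab: "upL F u0 = ereal a" "upL F u1 = ereal b"
    using nonzero_levels(1)[OF v F] ug u0(2) u1(3) by metis
  have "upL F u0 \<le> upL F u1" using asc ug(2) unfolding asc_filt_def u0_def by blast
  then have le: "a \<le> b" using ab by simp
  \<comment> \<open>\<open>u0\<close> bounds \<open>u1\<close> and the middle complex has zero
    differential, so \<open>u0\<close> maps to the boundary of \<open>psiU F u1\<close>, which is
    0.\<close>
  have psi0: "psiU F u0 = 0" using F' ug(2) z wl unfolding u0_def by metis
  have y1: "psiU F u1 \<in> DG F (k + 1)" using gmapD[OF wg(4) u1(1)] by simp
  have du0: "upD F u0 = 0" using dd[OF ug(2)] by (simp add: u0_def)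
  have ldd: "l (upD F (upD F x)) = 0" if "x \<in> gcar s (upG F)" for x using dd[OF that] l0 by simp
  have dy1: "DD F (psiU F u1) = 0" using z wl(4) ug(2) by blast
  have "k + 1 \<noteq> k" by simp
  then have lu1: "l u1 = 0" using l(3) u1(1) by blast
  interpret splitting s F "Up a b k" k l ?l1 "\<lambda>_. 0" "\<lambda>_. 0" u0 u1 0 0 "psiU F u1" True True False False
    by unfold_locales
      (use v F lg lg1 l(2-4) u0 u1(1) sub ug ab maps_zero[OF v F] deg1 lev1 psi0 y1 l0 du0 ldd dy1 lu1 in \<open>auto simp: linf_zero subspace_0 u0_def[symmetric]\<close>)
  show ?thesis by (rule reduce[OF fd _ IH]) (use le in auto)
qed


lemma subspace_gmap_image:
  assumes v: "vector_space s" and f: "gmap s s G H m f" and V: "module.subspace s V" "V \<subseteq> gcar s G"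
  shows "module.subspace s (f ` V)"
proof -
  interpret vector_space s by fact
  note l = gmap_lin[OF v v f]
  show ?thesis
  proof (rule subspaceI)
    show "0 \<in> f ` V" using l subspace_0[OF V(1)] by (metis imageI)
  next
    fix p q assume "p \<in> f ` V" "q \<in> f ` V"
    then obtain x y where xy: "p = f x" "q = f y" "x \<in> V" "y \<in> V" by blast
    moreover from xy V(2) have "x \<in> gcar s G" "y \<in> gcar s G" by blast+
    ultimately have "p + q = f (x + y)" by (simp add: l)
    then show "p + q \<in> f ` V" using subspace_add[OF V(1) xy(3,4)] by blast
  next
    fix p r assume "p \<in> f ` V"
    then obtain x where x: "p = f x" "x \<in> V" by blast
    moreover from x V(2) have "x \<in> gcar s G" by blast
    ultimately have "s r p = f (s r x)" by (simp add: l)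
    then show "s r p \<in> f ` V" using subspace_scale[OF V(1) x(2)] by blast
  qed
qed

text \<open>\<open>u\<close> has least level among the homogeneous elements with nonzero image, and
  a single functional \<open>l\<close> on the middle with value 1 at that image \<open>c\<close> is
  pulled back to both arms; this makes the complement compatible with \<open>psiU\<close> and
  \<open>psiD\<close>. If the descending arm does not reach \<open>c\<close>, then \<open>l\<close>
  can kill its image, which yields \<open>NE\<close>. Otherwise \<open>l\<close> kills only the
  images of what lies above the best preimage \<open>w\<close> of \<open>c\<close>, which yields
  \<open>Gt\<close>.\<close>

lemma case_psiU:
  fixes s :: "'k::field \<Rightarrow> 'v::ab_group_add \<Rightarrow> 'v"
  assumes v: "vector_space s" and F: "is_cospan s F" and fd: "fdc s F"
    and z: "\<And>x. x \<in> gcar s (upG F) \<Longrightarrow> upD F x = 0" "\<And>x. x \<in> gcar s (dnG F) \<Longrightarrow> dnD F x = 0" "\<And>x. x \<in> gcar s (DG F) \<Longrightarrow> DD F x = 0"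
    and x: "x \<in> gcar s (upG F)" "psiU F x \<noteq> 0"
    and IH: "\<And>F''. is_cospan s F'' \<Longrightarrow> fdc s F'' \<Longrightarrow> dimc s F'' < dimc s F \<Longrightarrow> hasnf s F''"
  shows "hasnf s F"
proof -
  note F' = F[unfolded is_cospan_def]
  interpret vector_space s by fact
  note wg = wcosD[OF is_cospan_wcos[OF v F]]
  note wl = wg[THEN gmap_lin[OF v v]]
  have gr: "is_graded s (upG F)" "is_graded s (dnG F)" "is_graded s (DG F)" using F' by (auto simp: is_chain_def)
  have sub: "subspace (upG F k)" "subspace (dnG F k)" "subspace (DG F k)" for k using gr by (auto simp: is_graded_def)
  have asc: "asc_filt s (upG F) (upD F) (upL F)" and dsc: "asc_filt s (dnG F) (dnD F) (\<lambda>x. - dnL F x)"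
    using F' by (auto simp: desc_filt_def)
  have "lin_on s s (gcar s (upG F)) (psiU F)" using wg(4) by (simp add: gmap_def)
  then obtain k' x' where x': "x' \<in> upG F k'" "psiU F x' \<noteq> 0" using homogeneous_nonzero[OF v v _ x(1)] x(2) by blast
  note gcU = gcar_closed(6)[OF v, of _ "upG F"] and gcD = gcar_closed(6)[OF v, of _ "dnG F"]
  obtain u where "u \<in> gcar s (upG F)" and u': "\<exists>k. u \<in> upG F k \<and> psiU F u \<noteq> 0"
    "\<forall>y\<in>gcar s (upG F). (\<exists>k. y \<in> upG F k \<and> psiU F y \<noteq> 0) \<longrightarrow> upL F u \<le> upL F y"
    using exists_min_level[OF v asc _ gcU[OF x'(1)], of "\<lambda>y. \<exists>k. y \<in> upG F k \<and> psiU F y \<noteq> 0"] fd x' by (auto simp: fdc_def)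
  then obtain k where k: "u \<in> upG F k" "psiU F u \<noteq> 0" by blast
  define c where "c = psiU F u"
  have u0: "u \<noteq> 0" using k(2) maps_zero(4)[OF v F] by auto
  have c: "c \<in> DG F k" "c \<noteq> 0" using gmapD[OF wg(4) k(1)] k(2) by (simp_all add: c_def)
  have ug: "u \<in> gcar s (upG F)" and cg: "c \<in> gcar s (DG F)"
    using gcU[OF k(1)] gcar_closed(6)[OF v, of c "DG F" k] c by blast+
  obtain a where a: "upL F u = ereal a" using nonzero_levels(1)[OF v F ug u0] by blast
  \<comment> \<open>What both cases share: the pulled back functionals are linear, concentrated in
    degree \<open>k\<close>, and the one on the ascending arm respects the level of
    \<open>u\<close>, because lower elements of that degree have image 0.\<close>
  have key: "hasnf s F" if l: "linf s UNIV l" "l c = 1" "\<forall>j x. j \<noteq> k \<longrightarrow> x \<in> DG F j \<longrightarrow> l x = 0"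
    and S: "\<And>lg l0 lD. linf s (gcar s (upG F)) (\<lambda>x. l (psiU F x)) \<Longrightarrow> linf s (gcar s (dnG F)) (\<lambda>x. l (psiD F x)) \<Longrightarrow> linf s (gcar s (DG F)) l
      \<Longrightarrow> l 0 = 0 \<Longrightarrow> (\<And>j x. x \<in> upG F j \<Longrightarrow> j \<noteq> k \<Longrightarrow> l (psiU F x) = 0) \<Longrightarrow> (\<And>j x. x \<in> dnG F j \<Longrightarrow> j \<noteq> k \<Longrightarrow> l (psiD F x) = 0)
      \<Longrightarrow> (\<And>x. x \<in> gcar s (upG F) \<Longrightarrow> l (psiU F x) \<noteq> 0 \<Longrightarrow> upL F u \<le> upL F x) \<Longrightarrow> hasnf s F" for l
  proof -
    have lg: "linf s (gcar s (DG F)) l" by (rule linf_mono[OF l(1)]) simp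
    have l0: "l 0 = 0" by (rule linfD(3)[OF lg v])
    have lU: "linf s (gcar s (upG F)) (\<lambda>x. l (psiU F x))" by (rule linf_comp[OF v v wg(4) lg])
    have lD: "linf s (gcar s (dnG F)) (\<lambda>x. l (psiD F x))" by (rule linf_comp[OF v v wg(5) lg])
    have dU: "l (psiU F x) = 0" if "x \<in> upG F j" "j \<noteq> k" for j x
      using gmapD[OF wg(4) that(1)] l(3) that(2) by auto
    have dD: "l (psiD F x) = 0" if "x \<in> dnG F j" "j \<noteq> k" for j x
      using gmapD[OF wg(5) that(1)] l(3) that(2) by auto
    have lev: "upL F u \<le> upL F x" if "x \<in> gcar s (upG F)" "l (psiU F x) \<noteq> 0" for x
    proof (rule functional_level[where f = "\<lambda>x. l (psiU F x)" and k = k and u = u, OF v gr(1) asc lU dU _ that])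
      fix y assume y: "y \<in> upG F k" "upL F y < upL F u"
      then have "psiU F y = 0" using u'(2) gcU[OF y(1)] by force
      then show "l (psiU F y) = 0" using l0 by simp
    qed
    show ?thesis by (rule S[OF lU lD lg l0 dU dD lev])
  qed
  show ?thesis
  proof (cases "\<exists>x\<in>dnG F k. psiD F x = c")
    case False
    let ?W = "psiD F ` dnG F k"
    have W: "subspace ?W" by (rule subspace_gmap_image[OF v wg(5) sub(2)]) (use gcD in blast)
    have WG: "?W \<subseteq> DG F k" using gmapD[OF wg(5)] by force
    have "c \<notin> ?W" using False by blast
    then obtain l where l: "linf s UNIV l" "l c = 1" "\<forall>x\<in>?W. l x = 0" "\<forall>j x. j \<noteq> k \<longrightarrow> x \<in> DG F j \<longrightarrow> l x = 0"
      using graded_functional[OF v gr(3) c(1) W WG] by blast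
    show ?thesis
    proof (rule key[OF l(1,2,4)])
      assume lU: "linf s (gcar s (upG F)) (\<lambda>x. l (psiU F x))" and lD: "linf s (gcar s (dnG F)) (\<lambda>x. l (psiD F x))" and lg: "linf s (gcar s (DG F)) l"
        and l0: "l 0 = 0" and dU: "\<And>j x. x \<in> upG F j \<Longrightarrow> j \<noteq> k \<Longrightarrow> l (psiU F x) = 0" and dD: "\<And>j x. x \<in> dnG F j \<Longrightarrow> j \<noteq> k \<Longrightarrow> l (psiD F x) = 0"
        and lev: "\<And>x. x \<in> gcar s (upG F) \<Longrightarrow> l (psiU F x) \<noteq> 0 \<Longrightarrow> upL F u \<le> upL F x"
      have lD0: "l (psiD F x) = 0" if "x \<in> gcar s (dnG F)" for x
      proof (rule homogeneous_zero[OF v lD _ that])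
        fix j y assume y: "y \<in> dnG F j"
        then show "l (psiD F y) = 0" using dD[OF y] l(3) by (cases "j = k") auto
      qed
      interpret splitting s F "NE a k" k "\<lambda>x. l (psiU F x)" "\<lambda>_. 0" "\<lambda>_. 0" l u 0 0 c 0 True False False True
        by unfold_locales
          (use v F lU lg l(2,4) k u0 c sub z ug cg a maps_zero[OF v F] l0 dU lev lD0 c_def[symmetric] in \<open>auto simp: linf_zero subspace_0 gcar_closed(1)[OF v]\<close>)
      show ?thesis by (rule reduce[OF fd _ IH]) auto
    qed
  next
    case True
    then obtain x1 where x1: "x1 \<in> dnG F k" "psiD F x1 = c" by blast
    \<comment> \<open>Descending levels enter with a minus sign, so the minimum is a preimage of
      largest level.\<close>
    obtain w where wg': "w \<in> gcar s (dnG F)" and w: "w \<in> dnG F k" "psiD F w = c"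
      and wmin: "\<forall>y\<in>gcar s (dnG F). y \<in> dnG F k \<and> psiD F y = c \<longrightarrow> - dnL F w \<le> - dnL F y"
      using exists_min_level[OF v dsc _ gcD[OF x1(1)], of "\<lambda>y. y \<in> dnG F k \<and> psiD F y = c"] fd x1 by (auto simp: fdc_def)
    have w0: "w \<noteq> 0" using w(2) c(2) maps_zero(5)[OF v F] by auto
    obtain b where b: "dnL F w = ereal b" using nonzero_levels(2)[OF v F wg' w0] by blast
    let ?V = "{y \<in> dnG F k. - dnL F y < - dnL F w}"
    let ?W = "psiD F ` ?V"
    have V: "subspace ?V" by (rule low_subspace[OF v gr(2) dsc w(1) w0])
    have W: "subspace ?W" by (rule subspace_gmap_image[OF v wg(5) V]) (use gcD in blast)
    have WG: "?W \<subseteq> DG F k" using gmapD[OF wg(5)] by force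
    \<comment> \<open>An element of \<open>?V\<close> over \<open>c\<close> would be a better
      preimage than \<open>w\<close>.\<close>
    have "c \<notin> ?W" using wmin gcD by force
    then obtain l where l: "linf s UNIV l" "l c = 1" "\<forall>x\<in>?W. l x = 0" "\<forall>j x. j \<noteq> k \<longrightarrow> x \<in> DG F j \<longrightarrow> l x = 0"
      using graded_functional[OF v gr(3) c(1) W WG] by blast
    show ?thesis
    proof (rule key[OF l(1,2,4)])
      assume lU: "linf s (gcar s (upG F)) (\<lambda>x. l (psiU F x))" and lD: "linf s (gcar s (dnG F)) (\<lambda>x. l (psiD F x))" and lg: "linf s (gcar s (DG F)) l"
        and l0: "l 0 = 0" and dU: "\<And>j x. x \<in> upG F j \<Longrightarrow> j \<noteq> k \<Longrightarrow> l (psiU F x) = 0" and dD: "\<And>j x. x \<in> dnG F j \<Longrightarrow> j \<noteq> k \<Longrightarrow> l (psiD F x) = 0"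
        and lev: "\<And>x. x \<in> gcar s (upG F) \<Longrightarrow> l (psiU F x) \<noteq> 0 \<Longrightarrow> upL F u \<le> upL F x"
      have levD: "dnL F x \<le> dnL F w" if "x \<in> gcar s (dnG F)" "l (psiD F x) \<noteq> 0" for x
      proof -
        have "- dnL F w \<le> - dnL F x"
          by (rule functional_level[where f = "\<lambda>x. l (psiD F x)" and k = k and u = w and l = "\<lambda>x. - dnL F x", OF v gr(2) dsc lD dD _ that]) (use l(3) in auto)
        then show ?thesis by simp
      qed
      interpret splitting s F "Gt b a k" k "\<lambda>x. l (psiU F x)" "\<lambda>_. 0" "\<lambda>x. l (psiD F x)" l u 0 w c 0 True False True True
        by unfold_locales
          (use v F lU lD lg l(2,4) k u0 c sub z ug cg a b w wg' maps_zero[OF v F] l0 dU dD lev levD c_def[symmetric] in \<open>auto simp: linf_zero subspace_0 gcar_closed(1)[OF v]\<close>)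
      show ?thesis by (rule reduce[OF fd _ IH]) auto
    qed
  qed
qed

text \<open>The middle complex carries no levels, so a pair \<open>y1\<close>,
  \<open>DD F y1\<close> can be removed up to homotopy at shift 0 and leaves no summand behind. This
  is a deformation retract rather than a direct sum: the images of the arms may involve the removed
  pair, so the maps to the middle are corrected by the projection \<open>p\<close>.\<close>

lemma case_D:
  fixes s :: "'k::field \<Rightarrow> 'v::ab_group_add \<Rightarrow> 'v"
  assumes v: "vector_space s" and F: "is_cospan s F" and fd: "fdc s F"
    and x: "x \<in> gcar s (DG F)" "DD F x \<noteq> 0"
    and IH: "\<And>F''. is_cospan s F'' \<Longrightarrow> fdc s F'' \<Longrightarrow> dimc s F'' < dimc s F \<Longrightarrow> hasnf s F''"
  shows "hasnf s F"
proof -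
  note F' = F[unfolded is_cospan_def]
  interpret vector_space s by fact
  note wF = is_cospan_wcos[OF v F]
  note wg = wcosD[OF wF]
  note wl = wg[THEN gmap_lin[OF v v]]
  note gc = gcar_closed[OF v]
  have gr: "is_graded s (DG F)" and sub: "subspace (DG F j)" for j using F' by (auto simp: is_chain_def is_graded_def)
  have dd: "DD F (DD F y) = 0" if "y \<in> gcar s (DG F)" for y using F' that by (auto simp: is_chain_def)
  have "lin_on s s (gcar s (DG F)) (DD F)" using wg(3) by (simp add: gmap_def)
  then obtain K y1 where K: "y1 \<in> DG F K" "DD F y1 \<noteq> 0" using homogeneous_nonzero[OF v v _ x(1)] x(2) by blast
  define k where "k = K - 1"
  have y1: "y1 \<in> DG F (k + 1)" using K by (simp add: k_def)
  define y0 where "y0 = DD F y1"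
  have y0: "y0 \<in> DG F k" "y0 \<noteq> 0" using gmapD[OF wg(3) y1] K(2) by (simp_all add: y0_def)
  have yg: "y0 \<in> gcar s (DG F)" "y1 \<in> gcar s (DG F)" using gc(6)[of _ "DG F"] y0(1) y1 by blast+
  have "subspace {0}" by (simp add: subspace_single_0)
  then obtain l where l: "linf s UNIV l" "l y0 = 1" "\<forall>j x. j \<noteq> k \<longrightarrow> x \<in> DG F j \<longrightarrow> l x = 0"
    using graded_functional[OF v gr y0(1), of "{0}"] y0(2) subspace_0[OF sub] by auto
  have lg: "linf s (gcar s (DG F)) l" by (rule linf_mono[OF l(1)]) simp
  note ll = linfD[OF lg v]
  have lg1: "linf s (gcar s (DG F)) (\<lambda>x. l (DD F x))" by (rule linf_comp[OF v v wg(3) lg])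
  have deg1: "l (DD F x) = 0" if "x \<in> DG F j" "j \<noteq> k + 1" for j x
  proof -
    have "j - 1 \<noteq> k" using that(2) by simp
    then show ?thesis using gmapD[OF wg(3) that(1)] l(3) by blast
  qed
  have "k + 1 \<noteq> k" by simp
  then have ly1: "l y1 = 0" using l(3) y1 by blast
  have d0: "DD F y0 = 0" using dd[OF yg(2)] by (simp add: y0_def)
  have d1: "DD F y1 = y0" by (simp add: y0_def)
  \<comment> \<open>\<open>l\<close> is dual to \<open>y0\<close> and its composite with
    \<open>DD F\<close> is dual to \<open>y1\<close>; this choice makes \<open>p\<close> commute
    with the differential.\<close>
  define p where "p x = x - (s (l (DD F x)) y1 + s (l x) y0)" for x
  let ?M = "{y \<in> gcar s (DG F). l y = 0 \<and> l (DD F y) = 0}"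
  have M: "subspace ?M" unfolding subspace_def by (simp add: gc ll wl)
  have pg: "gmap s s (DG F) (\<lambda>k. DG F k \<inter> ?M) 0 p"
    unfolding p_def
    by (rule gmap_into[OF v gmap_diff[OF v v gmap_id[unfolded id_def] gmap_add[OF v v gmap_rank1[OF v v lg1 deg1] gmap_rank1[OF v v lg] sub] sub]])
      (use y0(1) y1 l(2,3) in \<open>auto simp: sub gc yg ll wl ly1 d0 d1 dd\<close>)
  have p_d: "p (DD F x) = DD F (p x)" if "x \<in> gcar s (DG F)" for x
    using that by (simp add: p_def gc yg wl ll d0 d1 dd)
  have p_id: "p x = x" if "x \<in> ?M" for x using that by (simp add: p_def)
  have sw: "vector_space s" by fact
  define F2 where "F2 = F\<lparr>DG := \<lambda>k. DG F k \<inter> ?M, psiU := \<lambda>x. p (psiU F x), psiD := \<lambda>x. p (psiD F x)\<rparr>"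
  have sel: "upG F2 = upG F" "dnG F2 = dnG F" "DG F2 = (\<lambda>k. DG F k \<inter> ?M)" "upD F2 = upD F" "dnD F2 = dnD F" "DD F2 = DD F"
    "upL F2 = upL F" "dnL F2 = dnL F" "psiU F2 = (\<lambda>x. p (psiU F x))" "psiD F2 = (\<lambda>x. p (psiD F x))"
    by (simp_all add: F2_def)
  have carM: "x \<in> gcar s (DG F) \<and> x \<in> ?M" if "x \<in> gcar s (DG F2)" for x
    using gcar_sub[OF v M, of "DG F"] that unfolding sel by blast
  have ch: "is_chain s (\<lambda>k. DG F k \<inter> ?M) (DD F)"
    by (rule chain_sub[OF v M]) (use F' wl dd ll(3) in \<open>auto simp: gc(1)\<close>)
  have F2: "is_cospan s F2"
    unfolding is_cospan_def sel
  proof (intro conjI ballI)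
    show "gmap s s (upG F) (\<lambda>k. DG F k \<inter> ?M) 0 (\<lambda>x. p (psiU F x))"
      by (rule gmap_comp[OF v v v wg(4) pg]) simp
    show "gmap s s (dnG F) (\<lambda>k. DG F k \<inter> ?M) 0 (\<lambda>x. p (psiD F x))"
      by (rule gmap_comp[OF v v v wg(5) pg]) simp
    show "p (psiU F (upD F x)) = DD F (p (psiU F x))" if "x \<in> gcar s (upG F)" for x
      using F' wl that p_d by metis
    show "p (psiD F (dnD F x)) = DD F (p (psiD F x))" if "x \<in> gcar s (dnG F)" for x
      using F' wl that p_d by metis
  qed (use F' ch in auto)
  note wF2 = is_cospan_wcos[OF v F2]
  have "y0 \<notin> gcar s (DG F2)" using carM l(2) by auto
  then have "dimc s F2 < dimc s F \<and> fdc s F2"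
    using yg(1) carM by (intro dimc_less[OF v fd]) (auto simp: sel(1,2))
  then have nf: "hasnf s F2" using IH[OF F2] by blast
  let ?p = "\<lparr>mDn = id, mUp = id, mMid = p, KDn = \<lambda>_. 0, KUp = \<lambda>_. 0\<rparr> :: ('v, 'v) cmor"
  \<comment> \<open>The inclusion does not commute strictly with the corrected maps; its
    \<open>K\<close>-components make up for the difference. The same expression
    \<open>- s (l x) y1\<close> gives the homotopy \<open>?h\<close>: its boundary terms are exactly
    what \<open>p\<close> subtracts.\<close>
  let ?i = "\<lparr>mDn = id, mUp = id, mMid = id, KDn = \<lambda>x. - s (l (psiD F x)) y1, KUp = \<lambda>x. - s (l (psiU F x)) y1\<rparr> :: ('v, 'v) cmor"
  let ?h = "\<lparr>mDn = \<lambda>_. 0, mUp = \<lambda>_. 0, mMid = \<lambda>x. - s (l x) y1, KDn = \<lambda>_. 0, KUp = \<lambda>_. 0\<rparr> :: ('v, 'v) cmor"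
  have z: "gmap s s G (DG X) m (\<lambda>x. 0)" "gmap s s G (upG X) m (\<lambda>x. 0)" "gmap s s G (dnG X) m (\<lambda>x. 0)" if "wcos s X" for G m X
    by (rule gmap_zero[OF v wcos_sub(3)[OF that]] gmap_zero[OF v wcos_sub(1)[OF that]] gmap_zero[OF v wcos_sub(2)[OF that]])+
  have rk: "gmap s s G (DG F) (-1) (\<lambda>x. - s (l (f x)) y1)" if "gmap s s G (DG F) 0 f" for G f
  proof -
    have "l (f x) = 0" if "x \<in> G j" "j \<noteq> k" for x j
      using gmapD[OF \<open>gmap s s G (DG F) 0 f\<close> that(1)] l(3) that(2) by auto
    then show ?thesis
      by (intro gmap_minus[OF v v _ sub] gmap_rank1[OF v v linf_comp[OF v v that lg], where k = k] sub) (use y1 in auto)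
  qed
  have lv: "ehm real_of_ereal s s 0 F F2 ?p"
  proof -
    have "emor real_of_ereal s s 0 0 F F2 ?p"
      unfolding emor_def by (simp add: sel(1,2,7,8) gmap_id z[OF wF2]) (simp add: sel(3) pg)
    moreover have "mcyc s F F2 ?p" unfolding mcyc_def by (simp add: sel p_d wl ll(3) p_def[of 0] maps_zero[OF v F])
    ultimately show ?thesis by (simp add: ehm_def)
  qed
  have iv: "ehm real_of_ereal s s 0 F2 F ?i"
  proof -
    have "gmap s s (\<lambda>k. DG F k \<inter> ?M) (DG F) 0 id"
      by (simp add: gmap_def lin_on_def)
    then have em: "emor real_of_ereal s s 0 0 F2 F ?i"
      unfolding emor_def by (simp add: sel gmap_id rk[OF wg(4)] rk[OF wg(5)])
    have cm: "psiU F (upD F x) = DD F (psiU F x)" if "x \<in> gcar s (upG F)" for x using F' that by blast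
    have cm': "psiD F (dnD F x) = DD F (psiD F x)" if "x \<in> gcar s (dnG F)" for x using F' that by blast
    have "mcyc s F2 F ?i" unfolding mcyc_def
      by (simp add: sel(1,2,4-10) p_def wl gc yg ll d1 d0 cm cm')
    with em show ?thesis by (simp add: ehm_def)
  qed
  have "eiso real_of_ereal s s F F2"
  proof (rule eiso_retract[OF good_real[OF v F] good_real[OF v F2] lv iv])
    have "p (- s c y1) = 0" for c by (simp add: p_def gc yg wl ll d1 d0 ly1 l(2))
    then show "meq s F2 (mcomp ?p ?i) mid"
      unfolding meq_def mcomp_def mid_def using carM p_id by simp
    have "emor real_of_ereal s s 0 (-1) F F ?h"
      unfolding emor_def using rk[OF gmap_id[of s "DG F"]] by (simp add: z[OF wF])
    moreover have "ehtp s F F (mcomp ?i ?p) mid ?h"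
      unfolding ehtp_def mcomp_def mid_def
      by (simp add: maps_zero[OF v F] p_def wl gc yg ll d1)
    ultimately show "eho real_of_ereal s s 0 F F (mcomp ?i ?p) mid" unfolding eho_def by blast
  qed
  moreover obtain L where L: "okl real_of_ereal L" "eiso real_of_ereal s fscale F2 (model L :: (nat \<times> nat \<Rightarrow> 'k) cospan)"
    using nf by (auto simp: hasnf_def)
  ultimately show ?thesis
    using eiso_trans[OF good_real[OF v F] good_real[OF v F2] good_real_model] unfolding hasnf_def by blast
qed

lemma fdc_sw: "fdc s (sw F) = fdc s F" and dimc_sw: "dimc s (sw F) = dimc s F"
  by (auto simp: fdc_def dimc_def sw_def)

text \<open>Induction on the total dimension. The nesting of the cases provides their hypotheses:
  summands with a differential must go before those with a map to the middle, and these before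
  isolated generators.\<close>

theorem exists_nf:
  fixes s :: "'k::field \<Rightarrow> 'v::ab_group_add \<Rightarrow> 'v"
  assumes "vector_space s" "is_cospan s F" "fdc s F"
  shows "hasnf s F"
  using assms(2,3)
proof (induction "dimc s F" arbitrary: F rule: less_induct)
  case less
  note v = assms(1) and F = less.prems(1) and fd = less.prems(2)
  have IH: "hasnf s F''" if "is_cospan s F''" "fdc s F''" "dimc s F'' < dimc s F" for F''
    using less.hyps[OF that(3,1,2)] .
  have IH': "hasnf s F''" if "is_cospan s F''" "fdc s F''" "dimc s F'' < dimc s (sw F)" for F''
    using IH that by (simp add: dimc_sw)
  note Fs = is_cospan_sw[OF F]
  have fds: "fdc s (sw F)" using fd by (simp add: fdc_sw)
  have sel: "gcar s (upG (sw F)) = gcar s (dnG F)" "gcar s (dnG (sw F)) = gcar s (upG F)" "gcar s (DG (sw F)) = gcar s (DG F)"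
    "upD (sw F) = dnD F" "dnD (sw F) = upD F" "DD (sw F) = DD F" "psiU (sw F) = psiD F" "psiD (sw F) = psiU F"
    by (simp_all add: sw_def)
  note sw = hasnf_sw[OF v F]
  show ?case
  proof (cases "\<exists>x\<in>gcar s (DG F). DD F x \<noteq> 0")
    case True
    then show ?thesis using case_D[OF v F fd _ _ IH] by blast
  next
    case False
    then have D: "\<And>x. x \<in> gcar s (DG F) \<Longrightarrow> DD F x = 0" by blast
    show ?thesis
    proof (cases "\<exists>x\<in>gcar s (upG F). upD F x \<noteq> 0")
      case True
      then show ?thesis using case_Up[OF v F fd D _ _ IH] by blast
    next
      case False
      then have U: "\<And>x. x \<in> gcar s (upG F) \<Longrightarrow> upD F x = 0" by blast
      show ?thesis
      proof (cases "\<exists>x\<in>gcar s (dnG F). dnD F x \<noteq> 0")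
        case True
        then obtain x where x: "x \<in> gcar s (dnG F)" "dnD F x \<noteq> 0" by blast
        show ?thesis by (rule sw, rule case_Up[where x = x, OF v Fs fds _ _ _ IH']) (use D x in \<open>simp_all add: sel\<close>)
      next
        case False
        then have N: "\<And>x. x \<in> gcar s (dnG F) \<Longrightarrow> dnD F x = 0" by blast
        show ?thesis
        proof (cases "\<exists>x\<in>gcar s (upG F). psiU F x \<noteq> 0")
          case True
          then show ?thesis using case_psiU[OF v F fd U N D _ _ IH] by blast
        next
          case False
          then have pU: "\<And>x. x \<in> gcar s (upG F) \<Longrightarrow> psiU F x = 0" by blast
          show ?thesis
          proof (cases "\<exists>x\<in>gcar s (dnG F). psiD F x \<noteq> 0")
            case True
            then obtain x where x: "x \<in> gcar s (dnG F)" "psiD F x \<noteq> 0" by blast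
            show ?thesis by (rule sw, rule case_psiU[where x = x, OF v Fs fds _ _ _ _ _ IH']) (use N U D x in \<open>simp_all add: sel\<close>)
          next
            case False
            then have pD: "\<And>x. x \<in> gcar s (dnG F) \<Longrightarrow> psiD F x = 0" by blast
            show ?thesis
            proof (cases "\<exists>x\<in>gcar s (upG F). x \<noteq> 0")
              case True
              then show ?thesis using case_UpInf[OF v F fd U N D pU _ _ IH] by blast
            next
              case False
              then have zU: "\<And>x. x \<in> gcar s (upG F) \<Longrightarrow> x = 0" by blast
              show ?thesis
              proof (cases "\<exists>x\<in>gcar s (dnG F). x \<noteq> 0")
                case True
                then obtain x where x: "x \<in> gcar s (dnG F)" "x \<noteq> 0" by blast
                show ?thesis by (rule sw, rule case_UpInf[where x = x, OF v Fs fds _ _ _ _ _ _ IH']) (use N U D pD x in \<open>simp_all add: sel\<close>)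
              next
                case False
                then have zD: "\<And>x. x \<in> gcar s (dnG F) \<Longrightarrow> x = 0" by blast
                show ?thesis
                proof (cases "\<exists>x\<in>gcar s (DG F). x \<noteq> 0")
                  case True
                  then show ?thesis using case_Sq[OF v F fd zU zD D _ _ IH] by blast
                next
                  case False
                  then show ?thesis using case_empty[OF v F zU zD] by blast
                qed
              qed
            qed
          qed
        qed
      qed
    qed
  qed
qed

text \<open>A bar whose end does not exceed its start is contractible at shift 0, so matching all
  other summands with themselves is a 0-interleaving, that is, an equivalence.\<close>

lemma model_drop:
  fixes L :: "summand list"
  obtains L' where "set L' \<subseteq> set L" "\<And>x. x \<in> set L' \<Longrightarrow> \<not> small real_of_ereal 0 x"
    "eiso real_of_ereal fscale fscale (model L) (model L' :: (nat \<times> nat \<Rightarrow> 'k::field) cospan)"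
proof -
  define ix where "ix = filter (\<lambda>i. \<not> small real_of_ereal 0 (L ! i)) [0..<length L]"
  define L' where "L' = map ((!) L) ix"
  have ix: "distinct ix" "set ix = {i. i < length L \<and> \<not> small real_of_ereal 0 (L ! i)}" by (auto simp: ix_def)
  define r where "r i' = (if i' < length ix then Some (ix ! i') else None)" for i'
  define r' where "r' i = (if i \<in> set ix then Some (THE j. j < length ix \<and> ix ! j = i) else None)" for i
  have rr: "r i' = Some i \<longleftrightarrow> r' i = Some i'" for i i'
  proof -
    have *: "(THE j. j < length ix \<and> ix ! j = ix ! m) = m" if "m < length ix" for m
      using that ix(1) by (intro the_equality) (auto simp: nth_eq_iff_index_eq)
    show ?thesis unfolding r_def r'_def by (auto simp: in_set_conv_nth * nth_eq_iff_index_eq[OF ix(1)])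
  qed
  have "eint real_of_ereal fscale fscale 0 (model L) (model L' :: (nat \<times> nat \<Rightarrow> 'k) cospan)"
  proof (rule model_eint[where r = r and r' = r' and B = UNIV, OF rr])
    show "i < length L \<and> i' < length L' \<and> sle real_of_ereal 0 (L ! i) (L' ! i') \<and> sle real_of_ereal 0 (L' ! i') (L ! i)"
      if "r i' = Some i" for i i'
      using that ix(2) nth_mem[of i' ix] unfolding r_def L'_def by (auto simp: sle_def split: if_splits)
    show "small real_of_ereal (2 * 0) (L ! i)" if "i < length L" "r' i = None" for i
      using that ix(2) unfolding r'_def by (auto split: if_splits)
    show "small real_of_ereal (2 * 0) (L' ! i)" if "i < length L'" "r i = None" for i
      using that unfolding r_def L'_def by (auto split: if_splits)
  qed (rule levin_UNIV levin_UNIV mono_on_real)+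
  then have "eiso real_of_ereal fscale fscale (model L) (model L' :: (nat \<times> nat \<Rightarrow> 'k) cospan)" by (simp add: eiso_eint0)
  then show thesis
  proof (rule that[rotated 2])
    show "set L' \<subseteq> set L" unfolding L'_def set_map ix(2) by auto
    fix x assume "x \<in> set L'"
    then have "\<exists>i. i \<in> set ix \<and> x = L ! i" unfolding L'_def set_map by blast
    then show "\<not> small real_of_ereal 0 x" unfolding ix(2) by blast
  qed
qed

section \<open>Matrices of morphisms between models\<close>

lemma lin_expand:
  fixes \<phi> :: "('a \<Rightarrow> 'k::field) \<Rightarrow> ('b \<Rightarrow> 'k)"
  assumes l: "lin_on fscale fscale (gcar fscale G) \<phi>" and S: "finite S" "\<And>r. r \<in> S \<Longrightarrow> unit r \<in> gcar fscale G"
    and x: "\<And>r. x r \<noteq> 0 \<Longrightarrow> r \<in> S"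
  shows "\<phi> x r' = (\<Sum>r\<in>S. x r * \<phi> (unit r) r')"
proof -
  note gc = gcar_closed[OF vs_fscale]
  have *: "(\<Sum>r\<in>T. fscale (x r) (unit r)) \<in> gcar fscale G \<and> \<phi> (\<Sum>r\<in>T. fscale (x r) (unit r)) = (\<Sum>r\<in>T. fscale (x r) (\<phi> (unit r)))"
    if "T \<subseteq> S" for T
    using finite_subset[OF that S(1)] that
  proof (induction T rule: finite_induct)
    case empty
    show ?case using lin_on_basic(1)[OF vs_fscale vs_fscale l] gc(1)[where G = G] by (simp only: sum.empty simp_thms)
  next
    case (insert r T)
    then have IH: "(\<Sum>r\<in>T. fscale (x r) (unit r)) \<in> gcar fscale G"
      "\<phi> (\<Sum>r\<in>T. fscale (x r) (unit r)) = (\<Sum>r\<in>T. fscale (x r) (\<phi> (unit r)))" and r: "unit r \<in> gcar fscale G"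
      using S(2) by auto
    have ug: "fscale (x r) (unit r) \<in> gcar fscale G" using gc(5)[OF r] .
    have e1: "(\<Sum>r\<in>insert r T. fscale (x r) (unit r)) = fscale (x r) (unit r) + (\<Sum>r\<in>T. fscale (x r) (unit r))"
      and e2: "(\<Sum>r\<in>insert r T. fscale (x r) (\<phi> (unit r))) = fscale (x r) (\<phi> (unit r)) + (\<Sum>r\<in>T. fscale (x r) (\<phi> (unit r)))"
      by (rule sum.insert[OF insert.hyps])+
    have "\<phi> (fscale (x r) (unit r) + (\<Sum>r\<in>T. fscale (x r) (unit r))) = \<phi> (fscale (x r) (unit r)) + \<phi> (\<Sum>r\<in>T. fscale (x r) (unit r))"
      using l ug IH(1) unfolding lin_on_def by blast
    moreover have "\<phi> (fscale (x r) (unit r)) = fscale (x r) (\<phi> (unit r))" using l r unfolding lin_on_def by blast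
    ultimately show ?case unfolding e1 e2 using gc(2)[OF ug IH(1)] IH(2) by (simp only: simp_thms)
  qed
  have "x = (\<Sum>r\<in>S. fscale (x r) (unit r))" by (rule unit_expand[OF S(1) x])
  then have "\<phi> x = (\<Sum>r\<in>S. fscale (x r) (\<phi> (unit r)))" using *[of S] by simp
  then show ?thesis by (simp add: fun_sum_apply fscale_def)
qed

lemma unit_in:
  "i < length L \<Longrightarrow> (j, k, a) \<in> set (up_basis (L ! i)) \<Longrightarrow> (unit (i, j) :: nat \<times> nat \<Rightarrow> 'k::field) \<in> upG (model L) k"
  "i < length L \<Longrightarrow> (j, k) \<in> set (mid_basis (L ! i)) \<Longrightarrow> (unit (i, j) :: nat \<times> nat \<Rightarrow> 'k::field) \<in> DG (model L) k"
  by (auto simp: model_G upS_def midS_def unit_apply)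

lemma unit_gcar:
  "r \<in> (\<Union>k. upS L k) \<Longrightarrow> (unit r :: nat \<times> nat \<Rightarrow> 'k::field) \<in> gcar fscale (upG (model L))"
  "r \<in> (\<Union>k. midS L k) \<Longrightarrow> (unit r :: nat \<times> nat \<Rightarrow> 'k::field) \<in> gcar fscale (DG (model L))"
  by (simp_all add: model_car unit_apply)

lemma unit_gcar_up:
  assumes "i < length L" "(j, k, a) \<in> set (up_basis (L ! i))"
  shows "(unit (i, j) :: nat \<times> nat \<Rightarrow> 'k::field) \<in> gcar fscale (upG (model L))"
  by (rule gcar_closed(6)[OF vs_fscale, where G = "upG (model L)", OF unit_in(1)[OF assms]])

lemma upL_unit:
  assumes "i < length L" "(j, k, a) \<in> set (up_basis (L ! i))"
  shows "upL (model L) (unit (i, j) :: nat \<times> nat \<Rightarrow> 'k::field) = ereal a"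
proof (rule antisym)
  show "upL (model L) (unit (i, j) :: nat \<times> nat \<Rightarrow> 'k) \<le> ereal a"
    by (rule upL_leI) (use assms(2) up_basis_unique in \<open>auto simp: unit_apply split: if_splits, blast\<close>)
  show "ereal a \<le> upL (model L) (unit (i, j) :: nat \<times> nat \<Rightarrow> 'k)"
    by (rule upL_ge[OF assms]) (simp add: unit_apply)
qed

text \<open>A nonzero coefficient at a basis vector bounds its level by that of the image, and the
  image is bounded by the shift. The degree of the target is forced by the grading.\<close>

lemma coef_level:
  fixes f :: "(nat \<times> nat \<Rightarrow> 'k::field, nat \<times> nat \<Rightarrow> 'k) cmor"
  assumes f: "emor A fscale fscale e m (model L) (model L') f"
    and B: "\<And>i. i < length L' \<Longrightarrow> levin B (L' ! i)" "mono_on (ereal ` B) A"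
    and p: "p < length L" "(j, k, a) \<in> set (up_basis (L ! p))"
    and c: "mUp f (unit (p, j)) (q, j') \<noteq> 0"
  shows "q < length L' \<and> (\<exists>a'. (j', k - m, a') \<in> set (up_basis (L' ! q)) \<and> A (ereal a') \<le> A (ereal a) + e)"
proof -
  note u = unit_in(1)[OF p]
  let ?x = "unit (p, j) :: nat \<times> nat \<Rightarrow> 'k"
  have ug: "?x \<in> gcar fscale (upG (model L))" by (rule gcar_closed(6)[OF vs_fscale, where G = "upG (model L)", OF u])
  have fx: "mUp f ?x \<in> upG (model L') (k - m)" by (rule gmapD[OF emorD(2)[OF f] u])
  have fg: "mUp f ?x \<in> gcar fscale (upG (model L'))" by (rule gcar_closed(6)[OF vs_fscale, where G = "upG (model L')", OF fx])
  have "(q, j') \<in> upS L' (k - m)" using fx c unfolding model_G by blast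
  then obtain a' where q: "q < length L'" and a': "(j', k - m, a') \<in> set (up_basis (L' ! q))" by (auto simp: upS_def)
  have ne: "mUp f ?x \<noteq> 0" using c by (metis zero_fun_apply)
  have "upL (model L') (mUp f ?x) \<in> ereal ` B"
    using levok_model[where B = B and L = L', OF B(1)] fg ne unfolding levok_def by blast
  then have "A (ereal a') \<le> A (upL (model L') (mUp f ?x))"
    using upL_ge[where v = "mUp f ?x", OF q a' c] levinD(1)[OF B(1)[OF q] a'] by (intro mono_onD[OF B(2)]) auto
  also have "\<dots> \<le> A (ereal a) + e" using emorL(1)[OF f ug ne] by (simp add: upL_unit[OF p])
  finally show ?thesis using q a' by blast
qed

text \<open>The up types are recognised by a cycle in slot 0 that \<open>psiU\<close> kills, the
  middle types by slot 4. The remaining types \<open>Dn\<close> and \<open>DnInf\<close> are reached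
  through \<open>sws\<close>.\<close>

definition upty where "upty s \<longleftrightarrow> ty s \<in> {0, 1}"
definition midty where "midty s \<longleftrightarrow> ty s \<in> {4, 5, 6, 7}"

lemma upty_basis: "upty s \<Longrightarrow> \<exists>a. (0, dg s, a) \<in> set (up_basis s)" "upty s \<Longrightarrow> \<not> has_psiU s"
  "(0, k, a) \<in> set (up_basis s) \<Longrightarrow> \<not> has_psiU s \<Longrightarrow> upty s \<and> dg s = k"
  "(1, k, a) \<in> set (up_basis s) \<Longrightarrow> is_up2 s"
  by (cases s; auto simp: upty_def)+

lemma midty_basis: "midty s \<Longrightarrow> (4, dg s) \<in> set (mid_basis s)" "(4, k) \<in> set (mid_basis s) \<Longrightarrow> midty s \<and> dg s = k"
  "has_psiU s \<Longrightarrow> midty s \<and> (\<exists>a. (0, dg s, a) \<in> set (up_basis s))" "has_psiD s \<Longrightarrow> midty s \<and> (\<exists>a. (2, dg s, a) \<in> set (dn_basis s))"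
  by (cases s; auto simp: midty_def)+

lemma ty_flags: "ty s = ty s' \<Longrightarrow> has_psiU s = has_psiU s' \<and> has_psiD s = has_psiD s'"
  by (cases s; cases s'; simp)

lemma midty_flags: "midty s \<Longrightarrow> midty s' \<Longrightarrow> has_psiU s = has_psiU s' \<Longrightarrow> has_psiD s = has_psiD s' \<Longrightarrow> ty s = ty s'"
  by (cases s; cases s'; simp add: midty_def)

text \<open>The generator in slot 0 is a cycle killed by \<open>psiU\<close>, hence so is its image.
  Cycles have no entries in slot 1, where the differential is injective, and the kernel of
  \<open>psiU\<close> has none in summands attached to the middle. The generator of a finite bar is
  moreover a boundary, and boundaries live in finite bars only.\<close>

lemma up_row:
  fixes f :: "(nat \<times> nat \<Rightarrow> 'k::field, nat \<times> nat \<Rightarrow> 'k) cmor"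
  assumes e: "0 \<le> e" and f: "ehm A fscale fscale e (model L) (model L') f"
    and B: "\<And>i. i < length L' \<Longrightarrow> levin B (L' ! i)" "mono_on (ereal ` B) A"
    and p: "p < length L" "upty (L ! p)" and c: "mUp f (unit (p, 0)) (q, j) \<noteq> 0"
  shows "j = 0 \<and> q < length L' \<and> upty (L' ! q) \<and> (ty (L ! p) = 0 \<longrightarrow> ty (L' ! q) = 0) \<and> (ty (L ! p) = ty (L' ! q) \<longrightarrow> sle A e (L ! p) (L' ! q))"
proof -
  note fe = ehm_emor[OF f] and fc = f[unfolded ehm_def, THEN conjunct2]
  note fl = emorD[OF fe, THEN gmap_lin[OF vs_fscale vs_fscale]]
  let ?x = "unit (p, 0) :: nat \<times> nat \<Rightarrow> 'k" and ?M = "model L :: (nat \<times> nat \<Rightarrow> 'k) cospan" and ?N = "model L' :: (nat \<times> nat \<Rightarrow> 'k) cospan"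
  obtain a where a: "(0, dg (L ! p), a) \<in> set (up_basis (L ! p))" using upty_basis(1)[OF p(2)] by blast
  have ug: "?x \<in> gcar fscale (upG ?M)" by (rule unit_gcar_up[OF p(1) a])
  obtain a' where q: "q < length L'" and a': "(j, dg (L ! p), a') \<in> set (up_basis (L' ! q))" "A (ereal a') \<le> A (ereal a) + e"
    using coef_level[OF fe B p(1) a c] by auto
  have dx: "upD ?M ?x = 0" by (auto simp: fun_eq_iff model_maps unit_apply)
  have px: "psiU ?M ?x = 0" using upty_basis(2)[OF p(2)] by (auto simp: fun_eq_iff model_maps unit_apply)
  have df: "upD ?N (mUp f ?x) = 0" using mcycD(3)[OF fc ug] fl(2) dx by simp
  \<comment> \<open>In the cycle equation both \<open>K\<close>-terms vanish: \<open>?x\<close> has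
    zero boundary, and the middle of a model has zero differential.\<close>
  have pf: "psiU ?N (mUp f ?x) = 0" using mcycD(4)[OF fc ug] fl dx px by (simp add: model_maps(3))
  have j: "j = 0"
  proof (rule ccontr)
    assume "j \<noteq> 0"
    then have "j = 1" using basis_slots(1)[OF a'(1)] by simp
    then have "upD ?N (mUp f ?x) (q, 0) \<noteq> 0" using c q upty_basis(4) a'(1) by (auto simp: model_maps)
    then show False using df by simp
  qed
  have "\<not> has_psiU (L' ! q)"
  proof
    assume "has_psiU (L' ! q)"
    then have "psiU ?N (mUp f ?x) (q, 4) \<noteq> 0" using c q j by (simp add: model_maps)
    then show False using pf by simp
  qed
  then have t: "upty (L' ! q)" "dg (L' ! q) = dg (L ! p)" using upty_basis(3) a'(1) j by blast+
  \<comment> \<open>The image of the generator is the boundary of the image of slot 1, so its entry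
    at \<open>(q, 0)\<close> is the entry of the latter at \<open>(q, 1)\<close>; this compares the
    upper ends of the bars.\<close>
  have up: "\<exists>b b'. (1, dg (L ! p) + 1, b) \<in> set (up_basis (L ! p)) \<and> (1, dg (L ! p) + 1, b') \<in> set (up_basis (L' ! q)) \<and> A (ereal b') \<le> A (ereal b) + e"
    if "ty (L ! p) = 0"
  proof -
    from that obtain b where b: "(1, dg (L ! p) + 1, b) \<in> set (up_basis (L ! p))" by (cases "L ! p") auto
    let ?y = "unit (p, 1) :: nat \<times> nat \<Rightarrow> 'k"
    have yg: "?y \<in> gcar fscale (upG ?M)" by (rule unit_gcar_up[OF p(1) b])
    have "upD ?M ?y = ?x" using that p(1) by (cases "L ! p") (auto simp: fun_eq_iff model_maps unit_apply)
    then have "mUp f ?x = upD ?N (mUp f ?y)" using mcycD(3)[OF fc yg] by simp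
    then have "mUp f ?y (q, 1) \<noteq> 0" using c j by (auto simp: model_maps split: if_splits)
    from coef_level[OF fe B p(1) b this] b show ?thesis by auto
  qed
  have "ty (L ! p) = 0 \<longrightarrow> ty (L' ! q) = 0" using up by (cases "L' ! q") auto
  moreover have "sle A e (L ! p) (L' ! q)" if s: "ty (L ! p) = ty (L' ! q)"
    using e up a a' t p(2) j s by (cases "L ! p"; cases "L' ! q"; auto simp: sle_def upty_def)
  ultimately show ?thesis using j q t by blast
qed

text \<open>The middle has no levels of its own. They are read off by lifting the generator to
  whichever arms it has; the lift maps to a lift of the image, so the target summands must possess
  these arms too, and attached arms can only be gained along a map.\<close>

lemma mid_row:
  fixes f :: "(nat \<times> nat \<Rightarrow> 'k::field, nat \<times> nat \<Rightarrow> 'k) cmor"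
  assumes e: "0 \<le> e" and f: "ehm A fscale fscale e (model L) (model L') f"
    and B: "\<And>i. i < length L \<Longrightarrow> levin B (L ! i)" "\<And>i. i < length L' \<Longrightarrow> levin B (L' ! i)" "mono_on (ereal ` B) A"
    and p: "p < length L" "midty (L ! p)" and c: "mMid f (unit (p, 4)) (q, j) \<noteq> 0"
  shows "j = 4 \<and> q < length L' \<and> midty (L' ! q) \<and> (has_psiU (L ! p) \<longrightarrow> has_psiU (L' ! q)) \<and> (has_psiD (L ! p) \<longrightarrow> has_psiD (L' ! q)) \<and>
    (ty (L ! p) = ty (L' ! q) \<longrightarrow> sle A e (L ! p) (L' ! q))"
proof -
  note fe = ehm_emor[OF f] and fc = f[unfolded ehm_def, THEN conjunct2]
  note fl = emorD[OF fe, THEN gmap_lin[OF vs_fscale vs_fscale]]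
  let ?M = "model L :: (nat \<times> nat \<Rightarrow> 'k) cospan" and ?N = "model L' :: (nat \<times> nat \<Rightarrow> 'k) cospan"
  let ?x = "unit (p, 4) :: nat \<times> nat \<Rightarrow> 'k"
  have xm: "?x \<in> DG ?M (dg (L ! p))" by (rule unit_in(2)[OF p(1) midty_basis(1)[OF p(2)]])
  have "mMid f ?x \<in> DG ?N (dg (L ! p) - 0)" by (rule gmapD[OF emorD(3)[OF fe] xm])
  then have "(q, j) \<in> midS L' (dg (L ! p))" using c unfolding model_G by auto
  then have q: "q < length L'" "(j, dg (L ! p)) \<in> set (mid_basis (L' ! q))" by (auto simp: midS_def)
  then have j: "j = 4" using basis_slots(3) by blast
  then have t: "midty (L' ! q)" "dg (L' ! q) = dg (L ! p)" using midty_basis(2) q(2) by blast+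
  have U: "has_psiU (L' ! q) \<and> (\<forall>a a'. (0, dg (L ! p), a) \<in> set (up_basis (L ! p)) \<longrightarrow> (0, dg (L ! p), a') \<in> set (up_basis (L' ! q)) \<longrightarrow> A (ereal a') \<le> A (ereal a) + e)"
    if h: "has_psiU (L ! p)"
  proof -
    let ?y = "unit (p, 0) :: nat \<times> nat \<Rightarrow> 'k"
    obtain a where a: "(0, dg (L ! p), a) \<in> set (up_basis (L ! p))" using midty_basis(3)[OF h] by blast
    have yg: "?y \<in> gcar fscale (upG ?M)" by (rule unit_gcar_up[OF p(1) a])
    \<comment> \<open>\<open>?y\<close> is a cycle and \<open>DD\<close> vanishes on models, so no
      \<open>K\<close>-term disturbs the square.\<close>
    have "psiU ?M ?y = ?x" using h p(1) by (auto simp: fun_eq_iff model_maps unit_apply)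
    moreover have "upD ?M ?y = 0" by (auto simp: fun_eq_iff model_maps unit_apply)
    ultimately have "mMid f ?x = psiU ?N (mUp f ?y)" using mcycD(4)[OF fc yg] fl by (simp add: model_maps(3))
    then have n: "has_psiU (L' ! q)" "mUp f ?y (q, 0) \<noteq> 0" using c j by (auto simp: model_maps split: if_splits)
    obtain a' where a': "(0, dg (L ! p), a') \<in> set (up_basis (L' ! q))" "A (ereal a') \<le> A (ereal a) + e"
      using coef_level[OF fe B(2,3) p(1) a n(2)] by auto
    show ?thesis using n(1) a' a up_basis_unique by blast
  qed
  have D: "has_psiD (L' ! q) \<and> (\<forall>a a'. (2, dg (L ! p), a) \<in> set (dn_basis (L ! p)) \<longrightarrow> (2, dg (L ! p), a') \<in> set (dn_basis (L' ! q)) \<longrightarrow> A (ereal a') \<ge> A (ereal a) - e)"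
    if h: "has_psiD (L ! p)"
  proof -
    let ?y = "unit (p, 2) :: nat \<times> nat \<Rightarrow> 'k"
    obtain a where a: "(2, dg (L ! p), a) \<in> set (dn_basis (L ! p))" using midty_basis(4)[OF h] by blast
    have ym: "?y \<in> dnG ?M (dg (L ! p))" using p(1) a by (auto simp: model_G dnS_def unit_apply)
    have yg: "?y \<in> gcar fscale (dnG ?M)" by (rule gcar_closed(6)[OF vs_fscale, where G = "dnG ?M", OF ym])
    have "psiD ?M ?y = ?x" using h p(1) by (auto simp: fun_eq_iff model_maps unit_apply)
    moreover have "dnD ?M ?y = 0" by (auto simp: fun_eq_iff model_maps unit_apply)
    ultimately have "mMid f ?x = psiD ?N (mDn f ?y)" using mcycD(2)[OF fc yg] fl by (simp add: model_maps(3))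
    then have n: "has_psiD (L' ! q)" "mDn f ?y (q, 2) \<noteq> 0" using c j by (auto simp: model_maps split: if_splits)
    have ne: "mDn f ?y \<noteq> 0" using n(2) by (metis zero_fun_apply)
    have fg: "mDn f ?y \<in> gcar fscale (dnG ?N)" using fl(1) yg by blast
    obtain a' where a': "(2, dg (L ! p), a') \<in> set (dn_basis (L' ! q))"
      using midty_basis(4)[OF n(1)] t(2) by auto
    have "dnL ?N (mDn f ?y) \<in> ereal ` B" using levok_model[where B = B and L = L', OF B(2)] fg ne unfolding levok_def by blast
    then have "A (ereal a') \<ge> A (dnL ?N (mDn f ?y))"
      using dnL_le[where v = "mDn f ?y", OF q(1) a' n(2)] levinD(2)[OF B(2)[OF q(1)] a'] by (intro mono_onD[OF B(3)]) auto
    moreover have "A (dnL ?M ?y) - e \<le> A (dnL ?N (mDn f ?y))" by (rule emorL(2)[OF fe yg ne])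
    moreover have "dnL ?M ?y = ereal a"
    proof (rule antisym)
      show "dnL ?M ?y \<le> ereal a" by (rule dnL_le[OF p(1) a]) (simp add: unit_apply)
      show "ereal a \<le> dnL ?M ?y" by (rule dnL_geI) (use a dn_basis_unique in \<open>auto simp: unit_apply split: if_splits, blast\<close>)
    qed
    ultimately have "A (ereal a') \<ge> A (ereal a) - e" by simp
    then show ?thesis using n(1) a' a dn_basis_unique by blast
  qed
  have "sle A e (L ! p) (L' ! q)" if s: "ty (L ! p) = ty (L' ! q)"
    using e U D t p(2) s by (cases "L ! p"; cases "L' ! q"; auto simp: sle_def midty_def)
  then show ?thesis using j q(1) t U D by blast
qed


text \<open>Row \<open>p\<close> and column \<open>q\<close> describe the component from summand
  \<open>p\<close> to summand \<open>q\<close>, read off at the slot that represents the type: 0 for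
  up types, 4 for middle types. Rows of down types are set to 0.\<close>

definition cmat :: "('k::field) itself \<Rightarrow> (nat \<times> nat \<Rightarrow> 'k, nat \<times> nat \<Rightarrow> 'k) cmor \<Rightarrow> summand list \<Rightarrow> summand list \<Rightarrow> nat \<Rightarrow> nat \<Rightarrow> 'k" where
  "cmat _ f L L' p q = (if ty (L ! p) = ty (L' ! q) then
     (if upty (L ! p) then mUp f (unit (p, 0)) (q, 0) else if midty (L ! p) then mMid f (unit (p, 4)) (q, 4) else 0) else 0)"

lemma cmat_sle:
  fixes f :: "(nat \<times> nat \<Rightarrow> 'k::field, nat \<times> nat \<Rightarrow> 'k) cmor"
  assumes e: "0 \<le> e" and f: "ehm A fscale fscale e (model L) (model L') f"
    and B: "\<And>i. i < length L \<Longrightarrow> levin B (L ! i)" "\<And>i. i < length L' \<Longrightarrow> levin B (L' ! i)" "mono_on (ereal ` B) A"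
    and p: "p < length L" and c: "cmat TYPE('k) f L L' p q \<noteq> 0"
  shows "sle A e (L ! p) (L' ! q)"
  using c up_row[OF e f B(2,3) p, of q 0] mid_row[OF e f B p, of q 4] unfolding cmat_def by (auto split: if_splits)

text \<open>On the middle complex the homotopy relation is an equality, because the differential is
  zero. On slot 0 the composite differs from the identity by the boundary of the homotopy alone, and
  this term is excluded by the order of the summands. Paths through other types vanish by the
  monotonicity found in the row lemmas.\<close>

lemma cmat_comp:
  fixes f g :: "(nat \<times> nat \<Rightarrow> 'k::field, nat \<times> nat \<Rightarrow> 'k) cmor"
  assumes e: "0 \<le> e" and f: "ehm A fscale fscale e (model L) (model L') f" and g: "ehm A fscale fscale e (model L') (model L) g"
    and gf: "eho A fscale fscale (2 * e) (model L) (model L) (mcomp g f) mid"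
    and B: "\<And>i. i < length L \<Longrightarrow> levin B (L ! i)" "\<And>i. i < length L' \<Longrightarrow> levin B (L' ! i)" "mono_on (ereal ` B) A"
    and p: "p < length L" "p' < length L" "ty (L ! p) = ty (L ! p')" "upty (L ! p) \<or> midty (L ! p)"
    and sm: "\<not> small A (2 * e) (L ! p)" "\<not> small A (2 * e) (L ! p')"
    and al: "c1 A (L ! p) + c2 A (L ! p) \<le> c1 A (L ! p') + c2 A (L ! p')"
  shows "(\<Sum>q<length L'. cmat TYPE('k) f L L' p q * cmat TYPE('k) g L' L q p') = (if p = p' then 1 else 0)"
proof -
  let ?M = "model L :: (nat \<times> nat \<Rightarrow> 'k) cospan" and ?N = "model L' :: (nat \<times> nat \<Rightarrow> 'k) cospan"
  note fe = ehm_emor[OF f] and ge = ehm_emor[OF g] and gc' = g[unfolded ehm_def, THEN conjunct2]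
  note fl = emorD[OF fe, THEN gmap_lin[OF vs_fscale vs_fscale]]
  obtain h where h: "emor A fscale fscale (2 * e) (-1) ?M ?M h" "ehtp fscale ?M ?M (mcomp g f) mid h"
    using gf by (auto simp: eho_def)
  note hl = emorD[OF h(1), THEN gmap_lin[OF vs_fscale vs_fscale]]
  show ?thesis
  proof (cases "upty (L ! p)")
    case True
    then have up: "upty (L ! p)" "upty (L ! p')" "\<not> midty (L ! p)" using p(3) by (auto simp: upty_def midty_def)
    let ?x = "unit (p, 0) :: nat \<times> nat \<Rightarrow> 'k"
    obtain a where a: "(0, dg (L ! p), a) \<in> set (up_basis (L ! p))" using upty_basis(1)[OF up(1)] by blast
    have xg: "?x \<in> gcar fscale (upG ?M)" by (rule unit_gcar_up[OF p(1) a])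
    have dx: "upD ?M ?x = 0" by (auto simp: fun_eq_iff model_maps unit_apply)
    have "mUp g (mUp f ?x) = ?x - upD ?M (mUp h ?x)"
      using ehtpD(3)[OF h(2) xg] hl(2) dx by (simp add: mcomp_def mid_def)
    \<comment> \<open>An entry here means that \<open>L ! p'\<close> ends at most
      \<open>2 * e\<close> above the start of \<open>L ! p\<close>. As neither bar is small,
      \<open>p'\<close> then starts before \<open>p\<close> and ends before \<open>p\<close>,
      against the assumed order of the sums.\<close>
    moreover have "upD ?M (mUp h ?x) (p', 0) = 0"
    proof (rule ccontr)
      assume n: "upD ?M (mUp h ?x) (p', 0) \<noteq> 0"
      then have u: "is_up2 (L ! p')" "mUp h ?x (p', 1) \<noteq> 0" by (auto simp: model_maps split: if_splits)
      obtain b where b: "(1, dg (L ! p) + 1, b) \<in> set (up_basis (L ! p'))" "A (ereal b) \<le> A (ereal a) + 2 * e"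
        using coef_level[OF h(1) B(1,3) p(1) a u(2)] by auto
      show False using b a u(1) sm al p(3) by (cases "L ! p"; cases "L ! p'"; auto simp: small_def)
    qed
    ultimately have d: "mUp g (mUp f ?x) (p', 0) = (if p = p' then 1 else 0)" by (auto simp: unit_apply)
    let ?S = "\<Union>k. upS L' k"
    have "lin_on fscale fscale (gcar fscale (upG ?N)) (mUp g)" using emorD(2)[OF ge] by (simp add: gmap_def)
    moreover have fx: "mUp f ?x \<in> gcar fscale (upG ?N)" using fl(2) xg by blast
    moreover have "\<And>r. r \<in> ?S \<Longrightarrow> (unit r :: nat \<times> nat \<Rightarrow> 'k) \<in> gcar fscale (upG ?N)" by (rule unit_gcar(1))
    moreover have "\<And>r. mUp f ?x r \<noteq> 0 \<Longrightarrow> r \<in> ?S" using fx unfolding model_car by blast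
    ultimately have "mUp g (mUp f ?x) (p', 0) = (\<Sum>r\<in>?S. mUp f ?x r * mUp g (unit r) (p', 0))"
      by (intro lin_expand[where G = "upG ?N"] finite_slots) blast+
    \<comment> \<open>The two index sets overlap in the slots 0 that exist; outside of the overlap
      the row of \<open>f\<close> is zero on either side.\<close>
    also have "\<dots> = (\<Sum>r\<in>(\<lambda>q. (q, 0 :: nat)) ` {..<length L'}. cmat TYPE('k) f L L' p (fst r) * cmat TYPE('k) g L' L (fst r) p')"
    proof (rule sum.mono_neutral_cong)
      fix r assume r: "r \<in> (\<lambda>q. (q, 0 :: nat)) ` {..<length L'} - ?S"
      then have "mUp f ?x r = 0" using fx by (auto simp: model_car)
      then show "cmat TYPE('k) f L L' p (fst r) * cmat TYPE('k) g L' L (fst r) p' = 0" using r up by (auto simp: cmat_def)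
    next
      fix r assume r: "r \<in> ?S - (\<lambda>q. (q, 0 :: nat)) ` {..<length L'}"
      have "mUp f ?x r = 0"
      proof (rule ccontr)
        assume "mUp f ?x r \<noteq> 0"
        then have "snd r = 0 \<and> fst r < length L'" using up_row[OF e f B(2,3) p(1) up(1), of "fst r" "snd r"] by simp
        then show False using r by (cases r) auto
      qed
      then show "mUp f ?x r * mUp g (unit r) (p', 0) = 0" by simp
    next
      fix r assume "r \<in> ?S \<inter> (\<lambda>q. (q, 0 :: nat)) ` {..<length L'}"
      then obtain q where q: "r = (q, 0)" "q < length L'" by blast
      show "mUp f ?x r * mUp g (unit r) (p', 0) = cmat TYPE('k) f L L' p (fst r) * cmat TYPE('k) g L' L (fst r) p'"
      proof (cases "ty (L' ! q) = ty (L ! p)")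
        case True
        then have "upty (L' ! q)" using up(1) by (simp add: upty_def)
        then show ?thesis using True up(1) p(3) q(1) by (simp add: cmat_def)
      next
        case False
        \<comment> \<open>Through a different type the path would lead from a finite to an infinite
          bar in one of its two steps.\<close>
        have "mUp f ?x r * mUp g (unit r) (p', 0) = 0"
        proof (rule ccontr)
          assume "\<not> ?thesis"
          then have n: "mUp f ?x (q, 0) \<noteq> 0" "mUp g (unit (q, 0)) (p', 0) \<noteq> 0" using q(1) by auto
          note r1 = up_row[OF e f B(2,3) p(1) up(1) n(1)]
          then have "upty (L' ! q)" by blast
          note r2 = up_row[OF e g B(1,3) q(2) this n(2)]
          show False using r1 r2 False p(3) up(1) by (auto simp: upty_def)
        qed
        then show ?thesis using False q(1) by (simp add: cmat_def)
      qed
    qed (auto simp: finite_slots)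
    also have "\<dots> = (\<Sum>q<length L'. cmat TYPE('k) f L L' p q * cmat TYPE('k) g L' L q p')"
      by (subst sum.reindex) (auto simp: inj_on_def)
    finally show ?thesis using d by simp
  next
    case False
    then have md: "midty (L ! p)" "midty (L ! p')" "\<not> upty (L ! p)" using p(3,4) by (auto simp: midty_def)
    let ?x = "unit (p, 4) :: nat \<times> nat \<Rightarrow> 'k"
    have xm: "?x \<in> DG ?M (dg (L ! p))" by (rule unit_in(2)[OF p(1) midty_basis(1)[OF md(1)]])
    have xg: "?x \<in> gcar fscale (DG ?M)" by (rule gcar_closed(6)[OF vs_fscale, where G = "DG ?M", OF xm])
    have "mMid g (mMid f ?x) = ?x"
      using ehtpD(5)[OF h(2) xg] hl(3) by (simp add: mcomp_def mid_def model_maps(3))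
    then have d: "mMid g (mMid f ?x) (p', 4) = (if p = p' then 1 else 0)" by (auto simp: unit_apply)
    let ?S = "\<Union>k. midS L' k"
    have "lin_on fscale fscale (gcar fscale (DG ?N)) (mMid g)" using emorD(3)[OF ge] by (simp add: gmap_def)
    moreover have fx: "mMid f ?x \<in> gcar fscale (DG ?N)" using fl(3) xg by blast
    moreover have "\<And>r. r \<in> ?S \<Longrightarrow> (unit r :: nat \<times> nat \<Rightarrow> 'k) \<in> gcar fscale (DG ?N)" by (rule unit_gcar(2))
    moreover have "\<And>r. mMid f ?x r \<noteq> 0 \<Longrightarrow> r \<in> ?S" using fx unfolding model_car by blast
    ultimately have "mMid g (mMid f ?x) (p', 4) = (\<Sum>r\<in>?S. mMid f ?x r * mMid g (unit r) (p', 4))"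
      by (intro lin_expand[where G = "DG ?N"] finite_slots) blast+
    also have "\<dots> = (\<Sum>r\<in>(\<lambda>q. (q, 4 :: nat)) ` {..<length L'}. cmat TYPE('k) f L L' p (fst r) * cmat TYPE('k) g L' L (fst r) p')"
    proof (rule sum.mono_neutral_cong)
      fix r assume r: "r \<in> (\<lambda>q. (q, 4 :: nat)) ` {..<length L'} - ?S"
      then have "mMid f ?x r = 0" using fx by (auto simp: model_car)
      then show "cmat TYPE('k) f L L' p (fst r) * cmat TYPE('k) g L' L (fst r) p' = 0" using r md by (auto simp: cmat_def)
    next
      fix r assume r: "r \<in> ?S - (\<lambda>q. (q, 4 :: nat)) ` {..<length L'}"
      have "mMid f ?x r = 0"
      proof (rule ccontr)
        assume "mMid f ?x r \<noteq> 0"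
        then have "snd r = 4 \<and> fst r < length L'" using mid_row[OF e f B p(1) md(1), of "fst r" "snd r"] by simp
        then show False using r by (cases r) auto
      qed
      then show "mMid f ?x r * mMid g (unit r) (p', 4) = 0" by simp
    next
      fix r assume "r \<in> ?S \<inter> (\<lambda>q. (q, 4 :: nat)) ` {..<length L'}"
      then obtain q where q: "r = (q, 4)" "q < length L'" by blast
      show "mMid f ?x r * mMid g (unit r) (p', 4) = cmat TYPE('k) f L L' p (fst r) * cmat TYPE('k) g L' L (fst r) p'"
      proof (cases "ty (L' ! q) = ty (L ! p)")
        case True
        then have "midty (L' ! q)" "\<not> upty (L' ! q)" using md(1,3) by (auto simp: midty_def upty_def)
        then show ?thesis using True md(1,3) p(3) q(1) by (simp add: cmat_def)
      next
        case False
        have "mMid f ?x r * mMid g (unit r) (p', 4) = 0"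
        proof (rule ccontr)
          assume "\<not> ?thesis"
          then have n: "mMid f ?x (q, 4) \<noteq> 0" "mMid g (unit (q, 4)) (p', 4) \<noteq> 0" using q(1) by auto
          note r1 = mid_row[OF e f B p(1) md(1) n(1)]
          then have "midty (L' ! q)" by blast
          note r2 = mid_row[OF e g B(2,1,3) q(2) this n(2)]
          \<comment> \<open>Arms can only be gained in each step and agree at the two ends, so they
            agree in between.\<close>
          have "has_psiU (L ! p) = has_psiU (L' ! q)" "has_psiD (L ! p) = has_psiD (L' ! q)"
            using r1 r2 ty_flags[OF p(3)] by blast+
          then show False using midty_flags[OF md(1)] r1 False by metis
        qed
        then show ?thesis using False q(1) by (simp add: cmat_def)
      qed
    qed (auto simp: finite_slots)
    also have "\<dots> = (\<Sum>q<length L'. cmat TYPE('k) f L L' p q * cmat TYPE('k) g L' L q p')"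
      by (subst sum.reindex) (auto simp: inj_on_def)
    finally show ?thesis using d by simp
  qed
qed

section \<open>Matchings from invertible matrices\<close>

text \<open>Gaussian elimination, one column at a time: a row with nonzero entry in the column
  \<open>q0\<close> clears that column from all other rows and is then set aside.\<close>

lemma linear_dependence:
  fixes f :: "'a \<Rightarrow> 'b \<Rightarrow> 'k::field"
  assumes "finite M" "finite P" "card M < card P"
  shows "\<exists>c. (\<exists>p\<in>P. c p \<noteq> 0) \<and> (\<forall>q\<in>M. (\<Sum>p\<in>P. c p * f p q) = 0)"
  using assms
proof (induction M arbitrary: P f rule: finite_induct)
  case empty
  then obtain p where "p \<in> P" by fastforce
  then show ?case by (intro exI[of _ "\<lambda>_. 1"]) auto
next
  case (insert q0 M)
  show ?case
  proof (cases "\<forall>p\<in>P. f p q0 = 0")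
    case True
    obtain c where "\<exists>p\<in>P. c p \<noteq> 0" "\<forall>q\<in>M. (\<Sum>p\<in>P. c p * f p q) = 0"
      using insert.IH[of P f] insert.prems insert.hyps by auto
    then show ?thesis using True by (intro exI[of _ c]) auto
  next
    case False
    then obtain p0 where p0: "p0 \<in> P" "f p0 q0 \<noteq> 0" by blast
    let ?P = "P - {p0}" and ?g = "\<lambda>p q. f p q - f p q0 / f p0 q0 * f p0 q"
    have "card M < card ?P" using insert.prems insert.hyps p0 by (simp add: card_Diff_singleton)
    then obtain c where c: "\<exists>p\<in>?P. c p \<noteq> 0" "\<forall>q\<in>M. (\<Sum>p\<in>?P. c p * ?g p q) = 0"
      using insert.IH[of ?P ?g] insert.prems by auto
    \<comment> \<open>The row set aside gets the coefficient that kills the column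
      \<open>q0\<close>; in the other columns its contribution is the correction already contained
      in \<open>?g\<close>.\<close>
    define S where "S = (\<Sum>p\<in>?P. c p * f p q0)"
    define d where "d = c(p0 := - S / f p0 q0)"
    have dP: "(\<Sum>p\<in>P. d p * f p q) = (\<Sum>p\<in>?P. c p * f p q) - S / f p0 q0 * f p0 q" for q
    proof -
      have "(\<Sum>p\<in>P. d p * f p q) = d p0 * f p0 q + (\<Sum>p\<in>?P. d p * f p q)"
        using insert.prems(1) p0(1) by (simp add: sum.remove)
      also have "(\<Sum>p\<in>?P. d p * f p q) = (\<Sum>p\<in>?P. c p * f p q)" by (rule sum.cong) (auto simp: d_def)
      finally show ?thesis by (simp add: d_def)
    qed
    have "(\<Sum>p\<in>P. d p * f p q) = 0" if "q \<in> M" for q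
    proof -
      have "(\<Sum>p\<in>?P. c p * ?g p q) = (\<Sum>p\<in>?P. c p * f p q) - (\<Sum>p\<in>?P. c p * f p q0) / f p0 q0 * f p0 q"
        by (simp add: right_diff_distrib sum_subtractf sum_divide_distrib sum_distrib_right mult.assoc)
      then show ?thesis using c(2) that unfolding dP S_def by simp
    qed
    moreover have "(\<Sum>p\<in>P. d p * f p q0) = 0" unfolding dP using p0(2) by (simp add: S_def)
    moreover have "\<exists>p\<in>P. d p \<noteq> 0" using c(1) by (auto simp: d_def)
    ultimately show ?thesis by (intro exI[of _ d]) auto
  qed
qed

text \<open>With more rows than columns the rows of \<open>f\<close> satisfy a linear relation.
  Multiplying it by the column of \<open>g\<close> that belongs to an
  \<open>\<alpha>\<close>-maximal element \<open>p0\<close> of its support uses only the known half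
  of the product and leaves \<open>c p0 = 0\<close>.\<close>

lemma card_le_of_triangular:
  fixes f :: "'a \<Rightarrow> 'b \<Rightarrow> 'k::field" and \<alpha> :: "'a \<Rightarrow> real"
  assumes "finite M" "finite P"
    and tri: "\<And>p p'. p \<in> P \<Longrightarrow> p' \<in> P \<Longrightarrow> \<alpha> p \<le> \<alpha> p' \<Longrightarrow> (\<Sum>q\<in>M. f p q * g q p') = (if p = p' then 1 else 0)"
  shows "card P \<le> card M"
proof (rule ccontr)
  assume "\<not> ?thesis"
  then obtain c where c: "\<exists>p\<in>P. c p \<noteq> 0" "\<forall>q\<in>M. (\<Sum>p\<in>P. c p * f p q) = 0"
    using linear_dependence[OF assms(1,2), of f] by auto
  let ?S = "{p \<in> P. c p \<noteq> 0}"
  have S: "finite ?S" "?S \<noteq> {}" using c(1) assms(2) by auto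
  have "Max (\<alpha> ` ?S) \<in> \<alpha> ` ?S" by (rule Max_in) (use S in simp_all)
  then obtain p0 where "p0 \<in> ?S" "\<alpha> p0 = Max (\<alpha> ` ?S)" by (rule imageE) simp
  then have p0: "p0 \<in> ?S" "\<forall>p\<in>?S. \<alpha> p \<le> \<alpha> p0" using S(1) by simp_all
  have "0 = (\<Sum>q\<in>M. (\<Sum>p\<in>P. c p * f p q) * g q p0)" using c(2) by simp
  also have "\<dots> = (\<Sum>q\<in>M. \<Sum>p\<in>P. c p * (f p q * g q p0))" by (simp add: sum_distrib_right mult.assoc)
  also have "\<dots> = (\<Sum>p\<in>P. \<Sum>q\<in>M. c p * (f p q * g q p0))" by (rule sum.swap)
  also have "\<dots> = (\<Sum>p\<in>P. c p * (\<Sum>q\<in>M. f p q * g q p0))" by (simp add: sum_distrib_left)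
  also have "\<dots> = (\<Sum>p\<in>P. if p = p0 then c p0 else 0)"
  proof (rule sum.cong[OF refl])
    fix p assume "p \<in> P"
    then show "c p * (\<Sum>q\<in>M. f p q * g q p0) = (if p = p0 then c p0 else 0)"
      using tri[of p p0] p0 by (cases "c p = 0") auto
  qed
  also have "\<dots> = c p0" using p0(1) assms(2) by simp
  finally show False using p0(1) by simp
qed

text \<open>The dichotomy of Halmos and Vaughan: either some proper nonempty subset has exactly as
  many neighbours as elements, and \<open>P\<close> and its complement are matched separately, or
  every such subset has a neighbour to spare, and an arbitrary edge may be fixed.\<close>

lemma hall:
  assumes "finite P" "finite Q" "\<And>A. A \<subseteq> P \<Longrightarrow> card A \<le> card {q \<in> Q. \<exists>p\<in>A. E p q}"
  shows "\<exists>\<sigma>. inj_on \<sigma> P \<and> (\<forall>p\<in>P. \<sigma> p \<in> Q \<and> E p (\<sigma> p))"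
  using assms
proof (induction "card P" arbitrary: P Q rule: less_induct)
  case less
  note fP = less.prems(1) and fQ = less.prems(2) and H = less.prems(3)
  let ?N = "\<lambda>A. {q \<in> Q. \<exists>p\<in>A. E p q}"
  have fN: "finite (?N A)" for A using fQ by simp
  show ?case
  proof (cases "P = {}")
    case True then show ?thesis by auto
  next
    case ne: False
    show ?thesis
    proof (cases "\<exists>A. A \<subset> P \<and> A \<noteq> {} \<and> card A = card (?N A)")
      case True
      then obtain A where A: "A \<subset> P" "A \<noteq> {}" "card A = card (?N A)" by blast
      have fA: "finite A" using A(1) fP finite_subset by blast
      have "\<exists>\<sigma>. inj_on \<sigma> A \<and> (\<forall>p\<in>A. \<sigma> p \<in> ?N A \<and> E p (\<sigma> p))"
      proof (rule less.hyps)
        show "card A < card P" using A(1) fP psubset_card_mono by blast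
        fix B assume B: "B \<subseteq> A"
        have "{q \<in> ?N A. \<exists>p\<in>B. E p q} = ?N B" using B by blast
        then show "card B \<le> card {q \<in> ?N A. \<exists>p\<in>B. E p q}" using H[of B] B A(1) by auto
      qed (use fA fN in auto)
      then obtain \<sigma>1 where s1: "inj_on \<sigma>1 A" "\<forall>p\<in>A. \<sigma>1 p \<in> ?N A \<and> E p (\<sigma>1 p)" by blast
      have "\<exists>\<sigma>. inj_on \<sigma> (P - A) \<and> (\<forall>p\<in>P - A. \<sigma> p \<in> Q - ?N A \<and> E p (\<sigma> p))"
      proof (rule less.hyps)
        show "card (P - A) < card P" using A fP by (intro psubset_card_mono) auto
        fix B assume B: "B \<subseteq> P - A"
        have fB: "finite B" using B fP finite_subset by blast
        have "card A + card B = card (A \<union> B)" using B fA fB by (subst card_Un_disjoint) auto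
        also have "\<dots> \<le> card (?N (A \<union> B))" using B A(1) by (intro H) auto
        also have "?N (A \<union> B) = ?N A \<union> {q \<in> Q - ?N A. \<exists>p\<in>B. E p q}" by blast
        also have "card \<dots> = card (?N A) + card {q \<in> Q - ?N A. \<exists>p\<in>B. E p q}"
          using fQ by (intro card_Un_disjoint) auto
        finally show "card B \<le> card {q \<in> Q - ?N A. \<exists>p\<in>B. E p q}" using A(3) by simp
      qed (use fP fQ in auto)
      then obtain \<sigma>2 where s2: "inj_on \<sigma>2 (P - A)" "\<forall>p\<in>P - A. \<sigma>2 p \<in> Q - ?N A \<and> E p (\<sigma>2 p)" by blast
      let ?s = "\<lambda>p. if p \<in> A then \<sigma>1 p else \<sigma>2 p"
      have "inj_on ?s P"
      proof (rule inj_onI)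
        fix x y assume xy: "x \<in> P" "y \<in> P" "?s x = ?s y"
        consider "x \<in> A" "y \<in> A" | "x \<in> A" "y \<notin> A" | "x \<notin> A" "y \<in> A" | "x \<notin> A" "y \<notin> A" by blast
        then show "x = y"
        proof cases
          case 1 then show ?thesis using xy s1(1) by (auto dest: inj_onD)
        next
          case 2
          then have "\<sigma>1 x \<in> ?N A" using s1(2) by blast
          moreover have "\<sigma>2 y \<in> Q - ?N A" using 2 xy(2) s2(2) by blast
          moreover have "\<sigma>1 x = \<sigma>2 y" using 2 xy(3) by simp
          ultimately show ?thesis by (metis DiffD2)
        next
          case 3
          then have "\<sigma>1 y \<in> ?N A" using s1(2) by blast
          moreover have "\<sigma>2 x \<in> Q - ?N A" using 3 xy(1) s2(2) by blast
          moreover have "\<sigma>1 y = \<sigma>2 x" using 3 xy(3) by simp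
          ultimately show ?thesis by (metis DiffD2)
        next
          case 4 then show ?thesis using xy s2(1) by (auto dest: inj_onD)
        qed
      qed
      moreover have "\<forall>p\<in>P. ?s p \<in> Q \<and> E p (?s p)" using s1(2) s2(2) by auto
      ultimately show ?thesis by blast
    next
      case False
      obtain p0 where p0: "p0 \<in> P" using ne by blast
      have "card {p0} \<le> card (?N {p0})" using p0 by (intro H) auto
      then have "?N {p0} \<noteq> {}" by (metis card.empty card.insert empty_iff finite.emptyI not_one_le_zero One_nat_def)
      then obtain q0 where q0: "q0 \<in> Q" "E p0 q0" by blast
      have "\<exists>\<sigma>. inj_on \<sigma> (P - {p0}) \<and> (\<forall>p\<in>P - {p0}. \<sigma> p \<in> Q - {q0} \<and> E p (\<sigma> p))"
      proof (rule less.hyps)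
        show "card (P - {p0}) < card P" using p0 fP by (intro psubset_card_mono) auto
        fix B assume B: "B \<subseteq> P - {p0}"
        show "card B \<le> card {q \<in> Q - {q0}. \<exists>p\<in>B. E p q}"
        proof (cases "B = {}")
          case ne: False
          have "B \<subset> P" using B p0 by blast
          then have "card B \<noteq> card (?N B)" using False ne by blast
          moreover have "card B \<le> card (?N B)" using B by (intro H) auto
          ultimately have "card B < card (?N B)" by simp
          moreover have "{q \<in> Q - {q0}. \<exists>p\<in>B. E p q} = ?N B - {q0}" by blast
          moreover have "card (?N B) \<le> card (?N B - {q0}) + 1" using fN[of B] by (metis (no_types, lifting) card_Diff_singleton_if diff_le_self le_diff_conv order_refl trans_le_add1)
          ultimately show ?thesis by simp
        qed simp
      qed (use fP fQ in auto)
      then obtain \<sigma> where s: "inj_on \<sigma> (P - {p0})" "\<forall>p\<in>P - {p0}. \<sigma> p \<in> Q - {q0} \<and> E p (\<sigma> p)" by blast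
      have "inj_on (\<sigma>(p0 := q0)) P"
        using s p0 by (auto simp: inj_on_def)
      moreover have "\<forall>p\<in>P. (\<sigma>(p0 := q0)) p \<in> Q \<and> E p ((\<sigma>(p0 := q0)) p)" using s(2) q0 by auto
      ultimately show ?thesis by blast
    qed
  qed
qed

text \<open>This is the Schroeder-Bernstein argument: follow \<open>\<sigma>\<close> on a fixed point \<open>X\<close> and \<open>\<tau>\<close> off its image.\<close>
lemma combine_matchings:
  assumes s: "inj_on \<sigma> P0" "\<forall>p\<in>P0. \<sigma> p \<in> Q \<and> E p (\<sigma> p)" and t: "inj_on \<tau> Q0" "\<forall>q\<in>Q0. \<tau> q \<in> P \<and> E (\<tau> q) q"
    and "P0 \<subseteq> P" "Q0 \<subseteq> Q"
  shows "\<exists>r r'. (\<forall>p q. r q = Some p \<longleftrightarrow> r' p = Some q) \<and> (\<forall>p q. r q = Some p \<longrightarrow> p \<in> P \<and> q \<in> Q \<and> E p q) \<and>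
    (\<forall>p\<in>P0. r' p \<noteq> None) \<and> (\<forall>q\<in>Q0. r q \<noteq> None)"
proof -
  \<comment> \<open>Two complements occur, so \<open>?F\<close> is monotone; at its fixed point the
    elements of \<open>P0\<close> outside are exactly those of \<open>P0\<close> hit by
    \<open>\<tau>\<close> from the uncovered part of \<open>Q0\<close>.\<close>
  let ?F = "\<lambda>X. P0 - \<tau> ` (Q0 - \<sigma> ` X)"
  have "mono ?F" by (rule monoI) blast
  then have X: "lfp ?F = ?F (lfp ?F)" by (rule lfp_unfold)
  define X where "X = lfp ?F"
  have X: "X = P0 - \<tau> ` (Q0 - \<sigma> ` X)" using X by (simp add: X_def)
  define M where "M p q \<longleftrightarrow> (p \<in> X \<and> q = \<sigma> p) \<or> (q \<in> Q0 - \<sigma> ` X \<and> p = \<tau> q)" for p q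
  have XP: "X \<subseteq> P0" using X by blast
  have Xt: "\<tau> q \<notin> X" if "q \<in> Q0 - \<sigma> ` X" for q using that X by blast
  have M1: "q = q'" if m: "M p q" "M p q'" for p q q'
  proof (cases "p \<in> X")
    case True
    then have "q = \<sigma> p" "q' = \<sigma> p" using m Xt unfolding M_def by blast+
    then show ?thesis by simp
  next
    case False
    then have "q \<in> Q0" "q' \<in> Q0" "\<tau> q = p" "\<tau> q' = p" using m unfolding M_def by auto
    then show ?thesis using t(1) inj_onD by metis
  qed
  have M2: "p = p'" if m: "M p q" "M p' q" for p p' q
  proof (cases "q \<in> \<sigma> ` X")
    case True
    then have "p \<in> X" "p' \<in> X" "\<sigma> p = q" "\<sigma> p' = q" using m unfolding M_def by auto
    then show ?thesis using s(1) XP inj_onD by (metis subsetD)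
  next
    case False
    then have "p = \<tau> q" "p' = \<tau> q" using m unfolding M_def by blast+
    then show ?thesis by simp
  qed
  define r where "r q = (if \<exists>p. M p q then Some (THE p. M p q) else None)" for q
  define r' where "r' p = (if \<exists>q. M p q then Some (THE q. M p q) else None)" for p
  have T1: "(THE p. M p q) = p" if "M p q" for p q
    by (rule the_equality) (use that M2 in blast)+
  have T2: "(THE q. M p q) = q" if "M p q" for p q
    by (rule the_equality) (use that M1 in blast)+
  have r: "r q = Some p \<longleftrightarrow> M p q" for p q
    using T1 unfolding r_def by (metis option.distinct(1) option.inject)
  have r': "r' p = Some q \<longleftrightarrow> M p q" for p q
    using T2 unfolding r'_def by (metis option.distinct(1) option.inject)
  have "p \<in> P \<and> q \<in> Q \<and> E p q" if "M p q" for p q using that s(2) t(2) XP assms(5,6) unfolding M_def by blast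
  moreover have "\<exists>q. M p q" if "p \<in> P0" for p using that X unfolding M_def by blast
  moreover have "\<exists>p. M p q" if "q \<in> Q0" for q using that unfolding M_def by blast
  moreover have "r' p \<noteq> None \<longleftrightarrow> (\<exists>q. M p q)" "r q \<noteq> None \<longleftrightarrow> (\<exists>p. M p q)" for p q
    by (auto simp: r_def r'_def)
  ultimately show ?thesis using r r' by (intro exI[of _ r] exI[of _ r']) blast
qed


section \<open>Stability for models\<close>

text \<open>The rank count is applied with columns restricted to the neighbours of \<open>P\<close>;
  the triangular half of the product does not notice the restriction.\<close>

lemma hall_condition:
  fixes f g :: "(nat \<times> nat \<Rightarrow> 'k::field, nat \<times> nat \<Rightarrow> 'k) cmor"
  assumes e: "0 \<le> e" and f: "ehm A fscale fscale e (model L) (model L') f" and g: "ehm A fscale fscale e (model L') (model L) g"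
    and gf: "eho A fscale fscale (2 * e) (model L) (model L) (mcomp g f) mid"
    and B: "\<And>i. i < length L \<Longrightarrow> levin B (L ! i)" "\<And>i. i < length L' \<Longrightarrow> levin B (L' ! i)" "mono_on (ereal ` B) A"
    and P: "P \<subseteq> {p. p < length L \<and> (upty (L ! p) \<or> midty (L ! p)) \<and> \<not> small A (2 * e) (L ! p)}"
  shows "card P \<le> card {q \<in> {..<length L'}. \<exists>p\<in>P. sle A e (L ! p) (L' ! q) \<and> sle A e (L' ! q) (L ! p)}"
proof -
  let ?M = "{q \<in> {..<length L'}. \<exists>p\<in>P. sle A e (L ! p) (L' ! q) \<and> sle A e (L' ! q) (L ! p)}"
  let ?F = "cmat TYPE('k) f L L'" and ?G = "cmat TYPE('k) g L' L"
  have fP: "finite P" by (rule finite_subset[OF P]) simp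
  show ?thesis
  proof (rule card_le_of_triangular[OF _ fP, where f = ?F and g = ?G and \<alpha> = "\<lambda>p. c1 A (L ! p) + c2 A (L ! p)"])
    fix p p' assume p: "p \<in> P" "p' \<in> P" and al: "c1 A (L ! p) + c2 A (L ! p) \<le> c1 A (L ! p') + c2 A (L ! p')"
    have p1: "p < length L" "p' < length L" "upty (L ! p) \<or> midty (L ! p)" "\<not> small A (2 * e) (L ! p)" "\<not> small A (2 * e) (L ! p')"
      using P p by auto
    have nz: "q \<in> ?M \<and> ty (L ! p) = ty (L ! p')" if q: "q < length L'" "?F p q * ?G q p' \<noteq> 0" for q
    proof -
      have 1: "sle A e (L ! p) (L' ! q)" by (rule cmat_sle[OF e f B p1(1)]) (use q in auto)
      have 2: "sle A e (L' ! q) (L ! p')" by (rule cmat_sle[OF e g B(2,1,3) q(1)]) (use q in auto)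
      \<comment> \<open>Along p -> q -> p' each coordinate rises by at most \<open>e\<close> per
        step. If both steps dropped some coordinate by more than \<open>e\<close>, the two drops
        would outweigh what the other coordinate can gain, and the sum would strictly decrease from
        \<open>p\<close> to \<open>p'\<close>.\<close>
      have "sle A e (L' ! q) (L ! p) \<or> sle A e (L ! p') (L' ! q)"
      proof (rule ccontr)
        assume "\<not> ?thesis"
        then have "c1 A (L ! p) > c1 A (L' ! q) + e \<or> c2 A (L ! p) > c2 A (L' ! q) + e"
          "c1 A (L' ! q) > c1 A (L ! p') + e \<or> c2 A (L' ! q) > c2 A (L ! p') + e"
          using 1 2 unfolding sle_def by auto
        then show False using 1 2 al e unfolding sle_def by linarith
      qed
      then show ?thesis using 1 2 p q(1) unfolding sle_def by auto
    qed
    have "(\<Sum>q\<in>?M. ?F p q * ?G q p') = (\<Sum>q<length L'. ?F p q * ?G q p')"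
      by (rule sum.mono_neutral_left) (use nz in auto)
    also have "\<dots> = (if p = p' then 1 else 0)"
    proof (cases "ty (L ! p) = ty (L ! p')")
      case True
      show ?thesis by (rule cmat_comp[OF e f g gf B p1(1,2) True p1(3-5) al])
    next
      case False
      then have "?F p q * ?G q p' = 0" if "q < length L'" for q using nz that by blast
      then have "(\<Sum>q<length L'. ?F p q * ?G q p') = 0" by (intro sum.neutral) simp
      then show ?thesis using False by auto
    qed
    finally show "(\<Sum>q\<in>?M. ?F p q * ?G q p') = (if p = p' then 1 else 0)" .
  qed simp
qed

lemma mono_on_swA: "mono_on (ereal ` B) A \<Longrightarrow> uminus ` B \<subseteq> B \<Longrightarrow> mono_on (ereal ` B) (swA A)"
proof (rule mono_onI)
  fix x y :: ereal assume A: "mono_on (ereal ` B) A" "uminus ` B \<subseteq> B" and xy: "x \<in> ereal ` B" "y \<in> ereal ` B" "x \<le> y"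
  obtain a b where ab: "x = ereal a" "y = ereal b" "a \<in> B" "b \<in> B" using xy by blast
  then have "ereal (- b) \<in> ereal ` B" "ereal (- a) \<in> ereal ` B" "ereal (- b) \<le> ereal (- a)" using A(2) xy(3) by auto
  then have "A (ereal (- b)) \<le> A (ereal (- a))" using mono_onD[OF A(1)] by blast
  then show "swA A x \<le> swA A y" using ab by (simp add: swA_def)
qed

lemma sws_sle: "ty s \<in> {2, 3} \<Longrightarrow> sle (swA A) e (sws s) (sws s') \<Longrightarrow> sle A e s s'"
  "ty s' \<in> {2, 3} \<Longrightarrow> sle (swA A) e (sws s) (sws s') \<Longrightarrow> sle A e s s'"
  "ty s \<in> {2, 3} \<Longrightarrow> small (swA A) e (sws s) = small A e s"
  "ty s \<in> {2, 3} \<Longrightarrow> upty (sws s)"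
  by (cases s; cases s'; simp add: sle_def swA_def small_def upty_def)+

lemma eint_model_sw:
  fixes L L' :: "summand list"
  assumes e: "0 \<le> e" and i: "eint A fscale fscale e (model L) (model L' :: (nat \<times> nat \<Rightarrow> 'k::field) cospan)"
    and B: "\<And>i. i < length L \<Longrightarrow> levin B (L ! i)" "\<And>i. i < length L' \<Longrightarrow> levin B (L' ! i)" "mono_on (ereal ` B) A" "uminus ` B \<subseteq> B"
  shows "eint (swA A) fscale fscale e (model (map sws L)) (model (map sws L') :: (nat \<times> nat \<Rightarrow> 'k) cospan)"
proof -
  note m = mono_on_swA[OF B(3,4)]
  have l: "\<And>i. i < length (map sws L) \<Longrightarrow> levin B (map sws L ! i)" "\<And>i. i < length (map sws L') \<Longrightarrow> levin B (map sws L' ! i)"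
    using B levin_sws by auto
  show ?thesis
    by (rule eint_transfer[OF good_sw[OF good_model[OF B(1,3)]] good_sw[OF good_model[OF B(2,3)]] good_model[OF l(1) m] good_model[OF l(2) m]
      eint_sw[OF i] model_sw[OF B(1) m B(4)] model_sw[OF B(2) m B(4)] e])
qed

text \<open>Hall's condition is checked for up and middle types directly and for down types after
  exchanging the arms. The two estimates add up because close summands have the same type, so the
  two sets of neighbours are disjoint.\<close>

lemma stable_injection:
  fixes L L' :: "summand list"
  assumes e: "0 \<le> e" and i: "eint A fscale fscale e (model L) (model L' :: (nat \<times> nat \<Rightarrow> 'k::field) cospan)"
    and B: "\<And>i. i < length L \<Longrightarrow> levin B (L ! i)" "\<And>i. i < length L' \<Longrightarrow> levin B (L' ! i)" "mono_on (ereal ` B) A" "uminus ` B \<subseteq> B"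
  shows "\<exists>\<sigma>. inj_on \<sigma> {p \<in> {..<length L}. \<not> small A (2 * e) (L ! p)} \<and>
    (\<forall>p\<in>{p \<in> {..<length L}. \<not> small A (2 * e) (L ! p)}. \<sigma> p \<in> {..<length L'} \<and> sle A e (L ! p) (L' ! \<sigma> p) \<and> sle A e (L' ! \<sigma> p) (L ! p))"
proof (rule hall)
  let ?E = "\<lambda>p q. sle A e (L ! p) (L' ! q) \<and> sle A e (L' ! q) (L ! p)"
  fix P assume P: "P \<subseteq> {p \<in> {..<length L}. \<not> small A (2 * e) (L ! p)}"
  have fP: "finite P" by (rule finite_subset[OF P]) simp
  let ?P1 = "{p \<in> P. ty (L ! p) \<notin> {2, 3}}" and ?P2 = "{p \<in> P. ty (L ! p) \<in> {2, 3}}"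
  have ut: "upty s \<or> midty s" if "ty s \<notin> {2, 3}" for s using that by (cases s) (auto simp: upty_def midty_def)
  obtain f g where fg: "ehm A fscale fscale e (model L) (model L' :: (nat \<times> nat \<Rightarrow> 'k) cospan) f" "ehm A fscale fscale e (model L') (model L :: (nat \<times> nat \<Rightarrow> 'k) cospan) g"
    "eho A fscale fscale (2 * e) (model L) (model L :: (nat \<times> nat \<Rightarrow> 'k) cospan) (mcomp g f) mid"
    using i by (auto simp: eint_def)
  have 1: "card ?P1 \<le> card {q \<in> {..<length L'}. \<exists>p\<in>?P1. ?E p q}"
    by (rule hall_condition[OF e fg B(1-3)]) (use P ut in auto)
  let ?K = "map sws L" and ?K' = "map sws L'"
  obtain f g where fg: "ehm (swA A) fscale fscale e (model ?K) (model ?K' :: (nat \<times> nat \<Rightarrow> 'k) cospan) f" "ehm (swA A) fscale fscale e (model ?K') (model ?K :: (nat \<times> nat \<Rightarrow> 'k) cospan) g"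
    "eho (swA A) fscale fscale (2 * e) (model ?K) (model ?K :: (nat \<times> nat \<Rightarrow> 'k) cospan) (mcomp g f) mid"
    using eint_model_sw[OF e i B] by (auto simp: eint_def)
  have l: "\<And>i. i < length ?K \<Longrightarrow> levin B (?K ! i)" "\<And>i. i < length ?K' \<Longrightarrow> levin B (?K' ! i)" using B levin_sws by auto
  have "card ?P2 \<le> card {q \<in> {..<length ?K'}. \<exists>p\<in>?P2. sle (swA A) e (?K ! p) (?K' ! q) \<and> sle (swA A) e (?K' ! q) (?K ! p)}"
    by (rule hall_condition[OF e fg l mono_on_swA[OF B(3,4)]]) (use P sws_sle(3,4) in auto)
  also have "\<dots> \<le> card {q \<in> {..<length L'}. \<exists>p\<in>?P2. ?E p q}"
  proof (rule card_mono)
    show "{q \<in> {..<length ?K'}. \<exists>p\<in>?P2. sle (swA A) e (?K ! p) (?K' ! q) \<and> sle (swA A) e (?K' ! q) (?K ! p)}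
      \<subseteq> {q \<in> {..<length L'}. \<exists>p\<in>?P2. ?E p q}"
    proof
      fix q assume "q \<in> {q \<in> {..<length ?K'}. \<exists>p\<in>?P2. sle (swA A) e (?K ! p) (?K' ! q) \<and> sle (swA A) e (?K' ! q) (?K ! p)}"
      then have "q \<in> {..<length ?K'}" and ex: "\<exists>p\<in>?P2. sle (swA A) e (?K ! p) (?K' ! q) \<and> sle (swA A) e (?K' ! q) (?K ! p)"
        by blast+
      then have q: "q < length L'" by simp
      obtain p where p: "p \<in> ?P2" "sle (swA A) e (?K ! p) (?K' ! q)" "sle (swA A) e (?K' ! q) (?K ! p)" using ex by blast
      have pl: "p < length L" "ty (L ! p) \<in> {2, 3}" using p(1) P by auto
      have "sle A e (L ! p) (L' ! q)" using sws_sle(1)[OF pl(2), of A e "L' ! q"] p(2) pl(1) q by simp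
      moreover have "sle A e (L' ! q) (L ! p)" using sws_sle(2)[OF pl(2), of A e "L' ! q"] p(3) pl(1) q by simp
      ultimately show "q \<in> {q \<in> {..<length L'}. \<exists>p\<in>?P2. ?E p q}" using p(1) q by blast
    qed
  qed simp
  finally have 2: "card ?P2 \<le> card {q \<in> {..<length L'}. \<exists>p\<in>?P2. ?E p q}" .
  have "card P = card (?P1 \<union> ?P2)" by (rule arg_cong[where f = card]) blast
  also have "\<dots> \<le> card ?P1 + card ?P2" by (rule card_Un_le)
  also have "\<dots> \<le> card {q \<in> {..<length L'}. \<exists>p\<in>?P1. ?E p q} + card {q \<in> {..<length L'}. \<exists>p\<in>?P2. ?E p q}" using 1 2 by simp
  also have "\<dots> = card ({q \<in> {..<length L'}. \<exists>p\<in>?P1. ?E p q} \<union> {q \<in> {..<length L'}. \<exists>p\<in>?P2. ?E p q})"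
  proof (rule card_Un_disjoint[symmetric])
    have "False" if "p \<in> ?P1" "?E p q" "p' \<in> ?P2" "?E p' q" for p p' q
    proof -
      have "ty (L ! p) = ty (L' ! q)" "ty (L ! p') = ty (L' ! q)" using that(2,4) unfolding sle_def by blast+
      then show False using CollectD[OF that(1)] CollectD[OF that(3)] by metis
    qed
    note F = this
    show "{q \<in> {..<length L'}. \<exists>p\<in>?P1. ?E p q} \<inter> {q \<in> {..<length L'}. \<exists>p\<in>?P2. ?E p q} = {}"
    proof (rule equals0I)
      fix q assume q: "q \<in> {q \<in> {..<length L'}. \<exists>p\<in>?P1. ?E p q} \<inter> {q \<in> {..<length L'}. \<exists>p\<in>?P2. ?E p q}"
      have "\<exists>p\<in>?P1. ?E p q" by (rule CollectD[OF IntD1[OF q], THEN conjunct2])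
      moreover have "\<exists>p\<in>?P2. ?E p q" by (rule CollectD[OF IntD2[OF q], THEN conjunct2])
      ultimately show False using F by (elim bexE)
    qed
  qed simp_all
  also have "\<dots> \<le> card {q \<in> {..<length L'}. \<exists>p\<in>P. ?E p q}"
  proof (rule card_mono)
    have m: "{q \<in> {..<length L'}. \<exists>p\<in>R. ?E p q} \<subseteq> {q \<in> {..<length L'}. \<exists>p\<in>P. ?E p q}" if "R \<subseteq> P" for R
      using that by (intro Collect_mono impI conjI) (erule conjunct1, meson subsetD)
    show "{q \<in> {..<length L'}. \<exists>p\<in>?P1. ?E p q} \<union> {q \<in> {..<length L'}. \<exists>p\<in>?P2. ?E p q} \<subseteq> {q \<in> {..<length L'}. \<exists>p\<in>P. ?E p q}"
      by (intro Un_least m Collect_restrict)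
  qed simp
  finally show "card P \<le> card {q \<in> {..<length L'}. \<exists>p\<in>P. ?E p q}" .
qed simp_all

theorem model_stability:
  fixes L L' :: "summand list"
  assumes e: "0 \<le> e" and i: "eint A fscale fscale e (model L) (model L' :: (nat \<times> nat \<Rightarrow> 'k::field) cospan)"
    and B: "\<And>i. i < length L \<Longrightarrow> levin B (L ! i)" "\<And>i. i < length L' \<Longrightarrow> levin B (L' ! i)" "mono_on (ereal ` B) A" "uminus ` B \<subseteq> B"
  shows "\<exists>r r'. (\<forall>p q. r q = Some p \<longleftrightarrow> r' p = Some q) \<and>
    (\<forall>p q. r q = Some p \<longrightarrow> p < length L \<and> q < length L' \<and> sle A e (L ! p) (L' ! q) \<and> sle A e (L' ! q) (L ! p)) \<and>
    (\<forall>p<length L. \<not> small A (2 * e) (L ! p) \<longrightarrow> r' p \<noteq> None) \<and> (\<forall>q<length L'. \<not> small A (2 * e) (L' ! q) \<longrightarrow> r q \<noteq> None)"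
proof -
  let ?P = "{p \<in> {..<length L}. \<not> small A (2 * e) (L ! p)}" and ?Q = "{p \<in> {..<length L'}. \<not> small A (2 * e) (L' ! p)}"
  let ?E = "\<lambda>p q. sle A e (L ! p) (L' ! q) \<and> sle A e (L' ! q) (L ! p)"
  obtain \<sigma> where s: "inj_on \<sigma> ?P" "\<forall>p\<in>?P. \<sigma> p \<in> {..<length L'} \<and> ?E p (\<sigma> p)"
    using stable_injection[OF e i B] by blast
  obtain \<tau> where t: "inj_on \<tau> ?Q" "\<forall>q\<in>?Q. \<tau> q \<in> {..<length L} \<and> ?E (\<tau> q) q"
    using stable_injection[OF e eint_sym[OF i] B(2,1,3,4)] by blast
  have sub: "?P \<subseteq> {..<length L}" "?Q \<subseteq> {..<length L'}" by auto
  obtain r r' where 1: "\<forall>p q. r q = Some p \<longleftrightarrow> r' p = Some q"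
    and 2: "\<forall>p q. r q = Some p \<longrightarrow> p \<in> {..<length L} \<and> q \<in> {..<length L'} \<and> ?E p q"
    and 3: "\<forall>p\<in>?P. r' p \<noteq> None" "\<forall>q\<in>?Q. r q \<noteq> None"
    using combine_matchings[OF s t sub] by (elim exE conjE) (rule that)
  have "\<forall>p q. r q = Some p \<longrightarrow> p < length L \<and> q < length L' \<and> ?E p q" using 2 by simp
  moreover have "\<forall>p<length L. \<not> small A (2 * e) (L ! p) \<longrightarrow> r' p \<noteq> None" using 3(1) by simp
  moreover have "\<forall>q<length L'. \<not> small A (2 * e) (L' ! q) \<longrightarrow> r q \<noteq> None" using 3(2) by simp
  ultimately show ?thesis using 1 by (intro exI[of _ r] exI[of _ r'] conjI)
qed

section \<open>Boundedness of the normal form\<close>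

text \<open>Each level of the sum is attained in \<open>C\<close>: the image of a basis vector under
  \<open>g\<close> is not higher than the vector, and mapping it back by \<open>f\<close> gives
  coefficient 1 at the same basis vector, so it is not lower either. The bounds on \<open>C\<close>
  then apply.\<close>

lemma up_levels_bounded:
  fixes s :: "'k::field \<Rightarrow> 'v::ab_group_add \<Rightarrow> 'v"
  assumes v: "vector_space s" and C: "is_cospan s C" and b: "bounded_cospan s \<Lambda> C"
    and i: "eiso real_of_ereal s fscale C (model L :: (nat \<times> nat \<Rightarrow> 'k) cospan)"
    and ns: "\<And>p. p < length L \<Longrightarrow> \<not> small real_of_ereal 0 (L ! p)"
    and p: "p < length L" "(j, k, a) \<in> set (up_basis (L ! p))"
  shows "- \<Lambda> < a \<and> a < \<Lambda>"
proof -
  let ?M = "model L :: (nat \<times> nat \<Rightarrow> 'k) cospan"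
  obtain f g where f: "ehm real_of_ereal s fscale 0 C ?M f" and g: "ehm real_of_ereal fscale s 0 ?M C g"
    and fg: "eho real_of_ereal fscale fscale 0 ?M ?M (mcomp f g) mid" using i by (auto simp: eiso_def)
  obtain h where h: "emor real_of_ereal fscale fscale 0 (-1) ?M ?M h" "ehtp fscale ?M ?M (mcomp f g) mid h"
    using fg by (auto simp: eho_def)
  note fe = ehm_emor[OF f] and ge = ehm_emor[OF g]
  note hl = emorD[OF h(1), THEN gmap_lin[OF vs_fscale vs_fscale]]
  note fl = emorD[OF fe, THEN gmap_lin[OF v vs_fscale]] and gl = emorD[OF ge, THEN gmap_lin[OF vs_fscale v]]
  let ?x = "unit (p, j) :: nat \<times> nat \<Rightarrow> 'k"
  have xg: "?x \<in> gcar fscale (upG ?M)" by (rule unit_gcar_up[OF p])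
  \<comment> \<open>The homotopy has shift 0, so an entry from the lower to the upper generator of a
    bar would require the bar to be small at 0.\<close>
  have hz: "mUp h (unit (p, 0)) (p, 1) = 0" if u: "is_up2 (L ! p)"
  proof (rule ccontr)
    assume n: "mUp h (unit (p, 0)) (p, 1) \<noteq> 0"
    from u obtain a0 b0 k0 where L: "L ! p = Up a0 b0 k0" by (cases "L ! p") auto
    then have "(0, k0, a0) \<in> set (up_basis (L ! p))" by simp
    from coef_level[OF h(1) levin_UNIV mono_on_real p(1) this n] L have "b0 \<le> a0" by auto
    then show False using ns[OF p(1)] L by (simp add: small_def)
  qed
  have j: "j = 0 \<or> j = 1" by (rule basis_slots(1)[OF p(2)])
  have 1: "mUp f (mUp g ?x) (p, j) = 1"
  proof -
    have "mUp f (mUp g ?x) (p, j) = ?x (p, j) - upD ?M (mUp h ?x) (p, j) - mUp h (upD ?M ?x) (p, j)"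
      using ehtpD(3)[OF h(2) xg] by (simp add: mcomp_def mid_def)
    moreover have "upD ?M (mUp h ?x) (p, j) = 0" using hz j by (auto simp: model_maps)
    moreover have "mUp h (upD ?M ?x) (p, j) = 0"
    proof (cases "j = 0")
      case True
      then have "upD ?M ?x = 0" by (auto simp: fun_eq_iff model_maps unit_apply)
      then show ?thesis using hl(2) by simp
    next
      case False
      then have j1: "j = 1" using j by simp
      then have u: "is_up2 (L ! p)" using upty_basis(4) p(2) by simp
      then have "upD ?M ?x = unit (p, 0)" using j1 p(1) by (auto simp: fun_eq_iff model_maps unit_apply)
      then show ?thesis using hz[OF u] j1 by simp
    qed
    ultimately show ?thesis by (simp add: unit_apply)
  qed
  let ?y = "mUp g ?x"
  have y0: "?y \<noteq> 0"
  proof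
    assume "?y = 0"
    then have "mUp f ?y = 0" using fl(2) by simp
    then show False using 1 by simp
  qed
  have yg: "?y \<in> gcar s (upG C)" using gl(2) xg by blast
  obtain c where c: "upL C ?y = ereal c" "- \<Lambda> < c" "c < \<Lambda>"
    using b yg y0 nonzero_levels(1)[OF v C yg y0] unfolding bounded_cospan_def by fastforce
  have ux: "upL ?M ?x = ereal a" by (rule upL_unit[OF p])
  have "c \<le> a" using emorL(1)[OF ge xg y0] unfolding ux c(1) by simp
  moreover have "a \<le> c"
  proof -
    have fy: "mUp f ?y \<in> gcar fscale (upG ?M)" using fl(2) yg by blast
    have fy0: "mUp f ?y \<noteq> 0"
    proof
      assume "mUp f ?y = 0"
      then have "mUp f ?y (p, j) = 0" by simp
      then show False using 1 by simp
    qed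
    have "ereal a \<le> upL ?M (mUp f ?y)" by (rule upL_ge[OF p]) (use 1 in simp)
    moreover have "upL ?M (mUp f ?y) \<in> range ereal"
      using levok_model[where B = UNIV and L = L, OF levin_UNIV] fy fy0 unfolding levok_def by blast
    ultimately have "a \<le> real_of_ereal (upL ?M (mUp f ?y))" by (metis ereal_less_eq(3) imageE real_of_ereal.simps(1))
    also have "\<dots> \<le> c" using emorL(1)[OF fe yg fy0] c by simp
    finally show ?thesis .
  qed
  ultimately show ?thesis using c by simp
qed

lemma bounded_sw: "bounded_cospan s \<Lambda> C \<Longrightarrow> bounded_cospan s \<Lambda> (sw C)"
  unfolding bounded_cospan_def sw_def by (auto simp: ereal_uminus_less_reorder ereal_less_uminus_reorder)

text \<open>The finite-dimensional representative may have levels anywhere, and its decomposition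
  may contain bars of length zero at arbitrary places. Only after these are dropped do the levels
  become invariants of the equivalence class and inherit the bounds of \<open>C\<close>.\<close>

theorem exists_valid_nf:
  fixes s :: "'k::field \<Rightarrow> 'v::ab_group_add \<Rightarrow> 'v"
  assumes v: "vector_space s" and C: "is_cospan s C" and b: "bounded_cospan s \<Lambda> C" and fin: "finite_type s C"
  shows "\<exists>L. list_all (valid_summand \<Lambda>) L \<and> eiso real_of_ereal s fscale C (model L :: (nat \<times> nat \<Rightarrow> 'k) cospan)"
proof -
  obtain F :: "(nat \<Rightarrow> 'k) cospan" where F: "is_cospan fscale F" "fdc fscale F" "hco_iso s fscale C F"
    using fin unfolding finite_type_def fdc_def by blast
  obtain L1 where L1: "okl real_of_ereal L1" "eiso real_of_ereal fscale fscale F (model L1 :: (nat \<times> nat \<Rightarrow> 'k) cospan)"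
    using exists_nf[OF vs_fscale F(1,2)] by (auto simp: hasnf_def)
  obtain L where L: "set L \<subseteq> set L1" "\<And>x. x \<in> set L \<Longrightarrow> \<not> small real_of_ereal 0 x"
    "eiso real_of_ereal fscale fscale (model L1) (model L :: (nat \<times> nat \<Rightarrow> 'k) cospan)"
    using model_drop[of L1] by blast
  note gC = good_real[OF v C] and gF = good_real[OF vs_fscale F(1)]
  have "eiso real_of_ereal s fscale C F"
    using F(3) hco_iso_eiso[OF goodD(1)[OF gC] goodD(1)[OF gF] levok_UNIV[OF v C] levok_UNIV[OF vs_fscale F(1)], of real_of_ereal] by simp
  then have i: "eiso real_of_ereal s fscale C (model L :: (nat \<times> nat \<Rightarrow> 'k) cospan)"
    using eiso_trans[OF gC gF good_real_model _ L1(2)] eiso_trans[OF gC good_real_model good_real_model _ L(3)] by blast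
  \<comment> \<open>The bound is proved for ascending levels; descending ones are ascending after
    the exchange of the arms.\<close>
  have isw: "eiso (swA real_of_ereal) s fscale (sw C) (model (map sws L) :: (nat \<times> nat \<Rightarrow> 'k) cospan)"
    by (rule eiso_model_sw[where B = UNIV, OF v gC _ levin_UNIV mono_on_real _ _ i])
      (simp_all only: swA_real good_real[OF v is_cospan_sw[OF C]] mono_on_real subset_UNIV)
  have nss: "small real_of_ereal 0 (sws x) = small real_of_ereal 0 x" for x by (cases x) (simp_all add: small_def)
  have up: "- \<Lambda> < a \<and> a < \<Lambda>" if "p < length L" "(j, k, a) \<in> set (up_basis (L ! p))" for p j k a
    by (rule up_levels_bounded[OF v C b i _ that]) (use L(2) in simp)
  have dn: "- \<Lambda> < a \<and> a < \<Lambda>" if pl: "p < length L" "(j, k, a) \<in> set (dn_basis (L ! p))" for p j k a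
  proof -
    have "(swj j, k, - a) \<in> set (up_basis (map sws L ! p))" using pl by (simp add: sws_basis swj_simps)
    then have "- \<Lambda> < - a \<and> - a < \<Lambda>"
      by (intro up_levels_bounded[OF v is_cospan_sw[OF C] bounded_sw[OF b] isw[unfolded swA_real]]) (use L(2) pl nss in auto)
    then show ?thesis by simp
  qed
  have "valid_summand \<Lambda> (L ! p)" if "p < length L" for p
  proof -
    have ok: "ty (L ! p) \<in> {0, 2} \<longrightarrow> c1 real_of_ereal (L ! p) < c2 real_of_ereal (L ! p)"
      using L(2)[of "L ! p"] that by (auto simp: small_def)
    have u: "\<forall>j k a. (j, k, a) \<in> set (up_basis (L ! p)) \<longrightarrow> - \<Lambda> < a \<and> a < \<Lambda>" using up[OF that] by blast
    have d: "\<forall>j k a. (j, k, a) \<in> set (dn_basis (L ! p)) \<longrightarrow> - \<Lambda> < a \<and> a < \<Lambda>" using dn[OF that] by blast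
    show ?thesis using ok u d by (cases "L ! p") auto
  qed
  then show ?thesis using i by (auto simp: list_all_length)
qed

section \<open>The flow on the strip\<close>

locale strip =
  fixes \<Lambda> :: real and \<phi> :: "ereal \<Rightarrow> real"
  assumes pos: "\<Lambda> > 0" and mono: "mono \<phi>" and homeo: "\<exists>\<psi>. homeomorphism (UNIV :: ereal set) {-\<Lambda>..\<Lambda>} \<phi> \<psi>"
begin

abbreviation H where "H \<equiv> inv \<phi>"

lemma range_phi: "range \<phi> = {-\<Lambda>..\<Lambda>}" and inj_phi: "inj \<phi>"
  using homeo by (auto simp: homeomorphism_def intro: inj_on_inverseI)

lemma phi_le: "\<phi> x \<le> \<phi> y \<longleftrightarrow> x \<le> y"
  using monoD[OF mono] inj_phi by (metis inj_eq linorder_le_cases order_antisym)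

lemma H_phi: "H (\<phi> x) = x" and phi_H: "t \<in> {-\<Lambda>..\<Lambda>} \<Longrightarrow> \<phi> (H t) = t"
  using inj_phi range_phi by (auto simp: f_inv_into_f)

lemma H_le: "a \<in> {-\<Lambda>..\<Lambda>} \<Longrightarrow> b \<in> {-\<Lambda>..\<Lambda>} \<Longrightarrow> H a \<le> H b \<longleftrightarrow> a \<le> b"
  using phi_le[of "H a" "H b"] phi_H by simp

lemma phi_mem: "- \<Lambda> \<le> \<phi> x" "\<phi> x \<le> \<Lambda>"
  using range_phi by (metis atLeastAtMost_iff rangeI)+

lemma H_ends: "H \<Lambda> = \<infinity>" "H (- \<Lambda>) = - \<infinity>"
proof -
  have "\<phi> \<infinity> \<ge> \<phi> (H \<Lambda>)" "\<phi> (- \<infinity>) \<le> \<phi> (H (- \<Lambda>))" unfolding phi_le by simp_all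
  then have "\<phi> \<infinity> = \<Lambda>" "\<phi> (- \<infinity>) = - \<Lambda>" using phi_H pos phi_mem[of \<infinity>] phi_mem[of "- \<infinity>"] by simp_all
  then show "H \<Lambda> = \<infinity>" "H (- \<Lambda>) = - \<infinity>" using H_phi by metis+
qed

lemma rho_mem: "- \<Lambda> \<le> rho \<phi> e t" "rho \<phi> e t \<le> \<Lambda>"
  using phi_mem by (auto simp: rho_def)

lemma H_rho: "H (rho \<phi> e t) = ereal e + H t"
  by (simp add: rho_def H_phi)

lemma rho_le: "b \<in> {-\<Lambda>..\<Lambda>} \<Longrightarrow> rho \<phi> e a \<le> b \<longleftrightarrow> ereal e + H a \<le> H b"
  and le_rho: "b \<in> {-\<Lambda>..\<Lambda>} \<Longrightarrow> b \<le> rho \<phi> e a \<longleftrightarrow> H b \<le> ereal e + H a"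
  using H_le[of "rho \<phi> e a" b] H_le[of b "rho \<phi> e a"] rho_mem by (simp_all add: H_rho)

lemma rho_galois: "a \<in> {-\<Lambda>..\<Lambda>} \<Longrightarrow> b \<in> {-\<Lambda>..\<Lambda>} \<Longrightarrow> rho \<phi> (- e) a \<le> b \<longleftrightarrow> a \<le> rho \<phi> e b"
  unfolding rho_le le_rho by (cases "H a"; cases "H b") auto

lemma rho_ends: "rho \<phi> e \<Lambda> = \<Lambda>" "rho \<phi> e (- \<Lambda>) = - \<Lambda>"
  using phi_H[of \<Lambda>] phi_H[of "- \<Lambda>"] pos by (simp_all add: rho_def H_ends)

lemma rho_less: "t \<in> {-\<Lambda>..\<Lambda>} \<Longrightarrow> t < \<Lambda> \<Longrightarrow> rho \<phi> e t < \<Lambda>" "t \<in> {-\<Lambda>..\<Lambda>} \<Longrightarrow> - \<Lambda> < t \<Longrightarrow> - \<Lambda> < rho \<phi> e t"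
proof -
  assume t: "t \<in> {-\<Lambda>..\<Lambda>}"
  { assume "t < \<Lambda>"
    then have "H t \<noteq> \<infinity>" using H_le[of \<Lambda> t] t pos by (auto simp: H_ends)
    then show "rho \<phi> e t < \<Lambda>" using le_rho[of \<Lambda> e t] pos by (cases "H t") (auto simp: H_ends not_le[symmetric])
  }
  { assume "- \<Lambda> < t"
    then have "H t \<noteq> - \<infinity>" using H_le[of t "- \<Lambda>"] t pos by (auto simp: H_ends)
    then show "- \<Lambda> < rho \<phi> e t" using rho_le[of "- \<Lambda>" e t] pos by (cases "H t") (auto simp: H_ends not_le[symmetric])
  }
qed

text \<open>Cell \<open>n\<close> is the half-open interval of length \<open>2 * \<Lambda>\<close>
  centred at \<open>2 * \<Lambda> * n\<close>.\<close>

definition cell :: "real \<Rightarrow> int" where "cell z = \<lfloor>(z + \<Lambda>) / (2 * \<Lambda>)\<rfloor>"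

text \<open>The one-dimensional flow whose product with its inverse is the flow of the strip.\<close>
definition flo :: "real \<Rightarrow> real \<Rightarrow> real" where
  "flo e z = (let w = z - 2 * \<Lambda> * of_int (cell z) in
     (if even (cell z) then rho \<phi> e w else - rho \<phi> (- e) (- w)) + 2 * \<Lambda> * of_int (cell z))"

lemma cell_eq: "- \<Lambda> \<le> w \<Longrightarrow> w < \<Lambda> \<Longrightarrow> cell (w + 2 * \<Lambda> * of_int n) = n"
  unfolding cell_def using pos by (intro floor_unique) (auto simp: field_simps)

lemma ex_cell: "\<exists>w n. z = w + 2 * \<Lambda> * of_int n \<and> - \<Lambda> \<le> w \<and> w < \<Lambda>"
proof -
  have "of_int (cell z) \<le> (z + \<Lambda>) / (2 * \<Lambda>)" "(z + \<Lambda>) / (2 * \<Lambda>) < of_int (cell z) + 1"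
    unfolding cell_def by linarith+
  then have "2 * \<Lambda> * of_int (cell z) \<le> z + \<Lambda>" "z + \<Lambda> < 2 * \<Lambda> * of_int (cell z) + 2 * \<Lambda>"
    using pos by (simp_all add: field_simps)
  then show ?thesis by (intro exI[of _ "z - 2 * \<Lambda> * of_int (cell z)"] exI[of _ "cell z"]) auto
qed

text \<open>The right end of a cell already belongs to the next one; the formula holds there too,
  since both endpoints are fixed by \<open>rho\<close>.\<close>

lemma flo_cell:
  assumes "- \<Lambda> \<le> w" "w \<le> \<Lambda>"
  shows "flo e (w + 2 * \<Lambda> * of_int n) = (if even n then rho \<phi> e w else - rho \<phi> (- e) (- w)) + 2 * \<Lambda> * of_int n"
proof (cases "w = \<Lambda>")
  case True
  then have z: "w + 2 * \<Lambda> * of_int n = - \<Lambda> + 2 * \<Lambda> * of_int (n + 1)" by (simp add: algebra_simps)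
  have "cell (w + 2 * \<Lambda> * of_int n) = n + 1" unfolding z using pos by (intro cell_eq) auto
  then show ?thesis using True unfolding flo_def Let_def by (auto simp: rho_ends algebra_simps)
next
  case False
  then show ?thesis using assms cell_eq[of w n] unfolding flo_def Let_def by auto
qed

lemma flo_0: "- \<Lambda> \<le> w \<Longrightarrow> w \<le> \<Lambda> \<Longrightarrow> flo e w = rho \<phi> e w"
  using flo_cell[of w e 0] by simp

lemma flo_bounds:
  assumes "- \<Lambda> \<le> w" "w < \<Lambda>"
  shows "2 * \<Lambda> * of_int n - \<Lambda> \<le> flo e (w + 2 * \<Lambda> * of_int n)" "flo e (w + 2 * \<Lambda> * of_int n) < 2 * \<Lambda> * of_int n + \<Lambda>"
  using rho_less(1)[of w e] rho_less(2)[of "- w" "- e"] rho_mem[of e w] rho_mem[of "- e" "- w"] assms flo_cell[of w e n]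
  by (auto split: if_splits)

text \<open>The reflection takes cell \<open>n\<close> to cell \<open>j - n\<close>, which has the
  other parity as \<open>j\<close> is odd; the formulas for even and odd cells are exchanged by
  negation together with reversal of time.\<close>

lemma flo_reflect:
  assumes "odd j"
  shows "flo e (2 * \<Lambda> * of_int j - z) = 2 * \<Lambda> * of_int j - flo (- e) z"
proof -
  obtain w n where z: "z = w + 2 * \<Lambda> * of_int n" and w: "- \<Lambda> \<le> w" "w < \<Lambda>" using ex_cell by blast
  have 1: "2 * \<Lambda> * of_int j - z = - w + 2 * \<Lambda> * of_int (j - n)" by (simp add: z algebra_simps)
  have "flo e (2 * \<Lambda> * of_int j - z) = (if even (j - n) then rho \<phi> e (- w) else - rho \<phi> (- e) w) + 2 * \<Lambda> * of_int (j - n)"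
    unfolding 1 using w flo_cell[of "- w" e "j - n"] by simp
  moreover have "flo (- e) z = (if even n then rho \<phi> (- e) w else - rho \<phi> e (- w)) + 2 * \<Lambda> * of_int n"
    unfolding z using w flo_cell[of w "- e" n] by simp
  ultimately show ?thesis using assms by (auto simp: algebra_simps)
qed

lemma cell_less: "n < m \<Longrightarrow> 2 * \<Lambda> * of_int n + \<Lambda> \<le> 2 * \<Lambda> * of_int m - \<Lambda>" for n m :: int
proof -
  assume "n < m"
  then have "of_int (n + 1) \<le> (of_int m :: real)" by (metis of_int_le_iff zless_imp_add1_zle)
  then have "2 * \<Lambda> * of_int (n + 1) \<le> 2 * \<Lambda> * of_int m" using pos by (intro mult_left_mono) auto
  then show ?thesis by (simp add: algebra_simps)
qed

text \<open>In different cells the comparison is decided by the cells, which the flow preserves; in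
  the same cell it is \<open>rho_galois\<close>, applied to the negated points if the cell is
  odd.\<close>

lemma flo_galois: "flo (- e) a \<le> b \<longleftrightarrow> a \<le> flo e b"
proof -
  obtain w n where a: "a = w + 2 * \<Lambda> * of_int n" and w: "- \<Lambda> \<le> w" "w < \<Lambda>" using ex_cell by blast
  obtain v m where b: "b = v + 2 * \<Lambda> * of_int m" and v: "- \<Lambda> \<le> v" "v < \<Lambda>" using ex_cell by blast
  note fa = flo_bounds[OF w, where n = n and e = "- e"] and fb = flo_bounds[OF v, where n = m and e = e]
  consider "n < m" | "m < n" | "n = m" by linarith
  then show ?thesis
  proof cases
    case 1
    then show ?thesis using cell_less[OF 1] fa fb w v unfolding a b by linarith
  next
    case 2
    then show ?thesis using cell_less[OF 2] fa fb w v unfolding a b by linarith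
  next
    case 3
    show ?thesis
      using rho_galois[of w v e] rho_galois[of "- v" "- w" e] w v flo_cell[of w "- e" n] flo_cell[of v e m] 3
      unfolding a b by auto
  qed
qed

section \<open>Closeness on the line and its integer invariant\<close>

definition clo :: "real \<Rightarrow> real \<Rightarrow> real \<Rightarrow> bool" where "clo e a b \<longleftrightarrow> a \<le> flo e b \<and> b \<le> flo e a"

lemma clo_reflect: "odd j \<Longrightarrow> clo e (2 * \<Lambda> * of_int j - a) (2 * \<Lambda> * of_int j - b) \<longleftrightarrow> clo e a b"
  unfolding clo_def flo_reflect using flo_galois[of e a b] flo_galois[of e b a] by auto

lemma clo_self: "0 \<le> e \<Longrightarrow> clo e a a"
proof -
  assume e: "0 \<le> e"
  obtain w n where a: "a = w + 2 * \<Lambda> * of_int n" and w: "- \<Lambda> \<le> w" "w < \<Lambda>" using ex_cell by blast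
  have "w \<le> rho \<phi> e w" "rho \<phi> (- e) (- w) \<le> - w"
    using le_rho[of w e w] rho_le[of "- w" "- e" "- w"] w e by (cases "H w"; cases "H (- w)"; simp)+
  then show ?thesis unfolding clo_def a using flo_cell[of w e n] w by auto
qed

text \<open>Even in the interior of a cell, odd on its boundary; constant along the flow and monotone in \<open>z\<close>.\<close>
definition hcode :: "real \<Rightarrow> int" where "hcode z = \<lfloor>(z / \<Lambda> + 1) / 2\<rfloor> + \<lceil>(z / \<Lambda> - 1) / 2\<rceil>"

text \<open>Negation exchanges floor and ceiling, and the two terms of \<open>hcode\<close> are
  mirror images of each other.\<close>

lemma hcode_reflect: "hcode (2 * \<Lambda> * of_int j - z) = 2 * j - hcode z"
proof -
  have q: "(2 * \<Lambda> * of_int j - z) / \<Lambda> = 2 * of_int j - z / \<Lambda>" using pos by (simp add: field_simps)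
  have e: "((2 * \<Lambda> * of_int j - z) / \<Lambda> + 1) / 2 = of_int j + - ((z / \<Lambda> - 1) / 2)"
    "((2 * \<Lambda> * of_int j - z) / \<Lambda> - 1) / 2 = of_int j + - ((z / \<Lambda> + 1) / 2)" unfolding q by argo+
  have f: "\<lfloor>of_int j + - u\<rfloor> = j - \<lceil>u\<rceil>" "\<lceil>of_int j + - u\<rceil> = j - \<lfloor>u\<rfloor>" for u :: real by linarith+
  show ?thesis unfolding hcode_def e f by simp
qed

lemma hcode_cell: "- \<Lambda> \<le> w \<Longrightarrow> w < \<Lambda> \<Longrightarrow> hcode (w + 2 * \<Lambda> * of_int n) = (if w = - \<Lambda> then 2 * n - 1 else 2 * n)"
proof -
  assume w: "- \<Lambda> \<le> w" "w < \<Lambda>"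
  have z: "(w + 2 * \<Lambda> * of_int n) / \<Lambda> = w / \<Lambda> + 2 * of_int n" using pos by (simp add: field_simps)
  have wb: "- 1 \<le> w / \<Lambda>" "w / \<Lambda> < 1" using w pos by (simp_all add: field_simps)
  have 1: "\<lfloor>((w + 2 * \<Lambda> * of_int n) / \<Lambda> + 1) / 2\<rfloor> = n" unfolding z using wb by (intro floor_unique) auto
  have 2: "\<lceil>((w + 2 * \<Lambda> * of_int n) / \<Lambda> - 1) / 2\<rceil> = n" if "w \<noteq> - \<Lambda>"
  proof -
    have "- 1 < w / \<Lambda>" using that w pos by (simp add: field_simps)
    then show ?thesis unfolding z using wb by (intro ceiling_unique) auto
  qed
  have 3: "\<lceil>((w + 2 * \<Lambda> * of_int n) / \<Lambda> - 1) / 2\<rceil> = n - 1" if "w = - \<Lambda>"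
  proof -
    have "w / \<Lambda> = - 1" using that pos by simp
    then show ?thesis unfolding z by (intro ceiling_unique) auto
  qed
  show ?thesis using 1 2 3 unfolding hcode_def by auto
qed

lemma hcode_base: "- \<Lambda> < w \<Longrightarrow> w < \<Lambda> \<Longrightarrow> hcode w = 0" "hcode \<Lambda> = 1" "hcode (- \<Lambda>) = - 1"
  using hcode_cell[of w 0] hcode_cell[of "- \<Lambda>" 1] hcode_cell[of "- \<Lambda>" 0] pos by auto

lemma hcode_0: "hcode y = 0 \<Longrightarrow> y \<in> {-\<Lambda><..<\<Lambda>}"
proof -
  assume h: "hcode y = 0"
  obtain w n where y: "y = w + 2 * \<Lambda> * of_int n" and w: "- \<Lambda> \<le> w" "w < \<Lambda>" using ex_cell by blast
  have c: "(if w = - \<Lambda> then 2 * n - 1 else 2 * n) = 0" using h hcode_cell[OF w, of n] unfolding y by simp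
  then have "w \<noteq> - \<Lambda>" by (auto split: if_splits) presburger
  then show ?thesis using c w y by auto
qed

text \<open>The flow maps every cell into itself and fixes its left end, so two points that bound
  each other along the flow share the cell and are both at its end or both inside.\<close>

lemma clo_code:
  assumes "clo e a b"
  shows "hcode a = hcode b"
proof -
  obtain w n where a: "a = w + 2 * \<Lambda> * of_int n" and w: "- \<Lambda> \<le> w" "w < \<Lambda>" using ex_cell by blast
  obtain v m where b: "b = v + 2 * \<Lambda> * of_int m" and v: "- \<Lambda> \<le> v" "v < \<Lambda>" using ex_cell by blast
  note fa = flo_bounds[OF w, where n = n and e = e] and fb = flo_bounds[OF v, where n = m and e = e]
  have c: "a \<le> flo e b" "b \<le> flo e a" using assms by (auto simp: clo_def)
  have "n = m"
  proof (rule ccontr)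
    assume "n \<noteq> m"
    then consider "n < m" | "m < n" by linarith
    then show False
    proof cases
      case 1 then show ?thesis using cell_less[OF 1] fa fb w v c unfolding a b by linarith
    next
      case 2 then show ?thesis using cell_less[OF 2] fa fb w v c unfolding a b by linarith
    qed
  qed
  moreover have "flo e (- \<Lambda> + 2 * \<Lambda> * of_int n) = - \<Lambda> + 2 * \<Lambda> * of_int n"
    using flo_cell[of "- \<Lambda>" e n] pos by (auto simp: rho_ends)
  ultimately have "w = - \<Lambda> \<longleftrightarrow> v = - \<Lambda>" using c w v unfolding a b by auto
  then show ?thesis using \<open>n = m\<close> w v hcode_cell unfolding a b by auto
qed

subsection \<open>Product structure\<close>

definition flow2 where "flow2 e v = (flo (- e) (fst v), flo e (snd v))"
definition clo2 where "clo2 e v w \<longleftrightarrow> clo e (fst v) (fst w) \<and> clo e (snd v) (snd w)"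
text \<open>Together with \<open>difc\<close> an integer invariant of closeness: \<open>TM\<close>
  exchanges the coordinates and reflects them, so it negates the sum of the codes and raises their
  difference by 4.\<close>

definition sumc where "sumc v = hcode (fst v) + hcode (snd v)"
definition difc where "difc v = hcode (snd v) - hcode (fst v)"

lemma TM_eq: "TM \<Lambda> v = (2 * \<Lambda> * of_int (- 1) - snd v, 2 * \<Lambda> * of_int 1 - fst v)"
  "TMinv \<Lambda> v = (2 * \<Lambda> * of_int 1 - snd v, 2 * \<Lambda> * of_int (- 1) - fst v)"
  by (simp_all add: TM_def TMinv_def)

lemma TM_invariants:
  "flow2 e (TM \<Lambda> v) = TM \<Lambda> (flow2 e v)" "flow2 e (TMinv \<Lambda> v) = TMinv \<Lambda> (flow2 e v)"
  "clo2 e (TM \<Lambda> v) (TM \<Lambda> w) = clo2 e v w" "clo2 e (TMinv \<Lambda> v) (TMinv \<Lambda> w) = clo2 e v w"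
  "sumc (TM \<Lambda> v) = - sumc v" "sumc (TMinv \<Lambda> v) = - sumc v"
  "difc (TM \<Lambda> v) = difc v + 4" "difc (TMinv \<Lambda> v) = difc v - 4"
  using flo_reflect[of "- 1"] flo_reflect[of 1] clo_reflect[of "- 1"] clo_reflect[of 1] hcode_reflect[of "- 1"] hcode_reflect[of 1]
  by (auto simp: TM_eq flow2_def clo2_def sumc_def difc_def)

lemma Tpow_simp: "Tpow \<Lambda> k v = (if even k then (fst v - 2 * \<Lambda> * of_int k, snd v + 2 * \<Lambda> * of_int k)
    else (- snd v - 2 * \<Lambda> * of_int k, - fst v + 2 * \<Lambda> * of_int k))"
proof -
  have p: "(TM \<Lambda> ^^ n) v = (if even n then (fst v - 2 * \<Lambda> * of_nat n, snd v + 2 * \<Lambda> * of_nat n)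
    else (- snd v - 2 * \<Lambda> * of_nat n, - fst v + 2 * \<Lambda> * of_nat n))" for n
    by (induction n) (auto simp: TM_def algebra_simps)
  have m: "(TMinv \<Lambda> ^^ n) v = (if even n then (fst v + 2 * \<Lambda> * of_nat n, snd v - 2 * \<Lambda> * of_nat n)
    else (- snd v + 2 * \<Lambda> * of_nat n, - fst v - 2 * \<Lambda> * of_nat n))" for n
    by (induction n) (auto simp: TMinv_def algebra_simps)
  show ?thesis unfolding Tpow_def using p[of "nat k"] m[of "nat (- k)"] by (auto simp: even_nat_iff)
qed

lemma Tpow_invariants:
  "flow2 e (Tpow \<Lambda> k v) = Tpow \<Lambda> k (flow2 e v)" "clo2 e (Tpow \<Lambda> k v) (Tpow \<Lambda> k w) = clo2 e v w"
  "sumc (Tpow \<Lambda> k v) = (if even k then sumc v else - sumc v)" "difc (Tpow \<Lambda> k v) = difc v + 4 * k"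
proof -
  have n: "flow2 e ((TM \<Lambda> ^^ n) v) = (TM \<Lambda> ^^ n) (flow2 e v) \<and> flow2 e ((TMinv \<Lambda> ^^ n) v) = (TMinv \<Lambda> ^^ n) (flow2 e v)
    \<and> clo2 e ((TM \<Lambda> ^^ n) v) ((TM \<Lambda> ^^ n) w) = clo2 e v w \<and> clo2 e ((TMinv \<Lambda> ^^ n) v) ((TMinv \<Lambda> ^^ n) w) = clo2 e v w
    \<and> sumc ((TM \<Lambda> ^^ n) v) = (if even n then sumc v else - sumc v) \<and> sumc ((TMinv \<Lambda> ^^ n) v) = (if even n then sumc v else - sumc v)
    \<and> difc ((TM \<Lambda> ^^ n) v) = difc v + 4 * int n \<and> difc ((TMinv \<Lambda> ^^ n) v) = difc v - 4 * int n" for n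
    by (induction n) (auto simp: TM_invariants)
  show "flow2 e (Tpow \<Lambda> k v) = Tpow \<Lambda> k (flow2 e v)" "clo2 e (Tpow \<Lambda> k v) (Tpow \<Lambda> k w) = clo2 e v w"
    "sumc (Tpow \<Lambda> k v) = (if even k then sumc v else - sumc v)" "difc (Tpow \<Lambda> k v) = difc v + 4 * k"
    using n[of "nat k"] n[of "nat (- k)"] unfolding Tpow_def by (auto simp: even_nat_iff)
qed

text \<open>Points that lie in a translate of one of the three pieces, where the defining
  description of the flow has a value. It is verified for boundary points and for points of
  summands.\<close>

definition dec where "dec v \<longleftrightarrow> (\<exists>k x y. v = Tpow \<Lambda> k (x, y) \<and> (x, y) \<in> SM \<Lambda> \<union> LM \<Lambda> \<union> AM \<Lambda>)"

lemma flow2_domain: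
  "(x, y) \<in> SM \<Lambda> \<Longrightarrow> flow2 e (x, y) = (rho \<phi> (- e) x, rho \<phi> e y)"
  "(x, y) \<in> LM \<Lambda> \<Longrightarrow> flow2 e (x, y) = (- 2 * \<Lambda> - rho \<phi> e (- 2 * \<Lambda> - x), rho \<phi> e y)"
  "(x, y) \<in> AM \<Lambda> \<Longrightarrow> flow2 e (x, y) = (rho \<phi> (- e) x, 2 * \<Lambda> - rho \<phi> (- e) (2 * \<Lambda> - y))"
  using flo_reflect[of "- 1" "- e" "- 2 * \<Lambda> - x"] flo_reflect[of 1 e "2 * \<Lambda> - y"]
  by (auto simp: flow2_def SM_def LM_def AM_def flo_0)

text \<open>Every way of writing \<open>v\<close> as a translate gives the value
  \<open>flow2 e v\<close>, since \<open>flow2\<close> commutes with the translation and agrees with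
  each of the three formulas; this is the uniqueness that the description requires.\<close>

lemma flowM_eq: "dec v \<Longrightarrow> flowM \<Lambda> \<phi> e v = flow2 e v"
  unfolding flowM_def
proof (rule the_equality)
  assume "dec v"
  then obtain k x y where "v = Tpow \<Lambda> k (x, y)" "(x, y) \<in> SM \<Lambda> \<union> LM \<Lambda> \<union> AM \<Lambda>" by (auto simp: dec_def)
  then show "\<exists>k x y. v = Tpow \<Lambda> k (x, y) \<and>
     (((x, y) \<in> SM \<Lambda> \<and> flow2 e v = Tpow \<Lambda> k (rho \<phi> (-e) x, rho \<phi> e y)) \<or>
      ((x, y) \<in> LM \<Lambda> \<and> flow2 e v = Tpow \<Lambda> k (- 2 * \<Lambda> - rho \<phi> e (- 2 * \<Lambda> - x), rho \<phi> e y)) \<or>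
      ((x, y) \<in> AM \<Lambda> \<and> flow2 e v = Tpow \<Lambda> k (rho \<phi> (-e) x, 2 * \<Lambda> - rho \<phi> (-e) (2 * \<Lambda> - y))))"
    using flow2_domain[of x y e] Tpow_invariants(1)[of e k "(x, y)"]
    by (intro exI[of _ k] exI[of _ x] exI[of _ y]) auto
next
  fix u
  assume "\<exists>k x y. v = Tpow \<Lambda> k (x, y) \<and>
     (((x, y) \<in> SM \<Lambda> \<and> u = Tpow \<Lambda> k (rho \<phi> (-e) x, rho \<phi> e y)) \<or>
      ((x, y) \<in> LM \<Lambda> \<and> u = Tpow \<Lambda> k (- 2 * \<Lambda> - rho \<phi> e (- 2 * \<Lambda> - x), rho \<phi> e y)) \<or>
      ((x, y) \<in> AM \<Lambda> \<and> u = Tpow \<Lambda> k (rho \<phi> (-e) x, 2 * \<Lambda> - rho \<phi> (-e) (2 * \<Lambda> - y))))"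
  then show "u = flow2 e v" using flow2_domain[of _ _ e] Tpow_invariants(1)[of e] by force
qed

lemma precM_flow2: "precM v (flow2 e w) \<and> precM w (flow2 e v) \<longleftrightarrow> clo2 e v w"
  unfolding precM_def flow2_def clo2_def clo_def using flo_galois by auto

lemma dM_eq: "dec v \<Longrightarrow> dec w \<Longrightarrow> dM \<Lambda> \<phi> v w = Inf (ereal ` {e. 0 < e \<and> clo2 e v w})"
  unfolding dM_def by (simp add: flowM_eq precM_flow2)

lemma dM_le: "dec v \<Longrightarrow> dec w \<Longrightarrow> 0 < e \<Longrightarrow> clo2 e v w \<Longrightarrow> dM \<Lambda> \<phi> v w \<le> ereal e"
  unfolding dM_eq by (rule Inf_lower) auto

text \<open>An infimum at most \<open>e\<close> need not be attained, but it has a witness below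
  every \<open>e' > e\<close>. This is the slack that reappears when matchings are turned into
  interleavings.\<close>

lemma dM_leD: "dec v \<Longrightarrow> dec w \<Longrightarrow> dM \<Lambda> \<phi> v w \<le> ereal e \<Longrightarrow> e < e' \<Longrightarrow> \<exists>d. 0 < d \<and> d < e' \<and> clo2 d v w"
proof -
  assume d: "dec v" "dec w" "dM \<Lambda> \<phi> v w \<le> ereal e" "e < e'"
  then have "Inf (ereal ` {e. 0 < e \<and> clo2 e v w}) < ereal e'" unfolding dM_eq[OF d(1,2)] using le_less_trans by fastforce
  then show ?thesis by (auto simp: Inf_less_iff)
qed

lemma Tpow_inverse: "Tpow \<Lambda> k (Tpow \<Lambda> (- k) v) = v"
  by (cases v) (simp add: Tpow_simp)

lemma Tpow_bdM: "v \<in> bdM \<Lambda> \<Longrightarrow> Tpow \<Lambda> k v \<in> bdM \<Lambda>"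
  by (cases v) (auto simp: Tpow_simp bdM_def abs_if split: if_splits)

text \<open>A boundary point is determined by one coordinate. The cell of \<open>- x\<close> on the
  upper line, of \<open>y\<close> on the lower one, tells which power of \<open>TM\<close> brings
  the point into \<open>AM \<Lambda>\<close> or \<open>LM \<Lambda>\<close>.\<close>

lemma dec_bdM:
  assumes "v \<in> bdM \<Lambda>"
  shows "dec v"
proof -
  obtain x y where v: "v = (x, y)" by (cases v)
  have "x + y = 2 * \<Lambda> \<or> x + y = - 2 * \<Lambda>" using assms pos by (auto simp: v bdM_def abs_if split: if_splits)
  moreover have I: "dec v" if "Tpow \<Lambda> (- n) v \<in> SM \<Lambda> \<union> LM \<Lambda> \<union> AM \<Lambda>" for n
    using that Tpow_inverse[of n v] unfolding dec_def by (metis prod.exhaust)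
  ultimately show ?thesis
  proof (elim disjE)
    assume s: "x + y = 2 * \<Lambda>"
    obtain w n where z: "- x = w + 2 * \<Lambda> * of_int n" and w: "- \<Lambda> \<le> w" "w < \<Lambda>" using ex_cell by blast
    show ?thesis
      by (rule I[of n]) (use s z w in \<open>auto simp: v Tpow_simp AM_def LM_def\<close>)
  next
    assume s: "x + y = - 2 * \<Lambda>"
    obtain w n where z: "y = w + 2 * \<Lambda> * of_int n" and w: "- \<Lambda> \<le> w" "w < \<Lambda>" using ex_cell by blast
    show ?thesis
      by (rule I[of n]) (use s z w in \<open>auto simp: v Tpow_simp AM_def LM_def\<close>)
  qed
qed

lemma sumc_bdM:
  assumes "(x, y) \<in> bdM \<Lambda>"
  shows "x + y = 2 * \<Lambda> \<and> sumc (x, y) = 2 \<or> x + y = - 2 * \<Lambda> \<and> sumc (x, y) = - 2"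
proof -
  have "x + y = 2 * \<Lambda> \<or> x + y = - 2 * \<Lambda>" using assms pos by (auto simp: bdM_def abs_if split: if_splits)
  then show ?thesis
  proof
    assume s: "x + y = 2 * \<Lambda>"
    then have "y = 2 * \<Lambda> - x" by simp
    then have "sumc (x, y) = 2" using hcode_reflect[of 1 x] by (simp only: sumc_def) simp
    then show ?thesis using s by simp
  next
    assume s: "x + y = - 2 * \<Lambda>"
    then have "y = - (2 * \<Lambda>) - x" by simp
    then have "sumc (x, y) = - 2" using hcode_reflect[of "- 1" x] by (simp only: sumc_def) simp
    then show ?thesis using s by simp
  qed
qed

subsection \<open>Points of summands\<close>

text \<open>The inverse of \<open>\<phi>\<close> is infinite only at the two ends of the interval,
  so on the open interval no information is lost by passing to a real number.\<close>

definition AA :: "ereal \<Rightarrow> real" where "AA l = real_of_ereal (H (real_of_ereal l))"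

abbreviation B where "B \<equiv> {-\<Lambda><..<\<Lambda>}"

lemma H_AA: "a \<in> B \<Longrightarrow> H a = ereal (AA (ereal a))"
  using H_le[of \<Lambda> a] H_le[of a "- \<Lambda>"] pos unfolding AA_def by (cases "H a") (auto simp: H_ends)

lemma AA_le: "a \<in> B \<Longrightarrow> b \<in> B \<Longrightarrow> a \<le> b \<longleftrightarrow> AA (ereal a) \<le> AA (ereal b)"
  using H_le[of a b] H_AA[of a] H_AA[of b] by simp

lemma AA_rho: 
  assumes "a \<in> B" "b \<in> B"
  shows "rho \<phi> (- e) a \<le> b \<longleftrightarrow> AA (ereal a) \<le> AA (ereal b) + e" "rho \<phi> e a \<ge> b \<longleftrightarrow> AA (ereal a) \<ge> AA (ereal b) - e"
  using rho_le[of b "- e" a] le_rho[of b e a] H_AA[of a] H_AA[of b] assms by auto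

lemma AA_mono: "mono_on (ereal ` B) AA"
  by (intro mono_onI) (auto simp: AA_le[symmetric])

lemma clo_B: "a \<in> B \<Longrightarrow> b \<in> B \<Longrightarrow> clo e a b \<longleftrightarrow> AA (ereal a) \<le> AA (ereal b) + e \<and> AA (ereal b) \<le> AA (ereal a) + e"
  using le_rho[of b e a] le_rho[of a e b] H_AA[of a] H_AA[of b] by (auto simp: clo_def flo_0)

lemma clo_reflect1: "clo e (- (2 * \<Lambda>) - a) (- (2 * \<Lambda>) - b) \<longleftrightarrow> clo e a b" "clo e (2 * \<Lambda> - a) (2 * \<Lambda> - b) \<longleftrightarrow> clo e a b"
  using clo_reflect[of "- 1" e a b] clo_reflect[of 1 e a b] by simp_all

section \<open>Points of summands and what their codes determine\<close>

fun twist :: "summand \<Rightarrow> int" where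
  "twist (Up a b k) = - k - 1" | "twist (Dn a b k) = - k - 1" | "twist (Sq k) = - k + 1"
| "twist (UpInf a k) = - k" | "twist (DnInf a k) = - k" | "twist (Gt a b k) = - k" | "twist (SE a k) = - k" | "twist (NE a k) = - k"

fun base :: "summand \<Rightarrow> real \<times> real" where
  "base (Up a b k) = (- (2 * \<Lambda>) - a, b)" | "base (Dn a b k) = (b, 2 * \<Lambda> - a)" | "base (Sq k) = (\<Lambda>, - \<Lambda>)"
| "base (UpInf a k) = (\<Lambda>, a)" | "base (DnInf a k) = (a, - \<Lambda>)" | "base (Gt a b k) = (a, b)"
| "base (SE a k) = (a, \<Lambda>)" | "base (NE a k) = (- \<Lambda>, a)"

lemma summand_pt_base: "summand_pt \<Lambda> s = Tpow \<Lambda> (twist s) (base s)"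
  by (cases s) simp_all

lemma base_domain: "valid_summand \<Lambda> s \<Longrightarrow> base s \<in> SM \<Lambda> \<union> LM \<Lambda> \<union> AM \<Lambda>"
  using pos by (cases s) (auto simp: SM_def LM_def AM_def)

lemma dec_pt: "valid_summand \<Lambda> s \<Longrightarrow> dec (summand_pt \<Lambda> s)"
  using base_domain[of s] unfolding summand_pt_base dec_def by (cases "base s") auto

lemma base_codes:
  assumes "valid_summand \<Lambda> s"
  shows "hcode (fst (base s)) = [-2, 1, 0, 0, 0, 0, -1, 1] ! ty s" "hcode (snd (base s)) = [0, 0, 2, -1, 0, 1, 0, -1] ! ty s"
  using assms pos hcode_reflect[of "- 1"] hcode_reflect[of 1] by (cases s; simp add: hcode_base)+

lemma twist_eq: "twist s = - dg s + (if ty s \<in> {0, 2} then - 1 else if ty s = 7 then 1 else 0)"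
  by (cases s) simp_all

lemma pt_codes:
  assumes "valid_summand \<Lambda> s"
  shows "sumc (summand_pt \<Lambda> s) = (if even (twist s) then 1 else - 1) * [-2, 1, 2, -1, 0, 1, -1, 0] ! ty s"
    "difc (summand_pt \<Lambda> s) = [2, -1, 2, -1, 0, 1, 1, -2] ! ty s + 4 * twist s"
proof -
  have "sumc (base s) = [-2, 1, 2, -1, 0, 1, -1, 0] ! ty s" "difc (base s) = [2, -1, 2, -1, 0, 1, 1, -2] ! ty s"
    unfolding sumc_def difc_def base_codes[OF assms] by (cases s; simp)+
  then show "sumc (summand_pt \<Lambda> s) = (if even (twist s) then 1 else - 1) * [-2, 1, 2, -1, 0, 1, -1, 0] ! ty s"
    "difc (summand_pt \<Lambda> s) = [2, -1, 2, -1, 0, 1, 1, -2] ! ty s + 4 * twist s"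
    unfolding summand_pt_base Tpow_invariants by auto
qed

text \<open>The code differences of base points lie between -2 and 2 and a twist changes them by
  multiples of 4. Different twists would thus need the values 2 and -2, that is, a finite bar
  against \<open>Sq\<close>, whose code sums differ in absolute value. With equal twists the two
  codes of the base point single out the type.\<close>

lemma codes_type:
  assumes "valid_summand \<Lambda> s" "valid_summand \<Lambda> s'"
    and "sumc (summand_pt \<Lambda> s) = sumc (summand_pt \<Lambda> s')" "difc (summand_pt \<Lambda> s) = difc (summand_pt \<Lambda> s')"
  shows "ty s = ty s' \<and> dg s = dg s'"
proof -
  let ?D = "\<lambda>s. [2, -1, 2, -1, 0, 1, 1, -2 :: int] ! ty s" and ?S = "\<lambda>s. [-2, 1, 2, -1, 0, 1, -1, 0 :: int] ! ty s"
  have S: "(if even (twist s) then 1 else - 1) * ?S s = (if even (twist s') then 1 else - 1) * ?S s'"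
    and D: "?D s + 4 * twist s = ?D s' + 4 * twist s'"
    using assms(3,4) unfolding pt_codes[OF assms(1)] pt_codes[OF assms(2)] .
  have b: "- 2 \<le> ?D s \<and> ?D s \<le> 2" for s by (cases s) simp_all
  have far: False if "?D s = 2" "?D s' = - 2" "\<bar>?S s\<bar> = \<bar>?S s'\<bar>" for s s' using that by (cases s; cases s') simp_all
  have eq: "ty s = ty s'" if "?D s = ?D s'" "?S s = ?S s'" for s s' using that by (cases s; cases s') simp_all
  have a: "\<bar>?S s\<bar> = \<bar>?S s'\<bar>" using arg_cong[OF S, of abs] by (simp only: abs_mult) (simp only: abs_minus_cancel abs_one if_distrib if_cancel mult_1)
  have "twist s = twist s'"
  proof (rule ccontr)
    assume "twist s \<noteq> twist s'"
    then consider "?D s \<ge> ?D s' + 4" | "?D s' \<ge> ?D s + 4" using D by linarith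
    then show False
    proof cases
      case 1
      then have "?D s = 2" "?D s' = - 2" using b[of s] b[of s'] by linarith+
      then show ?thesis using far a by blast
    next
      case 2
      then have "?D s' = 2" "?D s = - 2" using b[of s] b[of s'] by linarith+
      then show ?thesis using far a by metis
    qed
  qed
  moreover from this have "ty s = ty s'"
  proof (intro eq)
    assume tw: "twist s = twist s'"
    show "?D s = ?D s'" using D unfolding tw by simp
    show "?S s = ?S s'" using S unfolding tw by (simp only: mult_cancel_left split: if_splits) (simp_all del: nth_Cons)
  qed
  ultimately show ?thesis unfolding twist_eq by (metis add_right_cancel neg_equal_iff_equal)
qed

lemma clo2_codes: "clo2 e v w \<Longrightarrow> sumc v = sumc w \<and> difc v = difc w"
  using clo_code by (auto simp: clo2_def sumc_def difc_def)

lemma clo2_base: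
  assumes "valid_summand \<Lambda> s" "valid_summand \<Lambda> s'" "ty s = ty s'" "dg s = dg s'" "0 \<le> e"
  shows "clo2 e (base s) (base s') \<longleftrightarrow> sle AA e s s' \<and> sle AA e s' s"
  using assms by (cases s; cases s') (auto simp: clo2_def sle_def clo_B clo_reflect1 clo_self)

text \<open>For equal type and degree the common twist can be removed and closeness is that of the
  coordinates of the base points; in all other cases the codes differ.\<close>

lemma clo2_pt:
  assumes v: "valid_summand \<Lambda> s" "valid_summand \<Lambda> s'" and e: "0 \<le> e"
  shows "clo2 e (summand_pt \<Lambda> s) (summand_pt \<Lambda> s') \<longleftrightarrow> sle AA e s s' \<and> sle AA e s' s"
proof (cases "ty s = ty s' \<and> dg s = dg s'")
  case True
  then have "twist s = twist s'" by (simp add: twist_eq)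
  then show ?thesis using clo2_base[OF v _ _ e] True by (simp add: summand_pt_base Tpow_invariants)
next
  case False
  then have "\<not> clo2 e (summand_pt \<Lambda> s) (summand_pt \<Lambda> s')" using clo2_codes codes_type[OF v] by blast
  then show ?thesis using False by (auto simp: sle_def)
qed

text \<open>The nearest boundary point has the middle of the bar in both coordinates, where the
  middle is taken in the flow parameter; each end is at distance at most \<open>e\<close> from
  it.\<close>

lemma small_near_bd:
  assumes v: "valid_summand \<Lambda> s" and sm: "small AA (2 * e) s" and e: "0 < e"
  shows "near_bd \<Lambda> \<phi> e (summand_pt \<Lambda> s)"
proof -
  have mid: "\<exists>m\<in>B. clo e a m \<and> clo e b m" if ab: "a \<in> B" "b \<in> B" "\<bar>AA (ereal a) - AA (ereal b)\<bar> \<le> 2 * e" for a b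
  proof -
    let ?c = "ereal ((AA (ereal a) + AA (ereal b)) / 2)"
    \<comment> \<open>The inverse of \<open>\<phi>\<close> is infinite at the ends of the interval,
      whereas \<open>?c\<close> is finite.\<close>
    have ne: "\<phi> ?c \<noteq> \<Lambda>" "\<phi> ?c \<noteq> - \<Lambda>" using H_phi[of ?c] H_ends by (metis PInfty_neq_ereal(1) MInfty_neq_ereal(1))+
    then have m: "\<phi> ?c \<in> B" using phi_mem[of ?c] by auto
    have "AA (ereal (\<phi> ?c)) = (AA (ereal a) + AA (ereal b)) / 2" using H_AA[OF m] H_phi[of ?c] by simp
    then show ?thesis using m ab by (intro bexI[of _ "\<phi> ?c"]) (auto simp: clo_B abs_if field_simps split: if_splits)
  qed
  have "\<exists>u\<in>bdM \<Lambda>. clo2 e (base s) u"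
  proof (cases s)
    case (Up a b k)
    then have "a \<in> B" "b \<in> B" "\<bar>AA (ereal a) - AA (ereal b)\<bar> \<le> 2 * e" using sm v AA_le[of a b] by (auto simp: small_def abs_if)
    from mid[OF this] obtain m where "clo e a m" "clo e b m" by blast
    then show ?thesis using Up pos by (intro bexI[of _ "(- (2 * \<Lambda>) - m, m)"]) (auto simp: clo2_def clo_reflect1 bdM_def)
  next
    case (Dn a b k)
    then have "a \<in> B" "b \<in> B" "\<bar>AA (ereal a) - AA (ereal b)\<bar> \<le> 2 * e" using sm v AA_le[of b a] by (auto simp: small_def abs_if)
    from mid[OF this] obtain m where "clo e a m" "clo e b m" by blast
    then show ?thesis using Dn pos by (intro bexI[of _ "(m, 2 * \<Lambda> - m)"]) (auto simp: clo2_def clo_reflect1 bdM_def)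
  qed (use sm in \<open>simp_all add: small_def\<close>)
  then obtain u where u: "u \<in> bdM \<Lambda>" "clo2 e (base s) u" by blast
  then have "clo2 e (summand_pt \<Lambda> s) (Tpow \<Lambda> (twist s) u)" by (simp add: summand_pt_base Tpow_invariants)
  then show ?thesis unfolding near_bd_def
    using dM_le[OF dec_pt[OF v] dec_bdM[OF Tpow_bdM[OF u(1)]] e] Tpow_bdM[OF u(1)] by blast
qed

text \<open>A boundary point has code sum 2 or -2, and among base points only finite bars do. The
  codes also tell which boundary line is met and that its free coordinate lies in the open interval;
  both ends of the bar are then close to this one value.\<close>

lemma near_bd_small:
  assumes v: "valid_summand \<Lambda> s" and n: "near_bd \<Lambda> \<phi> e (summand_pt \<Lambda> s)" and e: "e < e'"
  shows "small AA (2 * e') s"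
proof -
  obtain u where u: "u \<in> bdM \<Lambda>" "dM \<Lambda> \<phi> (summand_pt \<Lambda> s) u \<le> ereal e" using n by (auto simp: near_bd_def)
  obtain d where d: "d < e'" "clo2 d (summand_pt \<Lambda> s) u" using dM_leD[OF dec_pt[OF v] dec_bdM[OF u(1)] u(2) e] by blast
  define w where "w = Tpow \<Lambda> (- twist s) u"
  have w: "w \<in> bdM \<Lambda>" unfolding w_def by (rule Tpow_bdM[OF u(1)])
  have "u = Tpow \<Lambda> (twist s) w" by (simp add: w_def Tpow_inverse)
  then have c: "clo2 d (base s) w" using d(2) by (simp add: summand_pt_base Tpow_invariants)
  obtain x y where xy: "w = (x, y)" by (cases w)
  have cx: "hcode x = hcode (fst (base s))" "hcode y = hcode (snd (base s))"
    using c clo_code unfolding clo2_def xy by auto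
  note b = sumc_bdM[OF w[unfolded xy]]
  show ?thesis
  proof (cases s)
    case (Up a b k)
    then have s: "x = - (2 * \<Lambda>) - y" using b cx base_codes[OF v] by (auto simp: sumc_def)
    have y: "y \<in> B" using cx(2) base_codes(2)[OF v] Up by (intro hcode_0) simp
    have "a \<in> B" "b \<in> B" using v Up by auto
    then show ?thesis using c y d(1) Up unfolding clo2_def xy s by (auto simp: clo_reflect1 clo_B small_def)
  next
    case (Dn a b k)
    then have s: "y = 2 * \<Lambda> - x" using b cx base_codes[OF v] by (auto simp: sumc_def)
    have y: "x \<in> B" using cx(1) base_codes(1)[OF v] Dn by (intro hcode_0) simp
    have "a \<in> B" "b \<in> B" using v Dn by auto
    then show ?thesis using c y d(1) Dn unfolding clo2_def xy s by (auto simp: clo_reflect1 clo_B small_def)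
  qed (use b cx base_codes[OF v] in \<open>auto simp: sumc_def\<close>)
qed

end

section \<open>Matchings of multisets and of index sets\<close>

lemma mset_set_split: "finite A \<Longrightarrow> D \<subseteq> A \<Longrightarrow> mset_set A = mset_set D + mset_set (A - D)"
  using mset_set_Union[of D "A - D"] by (simp add: finite_subset Un_absorb1)

lemma matchingI:
  assumes "finite A" "finite B" "D \<subseteq> A" "D' \<subseteq> B" and s: "bij_betw \<sigma> D D'"
    and "\<And>a. a \<in> D \<Longrightarrow> dM \<Lambda> \<phi> (f a) (g (\<sigma> a)) \<le> ereal e"
    and "\<And>a. a \<in> A - D \<Longrightarrow> near_bd \<Lambda> \<phi> e (f a)" "\<And>b. b \<in> B - D' \<Longrightarrow> near_bd \<Lambda> \<phi> e (g b)"
  shows "matching \<Lambda> \<phi> e (image_mset f (mset_set A)) (image_mset g (mset_set B))"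
proof -
  have f: "finite D" "finite D'" using assms by (auto intro: finite_subset)
  have "image_mset \<sigma> (mset_set D) = mset_set D'"
    using s image_mset_mset_set[of \<sigma> D] by (simp add: bij_betw_def)
  then have "image_mset snd (image_mset (\<lambda>a. (f a, g (\<sigma> a))) (mset_set D)) = image_mset g (mset_set D')"
    by (simp add: multiset.map_comp comp_def flip: \<open>image_mset \<sigma> (mset_set D) = mset_set D'\<close>)
  moreover have "image_mset fst (image_mset (\<lambda>a. (f a, g (\<sigma> a))) (mset_set D)) = image_mset f (mset_set D)"
    by (simp add: multiset.map_comp comp_def)
  ultimately show ?thesis unfolding matching_def mset_set_split[OF assms(1,3)] mset_set_split[OF assms(2,4)]
    using assms f
    by (intro exI[of _ "image_mset f (mset_set D)"] exI[of _ "image_mset g (mset_set D')"]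
        exI[of _ "image_mset (\<lambda>a. (f a, g (\<sigma> a))) (mset_set D)"]) auto
qed

text \<open>Multisets forget which index a point came from, and equal points may be attributed to
  any of their indices. Each pair of \<open>R\<close> uses up one index on either side.\<close>

lemma submultisets_bij:
  assumes "finite A" "finite B" "image_mset fst R \<subseteq># image_mset f (mset_set A)" "image_mset snd R \<subseteq># image_mset g (mset_set B)"
  shows "\<exists>D D' \<sigma>. D \<subseteq> A \<and> D' \<subseteq> B \<and> bij_betw \<sigma> D D' \<and> (\<forall>a\<in>D. (f a, g (\<sigma> a)) \<in># R) \<and>
    image_mset f (mset_set (A - D)) = image_mset f (mset_set A) - image_mset fst R \<and>
    image_mset g (mset_set (B - D')) = image_mset g (mset_set B) - image_mset snd R"
  using assms
proof (induction R arbitrary: A B)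
  case empty
  show ?case by (intro exI[of _ "{}"]) (auto simp: bij_betw_def)
next
  case (add p R)
  have "fst p \<in># image_mset f (mset_set A)" "snd p \<in># image_mset g (mset_set B)"
    using add.prems(3,4) by (auto dest!: mset_subset_eqD[of _ _ "fst p"] mset_subset_eqD[of _ _ "snd p"])
  then obtain a b where ab: "a \<in> A" "f a = fst p" "b \<in> B" "g b = snd p" using add.prems(1,2) by auto
  have A: "mset_set A = add_mset a (mset_set (A - {a}))" "mset_set B = add_mset b (mset_set (B - {b}))"
    using ab add.prems(1,2) mset_set.remove by metis+
  obtain D D' \<sigma> where I: "D \<subseteq> A - {a}" "D' \<subseteq> B - {b}" "bij_betw \<sigma> D D'" "\<forall>a\<in>D. (f a, g (\<sigma> a)) \<in># R"
    "image_mset f (mset_set (A - {a} - D)) = image_mset f (mset_set (A - {a})) - image_mset fst R"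
    "image_mset g (mset_set (B - {b} - D')) = image_mset g (mset_set (B - {b})) - image_mset snd R"
    using add.IH[of "A - {a}" "B - {b}"] add.prems unfolding A by (auto simp: ab)
  have "bij_betw (\<sigma>(a := b)) (insert a D) (insert b D')"
  proof -
    have "bij_betw (\<sigma>(a := b)) {a} {b}" by (simp add: bij_betw_def)
    moreover have "bij_betw (\<sigma>(a := b)) D D'" using I(1,3) by (subst bij_betw_cong[of _ _ \<sigma>]) auto
    ultimately have "bij_betw (\<sigma>(a := b)) ({a} \<union> D) ({b} \<union> D')" by (rule bij_betw_combine) (use I(2) in auto)
    then show ?thesis by simp
  qed
  moreover have "A - {a} - D = A - insert a D" "B - {b} - D' = B - insert b D'" by blast+
  then have "image_mset f (mset_set (A - insert a D)) = image_mset f (mset_set A) - image_mset fst (add_mset p R)"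
    "image_mset g (mset_set (B - insert b D')) = image_mset g (mset_set B) - image_mset snd (add_mset p R)"
    using I(5,6) by (simp_all only: A image_mset_add_mset ab add_mset_diff_bothsides)
  moreover have "\<forall>c\<in>insert a D. (f c, g ((\<sigma>(a := b)) c)) \<in># add_mset p R"
    using I(1,4) ab by auto
  moreover have "insert a D \<subseteq> A" "insert b D' \<subseteq> B" using I(1,2) ab by blast+
  ultimately show ?case by (intro exI[of _ "insert a D"] exI[of _ "insert b D'"] exI[of _ "\<sigma>(a := b)"] conjI)
qed

lemma matchingE:
  assumes "finite A" "finite B" "matching \<Lambda> \<phi> e (image_mset f (mset_set A)) (image_mset g (mset_set B))"
  shows "\<exists>D D' \<sigma>. D \<subseteq> A \<and> D' \<subseteq> B \<and> bij_betw \<sigma> D D' \<and> (\<forall>a\<in>D. dM \<Lambda> \<phi> (f a) (g (\<sigma> a)) \<le> ereal e) \<and>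
    (\<forall>a\<in>A - D. near_bd \<Lambda> \<phi> e (f a)) \<and> (\<forall>b\<in>B - D'. near_bd \<Lambda> \<phi> e (g b))"
proof -
  obtain R where R: "image_mset fst R \<subseteq># image_mset f (mset_set A)" "image_mset snd R \<subseteq># image_mset g (mset_set B)"
    "\<forall>p\<in>#image_mset f (mset_set A) - image_mset fst R. near_bd \<Lambda> \<phi> e p"
    "\<forall>p\<in>#image_mset g (mset_set B) - image_mset snd R. near_bd \<Lambda> \<phi> e p" "\<forall>pq\<in>#R. dM \<Lambda> \<phi> (fst pq) (snd pq) \<le> ereal e"
    using assms(3) unfolding matching_def by blast
  obtain D D' \<sigma> where I: "D \<subseteq> A" "D' \<subseteq> B" "bij_betw \<sigma> D D'" "\<forall>a\<in>D. (f a, g (\<sigma> a)) \<in># R"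
    "image_mset f (mset_set (A - D)) = image_mset f (mset_set A) - image_mset fst R"
    "image_mset g (mset_set (B - D')) = image_mset g (mset_set B) - image_mset snd R"
    using submultisets_bij[OF assms(1,2) R(1,2)] by blast
  have "\<forall>a\<in>A - D. near_bd \<Lambda> \<phi> e (f a)" using R(3) assms(1) unfolding I(5)[symmetric] by simp
  moreover have "\<forall>b\<in>B - D'. near_bd \<Lambda> \<phi> e (g b)" using R(4) assms(2) unfolding I(6)[symmetric] by simp
  moreover have "\<forall>a\<in>D. dM \<Lambda> \<phi> (f a) (g (\<sigma> a)) \<le> ereal e" using I(4) R(5) by fastforce
  ultimately show ?thesis using I(1-3) by blast
qed

lemma mset_map_index: "mset (map f L) = image_mset (\<lambda>i. f (L ! i)) (mset_set {..<length L})"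
proof -
  have "map f L = map (\<lambda>i. f (L ! i)) [0..<length L]" by (rule nth_equalityI) simp_all
  then have "mset (map f L) = image_mset (\<lambda>i. f (L ! i)) (mset [0..<length L])" by simp
  then show ?thesis by (simp only: mset_upt atLeast0LessThan)
qed

lemma partial_bij:
  assumes "\<And>p q. r q = Some p \<longleftrightarrow> r' p = Some q"
  shows "bij_betw (\<lambda>p. the (r' p)) {p. r' p \<noteq> None} {q. r q \<noteq> None}"
proof -
  have 1: "r' (the (r q)) = Some q" if "r q \<noteq> None" for q using that assms[of q "the (r q)"] by simp
  have 2: "r (the (r' p)) = Some p" if "r' p \<noteq> None" for p using that assms[of "the (r' p)" p] by simp
  show ?thesis by (rule bij_betwI[where g = "\<lambda>q. the (r q)"]) (use 1 2 in auto)
qed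

section \<open>The isometry theorem\<close>

lemma sle_antisym: "sle real_of_ereal 0 s s' \<Longrightarrow> sle real_of_ereal 0 s' s \<Longrightarrow> s = s'"
  by (cases s; cases s') (auto simp: sle_def)

lemma sle_weaken: "sle A d s s' \<Longrightarrow> d \<le> e \<Longrightarrow> sle A e s s'"
  by (auto simp: sle_def)

text \<open>Stability at shift 0: summands that map to each other without moving real levels
  coincide, and a valid summand is never small at 0, so the partial bijection of indices is total on
  both sides.\<close>

lemma model_unique:
  fixes L L' :: "summand list"
  assumes i: "eiso real_of_ereal fscale fscale (model L) (model L' :: (nat \<times> nat \<Rightarrow> 'k::field) cospan)"
    and v: "list_all (valid_summand \<Lambda>) L" "list_all (valid_summand \<Lambda>) L'"
  shows "mset (map f L) = mset (map f L')"
proof -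
  obtain r r' where r0: "\<forall>p q. r q = Some p \<longleftrightarrow> r' p = Some q"
    "\<forall>p q. r q = Some p \<longrightarrow> p < length L \<and> q < length L' \<and> sle real_of_ereal 0 (L ! p) (L' ! q) \<and> sle real_of_ereal 0 (L' ! q) (L ! p)"
    "\<forall>p<length L. \<not> small real_of_ereal (2 * 0) (L ! p) \<longrightarrow> r' p \<noteq> None"
    "\<forall>q<length L'. \<not> small real_of_ereal (2 * 0) (L' ! q) \<longrightarrow> r q \<noteq> None"
    using model_stability[of 0 real_of_ereal L L' UNIV, OF order_refl i[unfolded eiso_eint0] levin_UNIV levin_UNIV mono_on_real subset_UNIV]
    by (elim exE conjE) (rule that)
  note r = r0[rule_format]
  have ns: "\<not> small real_of_ereal (2 * 0) s" if "valid_summand \<Lambda> s" for s using that by (cases s) (auto simp: small_def)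
  have "{p. r' p \<noteq> None} = {..<length L}" "{q. r q \<noteq> None} = {..<length L'}"
    using r ns v by (fastforce simp: list_all_length)+
  then have b: "bij_betw (\<lambda>p. the (r' p)) {..<length L} {..<length L'}" using partial_bij[of r r', OF r(1)] by simp
  have e: "L ! p = L' ! the (r' p)" if "p < length L" for p
  proof -
    have "p \<in> {p. r' p \<noteq> None}" using that \<open>{p. r' p \<noteq> None} = {..<length L}\<close> by simp
    then obtain q where q: "r' p = Some q" by blast
    then have "r q = Some p" by (simp only: r(1))
    from r(2)[OF this] show ?thesis using sle_antisym q by (metis option.sel)
  qed
  have "image_mset (\<lambda>i. f (L ! i)) (mset_set {..<length L}) = image_mset (\<lambda>i. f (L' ! i)) (image_mset (\<lambda>p. the (r' p)) (mset_set {..<length L}))"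
    unfolding multiset.map_comp comp_def by (rule image_mset_cong) (use e in auto)
  then show ?thesis unfolding mset_map_index using b image_mset_mset_set[of "\<lambda>p. the (r' p)" "{..<length L}"] by (simp add: bij_betw_def)
qed

lemma diagram_eq:
  fixes s :: "'k::field \<Rightarrow> 'v::ab_group_add \<Rightarrow> 'v"
  assumes v: "vector_space s" and C: "is_cospan s C" and L: "list_all (valid_summand \<Lambda>) L"
    and i: "eiso real_of_ereal s fscale C (model L :: (nat \<times> nat \<Rightarrow> 'k) cospan)"
  shows "diagram \<Lambda> s C = mset (map (summand_pt \<Lambda>) L)"
proof -
  note g = good_real[OF v C]
  have h: "hco_iso s fscale C (model K :: (nat \<times> nat \<Rightarrow> 'k) cospan) \<longleftrightarrow> eiso real_of_ereal s fscale C (model K :: (nat \<times> nat \<Rightarrow> 'k) cospan)" for K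
    by (rule hco_iso_eiso[OF goodD(1)[OF g] wcos_model levok_UNIV[OF v C] levok_model[where B = UNIV, OF levin_UNIV]]) simp
  show ?thesis unfolding diagram_def
  proof (rule the_equality)
    show "is_diagram \<Lambda> s C (mset (map (summand_pt \<Lambda>) L))" using L i unfolding is_diagram_def h by blast
    fix M assume "is_diagram \<Lambda> s C M"
    then obtain K where K: "list_all (valid_summand \<Lambda>) K" "M = mset (map (summand_pt \<Lambda>) K)"
      "eiso real_of_ereal s fscale C (model K :: (nat \<times> nat \<Rightarrow> 'k) cospan)" unfolding is_diagram_def h by blast
    show "M = mset (map (summand_pt \<Lambda>) L)" unfolding K(2)
      by (rule model_unique[OF eiso_trans[OF good_real_model g good_real_model eiso_sym[OF K(3)] i] K(1) L])
  qed
qed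

context strip
begin

lemma valid_levin: "list_all (valid_summand \<Lambda>) L \<Longrightarrow> i < length L \<Longrightarrow> levin B (L ! i)"
  by (cases "L ! i") (auto simp: levin_def list_all_length dest!: spec[of _ i])

text \<open>Closeness at \<open>e\<close> is itself a witness for the infimum in \<open>dM\<close>,
  which runs over positive parameters; this direction loses nothing.\<close>

lemma eint_matching:
  fixes L L' :: "summand list"
  assumes v: "list_all (valid_summand \<Lambda>) L" "list_all (valid_summand \<Lambda>) L'" and e: "0 < e"
    and i: "eint AA fscale fscale e (model L) (model L' :: (nat \<times> nat \<Rightarrow> 'k::field) cospan)"
  shows "matching \<Lambda> \<phi> e (mset (map (summand_pt \<Lambda>) L)) (mset (map (summand_pt \<Lambda>) L'))"
proof -
  have e0: "0 \<le> e" and B: "uminus ` B \<subseteq> B" using e by auto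
  have vi: "valid_summand \<Lambda> (L ! p)" if "p < length L" for p using v that by (simp add: list_all_length)
  have vi': "valid_summand \<Lambda> (L' ! p)" if "p < length L'" for p using v that by (simp add: list_all_length)
  obtain r r' where r0: "\<forall>p q. r q = Some p \<longleftrightarrow> r' p = Some q"
    "\<forall>p q. r q = Some p \<longrightarrow> p < length L \<and> q < length L' \<and> sle AA e (L ! p) (L' ! q) \<and> sle AA e (L' ! q) (L ! p)"
    "\<forall>p<length L. \<not> small AA (2 * e) (L ! p) \<longrightarrow> r' p \<noteq> None"
    "\<forall>q<length L'. \<not> small AA (2 * e) (L' ! q) \<longrightarrow> r q \<noteq> None"
    by (rule exE[OF model_stability[where B = B, OF e0 i _ _ AA_mono B]],
      erule valid_levin[OF v(1)], erule valid_levin[OF v(2)], elim exE conjE, rule that)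
  note r = r0[rule_format]
  show ?thesis unfolding mset_map_index
  proof (rule matchingI[OF _ _ _ _ partial_bij[of r r', OF r(1)]])
    show "{p. r' p \<noteq> None} \<subseteq> {..<length L}" "{q. r q \<noteq> None} \<subseteq> {..<length L'}" using r(1,2) by fastforce+
    fix p assume "p \<in> {p. r' p \<noteq> None}"
    then obtain q where q: "r' p = Some q" by auto
    then have "p < length L" "q < length L'" "sle AA e (L ! p) (L' ! q)" "sle AA e (L' ! q) (L ! p)" using r(2)[of q p] r(1) by auto
    then show "dM \<Lambda> \<phi> (summand_pt \<Lambda> (L ! p)) (summand_pt \<Lambda> (L' ! the (r' p))) \<le> ereal e"
      using dM_le[OF dec_pt[OF vi] dec_pt[OF vi'] e] clo2_pt[OF vi vi' e0] q by simp
  next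
    fix p assume "p \<in> {..<length L} - {p. r' p \<noteq> None}"
    then show "near_bd \<Lambda> \<phi> e (summand_pt \<Lambda> (L ! p))" using small_near_bd[OF vi _ e] r(3)[of p] by auto
  next
    fix q assume "q \<in> {..<length L'} - {q. r q \<noteq> None}"
    then show "near_bd \<Lambda> \<phi> e (summand_pt \<Lambda> (L' ! q))" using small_near_bd[OF vi' _ e] r(4)[of q] by auto
  qed simp_all
qed

text \<open>The infima in \<open>dM\<close> provide witnesses only below a larger \<open>e'\<close>.
  Matched summands become reindexing maps, and unmatched ones are contracted.\<close>

lemma matching_eint:
  fixes L L' :: "summand list"
  assumes v: "list_all (valid_summand \<Lambda>) L" "list_all (valid_summand \<Lambda>) L'" and e: "e < e'"
    and m: "matching \<Lambda> \<phi> e (mset (map (summand_pt \<Lambda>) L)) (mset (map (summand_pt \<Lambda>) L'))"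
  shows "eint AA fscale fscale e' (model L) (model L' :: (nat \<times> nat \<Rightarrow> 'k::field) cospan)"
proof -
  have vi: "valid_summand \<Lambda> (L ! p)" if "p < length L" for p using v that by (simp add: list_all_length)
  have vi': "valid_summand \<Lambda> (L' ! p)" if "p < length L'" for p using v that by (simp add: list_all_length)
  obtain D D' \<sigma> where I: "D \<subseteq> {..<length L}" "D' \<subseteq> {..<length L'}" "bij_betw \<sigma> D D'"
    "\<And>a. a \<in> D \<Longrightarrow> dM \<Lambda> \<phi> (summand_pt \<Lambda> (L ! a)) (summand_pt \<Lambda> (L' ! \<sigma> a)) \<le> ereal e"
    "\<And>a. a \<in> {..<length L} - D \<Longrightarrow> near_bd \<Lambda> \<phi> e (summand_pt \<Lambda> (L ! a))"
    "\<And>b. b \<in> {..<length L'} - D' \<Longrightarrow> near_bd \<Lambda> \<phi> e (summand_pt \<Lambda> (L' ! b))"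
    using matchingE[OF finite_lessThan finite_lessThan m[unfolded mset_map_index]] by blast
  define r' where "r' p = (if p \<in> D then Some (\<sigma> p) else None)" for p
  define r where "r q = (if q \<in> D' then Some (inv_into D \<sigma> q) else None)" for q
  have s: "\<sigma> p \<in> D'" "inv_into D \<sigma> (\<sigma> p) = p" if "p \<in> D" for p
    using I(3) that by (auto simp: bij_betw_def)
  have s': "inv_into D \<sigma> q \<in> D" "\<sigma> (inv_into D \<sigma> q) = q" if "q \<in> D'" for q
    using I(3) that by (auto simp: bij_betw_def f_inv_into_f inv_into_into)
  show ?thesis
  proof (rule model_eint[where r = r and r' = r' and B = B])
    show eq: "r q = Some p \<longleftrightarrow> r' p = Some q" for p q unfolding r_def r'_def using s s' by auto
    show "p < length L \<and> q < length L' \<and> sle AA e' (L ! p) (L' ! q) \<and> sle AA e' (L' ! q) (L ! p)" if "r q = Some p" for p q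
    proof -
      have pq: "p \<in> D" "q = \<sigma> p" using that eq unfolding r'_def by (auto split: if_splits)
      have l: "p < length L" "q < length L'" using pq I(1,2) s(1) by auto
      obtain d where d: "0 < d" "d < e'" "clo2 d (summand_pt \<Lambda> (L ! p)) (summand_pt \<Lambda> (L' ! q))"
        using dM_leD[OF dec_pt[OF vi[OF l(1)]] dec_pt[OF vi'[OF l(2)]] _ e] I(4)[OF pq(1)] unfolding pq(2) by blast
      then have "sle AA d (L ! p) (L' ! q)" "sle AA d (L' ! q) (L ! p)" using clo2_pt[OF vi[OF l(1)] vi'[OF l(2)], of d] by simp_all
      then show ?thesis using l d(2) sle_weaken by (meson less_imp_le)
    qed
    show "small AA (2 * e') (L ! p)" if "p < length L" "r' p = None" for p
      using near_bd_small[OF vi _ e] I(5)[of p] that unfolding r'_def by (auto split: if_splits)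
    show "small AA (2 * e') (L' ! q)" if "q < length L'" "r q = None" for q
      using near_bd_small[OF vi' _ e] I(6)[of q] that unfolding r_def by (auto split: if_splits)
  qed (use valid_levin v AA_mono in auto)
qed

end

theorem theorem1p6:
  fixes \<Lambda> :: real and \<phi> :: "ereal \<Rightarrow> real"
    and s1 :: "'k::field \<Rightarrow> 'v::ab_group_add \<Rightarrow> 'v"
    and s2 :: "'k \<Rightarrow> 'w::ab_group_add \<Rightarrow> 'w"
    and C :: "'v cospan" and X :: "'w cospan"
  assumes "\<Lambda> > 0"
    and "mono \<phi>" and "\<exists>\<psi>. homeomorphism (UNIV :: ereal set) {-\<Lambda>..\<Lambda>} \<phi> \<psi>"
    and "vector_space s1" and "vector_space s2"
    and "is_cospan s1 C" and "bounded_cospan s1 \<Lambda> C" and "finite_type s1 C"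
    and "is_cospan s2 X" and "bounded_cospan s2 \<Lambda> X" and "finite_type s2 X"
  shows "dB \<Lambda> \<phi> (diagram \<Lambda> s2 X) (diagram \<Lambda> s1 C) = d_int \<phi> s2 s1 X C"
proof -
  interpret strip \<Lambda> \<phi> by unfold_locales (use assms(1-3) in auto)
  obtain L where L: "list_all (valid_summand \<Lambda>) L" "eiso real_of_ereal s1 fscale C (model L :: (nat \<times> nat \<Rightarrow> 'k) cospan)"
    using exists_valid_nf[OF assms(4,6,7,8)] by blast
  obtain K where K: "list_all (valid_summand \<Lambda>) K" "eiso real_of_ereal s2 fscale X (model K :: (nat \<times> nat \<Rightarrow> 'k) cospan)"
    using exists_valid_nf[OF assms(5,9,10,11)] by blast
  have lM: "levok B fscale (model N :: (nat \<times> nat \<Rightarrow> 'k) cospan)" if "list_all (valid_summand \<Lambda>) N" for N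
    by (rule levok_model) (rule valid_levin[OF that])
  have gM: "good AA fscale (model N :: (nat \<times> nat \<Rightarrow> 'k) cospan)" if "list_all (valid_summand \<Lambda>) N" for N
    by (rule good_model[OF _ AA_mono]) (rule valid_levin[OF that])
  note lC = levok_bounded[OF assms(4,6,7)] and lX = levok_bounded[OF assms(5,9,10)]
  note gC = good_cospan[OF assms(4,6) lC AA_mono] and gX = good_cospan[OF assms(5,9) lX AA_mono]
  note wC = goodD(1)[OF gC] and wX = goodD(1)[OF gX]
  \<comment> \<open>The normal form was found for real levels; \<open>real_of_ereal\<close> and
    \<open>AA\<close> both embed the order of the levels that occur, so they define the same
    equivalences.\<close>
  have iC: "eiso AA s1 fscale C (model L :: (nat \<times> nat \<Rightarrow> 'k) cospan)"
    using L(2) hco_iso_eiso[OF wC wcos_model levok_UNIV[OF assms(4,6)] levok_model[where B = UNIV and L = L, OF levin_UNIV], of real_of_ereal]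
      hco_iso_eiso[OF wC wcos_model lC lM[OF L(1)] AA_le] by simp
  have iX: "eiso AA s2 fscale X (model K :: (nat \<times> nat \<Rightarrow> 'k) cospan)"
    using K(2) hco_iso_eiso[OF wX wcos_model levok_UNIV[OF assms(5,9)] levok_model[where B = UNIV and L = K, OF levin_UNIV], of real_of_ereal]
      hco_iso_eiso[OF wX wcos_model lX lM[OF K(1)] AA_le] by simp
  have eq: "interleaved \<phi> s2 s1 e X C \<longleftrightarrow> eint AA fscale fscale e (model K) (model L :: (nat \<times> nat \<Rightarrow> 'k) cospan)" if "0 < e" for e
  proof -
    have "interleaved \<phi> s2 s1 e X C \<longleftrightarrow> eint AA s2 s1 e X C" by (rule interleaved_eint[OF wX wC lX lC AA_rho])
    then show ?thesis using eint_transfer[OF gX gC gM[OF K(1)] gM[OF L(1)] _ iX iC]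
      eint_transfer[OF gM[OF K(1)] gM[OF L(1)] gX gC _ eiso_sym[OF iX] eiso_sym[OF iC]] that by fastforce
  qed
  let ?P = "mset (map (summand_pt \<Lambda>) K)" and ?Q = "mset (map (summand_pt \<Lambda>) L)"
  have D: "diagram \<Lambda> s2 X = ?P" "diagram \<Lambda> s1 C = ?Q"
    using diagram_eq[OF assms(5,9) K] diagram_eq[OF assms(4,6) L] by auto
  show ?thesis unfolding D
  proof (rule antisym)
    show "dB \<Lambda> \<phi> ?P ?Q \<le> d_int \<phi> s2 s1 X C"
      unfolding dB_def d_int_def using eint_matching[OF K(1) L(1)] eq by (intro Inf_superset_mono image_mono) auto
    show "d_int \<phi> s2 s1 X C \<le> dB \<Lambda> \<phi> ?P ?Q" unfolding dB_def
    proof (rule Inf_greatest, clarsimp)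
      fix e :: real assume e: "0 \<le> e" and m: "matching \<Lambda> \<phi> e (image_mset (summand_pt \<Lambda>) (mset K)) (image_mset (summand_pt \<Lambda>) (mset L))"
      \<comment> \<open>A matching at \<open>e\<close> interleaves at \<open>e + t\<close> for every
        positive \<open>t\<close>, which is enough for the infimum.\<close>
      have "d_int \<phi> s2 s1 X C \<le> ereal e + ereal t" if "0 < t" for t
        unfolding d_int_def using eq[of "e + t"] matching_eint[OF K(1) L(1), of e "e + t"] m e that
        by (intro Inf_lower) auto
      then show "d_int \<phi> s2 s1 X C \<le> ereal e" by (rule ereal_le_epsilon2[rule_format])
    qed
  qed
qed

end
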